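(* Let $m>n\ge 0$ be integers and let $\Omega\subset\mathbb R^{2m}$ be open. Let $G\in C^\infty(\Omega)\otimes\mathfrak G_{2n}\otimes\mathcal C_{2m,2n}$ be sh-monogenic (i.e. $\partial_{\mathbf Z}[G]=0=\partial_{\mathbf Z^\dagger}[G]$ in $\Omega$), and put $\boldsymbol G_0=G\,I_2=\begin{pmatrix}G&0\\0&G\end{pmatrix}$. Let $g=g_0+\mathbf g\in C^\infty(\mathbb R^{2m})\otimes\mathfrak G_{2n}^{(ev)}$ be a phase function such that $\{g_0\le0\}\subset\Omega$ is compact and the gradient of $g_0$ does not vanish on $g_0^{-1}(0)$. Then $$\int_{\mathbb R^{2m|2n}}\boldsymbol\Psi^{m|n}_{2\times2}(\mathbf Z-\mathbf U)\,\delta(g(\mathbf x))\,\boldsymbol{\mathcal D}_{(\mathbf Z,\mathbf Z^\dagger)}[g(\mathbf x)]\,\boldsymbol G_0(\mathbf x)=\begin{cases}\boldsymbol G_0(\mathbf y),&g_0(\underline y)<0,\\0,&g_0(\underline y)>0.\end{cases}$$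
   Context: Superspace. Commuting variables $x_1,\dots,x_{2m}$ (coordinates of $\underline x\in\mathbb R^{2m}$), anticommuting variables $\grave x_1,\dots,\grave x_{2n}$ commuting with the $x_j$; $\mathfrak G_{2n}$ is the Grassmann algebra generated by the $\grave x_j$, $\mathfrak G_{2n}^{(ev)}$ its even part. Superfunctions are $F=\sum_A F_A(\underline x)\grave{\underline x}_A$ with $F_A$ complex-valued smooth and $\grave{\underline x}_A$ ordered monomials; body $F_0=F_\emptyset$, nilpotent part $F-F_0$; real if all $F_A$ are real. A phase function is an even real superfunction $g=g_0+\mathbf g$ (body plus nilpotent part). For an even real superfunction $a=a_0+\mathbf a$ with $a_0>0$, $a^p=\sum_{j=0}^n\frac{\mathbf a^j}{j!}p(p-1)\cdots(p-j+1)a_0^{p-j}$. $\partial_{\grave x_j}F$ is the left derivative ($\partial_{\grave x_j}[1]=0$, $\partial_{\grave x_j}\grave x_k+\grave x_k\partial_{\grave x_j}=\delta_{jk}$, commuting with the $x_k$). Clifford generators. $\mathcal C_{2m,2n}$ is generated by $e_1,\dots,e_{2m},\grave e_1,\dots,\grave e_{2n}$ with $e_je_k+e_ke_j=-2\delta_{jk}$, $e_j\grave e_k+\grave e_ke_j=0$, $\grave e_j\grave e_k-\grave e_k\grave e_j=g_{jk}$, where $g_{2j,2k}=g_{2j-1,2k-1}=0$, $g_{2j-1,2k}=-g_{2k,2j-1}=\delta_{jk}$; it commutes with all variables and partial derivatives. Complex scalars are allowed. Put $\mathfrak f_j=\frac12(e_j-ie_{m+j})$, $\mathfrak f_j^\dagger=-\frac12(e_j+ie_{m+j})$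 ($1\le j\le m$), $\grave{\mathfrak f}_j=\frac12(\grave e_{2j-1}-i\grave e_{2j})$, $\grave{\mathfrak f}_j^\dagger=-\frac12(\grave e_{2j-1}+i\grave e_{2j})$ ($1\le j\le n$). Complex variables: $z_j=x_j+ix_{m+j}$, $z_j^c=x_j-ix_{m+j}$, $\grave z_j=\grave x_{2j-1}+i\grave x_{2j}$, $\grave z_j^c=\grave x_{2j-1}-i\grave x_{2j}$; $\partial_{z_j}=\frac12(\partial_{x_j}-i\partial_{x_{m+j}})$, $\partial_{z_j^c}=\frac12(\partial_{x_j}+i\partial_{x_{m+j}})$, $\partial_{\grave z_j}=\frac12(\partial_{\grave x_{2j-1}}-i\partial_{\grave x_{2j}})$, $\partial_{\grave z_j^c}=\frac12(\partial_{\grave x_{2j-1}}+i\partial_{\grave x_{2j}})$. Hermitian Dirac operators: $\partial_{\mathbf Z}F=\sum_{j=1}^m\mathfrak f_j^\dagger\partial_{z_j}F+2i\sum_{j=1}^n\grave{\mathfrak f}_j^\dagger\partial_{\grave z_j}F$, $\partial_{\mathbf Z^\dagger}F=\sum_{j=1}^m\mathfrak f_j\partial_{z_j^c}F-2i\sum_{j=1}^n\grave{\mathfrak f}_j\partial_{\grave z_j^c}F$. Matrix Dirac operator: $\boldsymbol{\mathcal D}_{(\mathbf Z,\mathbf Z^\dagger)}=\begin{pmatrix}\partial_{\mathbf Z}&\partial_{\mathbf Z^\dagger}\\\partial_{\mathbf Z^\dagger}&\partial_{\mathbf Z}\end{pmatrix}$, so $\boldsymbol{\mathcal D}_{(\mathbf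 Z,\mathbf Z^\dagger)}[g]=\begin{pmatrix}\partial_{\mathbf Z}[g]&\partial_{\mathbf Z^\dagger}[g]\\\partial_{\mathbf Z^\dagger}[g]&\partial_{\mathbf Z}[g]\end{pmatrix}$. Kernel. $\mathbf Z=\sum_j z_j\mathfrak f_j+\sum_j\grave z_j\grave{\mathfrak f}_j$, $\mathbf Z^\dagger=\sum_j z_j^c\mathfrak f_j^\dagger+\sum_j\grave z_j^c\grave{\mathfrak f}_j^\dagger$, $|\mathbf Z|^2=\mathbf Z\mathbf Z^\dagger+\mathbf Z^\dagger\mathbf Z=\sum_j z_jz_j^c-\frac i2\sum_j\grave z_j\grave z_j^c$. $\mathbf y=\underline y+\grave{\underline y}$ consists of a point $\underline y\in\mathbb R^{2m}$ and further anticommuting parameters $\grave y_1,\dots,\grave y_{2n}$ (also anticommuting with the $\grave x_j$); $\mathbf U,\mathbf U^\dagger$ are built from $\mathbf y$ as $\mathbf Z,\mathbf Z^\dagger$ are from the $x_j,\grave x_j$. With $M=2m-2n$ and $|\mathbb S^{2m-1|2n}|=2\pi^{M/2}/\Gamma(M/2)$, $$\Psi_1^{m|n}(\mathbf Z)=\frac{2}{|\mathbb S^{2m-1|2n}|}\frac{\mathbf Z}{|\mathbf Z|^M},\quad {\Psi_1^{m|n}}^\dagger(\mathbf Z)=\frac{2}{|\mathbb S^{2m-1|2n}|}\frac{\mathbf Z^\dagger}{|\mathbf Z|^M},\quad \boldsymbol\Psi^{m|n}_{2\times2}=\begin{pmatrix}\Psi_1^{m|n}&{\Psi_1^{m|n}}^\dagger\\{\Psi_1^{m|n}}^\dagger&\Psi_1^{m|n}\end{pmatrix}.$$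 Integration. $\int_B=\pi^{-n}\partial_{\grave x_{2n}}\cdots\partial_{\grave x_1}$. For a compactly supported superdistribution $\alpha=\sum_A\alpha_A\grave{\underline x}_A$ ($\alpha_A$ distributions on $\mathbb R^{2m}$) and $F=\sum_BF_B\grave{\underline x}_B$ smooth near the support, $\int_{\mathbb R^{2m|2n}}\alpha F=\sum_{A,B}\langle\alpha_A,F_B\rangle\int_B\grave{\underline x}_A\grave{\underline x}_B$, extended entrywise and linearly to Clifford-valued matrices, the $\grave y_j$ being constants. $\delta(g)=\sum_{j=0}^n\frac{\mathbf g^j}{j!}\delta^{(j)}(g_0)$, with $\delta^{(j)}(g_0)$ the pullback of $\delta^{(j)}$ by $g_0$. The kernel is smooth in $\underline x$ away from $\underline y$, so its product with $\delta(g)$ is well defined when $g_0(\underline y)\ne0$. *)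

theory Defs
  imports "HOL-Analysis.Analysis"
begin

text \<open>
  The unital associative complex algebra with generators \<open>e\<^sub>j\<close> (indexed by \<open>'m + 'm\<close>: \<open>Inl j\<close> is the
  index \<open>j\<close> and \<open>Inr j\<close> the index \<open>m + j\<close>, where \<open>m = CARD('m)\<close>) and symplectic generators indexed
  by \<open>nat\<close>, presented by its relations: terms modulo the least congruence containing the algebra
  axioms and the defining relations. No type can depend on the number \<open>2n\<close> of symplectic
  generators; the algebra with \<open>2n\<close> of them is the subalgebra \<open>clifford_sub n\<close> below, since the
  ordered monomials form a basis.
\<close>

datatype 'm cterm =
    Scal complex
  | GenE "'m + 'm"
  | GenG nat
  | Plus "'m cterm" "'m cterm"
  | Times "'m cterm" "'m cterm"

definition sympl :: "nat \<Rightarrow> nat \<Rightarrow> complex" where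
  "sympl j k = (if odd j \<and> k = Suc j then 1 else if odd k \<and> j = Suc k then - 1 else 0)"

abbreviation Minus :: "'m cterm \<Rightarrow> 'm cterm \<Rightarrow> 'm cterm" where
  "Minus s t \<equiv> Plus s (Times (Scal (- 1)) t)"

inductive ceq :: "'m cterm \<Rightarrow> 'm cterm \<Rightarrow> bool" where
  ceq_refl: "ceq s s"
| ceq_sym: "ceq s t \<Longrightarrow> ceq t s"
| ceq_trans: "ceq s t \<Longrightarrow> ceq t u \<Longrightarrow> ceq s u"
| ceq_cong_plus: "ceq s s' \<Longrightarrow> ceq t t' \<Longrightarrow> ceq (Plus s t) (Plus s' t')"
| ceq_cong_times: "ceq s s' \<Longrightarrow> ceq t t' \<Longrightarrow> ceq (Times s t) (Times s' t')"
| ceq_plus_assoc: "ceq (Plus (Plus s t) u) (Plus s (Plus t u))"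
| ceq_plus_comm: "ceq (Plus s t) (Plus t s)"
| ceq_plus_zero: "ceq (Plus (Scal 0) s) s"
| ceq_plus_inv: "ceq (Minus s s) (Scal 0)"
| ceq_times_assoc: "ceq (Times (Times s t) u) (Times s (Times t u))"
| ceq_one_left: "ceq (Times (Scal 1) s) s"
| ceq_one_right: "ceq (Times s (Scal 1)) s"
| ceq_distrib_left: "ceq (Times s (Plus t u)) (Plus (Times s t) (Times s u))"
| ceq_distrib_right: "ceq (Times (Plus s t) u) (Plus (Times s u) (Times t u))"
| ceq_scal_plus: "ceq (Plus (Scal a) (Scal b)) (Scal (a + b))"
| ceq_scal_times: "ceq (Times (Scal a) (Scal b)) (Scal (a * b))"
| ceq_scal_central: "ceq (Times (Scal a) s) (Times s (Scal a))"
| ceq_rel_ee: "ceq (Plus (Times (GenE j) (GenE k)) (Times (GenE k) (GenE j)))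
               (Scal (if j = k then - 2 else 0))"
| ceq_rel_eg: "ceq (Plus (Times (GenE j) (GenG k)) (Times (GenG k) (GenE j))) (Scal 0)"
| ceq_rel_gg: "ceq (Minus (Times (GenG j) (GenG k)) (Times (GenG k) (GenG j))) (Scal (sympl j k))"

quotient_type 'm clifford = "'m cterm" / ceq
  by (intro equivpI reflpI sympI transpI) (auto intro: ceq_refl ceq_sym ceq_trans)

text \<open>A module on which the relations hold shows that the presented algebra is nonzero:
  polynomial-like sequences tensored with functions on subsets of the index set.\<close>

definition below :: "('m::finite + 'm) \<Rightarrow> ('m + 'm) set \<Rightarrow> nat" where
  "below j A = card {b \<in> A. to_nat b < to_nat j}"

definition flip :: "'a \<Rightarrow> 'a set \<Rightarrow> 'a set" where
  "flip j A = (if j \<in> A then A - {j} else insert j A)"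

fun crep :: "'m::finite cterm \<Rightarrow> ((nat \<Rightarrow> nat) \<Rightarrow> ('m + 'm) set \<Rightarrow> complex)
    \<Rightarrow> (nat \<Rightarrow> nat) \<Rightarrow> ('m + 'm) set \<Rightarrow> complex" where
  "crep (Scal a) v = (\<lambda>r A. a * v r A)"
| "crep (GenE j) v = (\<lambda>r A. \<i> * (- 1) ^ below j A * v r (flip j A))"
| "crep (GenG k) v = (let i = Suc k div 2 in
     if odd k then (\<lambda>r A. (- 1) ^ card A * (of_nat (Suc (r i)) * v (r(i := Suc (r i))) A))
     else (\<lambda>r A. (- 1) ^ card A * (if r i = 0 then 0 else v (r(i := r i - 1)) A)))"
| "crep (Plus s t) v = (\<lambda>r A. crep s v r A + crep t v r A)"
| "crep (Times s t) v = crep s (crep t v)"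

lemma crep_linear:
  "crep t (\<lambda>r A. a * v r A + w r A) = (\<lambda>r A. a * crep t v r A + crep t w r A)"
proof (induction t arbitrary: a v w)
  case (Plus s t)
  show ?case by (simp only: crep.simps Plus.IH) (simp add: algebra_simps)
next
  case (Times s t)
  then show ?case by simp
qed (auto simp: Let_def algebra_simps fun_eq_iff)

lemma crep_add: "crep t (\<lambda>r A. v r A + w r A) = (\<lambda>r A. crep t v r A + crep t w r A)"
  using crep_linear[of t 1 v w] by simp

lemma crep_scal: "crep t (\<lambda>r A. a * v r A) = (\<lambda>r A. a * crep t v r A)"
proof -
  have z: "crep t (\<lambda>r A. 0) = (\<lambda>r A. 0)"
    using crep_linear[of t "-1" "\<lambda>r A. 0" "\<lambda>r A. 0"] by simp
  show ?thesis using crep_linear[of t a v "\<lambda>r A. 0"] by (simp add: z)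
qed

lemma flip_flip [simp]: "flip j (flip j A) = A"
  by (auto simp: flip_def)

lemma flip_commute: "flip j (flip k A) = flip k (flip j A)"
  by (auto simp: flip_def)

lemma below_flip_same [simp]: "below j (flip j A) = below j A"
  unfolding below_def by (rule arg_cong[where f = card]) (auto simp: flip_def)

lemma sign_card_flip: "(- 1 :: complex) ^ card (flip j A) = - ((- 1) ^ card A)" if "finite A"
proof (cases "j \<in> A")
  case True
  then have "card A = Suc (card (flip j A))" using that
    unfolding flip_def by (metis card.remove)
  then show ?thesis by simp
next
  case False
  then show ?thesis using that by (simp add: flip_def)
qed

lemma sign_below_flip:
  "(- 1 :: complex) ^ below j (flip k A) =
   (if to_nat k < to_nat j then - ((- 1) ^ below j A) else (- 1) ^ below j A)"
proof (cases "to_nat k < to_nat j")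
  case True
  have "{b \<in> flip k A. to_nat b < to_nat j} = flip k {b \<in> A. to_nat b < to_nat j}"
    using True by (auto simp: flip_def)
  then show ?thesis using True by (simp add: below_def sign_card_flip)
next
  case False
  have "{b \<in> flip k A. to_nat b < to_nat j} = {b \<in> A. to_nat b < to_nat j}"
    using False by (auto simp: flip_def)
  then show ?thesis using False by (simp add: below_def)
qed

lemma sign_sq: "(- 1 :: complex) ^ k * ((- 1) ^ k * z) = z"
  by (metis mult.assoc mult_1 power_add power_even_eq power2_eq_square one_power2 left_minus_one_mult_self)

lemma crep_ceq: "ceq s t \<Longrightarrow> crep s v = crep t v"
proof (induction arbitrary: v rule: ceq.induct)
  case (ceq_rel_ee j k)
  show ?case
  proof (cases "j = k")
    case True
    then show ?thesis by (auto simp: fun_eq_iff algebra_simps sign_sq)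
  next
    case False
    then have "to_nat j < to_nat k \<or> to_nat k < to_nat j"
      by (metis linorder_neqE_nat to_nat_split)
    with False show ?thesis
      by (auto simp: fun_eq_iff sign_below_flip flip_commute[of j k])
  qed
next
  case (ceq_rel_eg j k)
  show ?case by (auto simp: fun_eq_iff Let_def sign_card_flip algebra_simps)
next
  case (ceq_rel_gg j k)
  have eq: "Suc j div 2 = Suc k div 2 \<Longrightarrow> odd j \<Longrightarrow> even k \<Longrightarrow> k = Suc j" for j k :: nat
    by presburger
  have ne: "Suc j div 2 \<noteq> Suc k div 2 \<Longrightarrow> \<not> (odd j \<and> k = Suc j)" for j k :: nat
    by auto
  show ?case
    using eq[of j k] eq[of k j] ne[of j k] ne[of k j]
    by (cases "Suc j div 2 = Suc k div 2"; cases "odd j"; cases "odd k")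
       (auto simp: fun_eq_iff Let_def sympl_def sign_sq algebra_simps fun_upd_twist)
qed (auto simp: crep_add crep_scal algebra_simps)

instantiation clifford :: (finite) ring_1
begin

lift_definition zero_clifford :: "'a clifford" is "Scal 0" .
lift_definition one_clifford :: "'a clifford" is "Scal 1" .
lift_definition plus_clifford :: "'a clifford \<Rightarrow> 'a clifford \<Rightarrow> 'a clifford" is Plus
  by (rule ceq_cong_plus)
lift_definition times_clifford :: "'a clifford \<Rightarrow> 'a clifford \<Rightarrow> 'a clifford" is Times
  by (rule ceq_cong_times)
lift_definition uminus_clifford :: "'a clifford \<Rightarrow> 'a clifford" is "Times (Scal (- 1))"
  by (intro ceq_cong_times ceq_refl)
lift_definition minus_clifford :: "'a clifford \<Rightarrow> 'a clifford \<Rightarrow> 'a clifford" is Minus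
  by (intro ceq_cong_plus ceq_cong_times ceq_refl)

instance
proof
  fix a b c :: "'a clifford"
  show "a + b + c = a + (b + c)" by transfer (rule ceq_plus_assoc)
  show "a + b = b + a" by transfer (rule ceq_plus_comm)
  show "0 + a = a" by transfer (rule ceq_plus_zero)
  show "- a + a = 0" by transfer (rule ceq_trans[OF ceq_plus_comm ceq_plus_inv])
  show "a - b = a + - b" by transfer (rule ceq_refl)
  show "a * b * c = a * (b * c)" by transfer (rule ceq_times_assoc)
  show "1 * a = a" by transfer (rule ceq_one_left)
  show "a * 1 = a" by transfer (rule ceq_one_right)
  show "(a + b) * c = a * c + b * c" by transfer (rule ceq_distrib_right)
  show "a * (b + c) = a * b + a * c" by transfer (rule ceq_distrib_left)
  show "(0 :: 'a clifford) \<noteq> 1"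
  proof transfer
    show "\<not> ceq (Scal 0 :: 'a cterm) (Scal 1)"
    proof
      assume "ceq (Scal 0 :: 'a cterm) (Scal 1)"
      then have "crep (Scal 0 :: 'a cterm) (\<lambda>r A. 1) = crep (Scal 1) (\<lambda>r A. 1)"
        by (rule crep_ceq)
      then show False by (auto simp: fun_eq_iff)
    qed
  qed
qed

end

lift_definition cscal :: "complex \<Rightarrow> 'm::finite clifford" is Scal .
lift_definition clE :: "'m + 'm \<Rightarrow> 'm::finite clifford" is GenE .
lift_definition clG :: "nat \<Rightarrow> 'm::finite clifford" is GenG .

inductive_set clifford_sub :: "nat \<Rightarrow> 'm::finite clifford set" for n :: nat where
  "cscal a \<in> clifford_sub n"
| "clE j \<in> clifford_sub n"
| "k \<in> {1..2 * n} \<Longrightarrow> clG k \<in> clifford_sub n"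
| "s \<in> clifford_sub n \<Longrightarrow> t \<in> clifford_sub n \<Longrightarrow> s + t \<in> clifford_sub n"
| "s \<in> clifford_sub n \<Longrightarrow> t \<in> clifford_sub n \<Longrightarrow> s * t \<in> clifford_sub n"

lemma cscal_simps: "cscal 0 = 0" "cscal 1 = 1" "cscal (a + b) = cscal a + cscal b"
  "cscal (a * b) = cscal a * cscal b" "cscal a * s = s * cscal a"
  by (transfer, auto intro: ceq.intros)+

lemma clE_clE: "clE j * clE k + clE k * clE j = cscal (if j = k then - 2 else 0)"
  by transfer (rule ceq_rel_ee)

lemma clE_clG: "clE j * clG k + clG k * clE j = 0"
  by transfer (rule ceq_rel_eg)

lemma clG_clG: "clG j * clG k - clG k * clG j = cscal (sympl j k)"
  by transfer (rule ceq_rel_gg)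

text \<open>
  Elements over a coefficient ring are finitely supported families of coefficients of the ordered
  monomials. The generators \<open>XV j\<close> and \<open>YV j\<close> are the anticommuting variables of
  \<open>\<^bold>x\<close> and of \<open>\<^bold>y\<close>; all coefficients commute with all generators. In a monomial the \<open>YV\<close> come
  first, so that the coefficients of the monomials in the \<open>XV\<close> stand on the left also when they
  contain some \<open>YV\<close>.
\<close>

datatype gvar = YV nat | XV nat

instantiation gvar :: linorder
begin

fun less_eq_gvar :: "gvar \<Rightarrow> gvar \<Rightarrow> bool" where
  "YV i \<le> YV j \<longleftrightarrow> i \<le> j"
| "XV i \<le> XV j \<longleftrightarrow> i \<le> j"
| "YV i \<le> XV j \<longleftrightarrow> True"
| "XV i \<le> YV j \<longleftrightarrow> False"

definition less_gvar :: "gvar \<Rightarrow> gvar \<Rightarrow> bool" where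
  "less_gvar u v \<longleftrightarrow> u \<le> v \<and> \<not> v \<le> u"

instance
proof
  fix u v w :: gvar
  show "u < v \<longleftrightarrow> u \<le> v \<and> \<not> v \<le> u" by (rule less_gvar_def)
  show "u \<le> u" by (cases u) auto
  show "u \<le> v \<Longrightarrow> v \<le> w \<Longrightarrow> u \<le> w" by (cases u; cases v; cases w) auto
  show "u \<le> v \<Longrightarrow> v \<le> u \<Longrightarrow> u = v" by (cases u; cases v) auto
  show "u \<le> v \<or> v \<le> u" by (cases u; cases v) auto
qed

end

typedef (overloaded) 'c grass =
  "{F :: gvar set \<Rightarrow> 'c::ring_1. finite {A. F A \<noteq> 0} \<and> (\<forall>A. infinite A \<longrightarrow> F A = 0)}"
  morphisms gcoeff Abs_grass
  by (rule exI[where x = "\<lambda>_. 0"]) simp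

setup_lifting type_definition_grass

definition inv_sign :: "gvar set \<Rightarrow> gvar set \<Rightarrow> 'c::ring_1" where
  "inv_sign B C = (- 1) ^ card {(b, c). b \<in> B \<and> c \<in> C \<and> c < b}"

lemma grass_eqI: "(\<And>A. finite A \<Longrightarrow> gcoeff F A = gcoeff G A) \<Longrightarrow> F = G"
  by transfer (metis ext)

lemma inv_sign_Un_left:
  assumes "finite B" "finite C" "finite D" "B \<inter> C = {}"
  shows "inv_sign (B \<union> C) D = (inv_sign B D * inv_sign C D :: 'c::ring_1)"
proof -
  have fin: "finite {(b, c). b \<in> U \<and> c \<in> V \<and> c < b}" if "finite U" "finite V" for U V :: "gvar set"
    by (rule finite_subset[of _ "U \<times> V"]) (use that in auto)
  have "{(b, c). b \<in> B \<union> C \<and> c \<in> D \<and> c < b} =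
      {(b, c). b \<in> B \<and> c \<in> D \<and> c < b} \<union> {(b, c). b \<in> C \<and> c \<in> D \<and> c < b}" by auto
  moreover have "card \<dots> = card {(b, c). b \<in> B \<and> c \<in> D \<and> c < b} + card {(b, c). b \<in> C \<and> c \<in> D \<and> c < b}"
    by (rule card_Un_disjoint) (use assms fin in auto)
  ultimately show ?thesis unfolding inv_sign_def by (simp add: power_add)
qed

lemma inv_sign_Un_right:
  assumes "finite B" "finite C" "finite D" "C \<inter> D = {}"
  shows "inv_sign B (C \<union> D) = (inv_sign B C * inv_sign B D :: 'c::ring_1)"
proof -
  have fin: "finite {(b, c). b \<in> U \<and> c \<in> V \<and> c < b}" if "finite U" "finite V" for U V :: "gvar set"
    by (rule finite_subset[of _ "U \<times> V"]) (use that in auto)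
  have "{(b, c). b \<in> B \<and> c \<in> C \<union> D \<and> c < b} =
      {(b, c). b \<in> B \<and> c \<in> C \<and> c < b} \<union> {(b, c). b \<in> B \<and> c \<in> D \<and> c < b}" by auto
  moreover have "card \<dots> = card {(b, c). b \<in> B \<and> c \<in> C \<and> c < b} + card {(b, c). b \<in> B \<and> c \<in> D \<and> c < b}"
    by (rule card_Un_disjoint) (use assms fin in auto)
  ultimately show ?thesis unfolding inv_sign_def by (simp add: power_add)
qed

lemma inv_sign_empty [simp]: "inv_sign {} A = 1" "inv_sign A {} = 1"
  by (simp_all add: inv_sign_def)

lemma inv_sign_commute: "inv_sign B C * x = x * (inv_sign B C :: 'c::ring_1)"
  unfolding inv_sign_def
  by (cases "even (card {(b, c). b \<in> B \<and> c \<in> C \<and> c < b})") auto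

lemma inv_sign_left_commute: "x * (inv_sign B C * y) = inv_sign B C * (x * y)"
  for x :: "'c::ring_1"
  by (simp only: mult.assoc[symmetric] inv_sign_commute[of B C x])

lemmas inv_sign_simps = inv_sign_left_commute[of "inv_sign D E" for D E]
  inv_sign_left_commute[of "gcoeff F A" for F A]

instantiation grass :: (ring_1) ring_1
begin

lift_definition zero_grass :: "'a grass" is "\<lambda>_. 0" by simp
lift_definition one_grass :: "'a grass" is "\<lambda>A. if A = {} then 1 else 0"
  by simp
lift_definition plus_grass :: "'a grass \<Rightarrow> 'a grass \<Rightarrow> 'a grass" is "\<lambda>F G A. F A + G A"
proof (intro conjI allI impI)
  fix F G :: "gvar set \<Rightarrow> 'a"
  assume *: "finite {A. F A \<noteq> 0} \<and> (\<forall>A. infinite A \<longrightarrow> F A = 0)"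
    "finite {A. G A \<noteq> 0} \<and> (\<forall>A. infinite A \<longrightarrow> G A = 0)"
  have "{A. F A + G A \<noteq> 0} \<subseteq> {A. F A \<noteq> 0} \<union> {A. G A \<noteq> 0}" by auto
  then show "finite {A. F A + G A \<noteq> 0}" using * by (meson finite_UnI finite_subset)
qed auto
lift_definition uminus_grass :: "'a grass \<Rightarrow> 'a grass" is "\<lambda>F A. - F A" by simp
definition minus_grass :: "'a grass \<Rightarrow> 'a grass \<Rightarrow> 'a grass" where "minus_grass F G = F + - G"
lift_definition times_grass :: "'a grass \<Rightarrow> 'a grass \<Rightarrow> 'a grass" is
  "\<lambda>F G A. if finite A then \<Sum>B\<in>Pow A. inv_sign B (A - B) * F B * G (A - B) else 0"
proof (intro conjI allI impI)
  fix F G :: "gvar set \<Rightarrow> 'a"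
  assume *: "finite {A. F A \<noteq> 0} \<and> (\<forall>A. infinite A \<longrightarrow> F A = 0)"
    "finite {A. G A \<noteq> 0} \<and> (\<forall>A. infinite A \<longrightarrow> G A = 0)"
  have "{A. (if finite A then \<Sum>B\<in>Pow A. inv_sign B (A - B) * F B * G (A - B) else 0) \<noteq> 0}
      \<subseteq> (\<lambda>(B, C). B \<union> C) ` ({A. F A \<noteq> 0} \<times> {A. G A \<noteq> 0})" (is "?L \<subseteq> ?R")
  proof
    fix A assume "A \<in> ?L"
    then have "finite A" "(\<Sum>B\<in>Pow A. inv_sign B (A - B) * F B * G (A - B)) \<noteq> 0"
      by (auto split: if_splits)
    then obtain B where "B \<in> Pow A" "inv_sign B (A - B) * F B * G (A - B) \<noteq> 0"
      by (meson sum.neutral)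
    then have "B \<union> (A - B) = A" "F B \<noteq> 0" "G (A - B) \<noteq> 0" by auto
    then show "A \<in> ?R" by (intro image_eqI[of _ _ "(B, A - B)"]) auto
  qed
  then show "finite ?L" using * by (meson finite_SigmaI finite_imageI finite_subset)
qed auto

instance
proof
  fix F G H :: "'a grass"
  show "F + G + H = F + (G + H)" by transfer (simp add: add.assoc)
  show "F + G = G + F" by transfer (simp add: add.commute)
  show "0 + F = F" by transfer simp
  show "- F + F = 0" by transfer simp
  show "F - G = F + - G" by (rule minus_grass_def)
  show "(F + G) * H = F * H + G * H"
    by transfer (auto simp: fun_eq_iff algebra_simps sum.distrib)
  show "F * (G + H) = F * G + F * H"
    by transfer (auto simp: fun_eq_iff algebra_simps sum.distrib)
  show "(0 :: 'a grass) \<noteq> 1" by transfer (auto simp: fun_eq_iff)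
  show "1 * F = F"
  proof (rule grass_eqI)
    fix A :: "gvar set" assume "finite A"
    then have "gcoeff (1 * F) A =
        (\<Sum>B\<in>Pow A. if B = {} then inv_sign B (A - B) * gcoeff F (A - B) else 0)"
      unfolding times_grass.rep_eq one_grass.rep_eq
      by (simp only: if_True) (rule sum.cong[OF refl], simp)
    also have "\<dots> = gcoeff F A" using \<open>finite A\<close> by (simp add: sum.delta)
    finally show "gcoeff (1 * F) A = gcoeff F A" .
  qed
  show "F * 1 = F"
  proof (rule grass_eqI)
    fix A :: "gvar set" assume "finite A"
    then have "gcoeff (F * 1) A =
        (\<Sum>B\<in>Pow A. if B = A then inv_sign B (A - B) * gcoeff F B else 0)"
      unfolding times_grass.rep_eq one_grass.rep_eq
      by (simp only: if_True) (rule sum.cong[OF refl], simp)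
    also have "\<dots> = gcoeff F A" using \<open>finite A\<close> by (simp add: sum.delta)
    finally show "gcoeff (F * 1) A = gcoeff F A" .
  qed
  show "F * G * H = F * (G * H)"
  proof (rule grass_eqI)
    fix A :: "gvar set" assume A: "finite A"
    let ?t = "\<lambda>B C. inv_sign B C * inv_sign B (A - B - C) * inv_sign C (A - B - C)
       * (gcoeff F B * gcoeff G C * gcoeff H (A - B - C))"
    have "gcoeff (F * G * H) A = (\<Sum>D\<in>Pow A. \<Sum>B\<in>Pow D. ?t B (D - B))"
    proof -
      have "inv_sign D (A - D) * gcoeff (F * G) D * gcoeff H (A - D) = (\<Sum>B\<in>Pow D. ?t B (D - B))"
        if "D \<in> Pow A" for D
      proof -
        have D: "finite D" using that A finite_subset by auto
        have "inv_sign D (A - D) * (inv_sign B (D - B) * gcoeff F B * gcoeff G (D - B)) * gcoeff H (A - D)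
           = ?t B (D - B)" if "B \<in> Pow D" for B
        proof -
          have "B \<union> (D - B) = D" using that by auto
          moreover have "inv_sign (B \<union> (D - B)) (A - D) = (inv_sign B (A - D) * inv_sign (D - B) (A - D) :: 'a)"
          proof (rule inv_sign_Un_left)
            show "finite B" using that D finite_subset by blast
          qed (use D A in simp_all)
          ultimately have s: "inv_sign D (A - D) = (inv_sign B (A - D) * inv_sign (D - B) (A - D) :: 'a)"
            by (simp only:)
          have e: "A - B - (D - B) = A - D" using that by auto
          show ?thesis unfolding e s
            by (simp only: mult.assoc inv_sign_simps)
        qed
        then show ?thesis using D
          by (simp add: times_grass.rep_eq sum_distrib_left sum_distrib_right)
      qed
      then show ?thesis using A by (simp add: times_grass.rep_eq)
    qed
    also have "\<dots> = (\<Sum>(D, B)\<in>Sigma (Pow A) Pow. ?t B (D - B))"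
    proof (rule sum.Sigma)
      show "\<forall>D\<in>Pow A. finite (Pow D)" using A finite_subset by blast
    qed (use A in simp)
    also have "\<dots> = (\<Sum>(B, C)\<in>Sigma (Pow A) (\<lambda>B. Pow (A - B)). ?t B C)"
    proof (rule sum.reindex_bij_witness[where i = "\<lambda>(B, C). (B \<union> C, B)"
            and j = "\<lambda>(D, B). (B, D - B)"])
      fix p assume "p \<in> Sigma (Pow A) Pow"
      then obtain D B where p: "p = (D, B)" "B \<subseteq> D" "D \<subseteq> A" by blast
      show "(case case p of (D, B) \<Rightarrow> (B, D - B) of (B, C) \<Rightarrow> (B \<union> C, B)) = p"
        using p by auto
      show "(case p of (D, B) \<Rightarrow> (B, D - B)) \<in> Sigma (Pow A) (\<lambda>B. Pow (A - B))"
        using p by auto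
      show "(case case p of (D, B) \<Rightarrow> (B, D - B) of (B, C) \<Rightarrow> ?t B C)
          = (case p of (D, B) \<Rightarrow> ?t B (D - B))"
        unfolding p by (simp only: prod.case)
    next
      fix q assume "q \<in> Sigma (Pow A) (\<lambda>B. Pow (A - B))"
      then obtain B C where q: "q = (B, C)" "B \<subseteq> A" "C \<subseteq> A - B" by blast
      show "(case case q of (B, C) \<Rightarrow> (B \<union> C, B) of (D, B) \<Rightarrow> (B, D - B)) = q"
        using q by auto
      show "(case q of (B, C) \<Rightarrow> (B \<union> C, B)) \<in> Sigma (Pow A) Pow"
        using q by auto
    qed
    also have "\<dots> = (\<Sum>B\<in>Pow A. \<Sum>C\<in>Pow (A - B). ?t B C)"
      by (rule sum.Sigma[symmetric]) (use A in simp_all)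
    also have "\<dots> = gcoeff (F * (G * H)) A"
    proof -
      have "inv_sign B (A - B) * gcoeff F B * gcoeff (G * H) (A - B) = (\<Sum>C\<in>Pow (A - B). ?t B C)"
        if "B \<in> Pow A" for B
      proof -
        have B: "finite B" using that A finite_subset by auto
        have "inv_sign B (A - B) * gcoeff F B * (inv_sign C (A - B - C) * gcoeff G C * gcoeff H (A - B - C))
           = ?t B C" if "C \<in> Pow (A - B)" for C
        proof -
          have "C \<union> (A - B - C) = A - B" using that by auto
          moreover have "inv_sign B (C \<union> (A - B - C)) = (inv_sign B C * inv_sign B (A - B - C) :: 'a)"
          proof (rule inv_sign_Un_right)
            show "finite C" using that A finite_subset by blast
          qed (use B A in simp_all)
          ultimately have s: "inv_sign B (A - B) = (inv_sign B C * inv_sign B (A - B - C) :: 'a)"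
            by (simp only:)
          show ?thesis unfolding s
            by (simp only: mult.assoc inv_sign_simps)
        qed
        then show ?thesis using A
          by (simp add: times_grass.rep_eq sum_distrib_left sum_distrib_right)
      qed
      then show ?thesis using A by (simp add: times_grass.rep_eq)
    qed
    finally show "gcoeff (F * G * H) A = gcoeff (F * (G * H)) A" .
  qed
qed

end

lift_definition gconst :: "'c::ring_1 \<Rightarrow> 'c grass" is "\<lambda>c A. if A = {} then c else 0" by simp

lift_definition gmono :: "gvar set \<Rightarrow> 'c::ring_1 grass" is
  "\<lambda>B A. if A = B \<and> finite B then 1 else 0"
  by auto

abbreviation gvar :: "gvar \<Rightarrow> 'c::ring_1 grass" where "gvar v \<equiv> gmono {v}"

lift_definition gderiv_left :: "gvar \<Rightarrow> 'c::ring_1 grass \<Rightarrow> 'c grass" is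
  "\<lambda>v F A. if v \<in> A then 0 else (- 1) ^ card {b \<in> A. b < v} * F (insert v A)"
proof (intro conjI allI impI)
  fix v and F :: "gvar set \<Rightarrow> 'c"
  assume *: "finite {A. F A \<noteq> 0} \<and> (\<forall>A. infinite A \<longrightarrow> F A = 0)"
  have "{A. (if v \<in> A then 0 else (- 1) ^ card {b \<in> A. b < v} * F (insert v A)) \<noteq> 0}
     \<subseteq> (\<lambda>A. A - {v}) ` {A. F A \<noteq> 0}" (is "?L \<subseteq> ?R")
  proof
    fix A assume "A \<in> ?L"
    then have "v \<notin> A" "F (insert v A) \<noteq> 0" by (auto split: if_splits)
    then show "A \<in> ?R" by (intro image_eqI[of _ _ "insert v A"]) auto
  qed
  then show "finite ?L" using * by (meson finite_imageI finite_subset)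
qed auto

text \<open>The next lemma and \<open>gderiv_left_rule\<close> are the rules that determine the left derivative.\<close>

lemma gderiv_left_const: "gderiv_left v (gconst c) = 0"
  by transfer auto

lemma coeff_gvar_times:
  assumes "finite A"
  shows "gcoeff (gvar w * F) A =
    (if w \<in> A then (- 1) ^ card {b \<in> A. b < w} * gcoeff F (A - {w}) else (0 :: 'c::ring_1))"
proof -
  have "gcoeff (gvar w * F) A = (\<Sum>B\<in>Pow A. if B = {w} then inv_sign B (A - B) * gcoeff F (A - B) else 0)"
    using assms unfolding times_grass.rep_eq gmono.rep_eq
    by (simp only: if_True) (rule sum.cong[OF refl], simp)
  also have "\<dots> = (if w \<in> A then inv_sign {w} (A - {w}) * gcoeff F (A - {w}) else 0)"
    using assms by (simp add: sum.delta)
  also have "inv_sign {w} (A - {w}) = ((- 1) ^ card {b \<in> A. b < w} :: 'c)"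
  proof -
    have "{(b, c). b \<in> {w} \<and> c \<in> A - {w} \<and> c < b} = Pair w ` {b \<in> A. b < w}" by auto
    then show ?thesis unfolding inv_sign_def by (simp add: card_image inj_on_def)
  qed
  finally show ?thesis .
qed

lemma gderiv_left_rule:
  "gderiv_left v (gvar w * F) + gvar w * gderiv_left v F = (if v = w then F else (0 :: 'c::ring_1 grass))"
proof (rule grass_eqI)
  fix A :: "gvar set" assume A: "finite A"
  have sgn: "(- 1 :: 'c) ^ k * ((- 1) ^ k * z) = z" for k z
    by (cases "even k") auto
  have ins: "card {b \<in> insert u A. b < t} = card {b \<in> A. b < t} + (if u < t then 1 else 0)"
    if "u \<notin> A" for u t
  proof -
    have "{b \<in> insert u A. b < t} = (if u < t then insert u {b \<in> A. b < t} else {b \<in> A. b < t})" by auto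
    then show ?thesis using that A by simp
  qed
  have del: "card {b \<in> A. b < t} = card {b \<in> A - {u}. b < t} + (if u < t then 1 else 0)"
    if "u \<in> A" for u t
  proof -
    have "{b \<in> A. b < t} = (if u < t then insert u {b \<in> A - {u}. b < t} else {b \<in> A - {u}. b < t})" 
      using that by auto
    then show ?thesis using A by simp
  qed
  let ?n = "\<lambda>S t. card {b \<in> S. b < t}"
  have sum: "gcoeff (gderiv_left v (gvar w * F) + gvar w * gderiv_left v F) A =
      gcoeff (gderiv_left v (gvar w * F)) A + gcoeff (gvar w * gderiv_left v F) A"
    by (simp add: plus_grass.rep_eq)
  have 1: "gcoeff (gderiv_left v (gvar w * F)) A =
     (if v \<notin> A \<and> w \<in> insert v A then (- 1) ^ ?n A v * ((- 1) ^ ?n (insert v A) w * gcoeff F (insert v A - {w})) else 0)"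
    unfolding gderiv_left.rep_eq by (subst coeff_gvar_times) (use A in auto)
  have 2: "gcoeff (gvar w * gderiv_left v F) A =
     (if w \<in> A \<and> v \<notin> A - {w} then (- 1) ^ ?n A w * ((- 1) ^ ?n (A - {w}) v * gcoeff F (insert v (A - {w}))) else 0)"
    unfolding coeff_gvar_times[OF A] gderiv_left.rep_eq by simp
  show "gcoeff (gderiv_left v (gvar w * F) + gvar w * gderiv_left v F) A = gcoeff (if v = w then F else 0) A"
  proof (cases "v = w")
    case True
    show ?thesis
    proof (cases "w \<in> A")
      case True
      then have "insert w (A - {w}) = A" "{b \<in> A - {w}. b < w} = {b \<in> A. b < w}" by auto
      with True \<open>v = w\<close> show ?thesis unfolding sum 1 2 by (simp only: sgn) simp
    next
      case False
      then have "insert w A - {w} = A" "{b \<in> insert w A. b < w} = {b \<in> A. b < w}" by auto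
      with False \<open>v = w\<close> show ?thesis unfolding sum 1 2 by (simp only: sgn) simp
    qed
  next
    case False
    show ?thesis
    proof (cases "w \<in> A \<and> v \<notin> A")
      case True
      have d: "insert v A - {w} = insert v (A - {w})" using False by auto
      have n: "?n (insert v A) w = ?n A w + (if v < w then 1 else 0)"
        "?n A v = ?n (A - {w}) v + (if w < v then 1 else 0)"
        using ins[of v w] del[of w v] True by auto
      have c: "(- 1 :: 'c) ^ a * ((- 1) ^ b * z) = (- 1) ^ b * ((- 1) ^ a * z)" for a b z
        by (metis add.commute mult.assoc power_add)
      have s: "gcoeff (gderiv_left v (gvar w * F)) A = - gcoeff (gvar w * gderiv_left v F) A"
      proof (cases "v < w")
        case lt: True
        then have "\<not> w < v" by auto
        with lt show ?thesis unfolding 1 2 d n c[of "?n A w" "?n (A - {w}) v"] using True False by simp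
      next
        case ge: False
        then have "w < v" using False by auto
        then show ?thesis unfolding 1 2 d n c[of "?n A w" "?n (A - {w}) v"] using True False ge by simp
      qed
      show ?thesis unfolding sum s using False by (simp add: zero_grass.rep_eq)
    next
      case F: False
      then show ?thesis unfolding sum 1 2 using False by (auto simp: zero_grass.rep_eq)
    qed
  qed
qed

lift_definition gembed :: "complex grass \<Rightarrow> 'm::finite clifford grass" is "\<lambda>F A. cscal (F A)"
proof (intro conjI allI impI)
  fix F :: "gvar set \<Rightarrow> complex"
  assume *: "finite {A. F A \<noteq> 0} \<and> (\<forall>A. infinite A \<longrightarrow> F A = 0)"
  have "{A. cscal (F A) \<noteq> (0 :: 'm clifford)} \<subseteq> {A. F A \<noteq> 0}" by (auto simp: cscal_simps)
  then show "finite {A. cscal (F A) \<noteq> (0 :: 'm clifford)}" using * finite_subset by blast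
qed (auto simp: cscal_simps)

abbreviation sscal :: "complex \<Rightarrow> 'm::finite clifford grass" where
  "sscal a \<equiv> gconst (cscal a)"

text \<open>For \<open>B\<close> a set of variables \<open>XV\<close>, \<open>xcoeff B F\<close> is the coefficient \<open>F\<^sub>B\<close> in
  \<open>F = (\<Sum>B. F\<^sub>B * gmono B)\<close>, an element of the Grassmann algebra of the \<open>YV\<close>.\<close>

lift_definition xcoeff :: "gvar set \<Rightarrow> 'c::ring_1 grass \<Rightarrow> 'c grass" is
  "\<lambda>B F C. if B \<subseteq> range XV \<and> C \<subseteq> range YV then F (C \<union> B) else 0"
proof (intro conjI allI impI)
  fix B and F :: "gvar set \<Rightarrow> 'c"
  assume *: "finite {A. F A \<noteq> 0} \<and> (\<forall>A. infinite A \<longrightarrow> F A = 0)"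
  have "{C. (if B \<subseteq> range XV \<and> C \<subseteq> range YV then F (C \<union> B) else 0) \<noteq> 0}
      \<subseteq> (\<lambda>A. A \<inter> range YV) ` {A. F A \<noteq> 0}" (is "?L \<subseteq> ?R")
  proof
    fix C assume "C \<in> ?L"
    then have C: "B \<subseteq> range XV" "C \<subseteq> range YV" "F (C \<union> B) \<noteq> 0" by (auto split: if_splits)
    then have "(C \<union> B) \<inter> range YV = C" by auto
    with C show "C \<in> ?R" by (intro image_eqI[of _ _ "C \<union> B"]) auto
  qed
  then show "finite ?L" using * by (meson finite_imageI finite_subset)
qed auto

primrec to_xvar :: "gvar \<Rightarrow> gvar" where
  "to_xvar (YV j) = XV j"
| "to_xvar (XV j) = XV j"

text \<open>Substitution of \<open>YV j\<close> for each \<open>XV j\<close> in an element that only involves the \<open>XV\<close>.\<close>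

lift_definition subst_y :: "'c::ring_1 grass \<Rightarrow> 'c grass" is
  "\<lambda>F A. if A \<subseteq> range YV then F (to_xvar ` A) else 0"
proof (intro conjI allI impI)
  fix F :: "gvar set \<Rightarrow> 'c"
  assume *: "finite {A. F A \<noteq> 0} \<and> (\<forall>A. infinite A \<longrightarrow> F A = 0)"
  have "{A. (if A \<subseteq> range YV then F (to_xvar ` A) else 0) \<noteq> 0}
      \<subseteq> (\<lambda>B. YV ` {j. XV j \<in> B}) ` {A. F A \<noteq> 0}" (is "?L \<subseteq> ?R")
  proof
    fix A assume "A \<in> ?L"
    then have A: "A \<subseteq> range YV" "F (to_xvar ` A) \<noteq> 0" by (auto split: if_splits)
    then have "YV ` {j. XV j \<in> to_xvar ` A} = A" by force
    with A show "A \<in> ?R" by (intro image_eqI[of _ _ "to_xvar ` A"]) auto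
  qed
  then show "finite ?L" using * by (meson finite_imageI finite_subset)
next
  fix F :: "gvar set \<Rightarrow> 'c" and A :: "gvar set"
  assume *: "finite {A. F A \<noteq> 0} \<and> (\<forall>A. infinite A \<longrightarrow> F A = 0)" and A: "infinite A"
  have "infinite (to_xvar ` A)" if sub: "A \<subseteq> range YV"
  proof -
    have "inj_on to_xvar A" 
    proof (rule inj_onI)
      fix a b assume "a \<in> A" "b \<in> A" and eq: "to_xvar a = to_xvar b"
      then obtain i k where "a = YV i" "b = YV k" using sub by blast
      with eq show "a = b" by simp
    qed
    then show ?thesis using A finite_imageD by blast
  qed
  then show "(if A \<subseteq> range YV then F (to_xvar ` A) else 0) = 0" using * by auto
qed

definition gbody :: "complex grass \<Rightarrow> real" where
  "gbody a = Re (gcoeff a {})"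

definition gnil :: "complex grass \<Rightarrow> complex grass" where
  "gnil a = a - gconst (gcoeff a {})"

text \<open>For real \<open>a\<close> of positive body.\<close>

definition super_powr :: "nat \<Rightarrow> complex grass \<Rightarrow> real \<Rightarrow> complex grass" where
  "super_powr n a p = (\<Sum>j\<le>n. gconst (complex_of_real
     ((\<Prod>i<j. p - real i) / fact j * gbody a powr (p - real j))) * gnil a ^ j)"

abbreviation xvars :: "nat \<Rightarrow> gvar set" where
  "xvars n \<equiv> XV ` {1..2 * n}"

definition super_alg :: "nat \<Rightarrow> 'm::finite clifford grass set" where
  "super_alg n = {F. \<forall>A. gcoeff F A \<in> clifford_sub n \<and> (\<not> A \<subseteq> xvars n \<longrightarrow> gcoeff F A = 0)}"

definition berezin :: "nat \<Rightarrow> 'm::finite clifford grass \<Rightarrow> 'm clifford grass" where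
  "berezin n F = sscal (1 / complex_of_real (pi ^ n)) *
     fold (\<lambda>j. gderiv_left (XV j)) [1..<Suc (2 * n)] F"

fun C_k_on :: "nat \<Rightarrow> 'a::euclidean_space set \<Rightarrow> ('a \<Rightarrow> 'b::real_normed_vector) \<Rightarrow> bool" where
  "C_k_on 0 S f \<longleftrightarrow> continuous_on S f"
| "C_k_on (Suc k) S f \<longleftrightarrow> f differentiable_on S \<and>
     (\<forall>b\<in>Basis. C_k_on k S (\<lambda>x. frechet_derivative f (at x) b))"

text \<open>Only used for open \<open>S\<close>.\<close>

definition smooth_on :: "'a::euclidean_space set \<Rightarrow> ('a \<Rightarrow> 'b::real_normed_vector) \<Rightarrow> bool" where
  "smooth_on S f \<longleftrightarrow> (\<forall>k. C_k_on k S f)"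

text \<open>The space \<open>\<real>\<^sup>2\<^sup>m\<close> with coordinates \<open>x\<^sub>j = x $ Inl j\<close> and \<open>x\<^sub>m\<^sub>+\<^sub>j = x $ Inr j\<close>.\<close>

type_synonym 'm point = "real ^ ('m + 'm)"

text \<open>
  The algebraic tensor product of smooth functions on \<open>S\<close> with a complex vector space \<open>V\<close> is
  identified with the functions \<open>S \<rightarrow> V\<close> that are finite sums \<open>\<Sum>i. f\<^sub>i(x) c\<^sub>i\<close> with \<open>f\<^sub>i\<close> smooth and
  \<open>c\<^sub>i \<in> V\<close>. Linear operations on smooth functions extend to it by acting on the \<open>f\<^sub>i\<close>; the result
  does not depend on the chosen representation. The space \<open>V\<close> is the whole Grassmann--Clifford
  algebra, on which no topology is needed.
\<close>

definition smooth_rep :: "'m::finite point set \<Rightarrow> ('m point \<Rightarrow> 'm clifford grass) \<Rightarrow>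
    (('m point \<Rightarrow> complex) \<times> 'm clifford grass) list \<Rightarrow> bool" where
  "smooth_rep S F fs \<longleftrightarrow> (\<forall>(f, c)\<in>set fs. smooth_on S f) \<and>
     (\<forall>x\<in>S. F x = (\<Sum>(f, c)\<leftarrow>fs. sscal (f x) * c))"

definition superfunctions :: "nat \<Rightarrow> 'm::finite point set \<Rightarrow> ('m point \<Rightarrow> 'm clifford grass) set" where
  "superfunctions n S = {F. \<exists>fs. smooth_rep S F fs \<and> (\<forall>(f, c)\<in>set fs. c \<in> super_alg n)}"

definition phase_function :: "nat \<Rightarrow> ('m::finite point \<Rightarrow> complex grass) \<Rightarrow> bool" where
  "phase_function n g \<longleftrightarrow>
     (\<forall>A. smooth_on UNIV (\<lambda>x. gcoeff (g x) A)) \<and>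
     (\<forall>x A. gcoeff (g x) A \<in> \<real>) \<and>
     (\<forall>x A. gcoeff (g x) A \<noteq> 0 \<longrightarrow> A \<subseteq> xvars n \<and> even (card A))"

definition pdiff :: "'m::finite + 'm \<Rightarrow> ('m point \<Rightarrow> complex) \<Rightarrow> 'm point \<Rightarrow> complex" where
  "pdiff i f x = frechet_derivative f (at x) (axis i 1)"

definition super_pdiff :: "'m::finite + 'm \<Rightarrow> ('m point \<Rightarrow> 'm clifford grass) \<Rightarrow>
    'm point \<Rightarrow> 'm clifford grass" where
  "super_pdiff i F x = (THE v. \<exists>S fs. open S \<and> x \<in> S \<and> smooth_rep S F fs \<and>
     v = (\<Sum>(f, c)\<leftarrow>fs. sscal (pdiff i f x) * c))"

definition witt :: "'m \<Rightarrow> 'm::finite clifford" where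
  "witt j = cscal (1 / 2) * (clE (Inl j) - cscal \<i> * clE (Inr j))"

definition witt_dag :: "'m \<Rightarrow> 'm::finite clifford" where
  "witt_dag j = - cscal (1 / 2) * (clE (Inl j) + cscal \<i> * clE (Inr j))"

definition gwitt :: "nat \<Rightarrow> 'm::finite clifford" where
  "gwitt j = cscal (1 / 2) * (clG (2 * j - 1) - cscal \<i> * clG (2 * j))"

definition gwitt_dag :: "nat \<Rightarrow> 'm::finite clifford" where
  "gwitt_dag j = - cscal (1 / 2) * (clG (2 * j - 1) + cscal \<i> * clG (2 * j))"

definition d_z :: "'m::finite \<Rightarrow> ('m point \<Rightarrow> 'm clifford grass) \<Rightarrow> 'm point \<Rightarrow> 'm clifford grass" where
  "d_z j F x = sscal (1 / 2) * (super_pdiff (Inl j) F x - sscal \<i> * super_pdiff (Inr j) F x)"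

definition d_zc :: "'m::finite \<Rightarrow> ('m point \<Rightarrow> 'm clifford grass) \<Rightarrow> 'm point \<Rightarrow> 'm clifford grass" where
  "d_zc j F x = sscal (1 / 2) * (super_pdiff (Inl j) F x + sscal \<i> * super_pdiff (Inr j) F x)"

definition d_gz :: "nat \<Rightarrow> 'm::finite clifford grass \<Rightarrow> 'm clifford grass" where
  "d_gz j F = sscal (1 / 2) *
     (gderiv_left (XV (2 * j - 1)) F - sscal \<i> * gderiv_left (XV (2 * j)) F)"

definition d_gzc :: "nat \<Rightarrow> 'm::finite clifford grass \<Rightarrow> 'm clifford grass" where
  "d_gzc j F = sscal (1 / 2) *
     (gderiv_left (XV (2 * j - 1)) F + sscal \<i> * gderiv_left (XV (2 * j)) F)"

definition dirac_Z :: "nat \<Rightarrow> ('m::finite point \<Rightarrow> 'm clifford grass) \<Rightarrow>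
    'm point \<Rightarrow> 'm clifford grass" where
  "dirac_Z n F x = (\<Sum>j\<in>UNIV. gconst (witt_dag j) * d_z j F x)
     + sscal (2 * \<i>) * (\<Sum>j=1..n. gconst (gwitt_dag j) * d_gz j (F x))"

definition dirac_Zdag :: "nat \<Rightarrow> ('m::finite point \<Rightarrow> 'm clifford grass) \<Rightarrow>
    'm point \<Rightarrow> 'm clifford grass" where
  "dirac_Zdag n F x = (\<Sum>j\<in>UNIV. gconst (witt j) * d_zc j F x)
     - sscal (2 * \<i>) * (\<Sum>j=1..n. gconst (gwitt j) * d_gzc j (F x))"

definition sh_monogenic_on :: "nat \<Rightarrow> 'm::finite point set \<Rightarrow>
    ('m point \<Rightarrow> 'm clifford grass) \<Rightarrow> bool" where
  "sh_monogenic_on n S F \<longleftrightarrow> (\<forall>x\<in>S. dirac_Z n F x = 0 \<and> dirac_Zdag n F x = 0)"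

definition circ2 :: "'c::zero \<Rightarrow> 'c \<Rightarrow> 'c ^ 2 ^ 2" where
  "circ2 a b = vector [vector [a, b], vector [b, a]]"

definition dirac_matrix :: "nat \<Rightarrow> ('m::finite point \<Rightarrow> 'm clifford grass) \<Rightarrow>
    'm point \<Rightarrow> 'm clifford grass ^ 2 ^ 2" where
  "dirac_matrix n F x = circ2 (dirac_Z n F x) (dirac_Zdag n F x)"

text \<open>The vector variables are functions of the commuting coordinates \<open>x\<close> and of the anticommuting
  coordinates \<open>\<theta>\<close>, so that they can be evaluated at differences.\<close>

definition z_var :: "'m::finite \<Rightarrow> 'm point \<Rightarrow> complex" where
  "z_var j x = complex_of_real (x $ Inl j) + \<i> * complex_of_real (x $ Inr j)"

definition zc_var :: "'m::finite \<Rightarrow> 'm point \<Rightarrow> complex" where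
  "zc_var j x = complex_of_real (x $ Inl j) - \<i> * complex_of_real (x $ Inr j)"

definition gz_var :: "nat \<Rightarrow> (nat \<Rightarrow> complex grass) \<Rightarrow> complex grass" where
  "gz_var j \<theta> = \<theta> (2 * j - 1) + gconst \<i> * \<theta> (2 * j)"

definition gzc_var :: "nat \<Rightarrow> (nat \<Rightarrow> complex grass) \<Rightarrow> complex grass" where
  "gzc_var j \<theta> = \<theta> (2 * j - 1) - gconst \<i> * \<theta> (2 * j)"

definition Z_var :: "nat \<Rightarrow> 'm::finite point \<Rightarrow> (nat \<Rightarrow> complex grass) \<Rightarrow> 'm clifford grass" where
  "Z_var n x \<theta> = (\<Sum>j\<in>UNIV. sscal (z_var j x) * gconst (witt j))
     + (\<Sum>j=1..n. gembed (gz_var j \<theta>) * gconst (gwitt j))"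

definition Zdag_var :: "nat \<Rightarrow> 'm::finite point \<Rightarrow> (nat \<Rightarrow> complex grass) \<Rightarrow> 'm clifford grass" where
  "Zdag_var n x \<theta> = (\<Sum>j\<in>UNIV. sscal (zc_var j x) * gconst (witt_dag j))
     + (\<Sum>j=1..n. gembed (gzc_var j \<theta>) * gconst (gwitt_dag j))"

definition Z_norm2 :: "nat \<Rightarrow> 'm::finite point \<Rightarrow> (nat \<Rightarrow> complex grass) \<Rightarrow> complex grass" where
  "Z_norm2 n x \<theta> = gconst (\<Sum>j\<in>UNIV. z_var j x * zc_var j x)
     - gconst (\<i> / 2) * (\<Sum>j=1..n. gz_var j \<theta> * gzc_var j \<theta>)"

text \<open>\<open>super_dim m n\<close> is the superdimension of \<open>\<real>\<^sup>2\<^sup>m\<^sup>|\<^sup>2\<^sup>n\<close>.\<close>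

definition super_dim :: "nat \<Rightarrow> nat \<Rightarrow> real" where
  "super_dim m n = 2 * real m - 2 * real n"

definition super_sphere_area :: "nat \<Rightarrow> nat \<Rightarrow> real" where
  "super_sphere_area m n = 2 * pi powr (super_dim m n / 2) / Gamma (super_dim m n / 2)"

definition Z_norm_powr :: "nat \<Rightarrow> 'm::finite point \<Rightarrow> (nat \<Rightarrow> complex grass) \<Rightarrow> real \<Rightarrow> 'm clifford grass" where
  "Z_norm_powr n x \<theta> p = gembed (super_powr n (Z_norm2 n x \<theta>) (p / 2))"

definition Psi :: "nat \<Rightarrow> 'm::finite point \<Rightarrow> (nat \<Rightarrow> complex grass) \<Rightarrow> 'm clifford grass" where
  "Psi n x \<theta> = sscal (complex_of_real (2 / super_sphere_area CARD('m) n)) *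
     Z_var n x \<theta> * Z_norm_powr n x \<theta> (- super_dim CARD('m) n)"

definition Psi_dag :: "nat \<Rightarrow> 'm::finite point \<Rightarrow> (nat \<Rightarrow> complex grass) \<Rightarrow> 'm clifford grass" where
  "Psi_dag n x \<theta> = sscal (complex_of_real (2 / super_sphere_area CARD('m) n)) *
     Zdag_var n x \<theta> * Z_norm_powr n x \<theta> (- super_dim CARD('m) n)"

definition Psi_matrix :: "nat \<Rightarrow> 'm::finite point \<Rightarrow> (nat \<Rightarrow> complex grass) \<Rightarrow>
    'm clifford grass ^ 2 ^ 2" where
  "Psi_matrix n x \<theta> = circ2 (Psi n x \<theta>) (Psi_dag n x \<theta>)"

definition tsupp :: "('a::euclidean_space \<Rightarrow> complex) \<Rightarrow> 'a set" where
  "tsupp \<phi> = closure {x. \<phi> x \<noteq> 0}"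

definition test_function :: "('a::euclidean_space \<Rightarrow> complex) \<Rightarrow> bool" where
  "test_function \<phi> \<longleftrightarrow> smooth_on UNIV \<phi> \<and> compact (tsupp \<phi>)"

text \<open>Distributions are represented by their action on test functions.\<close>

type_synonym 'a dist = "('a \<Rightarrow> complex) \<Rightarrow> complex"

definition supported_in :: "'a::euclidean_space dist \<Rightarrow> 'a set \<Rightarrow> bool" where
  "supported_in T K \<longleftrightarrow> (\<forall>\<phi>. test_function \<phi> \<and> tsupp \<phi> \<inter> K = {} \<longrightarrow> T \<phi> = 0)"

text \<open>
  The pairing of a compactly supported distribution with a function \<open>F\<close> that is smooth on a
  neighbourhood \<open>S\<close> of the support: multiply by a cut-off function \<open>\<eta>\<close> that equals 1 near the support.
  The values of \<open>F\<close> outside \<open>S\<close> are irrelevant since \<open>\<eta>\<close> vanishes there.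
\<close>

definition dist_pair :: "'m::finite point dist \<Rightarrow> ('m point \<Rightarrow> 'm clifford grass) \<Rightarrow>
    'm clifford grass" where
  "dist_pair T F = (THE v. \<exists>K S U \<eta> fs.
     compact K \<and> supported_in T K \<and> open S \<and> K \<subseteq> S \<and> smooth_rep S F fs \<and>
     test_function \<eta> \<and> tsupp \<eta> \<subseteq> S \<and> open U \<and> K \<subseteq> U \<and> (\<forall>x\<in>U. \<eta> x = 1) \<and>
     v = (\<Sum>(f, c)\<leftarrow>fs. sscal (T (\<lambda>x. \<eta> x * f x)) * c))"

definition delta_deriv :: "nat \<Rightarrow> real dist" where
  "delta_deriv j h = (- 1) ^ j * ((\<lambda>k t. vector_derivative k (at t)) ^^ j) h 0"

text \<open>
  Pullback by a real function \<open>u\<close> that is a submersion near its zero set, as the transpose of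
  integration over the fibres: \<open>\<langle>u\<^sup>*T, \<phi>\<rangle> = \<langle>T, u\<^sub>*\<phi>\<rangle>\<close>, where \<open>u\<^sub>*\<phi>\<close> is determined by
  \<open>\<integral> (u\<^sub>*\<phi>) \<psi> = \<integral> \<phi> (\<psi> \<circ> u)\<close> for all test functions \<open>\<psi>\<close>. Since \<open>delta_deriv j\<close> is supported
  at 0, it suffices that \<open>u\<^sub>*\<phi>\<close> is a smooth function \<open>h\<close> on an interval around 0.
\<close>

definition delta_pullback :: "nat \<Rightarrow> ('m::finite point \<Rightarrow> real) \<Rightarrow> 'm point dist" where
  "delta_pullback j u \<phi> = (THE v. \<exists>r>0. \<exists>h. smooth_on {- r<..<r} h \<and>
     (\<forall>\<psi>. test_function \<psi> \<and> tsupp \<psi> \<subseteq> {- r<..<r} \<longrightarrow>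
       (LINT t|lborel. h t * \<psi> t) = (LINT x|lborel. \<phi> x * \<psi> (u x))) \<and>
     v = delta_deriv j h)"

text \<open>The component at \<open>A\<close> of the superdistribution \<open>\<delta>(g)\<close>.\<close>

definition super_delta :: "nat \<Rightarrow> ('m::finite point \<Rightarrow> complex grass) \<Rightarrow> gvar set \<Rightarrow> 'm point dist" where
  "super_delta n g A \<phi> = (\<Sum>j\<le>n. delta_pullback j (\<lambda>x. gbody (g x))
     (\<lambda>x. gcoeff (gnil (g x) ^ j) A / fact j * \<phi> x))"

definition super_integral :: "nat \<Rightarrow> (gvar set \<Rightarrow> 'm::finite point dist) \<Rightarrow>
    ('m point \<Rightarrow> 'm clifford grass) \<Rightarrow> 'm clifford grass" where
  "super_integral n \<alpha> F = (\<Sum>A\<in>Pow (xvars n). \<Sum>B\<in>Pow (xvars n).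
     dist_pair (\<alpha> A) (\<lambda>x. xcoeff B (F x)) * berezin n (gmono A * gmono B))"

text \<open>The superdistributions integrated here have only components of even degree and complex
  values, hence they commute with all matrix entries and may be written in front.\<close>

definition super_integral_matrix :: "nat \<Rightarrow> (gvar set \<Rightarrow> 'm::finite point dist) \<Rightarrow>
    ('m point \<Rightarrow> 'm clifford grass ^ 2 ^ 2) \<Rightarrow> 'm clifford grass ^ 2 ^ 2" where
  "super_integral_matrix n \<alpha> F = (\<chi> i k. super_integral n \<alpha> (\<lambda>x. F x $ i $ k))"

end

theory Submission
  imports Defs
begin

text \<open>
  Add \<open>e > 0\<close> to the body of the squared norm. Since \<open>\<^bold>Z\<close> and its conjugate are nilpotent with
  anticommutator \<open>|\<^bold>Z|\<^sup>2\<close>, the Dirac operators acting from the right map the regularised kernel to a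
  multiple of \<open>e (|\<^bold>Z - \<^bold>U|\<^sup>2 + e)\<close> to the power \<open>-(m - n) - 1\<close>. In the expansion of this power in its
  nilpotent part only the term of top degree survives as \<open>e \<rightarrow> 0\<close>: its body is an approximate identity, and its
  nilpotent factor, the product of all differences of the anticommuting variables, turns the Berezin integral
  into evaluation at \<open>\<^bold>y\<close>. Integration by parts thus yields a Cauchy--Pompeiu formula for compactly
  supported superfunctions.

  The integral against \<open>\<delta>(g)\<close> is determined by the integrals against \<open>\<rho>(g)\<close> for test functions
  \<open>\<rho>\<close> near 0. If \<open>\<theta>' = - \<rho>\<close> and \<open>\<theta>\<close> vanishes on the positive side, then \<open>\<theta>(g)\<close> is locally constant away
  from the zero set of the body, and the Dirac operators map \<open>\<theta>(g) G\<close> to \<open>- \<rho>(g)\<close> times the derivative of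
  \<open>g\<close> times \<open>G\<close>, because \<open>G\<close> is monogenic. The Cauchy--Pompeiu formula for \<open>\<theta>(g) G\<close> is the claim.

  Identities in the Clifford algebra, on which there is no topology, are tested against complex linear functionals
  \<open>L\<close>, so that only integrals of complex functions occur.
\<close>

text \<open>Two singular objects are kept apart. The kernel is singular at \<open>y\<close>, but
  \<theta>(g) is constant near \<open>y\<close>, so both Dirac derivatives of \<theta>(g) G vanish
  there and the limit e -> 0 is harmless for the differentiated function; all concentration sits in
  the factor produced by the regularisation. The distribution \<delta>(g) contains derivatives of
  fibre integrals at the single level 0, which no integral over the whole space reproduces. Its
  pairing is therefore characterised as the value at 0 of a continuous density on the line, and such
  a value is determined by integrating the density against test functions \<rho>. The claimed value
  corresponds to a constant density: the formula yields a fixed number times the integral of \<rho>,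
  because that integral is the jump of \<theta> across the zero set. The matrix identity amounts to
  two identities: on the diagonal the anticommutator of the vector variables enters and gives
  \<open>G\<close> at \<open>y\<close>, off the diagonal only their squares enter and give
  0.\<close>

section \<open>Calculus of smooth functions on open sets\<close>

lemma frechet_derivative_cong_open:
  assumes "open S" "x \<in> S" "\<And>x. x \<in> S \<Longrightarrow> f x = g x"
  shows "frechet_derivative f (at x) = frechet_derivative g (at x)"
proof -
  have "(f has_derivative F) (at x) \<longleftrightarrow> (g has_derivative F) (at x)" for F
    using assms has_derivative_transform_within_open[of f F x UNIV S g]
      has_derivative_transform_within_open[of g F x UNIV S f] by auto
  then show ?thesis by (simp add: frechet_derivative_def)
qed

lemma differentiable_on_cong_open:
  assumes "open S" "\<And>x. x \<in> S \<Longrightarrow> f x = g x"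
  shows "f differentiable_on S \<longleftrightarrow> g differentiable_on S"
  using assms has_derivative_transform_within_open[of f _ _ UNIV S g]
    has_derivative_transform_within_open[of g _ _ UNIV S f]
  unfolding differentiable_on_eq_differentiable_at[OF assms(1)] differentiable_def by metis

lemma C_k_on_cong:
  assumes "open S" "\<And>x. x \<in> S \<Longrightarrow> f x = g x"
  shows "C_k_on k S f \<longleftrightarrow> C_k_on k S g"
  using assms(2)
proof (induction k arbitrary: f g)
  case 0
  then show ?case by (simp cong: continuous_on_cong)
next
  case (Suc k)
  then have "frechet_derivative f (at x) = frechet_derivative g (at x)" if "x \<in> S" for x
    using frechet_derivative_cong_open[OF assms(1) that] by blast
  then have "C_k_on k S (\<lambda>x. frechet_derivative f (at x) b) \<longleftrightarrow>
      C_k_on k S (\<lambda>x. frechet_derivative g (at x) b)" for b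
    by (intro Suc.IH) simp
  then show ?case using differentiable_on_cong_open[OF assms(1) Suc.prems] by simp
qed

text \<open>\<open>C_k_on\<close> is stated with \<open>frechet_derivative\<close>, which is a
  choice operator. This rule lets any explicit derivative \<open>f'\<close> take its place, so that
  the closure properties below become inductions on \<open>k\<close>.\<close>

lemma C_k_on_SucI:
  assumes "open S" "\<And>x. x \<in> S \<Longrightarrow> (f has_derivative f' x) (at x)"
    and "\<And>b. b \<in> Basis \<Longrightarrow> C_k_on k S (\<lambda>x. f' x b)"
  shows "C_k_on (Suc k) S f"
proof -
  have "f differentiable_on S"
    using assms(1,2) by (auto simp: differentiable_on_eq_differentiable_at differentiable_def)
  moreover have "frechet_derivative f (at x) = f' x" if "x \<in> S" for x
    using frechet_derivative_at[OF assms(2)[OF that]] by simp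
  then have "C_k_on k S (\<lambda>x. frechet_derivative f (at x) b)" if "b \<in> Basis" for b
    using assms(3)[OF that] C_k_on_cong[OF assms(1), of "\<lambda>x. frechet_derivative f (at x) b" "\<lambda>x. f' x b" k]
    by simp
  ultimately show ?thesis by simp
qed

lemma C_k_on_has_derivative:
  assumes "open S" "C_k_on (Suc k) S f" "x \<in> S"
  shows "(f has_derivative frechet_derivative f (at x)) (at x)"
  using assms by (simp add: differentiable_on_eq_differentiable_at frechet_derivative_works)

lemma C_k_on_SucD: "C_k_on (Suc k) S f \<Longrightarrow> C_k_on k S f"
proof (induction k arbitrary: f)
  case 0
  then show ?case by (simp add: differentiable_imp_continuous_on)
next
  case (Suc k)
  then show ?case unfolding C_k_on.simps(2)[of "Suc k"] C_k_on.simps(2)[of k] by simp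
qed

lemma C_k_on_const: "C_k_on k S (\<lambda>x. c)"
  by (induction k arbitrary: c) (auto simp: frechet_derivative_const)

lemma C_k_on_bounded_linear:
  assumes "open S" "bounded_linear h" "C_k_on k S f"
  shows "C_k_on k S (\<lambda>x. h (f x))"
  using assms(3)
proof (induction k arbitrary: f)
  case 0
  then show ?case using assms(2) by (simp add: bounded_linear.continuous_on)
next
  case (Suc k)
  show ?case
    by (rule C_k_on_SucI[OF assms(1) bounded_linear.has_derivative[OF assms(2)
          C_k_on_has_derivative[OF assms(1) Suc.prems]]])
       (use Suc in auto)
qed

lemma C_k_on_add:
  assumes "open S" "C_k_on k S f" "C_k_on k S g"
  shows "C_k_on k S (\<lambda>x. f x + g x)"
  using assms(2,3)
proof (induction k arbitrary: f g)
  case 0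
  then show ?case by (simp add: continuous_on_add)
next
  case (Suc k)
  show ?case
    by (rule C_k_on_SucI[OF assms(1) has_derivative_add[OF
          C_k_on_has_derivative[OF assms(1) Suc.prems(1)] C_k_on_has_derivative[OF assms(1) Suc.prems(2)]]])
       (use Suc in auto)
qed

text \<open>The derivative of \<open>h (f x) (g x)\<close> is a sum of two terms of the same shape,
  in which one argument is differentiated and the other is demoted from order \<open>Suc k\<close>
  to \<open>k\<close>; hence the induction varies both functions.\<close>

lemma C_k_on_bilinear:
  assumes "open S" "bounded_bilinear h" "C_k_on k S f" "C_k_on k S g"
  shows "C_k_on k S (\<lambda>x. h (f x) (g x))"
  using assms(3,4)
proof (induction k arbitrary: f g)
  case 0
  then show ?case using assms(2) by (simp add: bounded_bilinear.continuous_on)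
next
  case (Suc k)
  show ?case
  proof (rule C_k_on_SucI[OF assms(1) bounded_bilinear.FDERIV[OF assms(2)
          C_k_on_has_derivative[OF assms(1) Suc.prems(1)] C_k_on_has_derivative[OF assms(1) Suc.prems(2)]]])
    fix b :: 'a assume b: "b \<in> Basis"
    have "C_k_on k S (\<lambda>x. h (f x) (frechet_derivative g (at x) b))"
      using Suc.prems b by (intro Suc.IH[OF C_k_on_SucD]) auto
    moreover have "C_k_on k S (\<lambda>x. h (frechet_derivative f (at x) b) (g x))"
      using Suc.prems b by (intro Suc.IH[OF _ C_k_on_SucD]) auto
    ultimately show "C_k_on k S (\<lambda>x. h (f x) (frechet_derivative g (at x) b) + h (frechet_derivative f (at x) b) (g x))"
      by (rule C_k_on_add[OF assms(1)])
  qed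
qed

text \<open>For a real inner function the derivative of \<open>f (u x)\<close> is the derivative of
  \<open>f\<close> at \<open>u x\<close> scaled by a derivative of \<open>u\<close>, again a
  bilinear product. An induction with \<open>f\<close> generalised thus avoids higher chain
  rules.\<close>

lemma C_k_on_compose_real:
  fixes f :: "real \<Rightarrow> 'b::real_normed_vector" and u :: "'a::euclidean_space \<Rightarrow> real"
  assumes "open S" "open I" "u ` S \<subseteq> I" "C_k_on k I f" "C_k_on k S u"
  shows "C_k_on k S (\<lambda>x. f (u x))"
  using assms(4,5)
proof (induction k arbitrary: f)
  case 0
  then show ?case using assms(3) continuous_on_compose2[of I f S u] by simp
next
  case (Suc k)
  let ?f' = "\<lambda>t. frechet_derivative f (at t) 1"
  have d: "((\<lambda>x. f (u x)) has_derivative (\<lambda>b. frechet_derivative u (at x) b *\<^sub>R ?f' (u x))) (at x)"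
    if "x \<in> S" for x
  proof -
    have f: "(f has_derivative frechet_derivative f (at (u x))) (at (u x))"
      using C_k_on_has_derivative[OF assms(2) Suc.prems(1)] that assms(3) by auto
    have "((\<lambda>x. f (u x)) has_derivative
        (\<lambda>b. frechet_derivative f (at (u x)) (frechet_derivative u (at x) b))) (at x)"
      using has_derivative_compose[OF C_k_on_has_derivative[OF assms(1) Suc.prems(2) that] f] .
    moreover have "(\<lambda>b. frechet_derivative f (at (u x)) (frechet_derivative u (at x) b)) =
        (\<lambda>b. frechet_derivative u (at x) b *\<^sub>R ?f' (u x))"
    proof (rule ext)
      fix b show "frechet_derivative f (at (u x)) (frechet_derivative u (at x) b) =
          frechet_derivative u (at x) b *\<^sub>R ?f' (u x)"
        using linear_cmul[OF has_derivative_linear[OF f], of "frechet_derivative u (at x) b" 1]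
        unfolding real_scaleR_def mult_1_right .
    qed
    ultimately show ?thesis by (simp only:)
  qed
  show ?case
  proof (rule C_k_on_SucI[OF assms(1) d])
    fix b :: 'a assume b: "b \<in> Basis"
    have "C_k_on k S (\<lambda>x. ?f' (u x))"
      using Suc.IH[of ?f', OF _ C_k_on_SucD[OF Suc.prems(2)]] Suc.prems(1) by simp
    then show "C_k_on k S (\<lambda>x. frechet_derivative u (at x) b *\<^sub>R ?f' (u x))"
      using Suc.prems(2) b by (intro C_k_on_bilinear[OF assms(1) bounded_bilinear_scaleR]) simp_all
  qed
qed

text \<open>Derivatives at a point of an open set do not refer to the set, so smoothness is local.
  This is what allows functions to be glued later on.\<close>

lemma C_k_on_Un:
  assumes "open S" "open T" "C_k_on k S f" "C_k_on k T f"
  shows "C_k_on k (S \<union> T) f"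
  using assms(3,4)
proof (induction k arbitrary: f)
  case 0
  then show ?case using assms continuous_on_open_Un by auto
next
  case (Suc k)
  then show ?case using assms(1,2) by (auto simp: differentiable_on_eq_differentiable_at open_Un)
qed

lemma C_k_on_subset:
  assumes "open S" "open T" "T \<subseteq> S" "C_k_on k S f"
  shows "C_k_on k T f"
  using assms(4)
proof (induction k arbitrary: f)
  case 0
  then show ?case using assms continuous_on_subset by auto
next
  case (Suc k)
  then show ?case using assms(1-3) differentiable_on_subset by auto
qed

lemma smooth_on_cong:
  "open S \<Longrightarrow> (\<And>x. x \<in> S \<Longrightarrow> f x = g x) \<Longrightarrow> smooth_on S f \<longleftrightarrow> smooth_on S g"
  using C_k_on_cong[of S f g] unfolding smooth_on_def by simp

lemma smooth_on_derivI:
  assumes "open S" "\<And>x. x \<in> S \<Longrightarrow> (f has_derivative f' x) (at x)"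
    and "\<And>b. b \<in> Basis \<Longrightarrow> smooth_on S (\<lambda>x. f' x b)"
  shows "smooth_on S f"
proof -
  have "C_k_on (Suc k) S f" for k
    using assms by (intro C_k_on_SucI) (auto simp: smooth_on_def)
  then show ?thesis using C_k_on_SucD smooth_on_def by blast
qed

lemma smooth_on_deriv: "smooth_on S f \<Longrightarrow> b \<in> Basis \<Longrightarrow> smooth_on S (\<lambda>x. frechet_derivative f (at x) b)"
  unfolding smooth_on_def by (metis C_k_on.simps(2))

lemma smooth_on_has_derivative:
  "smooth_on S f \<Longrightarrow> open S \<Longrightarrow> x \<in> S \<Longrightarrow> (f has_derivative frechet_derivative f (at x)) (at x)"
  unfolding smooth_on_def by (meson C_k_on_has_derivative)

lemma smooth_on_continuous: "smooth_on S f \<Longrightarrow> continuous_on S f"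
  unfolding smooth_on_def using C_k_on.simps(1) by blast

lemma smooth_on_const [intro, simp]: "smooth_on S (\<lambda>x. c)"
  by (simp add: smooth_on_def C_k_on_const)

lemma smooth_on_bounded_linear:
  "bounded_linear h \<Longrightarrow> open S \<Longrightarrow> smooth_on S f \<Longrightarrow> smooth_on S (\<lambda>x. h (f x))"
  by (simp add: smooth_on_def C_k_on_bounded_linear)

lemma smooth_on_id: "open S \<Longrightarrow> smooth_on S (\<lambda>x. x)"
  by (rule smooth_on_derivI[where f' = "\<lambda>x b. b"]) (simp_all add: has_derivative_ident)

lemma smooth_on_add: "open S \<Longrightarrow> smooth_on S f \<Longrightarrow> smooth_on S g \<Longrightarrow> smooth_on S (\<lambda>x. f x + g x)"
  by (simp add: smooth_on_def C_k_on_add)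

lemma smooth_on_minus: "open S \<Longrightarrow> smooth_on S f \<Longrightarrow> smooth_on S (\<lambda>x. - f x)"
  by (rule smooth_on_bounded_linear[OF bounded_linear_minus[OF bounded_linear_ident], where f = f])

lemma smooth_on_diff: "open S \<Longrightarrow> smooth_on S f \<Longrightarrow> smooth_on S g \<Longrightarrow> smooth_on S (\<lambda>x. f x - g x)"
  using smooth_on_add[of S f "\<lambda>x. - g x"] smooth_on_minus by auto

lemma smooth_on_bilinear:
  "bounded_bilinear h \<Longrightarrow> open S \<Longrightarrow> smooth_on S f \<Longrightarrow> smooth_on S g \<Longrightarrow> smooth_on S (\<lambda>x. h (f x) (g x))"
  by (simp add: smooth_on_def C_k_on_bilinear)

lemma smooth_on_mult:
  fixes f g :: "'a::euclidean_space \<Rightarrow> 'b::real_normed_algebra"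
  shows "open S \<Longrightarrow> smooth_on S f \<Longrightarrow> smooth_on S g \<Longrightarrow> smooth_on S (\<lambda>x. f x * g x)"
  using smooth_on_bilinear[OF bounded_bilinear_mult] by blast

lemma smooth_on_power:
  fixes f :: "'a::euclidean_space \<Rightarrow> 'b::real_normed_algebra_1"
  shows "open S \<Longrightarrow> smooth_on S f \<Longrightarrow> smooth_on S (\<lambda>x. f x ^ k)"
  by (induction k) (auto intro: smooth_on_mult)

lemma smooth_on_sum:
  "open S \<Longrightarrow> (\<And>i. i \<in> A \<Longrightarrow> smooth_on S (f i)) \<Longrightarrow> smooth_on S (\<lambda>x. \<Sum>i\<in>A. f i x)"
  by (induction A rule: infinite_finite_induct) (auto intro: smooth_on_add)

lemma smooth_on_prod:
  fixes f :: "'i \<Rightarrow> 'a::euclidean_space \<Rightarrow> 'b::real_normed_field"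
  shows "open S \<Longrightarrow> (\<And>i. i \<in> A \<Longrightarrow> smooth_on S (f i)) \<Longrightarrow> smooth_on S (\<lambda>x. \<Prod>i\<in>A. f i x)"
  by (induction A rule: infinite_finite_induct) (auto intro: smooth_on_mult)

lemma smooth_on_compose_real:
  fixes f :: "real \<Rightarrow> 'b::real_normed_vector" and u :: "'a::euclidean_space \<Rightarrow> real"
  shows "open S \<Longrightarrow> open I \<Longrightarrow> u ` S \<subseteq> I \<Longrightarrow> smooth_on I f \<Longrightarrow> smooth_on S u \<Longrightarrow> smooth_on S (\<lambda>x. f (u x))"
  by (simp add: smooth_on_def C_k_on_compose_real)

lemma smooth_on_Un: "open S \<Longrightarrow> open T \<Longrightarrow> smooth_on S f \<Longrightarrow> smooth_on T f \<Longrightarrow> smooth_on (S \<union> T) f"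
  by (simp add: smooth_on_def C_k_on_Un)

lemma smooth_on_subset: "smooth_on S f \<Longrightarrow> open S \<Longrightarrow> open T \<Longrightarrow> T \<subseteq> S \<Longrightarrow> smooth_on T f"
  by (meson smooth_on_def C_k_on_subset)

lemma smooth_on_of_real: "open S \<Longrightarrow> smooth_on S f \<Longrightarrow> smooth_on S (\<lambda>x. complex_of_real (f x))"
  by (rule smooth_on_bounded_linear[OF bounded_linear_of_real])

lemma smooth_on_Re: "open S \<Longrightarrow> smooth_on S f \<Longrightarrow> smooth_on S (\<lambda>x. Re (f x))"
  by (rule smooth_on_bounded_linear[OF bounded_linear_Re])

lemma smooth_on_vector_derivative:
  fixes f :: "real \<Rightarrow> 'b::real_normed_vector"
  assumes "open S" "smooth_on S f"
  shows "smooth_on S (\<lambda>t. vector_derivative f (at t))"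
    and "t \<in> S \<Longrightarrow> (f has_vector_derivative vector_derivative f (at t)) (at t)"
proof -
  have d: "(f has_vector_derivative vector_derivative f (at t)) (at t)" if "t \<in> S" for t
    using smooth_on_has_derivative[OF assms(2,1) that]
    by (meson differentiableI vector_derivative_works)
  then show "t \<in> S \<Longrightarrow> (f has_vector_derivative vector_derivative f (at t)) (at t)" .
  have "frechet_derivative f (at t) 1 = vector_derivative f (at t)" if "t \<in> S" for t
    using frechet_derivative_at[OF d[OF that, unfolded has_vector_derivative_def]] by (metis scaleR_one)
  then show "smooth_on S (\<lambda>t. vector_derivative f (at t))"
    using smooth_on_deriv[OF assms(2), of 1]
      smooth_on_cong[OF assms(1), of "\<lambda>t. frechet_derivative f (at t) 1" "\<lambda>t. vector_derivative f (at t)"]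
    by simp
qed

text \<open>The induction varies the exponent, since differentiation lowers it. Exponent
  \<open>- 1\<close> supplies smooth reciprocals of positive functions.\<close>

lemma smooth_on_powr: "smooth_on {0<..} (\<lambda>s::real. s powr q)"
proof -
  have "C_k_on k {0<..} (\<lambda>s::real. s powr q)" for k
  proof (induction k arbitrary: q)
    case 0
    then show ?case by (auto intro!: continuous_intros)
  next
    case (Suc k)
    have "((\<lambda>s. s powr q) has_derivative (\<lambda>b. b * (q * s powr (q - 1)))) (at s)" if "s > 0" for s
      using has_real_derivative_powr[OF that, of q] by (simp add: has_field_derivative_def mult_commute_abs)
    moreover have "C_k_on k {0<..} (\<lambda>s. b * (q * s powr (q - 1)))" for b
      using C_k_on_bounded_linear[OF open_greaterThan bounded_linear_mult_right[of "b * q"] Suc.IH[of "q - 1"]]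
      by (simp add: mult.assoc)
    ultimately show ?case by (intro C_k_on_SucI[OF open_greaterThan]) auto
  qed
  then show ?thesis by (simp add: smooth_on_def)
qed

text \<open>The iterate inside \<open>delta_deriv\<close>, named so that a derivative can be split
  off at either end.\<close>

definition vderivs :: "nat \<Rightarrow> (real \<Rightarrow> 'b::real_normed_vector) \<Rightarrow> real \<Rightarrow> 'b" where
  "vderivs j = (\<lambda>k t. vector_derivative k (at t)) ^^ j"

lemma vderivs_simps [simp]: "vderivs 0 f = f"
  "vderivs (Suc j) f = (\<lambda>t. vector_derivative (vderivs j f) (at t))"
  by (simp_all add: vderivs_def)

lemma vderivs_Suc_right: "vderivs (Suc j) f = vderivs j (\<lambda>t. vector_derivative f (at t))"
  unfolding vderivs_def funpow_Suc_right by simp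

lemma smooth_on_vderivs: "open S \<Longrightarrow> smooth_on S f \<Longrightarrow> smooth_on S (vderivs j f)"
  by (induction j) (simp_all add: smooth_on_vector_derivative(1))

lemma vderivs_has_vector_derivative:
  "open S \<Longrightarrow> smooth_on S f \<Longrightarrow> t \<in> S \<Longrightarrow> (vderivs j f has_vector_derivative vderivs (Suc j) f t) (at t)"
  using smooth_on_vector_derivative(2)[OF _ smooth_on_vderivs] by fastforce

lemma vector_derivative_cong_open:
  assumes "open S" "\<And>t. t \<in> S \<Longrightarrow> f t = g t" "t \<in> S"
  shows "vector_derivative f (at t) = vector_derivative g (at t)"
proof -
  have "(f has_vector_derivative D) (at t) \<longleftrightarrow> (g has_vector_derivative D) (at t)" for D
    using assms has_vector_derivative_transform_within_open[of f D t S g]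
      has_vector_derivative_transform_within_open[of g D t S f] by auto
  then show ?thesis by (simp add: vector_derivative_def)
qed

lemma vderivs_cong:
  assumes "open S" "\<And>t. t \<in> S \<Longrightarrow> f t = g t" "t \<in> S"
  shows "vderivs j f t = vderivs j g t"
  using assms(3)
proof (induction j arbitrary: t)
  case (Suc j)
  then show ?case using vector_derivative_cong_open[OF assms(1) Suc.IH] by simp
qed (use assms in simp)

subsection \<open>Test functions\<close>

lemma tsupp_zero: "x \<notin> tsupp \<phi> \<Longrightarrow> \<phi> x = 0"
  using closure_subset[of "{x. \<phi> x \<noteq> 0}"] by (auto simp: tsupp_def)

lemma closed_tsupp [simp]: "closed (tsupp \<phi>)"
  by (simp add: tsupp_def)

lemma tsupp_subset: "(\<And>x. x \<notin> C \<Longrightarrow> \<phi> x = 0) \<Longrightarrow> closed C \<Longrightarrow> tsupp \<phi> \<subseteq> C"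
  unfolding tsupp_def by (rule closure_minimal) auto

lemma test_functionI:
  assumes "smooth_on UNIV \<phi>" "compact C" "\<And>x. x \<notin> C \<Longrightarrow> \<phi> x = 0"
  shows "test_function \<phi>"
proof -
  have "tsupp \<phi> \<subseteq> C"
    using assms by (intro tsupp_subset) (auto simp: compact_imp_closed)
  then show ?thesis
    using assms(1,2) closed_Int_compact[OF closed_tsupp, of C \<phi>]
    by (simp add: test_function_def inf.absorb1)
qed

lemma smooth_on_extend_zero:
  assumes "open S" "smooth_on S \<phi>" "closed C" "C \<subseteq> S" "\<And>x. x \<notin> C \<Longrightarrow> \<phi> x = 0"
  shows "smooth_on UNIV \<phi>"
proof -
  have "smooth_on (- C) \<phi>"
    using assms(3,5) smooth_on_cong[of "- C" \<phi> "\<lambda>x. 0"] by (simp add: open_Compl)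
  then have "smooth_on (S \<union> - C) \<phi>"
    using assms by (intro smooth_on_Un) (auto simp: open_Compl)
  moreover have "S \<union> - C = UNIV" using assms(4) by blast
  ultimately show ?thesis by simp
qed

text \<open>\<open>f\<close> may be anything off \<open>S\<close>, since the cut-off vanishes there.
  In this way functions with a singularity at \<open>y\<close> are turned into test
  functions.\<close>

lemma test_function_mult:
  assumes "open S" "smooth_on S f" "test_function \<eta>" "tsupp \<eta> \<subseteq> S"
  shows "test_function (\<lambda>x. \<eta> x * f x)" "tsupp (\<lambda>x. \<eta> x * f x) \<subseteq> tsupp \<eta>"
proof -
  have "smooth_on S \<eta>" using assms by (auto simp: test_function_def intro: smooth_on_subset)
  then have "smooth_on UNIV (\<lambda>x. \<eta> x * f x)"
    using assms by (intro smooth_on_extend_zero[of S _ "tsupp \<eta>"]) (auto intro: smooth_on_mult simp: tsupp_zero)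
  then show "test_function (\<lambda>x. \<eta> x * f x)"
    using assms by (intro test_functionI[of _ "tsupp \<eta>"]) (auto simp: test_function_def tsupp_zero)
  show "tsupp (\<lambda>x. \<eta> x * f x) \<subseteq> tsupp \<eta>"
    by (rule tsupp_subset) (auto simp: tsupp_zero)
qed

lemma test_function_add:
  assumes "test_function f" "test_function g" shows "test_function (\<lambda>x. f x + g x)"
  using assms by (intro test_functionI[of _ "tsupp f \<union> tsupp g"])
    (auto simp: test_function_def tsupp_zero intro: smooth_on_add)

lemma test_function_scale:
  assumes "test_function f" shows "test_function (\<lambda>x. c * f x)"
  using assms by (intro test_functionI[of _ "tsupp f"])
    (auto simp: test_function_def tsupp_zero intro: smooth_on_mult)

lemma test_function_integrable:
  fixes f :: "'a::euclidean_space \<Rightarrow> 'b::euclidean_space"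
  assumes "continuous_on UNIV f" "compact C" "\<And>x. x \<notin> C \<Longrightarrow> f x = 0"
  shows "integrable lborel f"
proof -
  have "integrable lborel (\<lambda>x. indicator C x *\<^sub>R f x)"
    using borel_integrable_compact[OF assms(2) continuous_on_subset[OF assms(1)]] by auto
  moreover have "(\<lambda>x. indicator C x *\<^sub>R f x) = f" using assms(3) by (auto simp: indicator_def)
  ultimately show ?thesis by simp
qed

section \<open>Flat functions, smooth steps and cut-offs\<close>

definition exp_flat :: "nat \<Rightarrow> real \<Rightarrow> real" where
  "exp_flat k t = (if t > 0 then exp (- (1 / t)) / t ^ k else 0)"

lemma exp_flat_tendsto: "(exp_flat k \<longlongrightarrow> 0) (at 0)"
proof -
  have "((\<lambda>x. x ^ k / exp x) \<longlongrightarrow> (0::real)) at_top" by (rule tendsto_power_div_exp_0)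
  then have "((\<lambda>t. inverse t ^ k / exp (inverse t)) \<longlongrightarrow> (0::real)) (at_right 0)"
    by (rule filterlim_compose[OF _ filterlim_inverse_at_top_right])
  moreover have "eventually (\<lambda>t. inverse t ^ k / exp (inverse t) = exp_flat k t) (at_right 0)"
    by (rule eventually_at_right_less[THEN eventually_mono])
       (auto simp: exp_flat_def exp_minus field_simps)
  ultimately have "(exp_flat k \<longlongrightarrow> 0) (at_right 0)"
    using tendsto_cong by fast
  moreover have "(exp_flat k \<longlongrightarrow> 0) (at_left 0)"
    by (rule tendsto_eventually) (auto simp: eventually_at_filter exp_flat_def)
  ultimately show ?thesis by (simp add: filterlim_split_at)
qed

text \<open>The family is indexed by the pole order \<open>k\<close> because it is then closed under
  differentiation: a derivative is a combination of members with larger \<open>k\<close>. Smoothness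
  becomes an induction over the whole family.\<close>

lemma exp_flat_has_derivative:
  "(exp_flat k has_field_derivative (exp_flat (k + 2) t - of_nat k * exp_flat (Suc k) t)) (at t)"
proof -
  consider "t > 0" | "t < 0" | "t = 0" by linarith
  then show ?thesis
  proof cases
    case 1
    have "((\<lambda>t. exp (- (1 / t)) / t ^ k) has_field_derivative
        ((exp (- (1 / t)) * (1 / t\<^sup>2)) * t ^ k - exp (- (1 / t)) * (of_nat k * t ^ (k - 1))) / (t ^ k * t ^ k)) (at t)"
      using 1 by (auto intro!: derivative_eq_intros simp: power2_eq_square)
    moreover have "((exp (- (1 / t)) * (1 / t\<^sup>2)) * t ^ k - exp (- (1 / t)) * (of_nat k * t ^ (k - 1))) / (t ^ k * t ^ k)
        = exp_flat (k + 2) t - of_nat k * exp_flat (Suc k) t"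
      using 1 by (cases k) (simp_all add: exp_flat_def field_simps power2_eq_square)
    ultimately have "((\<lambda>t. exp (- (1 / t)) / t ^ k) has_field_derivative
        (exp_flat (k + 2) t - of_nat k * exp_flat (Suc k) t)) (at t)" by (simp only:)
    moreover have "\<And>s. s \<in> {0<..} \<Longrightarrow> exp (- (1 / s)) / s ^ k = exp_flat k s"
      by (simp add: exp_flat_def)
    ultimately show ?thesis
      using 1 has_field_derivative_transform_within_open[of _ _ t "{0<..}" "exp_flat k"] by auto
  next
    case 2
    have "((\<lambda>t. 0) has_field_derivative (0::real)) (at t)" by simp
    then have "(exp_flat k has_field_derivative 0) (at t)"
      by (rule has_field_derivative_transform_within_open[of _ _ _ "{..<0}"])
         (use 2 in \<open>auto simp: exp_flat_def\<close>)
    then show ?thesis using 2 by (simp add: exp_flat_def)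
  next
    case 3
    have "((\<lambda>y. (exp_flat k y - exp_flat k 0) / (y - 0)) \<longlongrightarrow> 0) (at 0)"
    \<comment> \<open>The difference quotient of \<open>exp_flat k\<close> at 0 is
      \<open>exp_flat (Suc k)\<close>, whose limit at 0 is known.\<close>
    proof (rule Lim_transform_eventually[OF exp_flat_tendsto[of "Suc k"]])
      show "\<forall>\<^sub>F y in at 0. exp_flat (Suc k) y = (exp_flat k y - exp_flat k 0) / (y - 0)"
        by (simp add: eventually_at_filter exp_flat_def field_simps)
    qed
    then show ?thesis using 3 by (simp add: has_field_derivative_iff exp_flat_def)
  qed
qed

lemma exp_flat_smooth: "smooth_on UNIV (exp_flat k)"
proof -
  have "C_k_on j UNIV (exp_flat k)" for j
  proof (induction j arbitrary: k)
    case 0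
    then show ?case
      using exp_flat_has_derivative[of k] by (auto intro!: continuous_at_imp_continuous_on DERIV_isCont)
  next
    case (Suc j)
    let ?d = "\<lambda>t. exp_flat (k + 2) t - of_nat k * exp_flat (Suc k) t"
    have c: "C_k_on j UNIV (\<lambda>t. ?d t * b)" for b
    proof -
      have "C_k_on j UNIV (\<lambda>t. b * exp_flat (k + 2) t + (- b * of_nat k) * exp_flat (Suc k) t)"
        by (intro C_k_on_add C_k_on_bounded_linear[OF _ bounded_linear_mult_right]) (use Suc in auto)
      then show ?thesis by (simp add: algebra_simps)
    qed
    show ?case
      by (rule C_k_on_SucI[OF open_UNIV exp_flat_has_derivative[of k, unfolded has_field_derivative_def] c])
  qed
  then show ?thesis by (simp add: smooth_on_def)
qed

text \<open>The sum never vanishes, since one of \<open>t\<close> and \<open>1 - t\<close> is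
  positive; its reciprocal is a \<open>powr\<close> so that \<open>smooth_on_powr\<close>
  applies.\<close>

definition smooth_step :: "real \<Rightarrow> real" where
  "smooth_step t = exp_flat 0 t * (exp_flat 0 t + exp_flat 0 (1 - t)) powr (- 1)"

lemma exp_flat_nonneg: "exp_flat 0 t \<ge> 0" by (simp add: exp_flat_def)

lemma exp_flat_sum_pos: "exp_flat 0 t + exp_flat 0 (1 - t) > 0"
  by (cases "t > 0") (auto simp: exp_flat_def add_pos_nonneg)

lemma smooth_step_bounds: "smooth_step t \<ge> 0" "smooth_step t \<le> 1"
  using exp_flat_sum_pos[of t] exp_flat_nonneg[of t] exp_flat_nonneg[of "1 - t"]
  by (auto simp: smooth_step_def powr_minus_divide field_simps)

lemma smooth_step_0: "t \<le> 0 \<Longrightarrow> smooth_step t = 0"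
  by (simp add: smooth_step_def exp_flat_def)

lemma smooth_step_1: "t \<ge> 1 \<Longrightarrow> smooth_step t = 1"
  using exp_flat_sum_pos[of t] by (simp add: smooth_step_def exp_flat_def powr_minus_divide)

lemma smooth_step_smooth: "smooth_on UNIV smooth_step"
  unfolding smooth_step_def
proof (rule smooth_on_mult)
  have r: "smooth_on UNIV (\<lambda>t. exp_flat 0 (1 - t))"
    by (rule smooth_on_compose_real[OF open_UNIV open_UNIV _ exp_flat_smooth])
       (auto intro!: smooth_on_diff smooth_on_id)
  show "smooth_on UNIV (\<lambda>t. (exp_flat 0 t + exp_flat 0 (1 - t)) powr - 1)"
    by (rule smooth_on_compose_real[OF open_UNIV open_greaterThan _ smooth_on_powr])
       (use exp_flat_sum_pos in \<open>auto intro!: smooth_on_add exp_flat_smooth r\<close>)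
qed (auto intro: exp_flat_smooth)

text \<open>Finitely many balls of half radius cover \<open>K\<close>. For bumps with values between
  0 and 1, the function 1 minus the product of all \<open>1 - b a x\<close> is 1 wherever one bump
  is 1 and 0 wherever all bumps are 0.\<close>

lemma smooth_cutoff_real:
  fixes K S :: "'a::euclidean_space set"
  assumes "compact K" "open S" "K \<subseteq> S"
  obtains \<eta> :: "'a \<Rightarrow> real" and U C where "smooth_on UNIV \<eta>" "\<And>x. 0 \<le> \<eta> x" "\<And>x. \<eta> x \<le> 1"
    "open U" "K \<subseteq> U" "\<And>x. x \<in> U \<Longrightarrow> \<eta> x = 1" "compact C" "C \<subseteq> S" "\<And>x. x \<notin> C \<Longrightarrow> \<eta> x = 0"
proof -
  have "\<forall>x\<in>K. \<exists>r>0. cball x r \<subseteq> S" using assms open_contains_cball by blast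
  then obtain r where r: "\<And>x. x \<in> K \<Longrightarrow> r x > 0 \<and> cball x (r x) \<subseteq> S" by metis
  have "K \<subseteq> (\<Union>a\<in>K. ball a (r a / 2))" using r by (auto simp: subset_iff intro!: bexI)
  then obtain F where F: "F \<subseteq> K" "finite F" "K \<subseteq> (\<Union>a\<in>F. ball a (r a / 2))"
    using compactE_image[OF assms(1), of K "\<lambda>a. ball a (r a / 2)"] by (metis open_ball)
  \<comment> \<open>The argument of the step is at least 1 within distance \<open>r a / 2\<close> of
    \<open>a\<close> and at most -2 beyond distance \<open>r a\<close>. The squared distance keeps
    it smooth at the centre.\<close>
  define b where "b a x = smooth_step (2 - 4 / (r a)\<^sup>2 * ((x - a) \<bullet> (x - a)))" for a x :: 'a
  have b1: "b a x = 1" if "a \<in> F" "x \<in> ball a (r a / 2)" for a x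
  proof -
    have "(norm (x - a))\<^sup>2 \<le> (r a / 2)\<^sup>2"
      using that by (intro power_mono) (auto simp: dist_norm norm_minus_commute)
    moreover have "r a > 0" using that F r by auto
    ultimately show ?thesis
      unfolding b_def by (intro smooth_step_1) (simp add: power2_norm_eq_inner field_simps)
  qed
  have b0: "b a x = 0" if "a \<in> F" "x \<notin> cball a (r a)" for a x
  proof -
    have ra: "r a > 0" using that F r by auto
    have "(r a)\<^sup>2 \<le> (norm (x - a))\<^sup>2"
      using that ra by (intro power_mono) (auto simp: dist_norm norm_minus_commute)
    then have "(r a)\<^sup>2 \<le> 2 * ((x - a) \<bullet> (x - a))"
      using zero_le_power2[of "r a"] unfolding power2_norm_eq_inner by linarith
    then show ?thesis
      unfolding b_def using ra by (intro smooth_step_0) (simp add: field_simps)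
  qed
  have bb: "0 \<le> b a x" "b a x \<le> 1" for a x by (auto simp: b_def smooth_step_bounds)
  have bs: "smooth_on UNIV (b a)" for a
  proof -
    have "smooth_on UNIV (\<lambda>x. 2 - 4 / (r a)\<^sup>2 * ((x - a) \<bullet> (x - a)))"
      by (intro smooth_on_diff smooth_on_mult smooth_on_bilinear[OF bounded_bilinear_inner]
          smooth_on_id smooth_on_const open_UNIV)
    then show ?thesis
      unfolding b_def by (intro smooth_on_compose_real[OF open_UNIV open_UNIV _ smooth_step_smooth]) simp_all
  qed
  show thesis
  proof (rule that[of "\<lambda>x. 1 - (\<Prod>a\<in>F. 1 - b a x)" "\<Union>a\<in>F. ball a (r a / 2)" "\<Union>a\<in>F. cball a (r a)"])
    show "smooth_on UNIV (\<lambda>x. 1 - (\<Prod>a\<in>F. 1 - b a x))"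
      by (intro smooth_on_diff smooth_on_prod smooth_on_const bs) auto
    show "0 \<le> 1 - (\<Prod>a\<in>F. 1 - b a x)" for x
      using prod_le_1[of F "\<lambda>a. 1 - b a x"] bb by auto
    show "1 - (\<Prod>a\<in>F. 1 - b a x) \<le> 1" for x
      using prod_nonneg[of F "\<lambda>a. 1 - b a x"] bb by auto
    show "1 - (\<Prod>a\<in>F. 1 - b a x) = 1" if x: "x \<in> (\<Union>a\<in>F. ball a (r a / 2))" for x
    proof -
      obtain a where "a \<in> F" "b a x = 1" using x b1 by blast
      then show ?thesis using F(2) by (simp add: prod_zero_iff) force
    qed
    show "1 - (\<Prod>a\<in>F. 1 - b a x) = 0" if "x \<notin> (\<Union>a\<in>F. cball a (r a))" for x
    proof -
      have "b a x = 0" if a: "a \<in> F" for a using b0[OF a] \<open>x \<notin> _\<close> a by blast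
      then show ?thesis by simp
    qed
    show "compact (\<Union>a\<in>F. cball a (r a))" using F(2) by (intro compact_UN) auto
    show "(\<Union>a\<in>F. cball a (r a)) \<subseteq> S" using F(1) r by blast
  qed (use F in auto)
qed

lemma smooth_cutoff:
  fixes K S :: "'a::euclidean_space set"
  assumes "compact K" "open S" "K \<subseteq> S"
  obtains \<eta> U where "test_function \<eta>" "tsupp \<eta> \<subseteq> S" "open U" "K \<subseteq> U" "\<And>x. x \<in> U \<Longrightarrow> \<eta> x = 1"
proof -
  obtain e :: "'a \<Rightarrow> real" and U C where e: "smooth_on UNIV e" "open U" "K \<subseteq> U"
    "\<And>x. x \<in> U \<Longrightarrow> e x = 1" "compact C" "C \<subseteq> S" "\<And>x. x \<notin> C \<Longrightarrow> e x = 0"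
    using smooth_cutoff_real[OF assms] by metis
  have "tsupp (\<lambda>x. complex_of_real (e x)) \<subseteq> C"
    by (rule tsupp_subset) (auto simp: e compact_imp_closed)
  then show thesis
    using that[of "\<lambda>x. complex_of_real (e x)" U] test_functionI[of "\<lambda>x. complex_of_real (e x)" C] e
    by (auto intro: smooth_on_of_real)
qed

subsection \<open>Integration by parts\<close>

text \<open>Translation invariance makes the integral of every difference quotient in direction
  \<open>b\<close> zero; dominated convergence passes to the derivative.\<close>

lemma integral_directional_derivative_zero:
  fixes f :: "'a::euclidean_space \<Rightarrow> complex"
  assumes der: "\<And>x. (f has_derivative f' x) (at x)"
    and cont: "continuous_on UNIV (\<lambda>x. f' x b)"
    and C: "compact C" and f0: "\<And>x. x \<notin> C \<Longrightarrow> f x = 0"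
  shows "(LINT x|lborel. f' x b) = 0"
proof -
  have d0: "f' x b = 0" if "x \<notin> C" for x
  proof -
    have "((\<lambda>x. 0) has_derivative f' x) (at x)"
      by (rule has_derivative_transform_within_open[OF der, of "- C"])
         (use that C f0 in \<open>auto simp: compact_imp_closed open_Compl\<close>)
    then have "f' x = (\<lambda>b. 0)" using has_derivative_unique has_derivative_const by blast
    then show ?thesis by simp
  qed
  have "bounded ((\<lambda>x. f' x b) ` C)"
    by (intro compact_imp_bounded compact_continuous_image continuous_on_subset[OF cont] C) simp
  then obtain M0 where M0: "\<And>x. x \<in> C \<Longrightarrow> norm (f' x b) \<le> M0" by (auto simp: bounded_iff)
  define M where "M = max M0 0"
  have M: "norm (f' x b) \<le> M" for x using M0 d0[of x] by (cases "x \<in> C") (simp_all add: M_def le_max_iff_disj)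
  define h where "h k = 1 / real (Suc k)" for k
  have h: "h k > 0" "h k \<le> 1" for k by (auto simp: h_def)
  define s where "s k x = (f (x + h k *\<^sub>R b) - f x) /\<^sub>R h k" for k x
  \<comment> \<open>\<open>C\<close> swept along \<open>- b\<close>: it contains the supports of all
    difference quotients with steps at most 1, so one integrable majorant serves them all.\<close>
  define C' where "C' = (\<lambda>(x, t). x - t *\<^sub>R b) ` (C \<times> {0..1::real})"
  have C': "compact C'" unfolding C'_def
    by (intro compact_continuous_image compact_Times C compact_Icc)
       (auto intro!: continuous_intros simp: case_prod_unfold)
  have line: "((\<lambda>t. f (x + t *\<^sub>R b)) has_vector_derivative f' (x + t *\<^sub>R b) b) (at t within T)" for x t T
  proof -
    have "((\<lambda>t. f (x + t *\<^sub>R b)) has_derivative (\<lambda>r. f' (x + t *\<^sub>R b) (r *\<^sub>R b))) (at t within T)"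
      by (rule has_derivative_compose[OF _ der]) (auto intro!: derivative_eq_intros)
    then show ?thesis
      unfolding has_vector_derivative_def
      by (simp only: linear_cmul[OF has_derivative_linear[OF der]])
  qed
  have fc: "continuous_on UNIV f"
    using der by (meson continuous_at_imp_continuous_on has_derivative_continuous)
  have int: "integrable lborel f" by (rule test_function_integrable[OF fc C f0])
  have distr: "distr lborel borel ((+) c) = (lborel :: 'a measure)" for c by (rule lborel_distr_plus)
  have int2: "integrable lborel (\<lambda>x. f (x + c))" "(LINT x|lborel. f (x + c)) = (LINT x|lborel. f x)" for c
  proof -
    have m: "f \<in> borel_measurable borel" using fc by (rule borel_measurable_continuous_onI)
    have "integrable (distr lborel borel ((+) c)) f" using int distr by simp
    then show "integrable lborel (\<lambda>x. f (x + c))"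
      using integrable_distr_eq[of "(+) c" lborel borel f] m by (simp add: add.commute)
    have "(LINT x|distr lborel borel ((+) c). f x) = (LINT x|lborel. f (c + x))"
      by (rule integral_distr) (use m in auto)
    then show "(LINT x|lborel. f (x + c)) = (LINT x|lborel. f x)" by (simp add: distr add.commute)
  qed
  have "(\<lambda>k. LINT x|lborel. s k x) \<longlonglongrightarrow> (LINT x|lborel. f' x b)"
  proof (rule integral_dominated_convergence[where w = "\<lambda>x. M * indicator C' x"])
    show "(\<lambda>x. f' x b) \<in> borel_measurable lborel"
      using borel_measurable_continuous_onI[OF cont] by simp
    show "s k \<in> borel_measurable lborel" for k
      unfolding s_def using int int2 by (auto intro!: borel_measurable_integrable)
    show "integrable lborel (\<lambda>x. M * indicator C' x :: real)"
      using borel_integrable_compact[OF C' continuous_on_const, of M] by (simp add: mult.commute)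
    show "AE x in lborel. (\<lambda>k. s k x) \<longlonglongrightarrow> f' x b"
    proof (rule AE_I2)
      fix x
      have "((\<lambda>t. norm (f (x + t *\<^sub>R b) - f x - t *\<^sub>R f' x b) / norm t) \<longlongrightarrow> 0) (at 0)"
        using line[of x 0 UNIV] by (simp add: has_vector_derivative_def has_derivative_at)
      then have "((\<lambda>t. norm ((f (x + t *\<^sub>R b) - f x) /\<^sub>R t - f' x b)) \<longlongrightarrow> 0) (at 0)"
      proof (rule Lim_transform_eventually)
        have "norm (v - t *\<^sub>R w) / norm t = norm (v /\<^sub>R t - w)" if "t \<noteq> 0" for v w :: complex and t :: real
        proof -
          have "v /\<^sub>R t - w = (v - t *\<^sub>R w) /\<^sub>R t" using that by (simp add: scaleR_diff_right)
          then show ?thesis by (simp add: divide_inverse mult.commute)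
        qed
        then show "\<forall>\<^sub>F t in at 0. norm (f (x + t *\<^sub>R b) - f x - t *\<^sub>R f' x b) / norm t =
            norm ((f (x + t *\<^sub>R b) - f x) /\<^sub>R t - f' x b)"
          by (simp add: eventually_at_filter)
      qed
      then have "((\<lambda>t. (f (x + t *\<^sub>R b) - f x) /\<^sub>R t) \<longlongrightarrow> f' x b) (at 0)"
        by (simp add: tendsto_norm_zero_iff LIM_zero_iff)
      moreover have "filterlim h (at 0) sequentially"
        using h unfolding filterlim_at h_def
        using LIMSEQ_Suc[OF lim_1_over_n[where 'a = real]] by simp
      ultimately show "(\<lambda>k. s k x) \<longlonglongrightarrow> f' x b"
        unfolding s_def by (rule filterlim_compose)
    qed
    show "AE x in lborel. norm (s k x) \<le> M * indicator C' x" for k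
    proof (rule AE_I2)
      fix x
      show "norm (s k x) \<le> M * indicator C' x"
      proof (cases "x \<in> C'")
        case True
        have "norm (f (x + h k *\<^sub>R b) - f (x + 0 *\<^sub>R b)) \<le> M * norm (h k - 0)"
        proof (rule differentiable_bound[of "{0..h k}" _ "\<lambda>t r. r *\<^sub>R f' (x + t *\<^sub>R b) b"])
          show "((\<lambda>t. f (x + t *\<^sub>R b)) has_derivative (\<lambda>r. r *\<^sub>R f' (x + t *\<^sub>R b) b)) (at t within {0..h k})" for t
            using line by (simp add: has_vector_derivative_def)
          show "onorm (\<lambda>r. r *\<^sub>R f' (x + t *\<^sub>R b) b) \<le> M" for t
          proof (rule onorm_bound)
            show "norm (r *\<^sub>R f' (x + t *\<^sub>R b) b) \<le> M * norm r" for r :: real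
              using mult_right_mono[OF M[of "x + t *\<^sub>R b"], of "norm r"] by (simp add: mult.commute)
          qed (simp add: M_def)
        qed (use h[of k] in simp_all)
        moreover have "norm (s k x) = norm (f (x + h k *\<^sub>R b) - f x) / h k"
          unfolding s_def norm_scaleR using h[of k] by (simp add: divide_inverse mult.commute)
        ultimately show ?thesis using True h[of k] by (simp add: divide_le_eq)
      next
        case False
        have "x \<notin> C"
        proof
          assume "x \<in> C"
          then have "x \<in> C'" unfolding C'_def by (intro image_eqI[of _ _ "(x, 0)"]) auto
          with False show False by simp
        qed
        moreover have "x + h k *\<^sub>R b \<notin> C"
        proof
          assume "x + h k *\<^sub>R b \<in> C"
          then have "x \<in> C'" unfolding C'_def using h[of k]
            by (intro image_eqI[of _ _ "(x + h k *\<^sub>R b, h k)"]) auto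
          with False show False by simp
        qed
        ultimately show ?thesis using False f0 by (simp add: s_def)
      qed
    qed
  qed
  moreover have "(LINT x|lborel. s k x) = 0" for k
    unfolding s_def using int int2 by simp
  ultimately show ?thesis using LIMSEQ_unique[of "\<lambda>_. 0"] by auto
qed

text \<open>If \<open>k t0\<close> were nonzero, multiplication by its conjugate would make the real
  part positive near \<open>t0\<close>. Tested against a narrow bump, this gives a nonnegative
  continuous function with integral 0, which has to vanish at \<open>t0\<close>.\<close>

lemma fundamental_lemma_variations:
  fixes k :: "real \<Rightarrow> complex"
  assumes I: "open I" and k: "continuous_on I k"
    and int: "\<And>\<psi>. test_function \<psi> \<Longrightarrow> tsupp \<psi> \<subseteq> I \<Longrightarrow> (LINT t|lborel. k t * \<psi> t) = 0"
    and t0: "t0 \<in> I"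
  shows "k t0 = 0"
proof (rule ccontr)
  assume nz: "k t0 \<noteq> 0"
  define q where "q t = Re (k t * cnj (k t0))" for t
  have qc: "continuous_on I q" unfolding q_def by (intro continuous_intros k)
  have q0: "q t0 > 0" using nz unfolding q_def
    by (simp add: complex_mult_cnj sum_power2_gt_zero_iff complex_eq_iff)
  have "open (I \<inter> q -` {0<..})"
    using qc I by (rule continuous_open_preimage) simp
  then obtain d where d: "d > 0" "cball t0 d \<subseteq> I \<inter> q -` {0<..}"
    using q0 t0 open_contains_cball by (metis IntI greaterThan_iff vimageI)
  obtain e :: "real \<Rightarrow> real" and U C where e: "smooth_on UNIV e" "\<And>x. 0 \<le> e x" "open U" "{t0} \<subseteq> U"
    "\<And>x. x \<in> U \<Longrightarrow> e x = 1" "compact C" "C \<subseteq> ball t0 d" "\<And>x. x \<notin> C \<Longrightarrow> e x = 0"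
    using smooth_cutoff_real[of "{t0}" "ball t0 d"] d(1) by (metis centre_in_ball compact_sing
        empty_subsetI insert_subset open_ball)
  define \<psi> where "\<psi> t = cnj (k t0) * complex_of_real (e t)" for t
  have "test_function \<psi>"
    unfolding \<psi>_def using e
    by (intro test_functionI[of _ C] smooth_on_mult smooth_on_of_real smooth_on_const) auto
  moreover have "tsupp \<psi> \<subseteq> C"
    by (rule tsupp_subset) (use e in \<open>auto simp: \<psi>_def compact_imp_closed\<close>)
  moreover have CI: "C \<subseteq> I" using e(7) d(2) ball_subset_cball[of t0 d] by blast
  ultimately have z: "(LINT t|lborel. k t * \<psi> t) = 0" by (intro int) auto
  let ?b = "cbox (t0 - d) (t0 + d)"
  have bI: "?b \<subseteq> I" "\<And>t. t \<in> ?b \<Longrightarrow> q t > 0"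
    using d(2) by (auto simp: cball_eq_atLeastAtMost)
  have "C \<subseteq> ?b" using e(7) by (auto simp: ball_eq_greaterThanLessThan)
  then have e0: "e t = 0" if "t \<notin> ?b" for t using that e(8)[of t] by blast
  have kp: "k t * \<psi> t = 0" if "t \<notin> ?b" for t
    using e0[OF that] by (simp add: \<psi>_def)
  have kc: "continuous_on ?b (\<lambda>t. k t * \<psi> t)"
    unfolding \<psi>_def using smooth_on_continuous[OF e(1)]
    by (intro continuous_intros continuous_on_subset[OF k bI(1)]) (auto intro: continuous_on_subset)
  have eq: "(\<lambda>t. indicator ?b t *\<^sub>R (k t * \<psi> t)) = (\<lambda>t. k t * \<psi> t)"
    using kp by (auto simp: indicator_def)
  have ki: "integrable lborel (\<lambda>t. k t * \<psi> t)"
    using borel_integrable_compact[OF compact_cbox kc] unfolding eq .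
  have "(LINT t|lborel. Re (k t * \<psi> t)) = Re (LINT t|lborel. k t * \<psi> t)"
    by (rule integral_Re[OF ki])
  then have z2: "(LINT t|lborel. q t * e t) = 0" unfolding z by (simp add: \<psi>_def q_def mult.assoc[symmetric])
  have qi: "integrable lborel (\<lambda>t. q t * e t)"
    using integrable_Re[OF ki] by (simp add: \<psi>_def q_def mult.assoc[symmetric])
  have qe: "q t * e t = 0" if "t \<notin> ?b" for t
    using e0[OF that] by simp
  have "((\<lambda>t. q t * e t) has_integral 0) UNIV"
    using has_integral_integral_lborel[OF qi] z2 by simp
  moreover have "(\<lambda>t. if t \<in> ?b then q t * e t else 0) = (\<lambda>t. q t * e t)" using qe by auto
  ultimately have "((\<lambda>t. q t * e t) has_integral 0) ?b"
    using has_integral_restrict_UNIV[of ?b "\<lambda>t. q t * e t" 0] by (simp only:)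
  then have "q t0 * e t0 = 0"
  proof (rule has_integral_0_cbox_imp_0[rotated 2])
    show "continuous_on ?b (\<lambda>t. q t * e t)"
      using smooth_on_continuous[OF e(1)]
      by (intro continuous_intros continuous_on_subset[OF qc bI(1)]) (auto intro: continuous_on_subset)
    show "0 \<le> q t * e t" if "t \<in> box (t0 - d) (t0 + d)" for t
      using bI(2)[of t] that e(2) by simp
  qed (use d in auto)
  then show False using q0 e(4,5) by simp
qed

text \<open>\<open>h\<close> is smooth only on \<open>I\<close>, but its product with
  \<open>\<psi>\<close> extends by zero, and the derivative of that extension integrates to
  zero.\<close>

lemma integral_by_parts_test:
  assumes I: "open I" and h: "smooth_on I h" and psi: "test_function \<psi>" "tsupp \<psi> \<subseteq> I"
  shows "(LINT t|lborel. vector_derivative h (at t) * \<psi> t) =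
      - (LINT t|lborel. h t * vector_derivative \<psi> (at t))" (is "?A = - ?B")
    and "test_function (\<lambda>t. vector_derivative \<psi> (at t))" (is ?C)
    and "tsupp (\<lambda>t. vector_derivative \<psi> (at t)) \<subseteq> tsupp \<psi>" (is ?D)
proof -
  let ?h' = "\<lambda>t. vector_derivative h (at t)" and ?p' = "\<lambda>t. vector_derivative \<psi> (at t)"
  have ps: "smooth_on UNIV \<psi>" "compact (tsupp \<psi>)" using psi by (auto simp: test_function_def)
  have pd: "(\<psi> has_vector_derivative ?p' t) (at t)" for t
    using smooth_on_vector_derivative(2)[OF open_UNIV ps(1)] by simp
  have p0: "?p' t = 0" if "t \<notin> tsupp \<psi>" for t
    using vector_derivative_cong_open[of "- tsupp \<psi>" \<psi> "\<lambda>_. 0" t] that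
    by (simp add: open_Compl tsupp_zero)
  show pt: ?C by (rule test_functionI[OF smooth_on_vector_derivative(1)[OF open_UNIV ps(1)] ps(2) p0])
  show pts: ?D by (rule tsupp_subset) (auto intro: p0)
  define F where "F t = \<psi> t * h t" for t
  have F: "test_function F" "tsupp F \<subseteq> tsupp \<psi>"
    unfolding F_def by (rule test_function_mult[OF I h psi])+
  then have Fs: "smooth_on UNIV F" by (simp add: test_function_def)
  have Fd: "(F has_vector_derivative vector_derivative F (at t)) (at t)" for t
    using smooth_on_vector_derivative(2)[OF open_UNIV Fs] by simp
  have Feq: "vector_derivative F (at t) = ?h' t * \<psi> t + h t * ?p' t" for t
  proof (cases "t \<in> I")
    case True
    have "(F has_vector_derivative \<psi> t * ?h' t + ?p' t * h t) (at t)"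
      unfolding F_def
      by (rule has_vector_derivative_mult[OF pd smooth_on_vector_derivative(2)[OF I h True]])
    then show ?thesis by (simp add: vector_derivative_at mult.commute)
  next
    case False
    then have "t \<notin> tsupp \<psi>" using psi(2) by auto
    then show ?thesis
      using vector_derivative_cong_open[of "- tsupp \<psi>" F "\<lambda>_. 0" t] p0
      by (simp add: open_Compl tsupp_zero F_def)
  qed
  have "continuous_on UNIV (\<lambda>t. vector_derivative F (at t))"
    by (rule smooth_on_continuous[OF smooth_on_vector_derivative(1)[OF open_UNIV Fs]])
  then have "(LINT t|lborel. 1 *\<^sub>R vector_derivative F (at t)) = 0"
    by (intro integral_directional_derivative_zero[of F "\<lambda>t b. b *\<^sub>R vector_derivative F (at t)" 1 "tsupp F"])
       (use Fd F(1) in \<open>auto simp: has_vector_derivative_def test_function_def tsupp_zero\<close>)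
  then have z: "(LINT t|lborel. ?h' t * \<psi> t + h t * ?p' t) = 0" by (simp add: Feq)
  have i: "integrable lborel (\<lambda>t. \<phi> t * k t)" if "smooth_on I k" "test_function \<phi>" "tsupp \<phi> \<subseteq> I" for \<phi> k
    using test_function_mult[OF I that] that(2)
    by (intro test_function_integrable[of _ "tsupp \<phi>"])
       (simp_all add: test_function_def tsupp_zero smooth_on_continuous)
  have "integrable lborel (\<lambda>t. ?h' t * \<psi> t)" "integrable lborel (\<lambda>t. h t * ?p' t)"
    using i[OF smooth_on_vector_derivative(1)[OF I h] psi] i[OF h pt] pts psi(2)
    by (simp_all add: mult.commute)
  then have "?A + ?B = 0" using z by simp
  then show "?A = - ?B" by (simp add: add_eq_0_iff2)
qed

text \<open>One derivative moves at a time: the induction takes it off \<open>h\<close> from the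
  inside and puts it on \<open>\<psi>\<close> from the outside, so \<open>h\<close> is generalised
  while \<open>\<psi>\<close> stays fixed.\<close>

lemma integral_by_parts_vderivs:
  assumes "open I" "smooth_on I h" "test_function \<psi>" "tsupp \<psi> \<subseteq> I"
  shows "(LINT t|lborel. vderivs j h t * \<psi> t) = (- 1) ^ j * (LINT t|lborel. h t * vderivs j \<psi> t)"
    and "test_function (vderivs j \<psi>)" "tsupp (vderivs j \<psi>) \<subseteq> tsupp \<psi>"
proof -
  have *: "test_function (vderivs j \<psi>) \<and> tsupp (vderivs j \<psi>) \<subseteq> tsupp \<psi>" for j
  proof (induction j)
    case (Suc j)
    then have "tsupp (vderivs j \<psi>) \<subseteq> I" using assms(4) by auto
    with Suc integral_by_parts_test(2,3)[OF assms(1,2), of "vderivs j \<psi>"] show ?case by auto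
  qed (use assms in auto)
  then show "test_function (vderivs j \<psi>)" "tsupp (vderivs j \<psi>) \<subseteq> tsupp \<psi>" by auto
  show "(LINT t|lborel. vderivs j h t * \<psi> t) = (- 1) ^ j * (LINT t|lborel. h t * vderivs j \<psi> t)"
    using assms(2)
  proof (induction j arbitrary: h)
    case (Suc j)
    have "(LINT t|lborel. vderivs (Suc j) h t * \<psi> t) =
        (- 1) ^ j * (LINT t|lborel. vector_derivative h (at t) * vderivs j \<psi> t)"
      unfolding vderivs_Suc_right
      using smooth_on_vector_derivative(1)[OF assms(1) Suc.prems] by (rule Suc.IH)
    also have "(LINT t|lborel. vector_derivative h (at t) * vderivs j \<psi> t) =
        - (LINT t|lborel. h t * vderivs (Suc j) \<psi> t)"
      using integral_by_parts_test(1)[OF assms(1) Suc.prems, of "vderivs j \<psi>"] * assms(4) by auto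
    finally show ?case by simp
  qed simp
qed

text \<open>A quadratic remainder bound is stable under integration against a fixed weight. It
  therefore replaces differentiation under the integral sign for integrands such as the squared
  positive part, which are only once differentiable.\<close>

lemma has_vector_derivative_quadratic:
  fixes f :: "real \<Rightarrow> 'b::real_normed_vector"
  assumes "\<And>s. norm (f s - f t - (s - t) *\<^sub>R D) \<le> C * (s - t)\<^sup>2"
  shows "(f has_vector_derivative D) (at t)"
proof -
  have "((\<lambda>h. norm (f (t + h) - f t - h *\<^sub>R D) / norm h) \<longlongrightarrow> 0) (at 0)"
  proof (rule Lim_null_comparison)
    show "\<forall>\<^sub>F h in at 0. norm (norm (f (t + h) - f t - h *\<^sub>R D) / norm h) \<le> C * norm h"
    proof (rule always_eventually, rule allI)
      fix h :: real
      show "norm (norm (f (t + h) - f t - h *\<^sub>R D) / norm h) \<le> C * norm h"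
        using assms[of "t + h"] by (cases "h = 0") (simp_all add: divide_le_eq power2_eq_square mult.assoc)
    qed
    show "((\<lambda>h. C * norm h) \<longlongrightarrow> 0) (at 0)" by (auto intro!: tendsto_eq_intros)
  qed
  then show ?thesis
    by (simp add: has_vector_derivative_def has_derivative_at bounded_linear_scaleR_left)
qed

text \<open>Half the squared positive part has the Lipschitz derivative \<open>max 0\<close>, so its
  first order remainder is quadratic even across the kink of that derivative.\<close>

lemma pos_part_square_quadratic:
  fixes a b :: real
  shows "\<bar>(max 0 b)\<^sup>2 / 2 - (max 0 a)\<^sup>2 / 2 - (b - a) * max 0 a\<bar> \<le> (b - a)\<^sup>2"
proof -
  have e: "(b - a)\<^sup>2 = b\<^sup>2 - 2 * (b * a) + a\<^sup>2" "(b - a) * a = b * a - a\<^sup>2"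
    by (simp_all add: power2_diff power2_eq_square algebra_simps)
  have p: "0 \<le> a\<^sup>2" "0 \<le> b\<^sup>2" "0 \<le> (b - a)\<^sup>2" by simp_all
  consider "a \<ge> 0" "b \<ge> 0" | "a \<ge> 0" "b < 0" | "a < 0" "b \<ge> 0" | "a < 0" "b < 0" by linarith
  then show ?thesis
  proof cases
    case 1
    then have "max 0 a = a" "max 0 b = b" by simp_all
    then show ?thesis using e p by (simp only: abs_le_iff) linarith
  next
    case 2
    then have "max 0 a = a" "max 0 b = 0" "b * a \<le> 0" by (simp_all add: mult_nonpos_nonneg)
    then show ?thesis using e p by (simp only: abs_le_iff power_zero_numeral) linarith
  next
    case 3
    then have "max 0 a = 0" "max 0 b = b" "b * a \<le> 0" by (simp_all add: mult_nonneg_nonpos)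
    then show ?thesis using e p by (simp only: abs_le_iff power_zero_numeral) linarith
  next
    case 4
    then show ?thesis by simp
  qed
qed

subsection \<open>Fibre integration\<close>

text \<open>The push-forward of a test function along a submersion is smooth because the vector field
  \<open>X = \<nabla>u / |\<nabla>u|\<^sup>2\<close> satisfies \<open>X(\<psi> \<circ> u) = \<psi>' \<circ> u\<close>: differentiating the push-forward of \<open>\<phi>\<close> amounts
  to replacing \<open>\<phi>\<close> by \<open>div (\<phi> X)\<close>.\<close>

lemma test_function_continuous: "test_function \<phi> \<Longrightarrow> continuous_on UNIV \<phi>"
  by (simp add: test_function_def smooth_on_continuous)

lemma tsupp_nonzero: "\<phi> x \<noteq> 0 \<Longrightarrow> x \<in> tsupp \<phi>"
  using tsupp_zero by blast

locale fibre =
  fixes u :: "'a::euclidean_space \<Rightarrow> real"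
  assumes u_smooth: "smooth_on UNIV u"
begin

definition du :: "'a \<Rightarrow> 'a \<Rightarrow> real" where "du b x = frechet_derivative u (at x) b"
definition gsq :: "'a \<Rightarrow> real" where "gsq x = (\<Sum>b\<in>Basis. (du b x)\<^sup>2)"
definition reg :: "'a set" where "reg = {x. gsq x > 0}"
text \<open>The components of the field X introduced above; \<open>gsq\<close> is the squared length
  of the gradient, and \<open>powr (- 1)\<close> gives its reciprocal on \<open>reg\<close>.\<close>

definition fld :: "'a \<Rightarrow> 'a \<Rightarrow> complex" where "fld b x = complex_of_real (du b x * gsq x powr (- 1))"
definition rtest :: "('a \<Rightarrow> complex) \<Rightarrow> bool" where "rtest \<phi> \<longleftrightarrow> test_function \<phi> \<and> tsupp \<phi> \<subseteq> reg"
definition dvg :: "('a \<Rightarrow> complex) \<Rightarrow> 'a \<Rightarrow> complex" where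
  "dvg \<phi> x = (\<Sum>b\<in>Basis. frechet_derivative (\<lambda>x. \<phi> x * fld b x) (at x) b)"
text \<open>The push-forward of \<open>\<phi>\<close> integrated twice, and in \<open>pot2\<close>
  three times: \<open>max 0 (t - s)\<close> and half its square are the second and third
  antiderivatives in t of a unit mass at s. Unlike the push-forward itself, these are integrals over
  the whole space with continuous integrands.\<close>

definition pot :: "('a \<Rightarrow> complex) \<Rightarrow> real \<Rightarrow> complex" where
  "pot \<phi> t = (LINT x|lborel. \<phi> x * complex_of_real (max 0 (t - u x)))"
definition pot2 :: "('a \<Rightarrow> complex) \<Rightarrow> real \<Rightarrow> complex" where
  "pot2 \<phi> t = (LINT x|lborel. \<phi> x * complex_of_real ((max 0 (t - u x))\<^sup>2 / 2))"

lemma du_smooth: "b \<in> Basis \<Longrightarrow> smooth_on UNIV (du b)"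
  unfolding du_def by (rule smooth_on_deriv[OF u_smooth])

lemma gsq_smooth: "smooth_on UNIV gsq"
  unfolding gsq_def by (intro smooth_on_sum smooth_on_power du_smooth) auto

lemma u_der: "(u has_derivative (\<lambda>b. du b x)) (at x)"
  using smooth_on_has_derivative[OF u_smooth] by (simp add: du_def)

lemma u_cont: "continuous_on UNIV u"
  by (rule smooth_on_continuous[OF u_smooth])

lemma open_reg: "open reg"
proof -
  have "open (gsq -` {0<..})"
    by (rule open_vimage) (auto intro: smooth_on_continuous gsq_smooth)
  then show ?thesis by (simp add: reg_def vimage_def)
qed

lemma fld_smooth: "b \<in> Basis \<Longrightarrow> smooth_on reg (fld b)"
proof -
  assume b: "b \<in> Basis"
  have "smooth_on reg (\<lambda>x. gsq x powr (- 1))"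
    by (rule smooth_on_compose_real[OF open_reg open_greaterThan[of 0] _ smooth_on_powr])
       (auto simp: reg_def intro!: smooth_on_subset[OF gsq_smooth] open_reg[unfolded reg_def])
  then show ?thesis unfolding fld_def
    by (intro smooth_on_of_real smooth_on_mult open_reg)
       (auto intro!: smooth_on_subset[OF du_smooth[OF b]] open_reg)
qed

lemma fld_du: "x \<in> reg \<Longrightarrow> (\<Sum>b\<in>Basis. fld b x * complex_of_real (du b x)) = 1"
proof -
  assume x: "x \<in> reg"
  have "(\<Sum>b\<in>Basis. fld b x * complex_of_real (du b x)) = complex_of_real (gsq x * gsq x powr (- 1))"
    unfolding fld_def gsq_def sum_distrib_right of_real_sum
    by (rule sum.cong[OF refl]) (simp add: power2_eq_square)
  then show ?thesis using x by (simp add: reg_def powr_minus_divide)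
qed

lemma rtest_fld:
  assumes "rtest \<phi>" "b \<in> Basis"
  shows "test_function (\<lambda>x. \<phi> x * fld b x)" "tsupp (\<lambda>x. \<phi> x * fld b x) \<subseteq> tsupp \<phi>"
  using test_function_mult[OF open_reg fld_smooth[OF assms(2)]] assms(1) by (auto simp: rtest_def)

lemma frechet_derivative_tsupp:
  assumes "x \<notin> tsupp f" shows "frechet_derivative f (at x) b = 0"
  using frechet_derivative_cong_open[of "- tsupp f" x f "\<lambda>_. 0"] assms
  by (simp add: open_Compl tsupp_zero frechet_derivative_const)

lemma rtest_dvg:
  assumes "rtest \<phi>" shows "rtest (dvg \<phi>)"
proof -
  have z: "dvg \<phi> x = 0" if "x \<notin> tsupp \<phi>" for x
    unfolding dvg_def
    by (intro sum.neutral ballI frechet_derivative_tsupp) (use that rtest_fld[OF assms] in auto)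
  have "smooth_on UNIV (dvg \<phi>)"
    unfolding dvg_def using rtest_fld(1)[OF assms]
    by (intro smooth_on_sum smooth_on_deriv) (auto simp: test_function_def)
  then have "test_function (dvg \<phi>)" using assms z
    by (intro test_functionI[of _ "tsupp \<phi>"]) (auto simp: rtest_def test_function_def)
  moreover have "tsupp (dvg \<phi>) \<subseteq> tsupp \<phi>" by (rule tsupp_subset) (use z in auto)
  ultimately show ?thesis using assms by (auto simp: rtest_def)
qed

lemma integrable_test_comp:
  assumes "test_function \<phi>" "continuous_on UNIV w"
  shows "integrable lborel (\<lambda>x. \<phi> x * (w (u x) :: complex))"
proof -
  have "continuous_on UNIV (\<lambda>x. w (u x))"
    using continuous_on_compose2[OF assms(2) u_cont] by simp
  then have "continuous_on UNIV (\<lambda>x. \<phi> x * w (u x))"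
    by (rule continuous_on_mult[OF test_function_continuous[OF assms(1)]])
  then show ?thesis using assms(1)
    by (intro test_function_integrable[of _ "tsupp \<phi>"]) (auto simp: test_function_def tsupp_zero)
qed

text \<open>Each coordinate contributes the integral of a derivative with compact support, which is
  zero. Where the derivative falls on \<open>w (u x)\<close>, the sum of \<open>fld b x\<close>
  times \<open>du b x\<close> is 1 on the support of \<open>\<phi>\<close>. Only one continuous
  derivative of \<open>w\<close> is asked for, since \<open>w\<close> will be a squared positive
  part.\<close>

lemma dvg_by_parts:
  assumes phi: "rtest \<phi>" and w: "\<And>s. (w has_vector_derivative w' s) (at s)" and w': "continuous_on UNIV w'"
  shows "(LINT x|lborel. dvg \<phi> x * w (u x)) = - (LINT x|lborel. \<phi> x * (w' (u x) :: complex))"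
proof -
  have wc: "continuous_on UNIV w"
    using w by (meson continuous_at_imp_continuous_on has_vector_derivative_continuous)
  have tphi: "test_function \<phi>" using phi by (simp add: rtest_def)
  let ?F = "\<lambda>b x. \<phi> x * fld b x"
  let ?g = "\<lambda>b x. frechet_derivative (?F b) (at x) b * w (u x) + ?F b x * (complex_of_real (du b x) * w' (u x))"
  have z: "(LINT x|lborel. ?g b x) = 0" and i: "integrable lborel (?g b)" if b: "b \<in> Basis" for b
  proof -
    have F: "test_function (?F b)" by (rule rtest_fld[OF phi b])
    then have Fs: "smooth_on UNIV (?F b)" by (simp add: test_function_def)
    have Fd: "(?F b has_derivative frechet_derivative (?F b) (at x)) (at x)" for x
      using smooth_on_has_derivative[OF Fs] by simp
    have wd: "((\<lambda>x. w (u x)) has_derivative (\<lambda>c. du c x *\<^sub>R w' (u x))) (at x)" for x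
      using has_derivative_compose[OF u_der w[unfolded has_vector_derivative_def]] .
    have d: "((\<lambda>x. ?F b x * w (u x)) has_derivative
      (\<lambda>c. ?F b x * (du c x *\<^sub>R w' (u x)) + frechet_derivative (?F b) (at x) c * w (u x))) (at x)" for x
      by (rule has_derivative_mult[OF Fd wd])
    have wuc: "continuous_on UNIV (\<lambda>x. w (u x))" "continuous_on UNIV (\<lambda>x. w' (u x))"
      using continuous_on_compose2[OF wc u_cont] continuous_on_compose2[OF w' u_cont] by simp_all
    have c: "continuous_on UNIV (?g b)"
      by (intro continuous_intros wuc smooth_on_continuous smooth_on_deriv[OF Fs b] Fs du_smooth b)
    have eq: "(\<lambda>x. ?F b x * (du b x *\<^sub>R w' (u x)) + frechet_derivative (?F b) (at x) b * w (u x)) = ?g b"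
      by (auto simp: scaleR_conv_of_real)
    show "(LINT x|lborel. ?g b x) = 0"
    proof -
      have "?F b x * w (u x) = 0" if "x \<notin> tsupp (?F b)" for x
        using tsupp_zero[OF that] by simp
      moreover have "compact (tsupp (?F b))" using F by (simp add: test_function_def)
      ultimately show ?thesis
        using integral_directional_derivative_zero[OF d, of b "tsupp (?F b)", unfolded eq, OF c] by blast
    qed
    show "integrable lborel (?g b)"
    proof (rule test_function_integrable[OF c, of "tsupp (?F b)"])
      show "compact (tsupp (?F b))" using F by (simp add: test_function_def)
      fix x assume x: "x \<notin> tsupp (?F b)"
      show "?g b x = 0" unfolding frechet_derivative_tsupp[OF x] tsupp_zero[OF x] by simp
    qed
  qed
  have "(\<Sum>b\<in>Basis. ?g b x) = dvg \<phi> x * w (u x) + \<phi> x * w' (u x)" for x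
  proof -
    have "(\<Sum>b\<in>Basis. ?F b x * (complex_of_real (du b x) * w' (u x))) =
        \<phi> x * w' (u x) * (\<Sum>b\<in>Basis. fld b x * complex_of_real (du b x))"
      unfolding sum_distrib_left by (rule sum.cong[OF refl]) (simp add: mult_ac)
    also have "\<dots> = \<phi> x * w' (u x)"
      using fld_du[of x] phi tsupp_zero[of x \<phi>] by (cases "x \<in> reg") (auto simp: rtest_def)
    finally show ?thesis by (simp add: dvg_def sum.distrib sum_distrib_right)
  qed
  moreover have "(LINT x|lborel. (\<Sum>b\<in>Basis. ?g b x)) = 0"
    using i z by (subst Bochner_Integration.integral_sum) auto
  ultimately have "(LINT x|lborel. dvg \<phi> x * w (u x) + \<phi> x * w' (u x)) = 0" by simp
  then have "(LINT x|lborel. dvg \<phi> x * w (u x)) + (LINT x|lborel. \<phi> x * w' (u x)) = 0"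
    using integrable_test_comp[OF tphi w'] integrable_test_comp[OF _ wc, of "dvg \<phi>"] rtest_dvg[OF phi]
    by (simp add: rtest_def)
  then show ?thesis by (simp add: add_eq_0_iff2)
qed

text \<open>Choosing half the squared positive part of \<open>t - s\<close> as weight trades one
  application of \<open>dvg\<close> for one order of regularity in \<open>t\<close>; together with
  the derivative of \<open>pot2\<close> this makes \<open>pot\<close> differentiable.\<close>

lemma pot_eq: assumes "rtest \<phi>" shows "pot \<phi> t = pot2 (dvg \<phi>) t"
proof -
  let ?w = "\<lambda>s. complex_of_real ((max 0 (t - s))\<^sup>2 / 2)" and ?w' = "\<lambda>s. - complex_of_real (max 0 (t - s))"
  have "(?w has_vector_derivative ?w' s) (at s)" for s
  proof (rule has_vector_derivative_quadratic[where C = 1])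
    fix r
    have "?w r - ?w s - (r - s) *\<^sub>R ?w' s =
        complex_of_real ((max 0 (t - r))\<^sup>2 / 2 - (max 0 (t - s))\<^sup>2 / 2 - ((t - r) - (t - s)) * max 0 (t - s))"
      by (simp add: scaleR_conv_of_real algebra_simps)
    also have "norm \<dots> \<le> ((t - r) - (t - s))\<^sup>2"
      unfolding norm_of_real by (rule pos_part_square_quadratic)
    finally show "norm (?w r - ?w s - (r - s) *\<^sub>R ?w' s) \<le> 1 * (r - s)\<^sup>2"
      by (simp add: power2_commute)
  qed
  moreover have "continuous_on UNIV ?w'" by (intro continuous_intros)
  ultimately have "(LINT x|lborel. dvg \<phi> x * ?w (u x)) = - (LINT x|lborel. \<phi> x * ?w' (u x))"
    by (rule dvg_by_parts[OF assms])
  then show ?thesis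
    unfolding pot_def pot2_def by (simp only: mult_minus_right Bochner_Integration.integral_minus minus_minus)
qed

text \<open>The quadratic remainder bound holds for each x and survives integration against the norm
  of \<open>\<phi>\<close>.\<close>

lemma pot2_has_derivative:
  assumes "test_function \<phi>" shows "(pot2 \<phi> has_vector_derivative pot \<phi> t) (at t)"
proof (rule has_vector_derivative_quadratic)
  fix s
  let ?f = "\<lambda>t x. \<phi> x * complex_of_real ((max 0 (t - u x))\<^sup>2 / 2)" and ?g = "\<lambda>x. \<phi> x * complex_of_real (max 0 (t - u x))"
  have i: "integrable lborel (?f t)" "integrable lborel (\<lambda>x. \<phi> x * complex_of_real (max 0 (t - u x)))" for t
    by (rule integrable_test_comp[OF assms, of "\<lambda>s. complex_of_real ((max 0 (t - s))\<^sup>2 / 2)"]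
        integrable_test_comp[OF assms, of "\<lambda>s. complex_of_real (max 0 (t - s))"],
        (auto intro!: continuous_intros)[1])+
  have ip: "integrable lborel \<phi>"
    using integrable_test_comp[OF assms, of "\<lambda>_. 1"] by simp
  have "pot2 \<phi> s - pot2 \<phi> t - (s - t) *\<^sub>R pot \<phi> t = (LINT x|lborel. ?f s x - ?f t x - (s - t) *\<^sub>R ?g x)"
    unfolding pot_def pot2_def using i by simp
  also have "norm \<dots> \<le> (LINT x|lborel. norm (\<phi> x) * (s - t)\<^sup>2)"
  proof (rule Bochner_Integration.integral_norm_bound_integral)
    fix x
    have "?f s x - ?f t x - (s - t) *\<^sub>R ?g x = \<phi> x * complex_of_real
       ((max 0 (s - u x))\<^sup>2 / 2 - (max 0 (t - u x))\<^sup>2 / 2 - ((s - u x) - (t - u x)) * max 0 (t - u x))"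
      by (simp add: scaleR_conv_of_real algebra_simps)
    also have "norm \<dots> \<le> norm (\<phi> x) * ((s - u x) - (t - u x))\<^sup>2"
      unfolding norm_mult norm_of_real by (intro mult_left_mono pos_part_square_quadratic) simp
    finally show "norm (?f s x - ?f t x - (s - t) *\<^sub>R ?g x) \<le> norm (\<phi> x) * (s - t)\<^sup>2" by simp
  qed (use i ip in auto)
  finally show "norm (pot2 \<phi> s - pot2 \<phi> t - (s - t) *\<^sub>R pot \<phi> t) \<le> (LINT x|lborel. norm (\<phi> x)) * (s - t)\<^sup>2"
    by simp
qed

lemma pot_has_derivative:
  assumes "rtest \<phi>" shows "(pot \<phi> has_vector_derivative pot (dvg \<phi>) t) (at t)"
proof -
  have "pot \<phi> = pot2 (dvg \<phi>)" using pot_eq[OF assms] by auto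
  then show ?thesis using pot2_has_derivative[of "dvg \<phi>"] rtest_dvg[OF assms] by (simp add: rtest_def)
qed

text \<open>Differentiating \<open>pot\<close> only replaces the weight by its \<open>dvg\<close>,
  which is again supported in \<open>reg\<close>; hence the induction generalises
  \<open>\<phi>\<close>.\<close>

lemma pot_smooth: assumes "rtest \<phi>" shows "smooth_on UNIV (pot \<phi>)"
proof -
  have "C_k_on k UNIV (pot \<phi>)" for k
    using assms
  proof (induction k arbitrary: \<phi>)
    case 0
    then show ?case
      using pot_has_derivative by (auto intro!: continuous_at_imp_continuous_on has_vector_derivative_continuous)
  next
    case (Suc k)
    have "C_k_on k UNIV (\<lambda>t. b *\<^sub>R pot (dvg \<phi>) t)" for b
      by (rule C_k_on_bounded_linear[OF open_UNIV bounded_linear_scaleR_right Suc.IH[OF rtest_dvg[OF Suc.prems]]])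
    then show ?case
      by (rule C_k_on_SucI[OF open_UNIV pot_has_derivative[OF Suc.prems, unfolded has_vector_derivative_def]])
  qed
  then show ?thesis by (simp add: smooth_on_def)
qed

text \<open>\<open>max 0 (t - s)\<close> is a fundamental solution of the second derivative, so two
  partial integrations recover \<open>\<psi>\<close>.\<close>

lemma taylor_representation:
  assumes "test_function \<psi>"
  shows "(LINT t|lborel. complex_of_real (max 0 (t - s)) * vderivs 2 \<psi> t) = \<psi> s"
proof -
  have ps: "smooth_on UNIV \<psi>" using assms by (simp add: test_function_def)
  have t1: "test_function (vderivs 1 \<psi>)" "tsupp (vderivs 1 \<psi>) \<subseteq> tsupp \<psi>"
    and t2: "test_function (vderivs 2 \<psi>)" "tsupp (vderivs 2 \<psi>) \<subseteq> tsupp \<psi>"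
    by (rule integral_by_parts_vderivs(2,3)[OF open_UNIV smooth_on_const[of UNIV 0] assms subset_UNIV])+
  have "compact (tsupp \<psi>)" using assms by (simp add: test_function_def)
  then obtain B where B: "\<And>t. t \<in> tsupp \<psi> \<Longrightarrow> \<bar>t\<bar> \<le> B"
    by (metis compact_imp_bounded bounded_iff real_norm_def)
  define R where "R = max s B + 1"
  have R: "s \<le> R" "R \<notin> tsupp \<psi>" "\<And>t. t > R \<Longrightarrow> t \<notin> tsupp \<psi>"
    using B by (fastforce simp: R_def)+
  \<comment> \<open>An antiderivative of \<open>?g\<close>: it vanishes at \<open>R\<close>, beyond
    the support, and equals \<open>- \<psi> s\<close> at \<open>s\<close>.\<close>
  let ?G = "\<lambda>t. complex_of_real (t - s) * vderivs 1 \<psi> t - \<psi> t"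
  let ?g = "\<lambda>t. complex_of_real (t - s) * vderivs 2 \<psi> t"
  have d0: "(\<psi> has_vector_derivative vderivs 1 \<psi> t) (at t within T)"
    and d1: "(vderivs 1 \<psi> has_vector_derivative vderivs 2 \<psi> t) (at t within T)" for t T
    using vderivs_has_vector_derivative[OF open_UNIV ps, of t 0] vderivs_has_vector_derivative[OF open_UNIV ps, of t 1]
    by (auto intro: has_vector_derivative_at_within simp: numeral_2_eq_2)
  have "(?g has_integral (?G R - ?G s)) {s..R}"
  proof (rule fundamental_theorem_of_calculus[OF R(1)])
    fix t
    have "((\<lambda>t. complex_of_real (t - s)) has_vector_derivative 1) (at t within {s..R})"
      by (auto intro!: derivative_eq_intros)
    from has_vector_derivative_diff[OF has_vector_derivative_mult[OF this d1] d0]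
    show "(?G has_vector_derivative ?g t) (at t within {s..R})" by simp
  qed
  moreover have "?G R - ?G s = \<psi> s"
    using R(2) t1(2) tsupp_zero[of R \<psi>] tsupp_zero[of R "vderivs 1 \<psi>"] by auto
  moreover have "(\<lambda>t. if t \<in> {s..R} then ?g t else 0) = (\<lambda>t. complex_of_real (max 0 (t - s)) * vderivs 2 \<psi> t)"
  proof
    fix t
    show "(if t \<in> {s..R} then ?g t else 0) = complex_of_real (max 0 (t - s)) * vderivs 2 \<psi> t"
      using R(3)[of t] t2(2) tsupp_zero[of t "vderivs 2 \<psi>"] by (cases "t \<le> R"; cases "s \<le> t") auto
  qed
  ultimately have "((\<lambda>t. complex_of_real (max 0 (t - s)) * vderivs 2 \<psi> t) has_integral \<psi> s) UNIV"
    using has_integral_restrict_UNIV[of "{s..R}" ?g "\<psi> s"] by simp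
  moreover have "integrable lborel (\<lambda>t. complex_of_real (max 0 (t - s)) * vderivs 2 \<psi> t)"
    using t2(1) by (intro test_function_integrable[of _ "tsupp (vderivs 2 \<psi>)"])
      (auto simp: test_function_def tsupp_zero intro!: continuous_intros test_function_continuous[OF t2(1)])
  ultimately show ?thesis
    using has_integral_integral_lborel has_integral_unique by blast
qed

lemma pot_fubini:
  assumes phi: "test_function \<phi>" and psi: "test_function \<psi>"
  shows "(LINT t|lborel. pot \<phi> t * \<psi> t) =
      (LINT x|lborel. \<phi> x * (LINT t|lborel. complex_of_real (max 0 (t - u x)) * \<psi> t))"
proof -
  let ?f = "\<lambda>x t. \<phi> x * complex_of_real (max 0 (t - u x)) * \<psi> t"
  have c: "continuous_on UNIV (\<lambda>(x, t). ?f x t)"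
  proof -
    have "continuous_on UNIV (\<lambda>p::'a \<times> real. u (fst p))" "continuous_on UNIV (\<lambda>p::'a \<times> real. \<phi> (fst p))"
      "continuous_on UNIV (\<lambda>p::'a \<times> real. \<psi> (snd p))"
      using continuous_on_compose2[OF u_cont continuous_on_fst[OF continuous_on_id]]
        continuous_on_compose2[OF _ continuous_on_fst[OF continuous_on_id], of UNIV \<phi> UNIV]
        continuous_on_compose2[OF _ continuous_on_snd[OF continuous_on_id], of UNIV \<psi> UNIV]
        phi psi by (auto simp: test_function_def dest: smooth_on_continuous)
    then show ?thesis unfolding case_prod_unfold by (intro continuous_intros)
  qed
  have "integrable lborel (\<lambda>(x, t). ?f x t)"
    by (rule test_function_integrable[OF c, of "tsupp \<phi> \<times> tsupp \<psi>"])
       (use phi psi in \<open>auto simp: test_function_def intro: compact_Times tsupp_nonzero\<close>)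
  then have i: "integrable (lborel \<Otimes>\<^sub>M lborel) (\<lambda>(x, t). ?f x t)" by (simp add: lborel_prod)
  have "(LINT t|lborel. pot \<phi> t * \<psi> t) = (LINT t|lborel. LINT x|lborel. ?f x t)"
    unfolding pot_def by simp
  also have "\<dots> = (LINT x|lborel. LINT t|lborel. ?f x t)"
    by (rule lborel_pair.Fubini_integral[OF i])
  also have "\<dots> = (LINT x|lborel. \<phi> x * (LINT t|lborel. complex_of_real (max 0 (t - u x)) * \<psi> t))"
    by (simp add: mult.assoc)
  finally show ?thesis .
qed

text \<open>The push-forward is the second derivative of \<open>pot \<phi>\<close>. Moving both
  derivatives to \<open>\<psi>\<close> and applying the fundamental solution for each x returns
  \<open>\<psi> (u x)\<close>.\<close>

lemma fibre_integral_regular: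
  assumes phi: "rtest \<phi>" and psi: "test_function \<psi>"
  shows "(LINT t|lborel. pot (dvg (dvg \<phi>)) t * \<psi> t) = (LINT x|lborel. \<phi> x * \<psi> (u x))"
proof -
  have "vderivs 2 (pot \<phi>) = pot (dvg (dvg \<phi>))"
  proof -
    have "(\<lambda>t. vector_derivative (pot \<phi>) (at t)) = pot (dvg \<phi>)"
      "(\<lambda>t. vector_derivative (pot (dvg \<phi>)) (at t)) = pot (dvg (dvg \<phi>))"
      using vector_derivative_at[OF pot_has_derivative[OF phi]]
        vector_derivative_at[OF pot_has_derivative[OF rtest_dvg[OF phi]]] by auto
    then show ?thesis by (simp add: numeral_2_eq_2)
  qed
  then have "(LINT t|lborel. pot (dvg (dvg \<phi>)) t * \<psi> t) = (LINT t|lborel. pot \<phi> t * vderivs 2 \<psi> t)"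
    using integral_by_parts_vderivs(1)[OF open_UNIV pot_smooth[OF phi] psi, of 2] by simp
  also have "\<dots> = (LINT x|lborel. \<phi> x * (LINT t|lborel. complex_of_real (max 0 (t - u x)) * vderivs 2 \<psi> t))"
    using integral_by_parts_vderivs(2)[OF open_UNIV pot_smooth[OF phi] psi] phi
    by (intro pot_fubini) (auto simp: rtest_def)
  finally show ?thesis unfolding taylor_representation[OF psi] .
qed

text \<open>Only levels near 0 matter. By compactness the part of the support outside
  \<open>reg\<close> stays away from level 0, so a cut-off in the value of \<open>u\<close> moves
  the weight into \<open>reg\<close> without affecting test functions supported near 0.\<close>

lemma fibre_integral_exists:
  assumes phi: "test_function \<phi>" and u0: "\<And>x. u x = 0 \<Longrightarrow> x \<in> reg"
  obtains r h where "r > 0" "smooth_on UNIV h"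
    "\<And>\<psi>. test_function \<psi> \<Longrightarrow> tsupp \<psi> \<subseteq> {- r<..<r} \<Longrightarrow>
      (LINT t|lborel. h t * \<psi> t) = (LINT x|lborel. \<phi> x * \<psi> (u x))"
proof -
  have cp: "compact (tsupp \<phi> - reg)"
    using phi open_reg by (auto simp: test_function_def intro: compact_diff)
  have "\<exists>r>0. \<forall>x\<in>tsupp \<phi> - reg. r < \<bar>u x\<bar>"
  proof (cases "tsupp \<phi> - reg = {}")
    case False
    have "continuous_on (tsupp \<phi> - reg) (\<lambda>x. \<bar>u x\<bar>)"
      by (intro continuous_intros continuous_on_subset[OF u_cont]) auto
    from continuous_attains_inf[OF cp False this] obtain x0 where
      x0: "x0 \<in> tsupp \<phi> - reg" "\<And>x. x \<in> tsupp \<phi> - reg \<Longrightarrow> \<bar>u x0\<bar> \<le> \<bar>u x\<bar>" by blast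
    have "\<bar>u x0\<bar> > 0" using x0(1) u0[of x0] by auto
    then show ?thesis using x0 by (intro exI[of _ "\<bar>u x0\<bar> / 2"]) force
  qed (auto intro: exI[of _ 1])
  then obtain r where r: "r > 0" "\<And>x. x \<in> tsupp \<phi> \<Longrightarrow> \<bar>u x\<bar> \<le> r \<Longrightarrow> x \<in> reg" by force
  obtain e :: "real \<Rightarrow> real" and U C where e: "smooth_on UNIV e" "open U" "{0} \<subseteq> U"
    "\<And>x. x \<in> U \<Longrightarrow> e x = 1" "compact C" "C \<subseteq> {- r<..<r}" "\<And>x. x \<notin> C \<Longrightarrow> e x = 0"
    using smooth_cutoff_real[of "{0}" "{- r<..<r}"] r(1) by (metis compact_sing empty_subsetI insert_subset
        greaterThanLessThan_iff neg_less_0_iff_less open_greaterThanLessThan)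
  obtain r' where r': "r' > 0" "{- r'<..<r'} \<subseteq> U"
    using e(2,3) openE[of U 0] by (metis ball_eq_greaterThanLessThan diff_0 add_0 insert_subset)
  define \<phi>' where "\<phi>' x = \<phi> x * complex_of_real (e (u x))" for x
  have es: "smooth_on UNIV (\<lambda>x. complex_of_real (e (u x)))"
    by (intro smooth_on_of_real smooth_on_compose_real[OF open_UNIV open_UNIV _ e(1) u_smooth]) auto
  have t: "test_function \<phi>'"
    unfolding \<phi>'_def by (rule test_function_mult[OF open_UNIV es phi]) simp
  have "closed (u -` C)"
    using closed_vimage[of C u] e(5) u_cont by (auto simp: compact_imp_closed)
  then have "tsupp \<phi>' \<subseteq> tsupp \<phi> \<inter> u -` C"
    by (intro tsupp_subset) (auto simp: \<phi>'_def e tsupp_zero)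
  also have "\<dots> \<subseteq> reg"
  proof
    fix x assume "x \<in> tsupp \<phi> \<inter> u -` C"
    then have "x \<in> tsupp \<phi>" "u x \<in> {- r<..<r}" using e(6) by auto
    then show "x \<in> reg" using r(2)[of x] by auto
  qed
  finally have R: "rtest \<phi>'" using t by (simp add: rtest_def)
  show thesis
  proof (rule that[OF r'(1) pot_smooth[OF rtest_dvg[OF rtest_dvg[OF R]]]])
    fix \<psi> assume p: "test_function \<psi>" "tsupp \<psi> \<subseteq> {- r'<..<r'}"
    have "(\<lambda>x. \<phi>' x * \<psi> (u x)) = (\<lambda>x. \<phi> x * \<psi> (u x))"
    proof
      fix x show "\<phi>' x * \<psi> (u x) = \<phi> x * \<psi> (u x)"
      using p(2) r'(2) e(4) tsupp_zero[of "u x" \<psi>] by (cases "u x \<in> U") (auto simp: \<phi>'_def)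
    qed
    then show "(LINT t|lborel. pot (dvg (dvg \<phi>')) t * \<psi> t) = (LINT x|lborel. \<phi> x * \<psi> (u x))"
      using fibre_integral_regular[OF R p(1)] by simp
  qed
qed

end

text \<open>\<open>germ_value v \<Phi>\<close>: near 0 the distribution \<open>\<Phi>\<close> is given by a continuous density with value \<open>v\<close> at 0.\<close>

definition germ_value :: "complex \<Rightarrow> ((real \<Rightarrow> complex) \<Rightarrow> complex) \<Rightarrow> bool" where
  "germ_value v \<Phi> \<longleftrightarrow> (\<exists>r>0. \<exists>k. continuous_on {- r<..<r} k \<and> k 0 = v \<and>
     (\<forall>\<psi>. test_function \<psi> \<and> tsupp \<psi> \<subseteq> {- r<..<r} \<longrightarrow> (LINT t|lborel. k t * \<psi> t) = \<Phi> \<psi>))"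

lemma germ_valueE:
  assumes "germ_value v \<Phi>"
  obtains r k where "r > 0" "continuous_on {- r<..<r} k" "k 0 = v"
    "\<And>\<psi>. test_function \<psi> \<Longrightarrow> tsupp \<psi> \<subseteq> {- r<..<r} \<Longrightarrow> (LINT t|lborel. k t * \<psi> t) = \<Phi> \<psi>"
  using assms unfolding germ_value_def by blast

lemma integrable_mult_test:
  assumes I: "open I" "continuous_on I k" and psi: "test_function \<psi>" "tsupp \<psi> \<subseteq> I"
  shows "integrable lborel (\<lambda>t. k t * (\<psi> t :: complex))"
proof -
  have c: "compact (tsupp \<psi>)" using psi by (simp add: test_function_def)
  have "continuous_on (tsupp \<psi>) (\<lambda>t. k t * \<psi> t)"
    by (intro continuous_on_mult continuous_on_subset[OF I(2) psi(2)]
        continuous_on_subset[OF test_function_continuous[OF psi(1)]]) simp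
  from borel_integrable_compact[OF c this]
  have "integrable lborel (\<lambda>t. indicator (tsupp \<psi>) t *\<^sub>R (k t * \<psi> t))" .
  moreover have "(\<lambda>t. indicator (tsupp \<psi>) t *\<^sub>R (k t * \<psi> t)) = (\<lambda>t. k t * \<psi> t)"
    by (auto simp: indicator_def tsupp_zero)
  ultimately show ?thesis by simp
qed

text \<open>Continuous densities that agree as distributions near 0 agree at 0. Linearity and
  locality of the pullback, and finally the integral formula itself, are all proved through this
  comparison.\<close>

lemma germ_value_unique:
  assumes v: "germ_value v \<Phi>" and w: "germ_value w \<Psi>" and r0: "r0 > 0"
    and eq: "\<And>\<psi>. test_function \<psi> \<Longrightarrow> tsupp \<psi> \<subseteq> {- r0<..<r0} \<Longrightarrow> \<Phi> \<psi> = \<Psi> \<psi>"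
  shows "v = w"
proof -
  obtain r k where r: "r > 0" "continuous_on {- r<..<r} k" "k 0 = v"
    "\<And>\<psi>. test_function \<psi> \<Longrightarrow> tsupp \<psi> \<subseteq> {- r<..<r} \<Longrightarrow> (LINT t|lborel. k t * \<psi> t) = \<Phi> \<psi>"
    using germ_valueE[OF v] by blast
  obtain s l where s: "s > 0" "continuous_on {- s<..<s} l" "l 0 = w"
    "\<And>\<psi>. test_function \<psi> \<Longrightarrow> tsupp \<psi> \<subseteq> {- s<..<s} \<Longrightarrow> (LINT t|lborel. l t * \<psi> t) = \<Psi> \<psi>"
    using germ_valueE[OF w] by blast
  define q where "q = min r0 (min r s)"
  have q: "q > 0" "{- q<..<q} \<subseteq> {- r<..<r}" "{- q<..<q} \<subseteq> {- s<..<s}" "{- q<..<q} \<subseteq> {- r0<..<r0}"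
    using r s r0 by (auto simp: q_def)
  have kc: "continuous_on {- q<..<q} k" and lc: "continuous_on {- q<..<q} l"
    using continuous_on_subset[OF r(2) q(2)] continuous_on_subset[OF s(2) q(3)] .
  have "(\<lambda>t. k t - l t) 0 = 0"
  proof (rule fundamental_lemma_variations[of "{- q<..<q}"])
    show "continuous_on {- q<..<q} (\<lambda>t. k t - l t)" by (intro continuous_on_diff kc lc)
    fix \<psi> assume p: "test_function \<psi>" "tsupp \<psi> \<subseteq> {- q<..<q}"
    have "(LINT t|lborel. k t * \<psi> t) = (LINT t|lborel. l t * \<psi> t)"
      using r(4)[OF p(1) order_trans[OF p(2) q(2)]] s(4)[OF p(1) order_trans[OF p(2) q(3)]]
        eq[OF p(1) order_trans[OF p(2) q(4)]] by simp
    then show "(LINT t|lborel. (k t - l t) * \<psi> t) = 0"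
      using integrable_mult_test[OF open_greaterThanLessThan kc p] integrable_mult_test[OF open_greaterThanLessThan lc p]
      by (simp add: left_diff_distrib)
  qed (use q in auto)
  then show ?thesis using r s by simp
qed

lemma germ_value_zero: "germ_value 0 (\<lambda>\<psi>. 0)"
  unfolding germ_value_def by (intro exI[of _ 1] conjI exI[of _ "\<lambda>_. 0"]) auto

lemma germ_value_const: "germ_value c (\<lambda>\<psi>. c * (LINT t|lborel. \<psi> t))"
  unfolding germ_value_def by (intro exI[of _ 1] conjI exI[of _ "\<lambda>_. c"]) auto

lemma germ_value_scale: assumes "germ_value v \<Phi>" shows "germ_value (c * v) (\<lambda>\<psi>. c * \<Phi> \<psi>)"
proof -
  obtain r k where r: "r > 0" "continuous_on {- r<..<r} k" "k 0 = v"
    "\<And>\<psi>. test_function \<psi> \<Longrightarrow> tsupp \<psi> \<subseteq> {- r<..<r} \<Longrightarrow> (LINT t|lborel. k t * \<psi> t) = \<Phi> \<psi>"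
    using germ_valueE[OF assms] by blast
  show ?thesis unfolding germ_value_def
    by (intro exI[of _ r] conjI exI[of _ "\<lambda>t. c * k t"])
       (use r in \<open>auto intro: continuous_intros simp: mult.assoc\<close>)
qed

lemma germ_value_add:
  assumes v: "germ_value v \<Phi>" and w: "germ_value w \<Psi>"
  shows "germ_value (v + w) (\<lambda>\<psi>. \<Phi> \<psi> + \<Psi> \<psi>)"
proof -
  obtain r k where r: "r > 0" "continuous_on {- r<..<r} k" "k 0 = v"
    "\<And>\<psi>. test_function \<psi> \<Longrightarrow> tsupp \<psi> \<subseteq> {- r<..<r} \<Longrightarrow> (LINT t|lborel. k t * \<psi> t) = \<Phi> \<psi>"
    using germ_valueE[OF v] by blast
  obtain s l where s: "s > 0" "continuous_on {- s<..<s} l" "l 0 = w"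
    "\<And>\<psi>. test_function \<psi> \<Longrightarrow> tsupp \<psi> \<subseteq> {- s<..<s} \<Longrightarrow> (LINT t|lborel. l t * \<psi> t) = \<Psi> \<psi>"
    using germ_valueE[OF w] by blast
  define q where "q = min r s"
  have q: "q > 0" "{- q<..<q} \<subseteq> {- r<..<r}" "{- q<..<q} \<subseteq> {- s<..<s}"
    using r s by (auto simp: q_def)
  have kc: "continuous_on {- q<..<q} k" and lc: "continuous_on {- q<..<q} l"
    using continuous_on_subset[OF r(2) q(2)] continuous_on_subset[OF s(2) q(3)] .
  show ?thesis unfolding germ_value_def
  proof (intro exI[of _ q] conjI exI[of _ "\<lambda>t. k t + l t"] allI impI)
    show "continuous_on {- q<..<q} (\<lambda>t. k t + l t)" by (intro continuous_on_add kc lc)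
    fix \<psi> assume "test_function \<psi> \<and> tsupp \<psi> \<subseteq> {- q<..<q}"
    then have p: "test_function \<psi>" "tsupp \<psi> \<subseteq> {- q<..<q}" by auto
    show "(LINT t|lborel. (k t + l t) * \<psi> t) = \<Phi> \<psi> + \<Psi> \<psi>"
      using integrable_mult_test[OF open_greaterThanLessThan kc p]
        integrable_mult_test[OF open_greaterThanLessThan lc p]
        r(4)[OF p(1) order_trans[OF p(2) q(2)]] s(4)[OF p(1) order_trans[OF p(2) q(3)]]
      by (simp add: distrib_right)
  qed (use q r s in auto)
qed

lemma germ_value_sum:
  assumes "\<And>i. i \<in> A \<Longrightarrow> germ_value (v i) (\<Phi> i)"
  shows "germ_value (\<Sum>i\<in>A. v i) (\<lambda>\<psi>. \<Sum>i\<in>A. \<Phi> i \<psi>)"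
  using assms by (induction A rule: infinite_finite_induct) (auto intro: germ_value_zero germ_value_add)

section \<open>Pullback of the delta distribution by a submersion\<close>

definition regular_zero_set :: "('m::finite point \<Rightarrow> real) \<Rightarrow> bool" where
  "regular_zero_set u \<longleftrightarrow> smooth_on UNIV u \<and> (\<forall>x. u x = 0 \<longrightarrow> \<not> GDERIV u x :> 0)"

lemma regular_zero_set_fibre:
  assumes "regular_zero_set u"
  shows "fibre u" and "u x = 0 \<Longrightarrow> x \<in> fibre.reg u"
proof -
  show f: "fibre u" using assms by (simp add: regular_zero_set_def fibre_def)
  assume x: "u x = 0"
  show "x \<in> fibre.reg u"
  proof (rule ccontr)
    assume "x \<notin> fibre.reg u"
    then have "(\<Sum>b\<in>Basis. (fibre.du u b x)\<^sup>2) \<le> 0"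
      by (simp add: fibre.reg_def[OF f] fibre.gsq_def[OF f])
    then have "(\<Sum>b\<in>Basis. (fibre.du u b x)\<^sup>2) = 0" by (simp add: antisym sum_nonneg)
    then have z: "fibre.du u b x = 0" if "b \<in> Basis" for b
      using that by (simp add: sum_nonneg_eq_0_iff)
    have d: "(u has_derivative (\<lambda>b. fibre.du u b x)) (at x)" by (rule fibre.u_der[OF f])
    have "(\<lambda>b. fibre.du u b x) = (\<lambda>b. 0)"
      by (rule linear_eq_stdbasis[OF has_derivative_linear[OF d]]) (auto simp: z linear_zero)
    then have "GDERIV u x :> 0" using d by (simp add: gderiv_def)
    then show False using assms x by (simp add: regular_zero_set_def)
  qed
qed

text \<open>Any two fibre densities coincide near 0, so the description in
  \<open>delta_pullback\<close> has a unique solution. By \<open>j\<close> partial integrations its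
  signed derivative of order \<open>j\<close> is the density of the functional that integrates
  \<open>\<phi>\<close> against \<open>vderivs j \<psi>\<close> along \<open>u\<close>; the sign in
  \<open>delta_deriv\<close> cancels the one from these integrations.\<close>

lemma germ_value_delta_pullback:
  assumes u: "regular_zero_set u" and phi: "test_function \<phi>"
  shows "germ_value (delta_pullback j u \<phi>) (\<lambda>\<psi>. LINT x|lborel. \<phi> x * vderivs j \<psi> (u x))"
proof -
  interpret fibre u by (rule regular_zero_set_fibre(1)[OF u])
  obtain r h where h: "r > 0" "smooth_on UNIV h"
    "\<And>\<psi>. test_function \<psi> \<Longrightarrow> tsupp \<psi> \<subseteq> {- r<..<r} \<Longrightarrow>
      (LINT t|lborel. h t * \<psi> t) = (LINT x|lborel. \<phi> x * \<psi> (u x))"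
    using fibre_integral_exists[OF phi regular_zero_set_fibre(2)[OF u]] by metis
  have hr: "smooth_on {- r<..<r} h" by (rule smooth_on_subset[OF h(2)]) auto
  have "delta_pullback j u \<phi> = delta_deriv j h"
    unfolding delta_pullback_def
  proof (rule the_equality)
    show "\<exists>r>0. \<exists>h'. smooth_on {- r<..<r} h' \<and>
       (\<forall>\<psi>. test_function \<psi> \<and> tsupp \<psi> \<subseteq> {- r<..<r} \<longrightarrow>
         (LINT t|lborel. h' t * \<psi> t) = (LINT x|lborel. \<phi> x * \<psi> (u x))) \<and>
       delta_deriv j h = delta_deriv j h'"
      using h hr by blast
    fix v
    assume "\<exists>r>0. \<exists>h'. smooth_on {- r<..<r} h' \<and>
       (\<forall>\<psi>. test_function \<psi> \<and> tsupp \<psi> \<subseteq> {- r<..<r} \<longrightarrow>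
         (LINT t|lborel. h' t * \<psi> t) = (LINT x|lborel. \<phi> x * \<psi> (u x))) \<and>
       v = delta_deriv j h'"
    then obtain s h' where s: "s > 0" "smooth_on {- s<..<s} h'"
       "\<And>\<psi>. test_function \<psi> \<Longrightarrow> tsupp \<psi> \<subseteq> {- s<..<s} \<Longrightarrow>
         (LINT t|lborel. h' t * \<psi> t) = (LINT x|lborel. \<phi> x * \<psi> (u x))"
       "v = delta_deriv j h'" by blast
    define q where "q = min r s"
    have q: "q > 0" "{- q<..<q} \<subseteq> {- r<..<r}" "{- q<..<q} \<subseteq> {- s<..<s}"
      using h s by (auto simp: q_def)
    have c: "continuous_on {- q<..<q} h" "continuous_on {- q<..<q} h'"
      using smooth_on_continuous[OF hr] smooth_on_continuous[OF s(2)] q continuous_on_subset by blast+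
    have "h' t - h t = 0" if t: "t \<in> {- q<..<q}" for t
    proof (rule fundamental_lemma_variations[of "{- q<..<q}" "\<lambda>t. h' t - h t", OF _ _ _ t])
      show "continuous_on {- q<..<q} (\<lambda>t. h' t - h t)" by (intro continuous_on_diff c)
      fix \<psi> assume p: "test_function \<psi>" "tsupp \<psi> \<subseteq> {- q<..<q}"
      then show "(LINT t|lborel. (h' t - h t) * \<psi> t) = 0"
        using integrable_mult_test[OF open_greaterThanLessThan c(1) p]
          integrable_mult_test[OF open_greaterThanLessThan c(2) p]
          h(3)[OF p(1) order_trans[OF p(2) q(2)]] s(3)[OF p(1) order_trans[OF p(2) q(3)]]
        by (simp add: left_diff_distrib)
    qed auto
    then have "vderivs j h' 0 = vderivs j h 0"
      using q(1) by (intro vderivs_cong[of "{- q<..<q}"]) auto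
    then show "v = delta_deriv j h" unfolding s(4) delta_deriv_def vderivs_def by simp
  qed
  then have e: "delta_pullback j u \<phi> = (- 1) ^ j * vderivs j h 0"
    by (simp add: delta_deriv_def vderivs_def)
  show ?thesis unfolding germ_value_def
  proof (intro exI[of _ r] conjI exI[of _ "\<lambda>t. (- 1) ^ j * vderivs j h t"] allI impI h(1))
    show "continuous_on {- r<..<r} (\<lambda>t. (- 1) ^ j * vderivs j h t)"
      by (intro continuous_intros smooth_on_continuous smooth_on_vderivs hr) auto
    show "(- 1) ^ j * vderivs j h 0 = delta_pullback j u \<phi>" by (simp add: e)
    fix \<psi> assume p: "test_function \<psi> \<and> tsupp \<psi> \<subseteq> {- r<..<r}"
    then have p': "test_function (vderivs j \<psi>)" "tsupp (vderivs j \<psi>) \<subseteq> {- r<..<r}"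
      using integral_by_parts_vderivs(2,3)[OF open_greaterThanLessThan hr, of \<psi> j] by auto
    have "(LINT t|lborel. (- 1) ^ j * vderivs j h t * \<psi> t) = (- 1) ^ j * (LINT t|lborel. vderivs j h t * \<psi> t)"
      by (simp add: mult.assoc)
    also have "\<dots> = (- 1) ^ j * ((- 1) ^ j * (LINT t|lborel. h t * vderivs j \<psi> t))"
      using integral_by_parts_vderivs(1)[OF open_greaterThanLessThan hr, of \<psi> j] p by simp
    also have "\<dots> = (LINT x|lborel. \<phi> x * vderivs j \<psi> (u x))" using h(3)[OF p'] by (simp add: sign_sq)
    finally show "(LINT t|lborel. (- 1) ^ j * vderivs j h t * \<psi> t) = (LINT x|lborel. \<phi> x * vderivs j \<psi> (u x))" .
  qed
qed

lemma vderivs_test: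
  assumes "test_function \<psi>"
  shows "test_function (vderivs j \<psi>)" "tsupp (vderivs j \<psi>) \<subseteq> tsupp \<psi>" "continuous_on UNIV (vderivs j \<psi>)"
  using integral_by_parts_vderivs(2,3)[OF open_UNIV smooth_on_const[of UNIV 0] assms subset_UNIV, of j]
  by (auto intro: test_function_continuous)

text \<open>Both sides are values at 0 of densities of the same functional, so linearity of the
  integral replaces any work with the description operator.\<close>

lemma delta_pullback_add:
  assumes u: "regular_zero_set u" and "test_function \<phi>" "test_function \<zeta>"
  shows "delta_pullback j u (\<lambda>x. \<phi> x + \<zeta> x) = delta_pullback j u \<phi> + delta_pullback j u \<zeta>"
proof (rule germ_value_unique[OF germ_value_delta_pullback[OF u test_function_add[OF assms(2,3)]]
      germ_value_add[OF germ_value_delta_pullback[OF u assms(2)] germ_value_delta_pullback[OF u assms(3)]], of 1])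
  interpret fibre u by (rule regular_zero_set_fibre(1)[OF u])
  fix \<psi> :: "real \<Rightarrow> complex" assume p: "test_function \<psi>"
  show "(LINT x|lborel. (\<phi> x + \<zeta> x) * vderivs j \<psi> (u x)) =
      (LINT x|lborel. \<phi> x * vderivs j \<psi> (u x)) + (LINT x|lborel. \<zeta> x * vderivs j \<psi> (u x))"
    using integrable_test_comp[OF assms(2) vderivs_test(3)[OF p]] integrable_test_comp[OF assms(3) vderivs_test(3)[OF p]]
    by (simp add: distrib_right)
qed simp

lemma delta_pullback_scale:
  assumes u: "regular_zero_set u" and "test_function \<phi>"
  shows "delta_pullback j u (\<lambda>x. c * \<phi> x) = c * delta_pullback j u \<phi>"
  by (rule germ_value_unique[OF germ_value_delta_pullback[OF u test_function_scale[OF assms(2)]]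
      germ_value_scale[OF germ_value_delta_pullback[OF u assms(2)]], of 1]) (simp_all add: mult.assoc)

text \<open>On the compact support of \<open>\<phi>\<close> the function \<open>u\<close> is bounded
  away from 0, so test functions on a short enough interval never meet its values.\<close>

lemma delta_pullback_supported:
  assumes u: "regular_zero_set u" and phi: "test_function \<phi>" and z: "tsupp \<phi> \<inter> {x. u x = 0} = {}"
  shows "delta_pullback j u \<phi> = 0"
proof -
  interpret fibre u by (rule regular_zero_set_fibre(1)[OF u])
  have cp: "compact (tsupp \<phi>)" using phi by (simp add: test_function_def)
  have "\<exists>r>0. \<forall>x\<in>tsupp \<phi>. r < \<bar>u x\<bar>"
  proof (cases "tsupp \<phi> = {}")
    case False
    have "continuous_on (tsupp \<phi>) (\<lambda>x. \<bar>u x\<bar>)"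
      by (intro continuous_intros continuous_on_subset[OF u_cont]) auto
    from continuous_attains_inf[OF cp False this] obtain x0 where
      x0: "x0 \<in> tsupp \<phi>" "\<And>x. x \<in> tsupp \<phi> \<Longrightarrow> \<bar>u x0\<bar> \<le> \<bar>u x\<bar>" by blast
    have "\<bar>u x0\<bar> > 0" using x0(1) z by auto
    then show ?thesis using x0 by (intro exI[of _ "\<bar>u x0\<bar> / 2"]) force
  qed (auto intro: exI[of _ 1])
  then obtain r where r: "r > 0" "\<And>x. x \<in> tsupp \<phi> \<Longrightarrow> r < \<bar>u x\<bar>" by blast
  show ?thesis
  proof (rule germ_value_unique[OF germ_value_delta_pullback[OF u phi] germ_value_zero r(1)])
    fix \<psi> assume p: "test_function \<psi>" "tsupp \<psi> \<subseteq> {- r<..<r}"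
    have "(\<lambda>x. \<phi> x * vderivs j \<psi> (u x)) = (\<lambda>_. 0)"
    proof
      fix x show "\<phi> x * vderivs j \<psi> (u x) = 0"
    proof (cases "x \<in> tsupp \<phi>")
      case True
      then have "u x \<notin> {- r<..<r}" using r(2) by force
      then have "u x \<notin> tsupp (vderivs j \<psi>)" using p(2) vderivs_test(2)[OF p(1)] by blast
      then show ?thesis by (simp add: tsupp_zero)
    qed (simp add: tsupp_zero)
    qed
    then show "(LINT x|lborel. \<phi> x * vderivs j \<psi> (u x)) = 0" by (simp only: Bochner_Integration.integral_zero)
  qed
qed

subsection \<open>Superfunctions and linear functionals\<close>

lemma gcoeff_infinite: "infinite A \<Longrightarrow> gcoeff F A = 0"
  using gcoeff[of F] by simp

lemma gcoeff_simps [simp]: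
  "gcoeff 0 A = 0" "gcoeff (F + G) A = gcoeff F A + gcoeff G A" "gcoeff (- F) A = - gcoeff F A"
  by (simp_all add: zero_grass.rep_eq plus_grass.rep_eq uminus_grass.rep_eq)

lemma gcoeff_diff [simp]: "gcoeff (F - G) A = gcoeff F A - gcoeff G A"
  unfolding minus_grass_def gcoeff_simps by (rule add_uminus_conv_diff)

lemma gcoeff_sum: "gcoeff (\<Sum>i\<in>I. F i) A = (\<Sum>i\<in>I. gcoeff (F i) A)"
  by (induction I rule: infinite_finite_induct) auto

lemma gcoeff_gconst_mult [simp]: "gcoeff (gconst c * F) A = c * gcoeff F A"
proof (cases "finite A")
  case True
  then have "gcoeff (gconst c * F) A = (\<Sum>B\<in>Pow A. if B = {} then c * gcoeff F (A - B) else 0)"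
    unfolding times_grass.rep_eq gconst.rep_eq
    by (simp only: if_True) (rule sum.cong[OF refl], simp)
  then show ?thesis using True by (simp add: sum.delta)
qed (simp add: gcoeff_infinite)

lemma gcoeff_mult_gconst [simp]: "gcoeff (F * gconst c) A = gcoeff F A * c"
proof (cases "finite A")
  case True
  then have "gcoeff (F * gconst c) A = (\<Sum>B\<in>Pow A. if B = A then gcoeff F B * c else 0)"
    unfolding times_grass.rep_eq gconst.rep_eq
    by (simp only: if_True) (rule sum.cong[OF refl], auto)
  then show ?thesis using True by (simp add: sum.delta)
qed (simp add: gcoeff_infinite)

lemma grass_eqI': "(\<And>A. gcoeff F A = gcoeff G A) \<Longrightarrow> F = G"
  by (rule grass_eqI) simp

lemma gconst_simps [simp]: "gconst 0 = 0" "gconst 1 = 1"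
  by (rule grass_eqI', simp add: gconst.rep_eq one_grass.rep_eq)+

lemma gconst_add: "gconst (a + b) = gconst a + gconst b"
  by (rule grass_eqI') (simp add: gconst.rep_eq)

lemma gconst_minus: "gconst (- a) = - gconst a"
  by (rule grass_eqI') (simp add: gconst.rep_eq)

lemma gconst_diff: "gconst (a - b) = gconst a - gconst b"
  by (rule grass_eqI') (simp add: gconst.rep_eq)

lemma gconst_mult: "gconst (a * b) = gconst a * gconst b"
  by (rule grass_eqI') (simp add: gconst.rep_eq)

lemma gconst_sum: "gconst (\<Sum>i\<in>I. f i) = (\<Sum>i\<in>I. gconst (f i))"
  by (induction I rule: infinite_finite_induct) (auto simp: gconst_add)

lemma cscal_minus: "cscal (- a) = - cscal a"
proof -
  have "cscal (- a) + cscal a = cscal (- a + a)" by (simp only: cscal_simps(3))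
  then show ?thesis by (simp add: cscal_simps(1) eq_neg_iff_add_eq_0)
qed

lemma cscal_diff: "cscal (a - b) = cscal a - cscal b"
  using cscal_simps(3)[of a "- b"] unfolding cscal_minus by simp

lemma cscal_sum: "cscal (\<Sum>i\<in>I. f i) = (\<Sum>i\<in>I. cscal (f i))"
  by (induction I rule: infinite_finite_induct) (auto simp: cscal_simps(1,3))

lemma sscal_simps: "sscal 0 = 0" "sscal 1 = 1" "sscal (a + b) = sscal a + sscal b"
  "sscal (a * b) = sscal a * sscal b" "sscal (- a) = - sscal a" "sscal (a - b) = sscal a - sscal b"
  by (simp_all only: cscal_simps(1-4) cscal_minus cscal_diff gconst_simps gconst_add gconst_mult gconst_minus gconst_diff)

lemma sscal_commute: "sscal c * F = F * sscal c"
  by (rule grass_eqI') (simp only: gcoeff_gconst_mult gcoeff_mult_gconst, rule cscal_simps(5))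

lemma sscal_left_commute: "F * (sscal c * G) = sscal c * (F * G)"
  by (metis mult.assoc sscal_commute)

section \<open>Complex linear functionals and smooth superfunctions\<close>

definition clin :: "('m::finite clifford grass \<Rightarrow> complex) \<Rightarrow> bool" where
  "clin L \<longleftrightarrow> (\<forall>a b. L (a + b) = L a + L b) \<and> (\<forall>c a. L (sscal c * a) = c * L a)"

definition clin_op :: "('m::finite clifford grass \<Rightarrow> 'm clifford grass) \<Rightarrow> bool" where
  "clin_op H \<longleftrightarrow> (\<forall>a b. H (a + b) = H a + H b) \<and> (\<forall>c a. H (sscal c * a) = sscal c * H a)"

lemma clin_add: "clin L \<Longrightarrow> L (a + b) = L a + L b"
  and clin_scal: "clin L \<Longrightarrow> L (sscal c * a) = c * L a"
  by (auto simp: clin_def)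

lemma clin_zero: "clin L \<Longrightarrow> L 0 = 0"
  using clin_scal[of L 0 0] by simp

lemma clin_minus: "clin L \<Longrightarrow> L (- a) = - L a"
  using clin_scal[of L "- 1" a] by (simp add: sscal_simps)

lemma clin_diff: "clin L \<Longrightarrow> L (a - b) = L a - L b"
  using clin_add[of L a "- b"] clin_minus[of L b] by simp

lemma clin_sum: "clin L \<Longrightarrow> L (\<Sum>i\<in>I. f i) = (\<Sum>i\<in>I. L (f i))"
  by (induction I rule: infinite_finite_induct) (auto simp: clin_add clin_zero)

lemma clin_op_add: "clin_op L \<Longrightarrow> L (a + b) = L a + L b"
  and clin_op_scal: "clin_op L \<Longrightarrow> L (sscal c * a) = sscal c * L a"
  by (auto simp: clin_op_def)

lemma clin_op_zero: "clin_op L \<Longrightarrow> L 0 = 0"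
  using clin_op_scal[of L 0 0] by (simp add: sscal_simps)

lemma clin_op_sum: "clin_op L \<Longrightarrow> L (\<Sum>i\<in>I. f i) = (\<Sum>i\<in>I. L (f i))"
  by (induction I rule: infinite_finite_induct) (auto simp: clin_op_add clin_op_zero)

lemma clin_comp: "clin L \<Longrightarrow> clin_op H \<Longrightarrow> clin (\<lambda>v. L (H v))"
  by (simp add: clin_def clin_op_def)

lemma clin_op_comp: "clin_op H \<Longrightarrow> clin_op K \<Longrightarrow> clin_op (\<lambda>v. H (K v))"
  by (simp add: clin_op_def)

lemma clin_op_left: "clin_op (\<lambda>v. w * v)"
  by (simp add: clin_op_def distrib_left sscal_left_commute)

lemma clin_op_right: "clin_op (\<lambda>v. v * w)"
  by (simp add: clin_op_def distrib_right mult.assoc)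

text \<open>Multiplication by \<open>sscal\<close> makes the algebra a complex vector space; a
  functional that is 1 on \<open>v - w\<close> comes from extending this independent vector to a
  basis.\<close>

lemma clin_separates:
  assumes "\<And>L. clin L \<Longrightarrow> L v = L w" shows "v = (w :: 'm::finite clifford grass)"
proof (rule ccontr)
  assume ne: "v \<noteq> w"
  define sc where "sc = (\<lambda>c (a :: 'm clifford grass). sscal c * a)"
  interpret V: vector_space sc
    by unfold_locales (simp_all add: sc_def distrib_left distrib_right sscal_simps mult.assoc)
  interpret VP: vector_space_pair sc "(*) :: complex \<Rightarrow> complex \<Rightarrow> complex"
    by unfold_locales (simp_all add: algebra_simps)
  have "V.independent {v - w}" using ne V.independent_insert[of "v - w" "{}"] by simp
  from VP.linear_independent_extend[OF this, of "\<lambda>_. 1"]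
  obtain L where L: "Vector_Spaces.linear sc (*) L" "L (v - w) = 1" by auto
  have "clin L" unfolding clin_def
    using linear_iff_module_hom module_hom.add[of sc "(*)" L] module_hom.scale[of sc "(*)" L] L(1)
    by (auto simp: sc_def linear_iff_module_hom)
  then show False using assms[of L] clin_diff[of L v w] L(2) by simp
qed

text \<open>Unlike in \<open>superfunctions\<close>, the coefficients may be any elements of the
  algebra, including the parameters \<open>YV\<close>, so that the kernel is covered.\<close>

definition sf :: "'m::finite point set \<Rightarrow> ('m point \<Rightarrow> 'm clifford grass) \<Rightarrow> bool" where
  "sf S F \<longleftrightarrow> (\<exists>fs. smooth_rep S F fs)"

lemma smooth_rep_Nil: "smooth_rep S F [] \<longleftrightarrow> (\<forall>x\<in>S. F x = 0)"
  by (simp add: smooth_rep_def)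

lemma smooth_rep_Cons: "smooth_rep S F ((f, c) # fs) \<longleftrightarrow>
    smooth_on S f \<and> smooth_rep S (\<lambda>x. F x - sscal (f x) * c) fs"
  by (auto simp: smooth_rep_def algebra_simps)

lemma sf_cong: "sf S F \<Longrightarrow> (\<And>x. x \<in> S \<Longrightarrow> F x = G x) \<Longrightarrow> sf S G"
  unfolding sf_def smooth_rep_def by metis

lemma sf_zero: "sf S (\<lambda>x. 0)"
  unfolding sf_def by (intro exI[of _ "[]"]) (simp add: smooth_rep_Nil)

text \<open>A representation determines the function only on \<open>S\<close>; the case
  \<open>cong\<close> accounts for arbitrary values elsewhere.\<close>

lemma sf_induct [consumes 1, case_names cong zero step]:
  assumes "sf S F"
    and cong: "\<And>F G. sf S F \<Longrightarrow> (\<And>x. x \<in> S \<Longrightarrow> F x = G x) \<Longrightarrow> P F \<Longrightarrow> P G"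
    and zero: "P (\<lambda>x. 0)"
    and step: "\<And>f c F. smooth_on S f \<Longrightarrow> sf S F \<Longrightarrow> P F \<Longrightarrow> P (\<lambda>x. sscal (f x) * c + F x)"
  shows "P F"
proof -
  obtain fs where "smooth_rep S F fs" using assms(1) sf_def by blast
  then show ?thesis
  proof (induction fs arbitrary: F)
    case Nil
    moreover have "sf S (\<lambda>x. 0)" unfolding sf_def by (intro exI[of _ "[]"]) (simp add: smooth_rep_Nil)
    ultimately show ?case using cong[of "\<lambda>x. 0" F] zero by (simp add: smooth_rep_Nil)
  next
    case (Cons p fs)
    obtain f c where p: "p = (f, c)" by fastforce
    have F: "smooth_on S f" "smooth_rep S (\<lambda>x. F x - sscal (f x) * c) fs"
      using Cons.prems unfolding p smooth_rep_Cons by auto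
    then have "P (\<lambda>x. sscal (f x) * c + (F x - sscal (f x) * c))"
      by (intro step Cons.IH) (auto simp: sf_def)
    then show ?case by simp
  qed
qed

lemma sf_step: assumes "smooth_on S f" "sf S F" shows "sf S (\<lambda>x. sscal (f x) * c + F x)"
proof -
  obtain fs where "smooth_rep S F fs" using assms(2) sf_def by blast
  then have "smooth_rep S (\<lambda>x. sscal (f x) * c + F x) ((f, c) # fs)"
    using assms(1) by (simp add: smooth_rep_Cons)
  then show ?thesis unfolding sf_def by blast
qed

lemma sf_scal: "smooth_on S f \<Longrightarrow> sf S (\<lambda>x. sscal (f x) * c)"
  using sf_step[OF _ sf_zero] by simp

lemma sf_const: "sf S (\<lambda>x. c)"
  using sf_scal[OF smooth_on_const[of S 1]] by (simp add: sscal_simps)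

lemma sf_add: assumes "sf S F" "sf S G" shows "sf S (\<lambda>x. F x + G x)"
  using assms(1)
proof (induction rule: sf_induct)
  case (cong F F')
  then show ?case by (elim sf_cong) simp
qed (use assms(2) in \<open>auto simp: add.assoc intro: sf_step\<close>)

lemma sf_clin_op: assumes "clin_op H" "sf S F" shows "sf S (\<lambda>x. H (F x))"
  using assms(2)
proof (induction rule: sf_induct)
  case (cong F F')
  then show ?case by (elim sf_cong) simp
qed (use assms(1) in \<open>auto simp: clin_op_zero clin_op_add clin_op_scal intro: sf_step sf_zero\<close>)

lemma sf_smult: assumes "open S" "smooth_on S f" "sf S F" shows "sf S (\<lambda>x. sscal (f x) * F x)"
  using assms(3)
proof (induction rule: sf_induct)
  case (cong F F')
  then show ?case by (elim sf_cong) simp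
next
  case (step h c F)
  have "sf S (\<lambda>x. sscal (f x * h x) * c + sscal (f x) * F x)"
    by (intro sf_step smooth_on_mult assms step)
  then show ?case by (simp add: sscal_simps distrib_left mult.assoc)
qed (auto intro: sf_zero)

lemma sf_mult: assumes "open S" "sf S F" "sf S G" shows "sf S (\<lambda>x. F x * G x)"
  using assms(2)
proof (induction rule: sf_induct)
  case (cong F F')
  then show ?case by (elim sf_cong) simp
next
  case (step h c F)
  have "sf S (\<lambda>x. sscal (h x) * (c * G x) + F x * G x)"
    by (intro sf_add sf_smult assms(1) step sf_clin_op[OF clin_op_left assms(3)])
  then show ?case by (simp add: distrib_right mult.assoc)
qed (auto intro: sf_zero)

lemma sf_sum: "(\<And>i. i \<in> I \<Longrightarrow> sf S (F i)) \<Longrightarrow> sf S (\<lambda>x. \<Sum>i\<in>I. F i x)"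
  by (induction I rule: infinite_finite_induct) (auto intro: sf_zero sf_add)

lemma sf_power: "open S \<Longrightarrow> sf S F \<Longrightarrow> sf S (\<lambda>x. F x ^ k)"
  by (induction k) (auto intro: sf_const sf_mult)

lemma sf_subset: "open S \<Longrightarrow> open T \<Longrightarrow> T \<subseteq> S \<Longrightarrow> sf S F \<Longrightarrow> sf T F"
proof -
  assume S: "open S" "open T" "T \<subseteq> S" and "sf S F"
  from this(4) show ?thesis
  proof (induction rule: sf_induct)
    case (cong F F')
    then show ?case using S by (elim sf_cong) auto
  qed (use S in \<open>auto intro: sf_zero sf_step smooth_on_subset\<close>)
qed

lemma clin_smooth: assumes "open S" "clin L" "sf S F" shows "smooth_on S (\<lambda>x. L (F x))"
  using assms(3)
proof (induction rule: sf_induct)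
  case (cong F F')
  then show ?case using smooth_on_cong[OF assms(1), of "\<lambda>x. L (F x)" "\<lambda>x. L (F' x)"] by simp
next
  case (step f c F)
  have "smooth_on S (\<lambda>x. f x * L c + L (F x))"
    by (intro smooth_on_add smooth_on_mult assms(1) step smooth_on_const)
  then show ?case by (simp add: clin_add[OF assms(2)] clin_scal[OF assms(2)])
qed (simp add: clin_zero[OF assms(2)])

section \<open>Partial derivatives of superfunctions\<close>

lemma pdiffI: "(f has_derivative D) (at x) \<Longrightarrow> pdiff i f x = D (axis i 1)"
  by (simp add: pdiff_def frechet_derivative_at[symmetric])

lemma pdiff_smooth:
  assumes "open S" "smooth_on S f" "x \<in> S"
  shows "(f has_derivative frechet_derivative f (at x)) (at x)"
  by (rule smooth_on_has_derivative[OF assms(2,1,3)])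

lemma pdiff_add:
  assumes "open S" "smooth_on S f" "smooth_on S g" "x \<in> S"
  shows "pdiff i (\<lambda>x. f x + g x) x = pdiff i f x + pdiff i g x"
  using pdiffI[OF has_derivative_add[OF pdiff_smooth[OF assms(1,2,4)] pdiff_smooth[OF assms(1,3,4)]]]
  by (simp add: pdiff_def)

lemma pdiff_mult:
  assumes "open S" "smooth_on S f" "smooth_on S g" "x \<in> S"
  shows "pdiff i (\<lambda>x. f x * g x) x = f x * pdiff i g x + pdiff i f x * g x"
  using pdiffI[OF has_derivative_mult[OF pdiff_smooth[OF assms(1,2,4)] pdiff_smooth[OF assms(1,3,4)]]]
  by (simp add: pdiff_def)

lemma pdiff_const: "pdiff i (\<lambda>x. c) x = 0"
  using pdiffI[OF has_derivative_const] by auto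

lemma pdiff_cong: "open S \<Longrightarrow> x \<in> S \<Longrightarrow> (\<And>x. x \<in> S \<Longrightarrow> f x = g x) \<Longrightarrow> pdiff i f x = pdiff i g x"
  unfolding pdiff_def using frechet_derivative_cong_open by metis

lemma pdiff_smooth_on: "smooth_on S f \<Longrightarrow> smooth_on S (pdiff i f)"
  using smooth_on_deriv[of S f "axis i 1"] by (simp add: pdiff_def[abs_def] axis_in_Basis_iff)

text \<open>A functional turns the formal derivative of a representation into the ordinary
  derivative of \<open>L (F x)\<close>, in which the representation no longer occurs. As functionals
  separate points, this makes \<open>super_pdiff\<close> well defined.\<close>

lemma smooth_rep_pdiff:
  assumes L: "clin L" and S: "open S" "x \<in> S" and rep: "smooth_rep S F fs"
  shows "L (\<Sum>(f, c)\<leftarrow>fs. sscal (pdiff i f x) * c) = pdiff i (\<lambda>x. L (F x)) x"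
  using rep
proof (induction fs arbitrary: F)
  case Nil
  then have "pdiff i (\<lambda>x. L (F x)) x = pdiff i (\<lambda>x. 0) x"
    by (intro pdiff_cong[OF S]) (simp add: smooth_rep_Nil clin_zero[OF L])
  then show ?case by (simp add: pdiff_const clin_zero[OF L])
next
  case (Cons p fs)
  obtain f c where p: "p = (f, c)" by fastforce
  let ?G = "\<lambda>x. F x - sscal (f x) * c"
  have F: "smooth_on S f" "smooth_rep S ?G fs"
    using Cons.prems unfolding p smooth_rep_Cons by auto
  then have g: "smooth_on S (\<lambda>x. L (?G x))" by (intro clin_smooth S L) (auto simp: sf_def)
  have "pdiff i (\<lambda>x. L (F x)) x = pdiff i (\<lambda>x. f x * L c + L (?G x)) x"
    by (simp add: clin_diff[OF L] clin_scal[OF L])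
  also have "\<dots> = pdiff i f x * L c + pdiff i (\<lambda>x. L (?G x)) x"
    using F(1) g S by (simp add: pdiff_add[OF S(1)] pdiff_mult[OF S(1)] pdiff_const smooth_on_mult)
  finally show ?case
    using Cons.IH[OF F(2)] by (simp add: p clin_add[OF L] clin_scal[OF L])
qed

lemma super_pdiff_rep:
  assumes S: "open S" "x \<in> S" and rep: "smooth_rep S F fs"
  shows "super_pdiff i F x = (\<Sum>(f, c)\<leftarrow>fs. sscal (pdiff i f x) * c)"
  unfolding super_pdiff_def
proof (rule the_equality)
  show "\<exists>S fs'. open S \<and> x \<in> S \<and> smooth_rep S F fs' \<and>
      (\<Sum>(f, c)\<leftarrow>fs. sscal (pdiff i f x) * c) = (\<Sum>(f, c)\<leftarrow>fs'. sscal (pdiff i f x) * c)"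
    using assms by blast
  fix v
  assume "\<exists>S fs'. open S \<and> x \<in> S \<and> smooth_rep S F fs' \<and> v = (\<Sum>(f, c)\<leftarrow>fs'. sscal (pdiff i f x) * c)"
  then obtain T fs' where T: "open T" "x \<in> T" "smooth_rep T F fs'"
    and v: "v = (\<Sum>(f, c)\<leftarrow>fs'. sscal (pdiff i f x) * c)" by blast
  show "v = (\<Sum>(f, c)\<leftarrow>fs. sscal (pdiff i f x) * c)"
    unfolding v by (rule clin_separates) (simp only: smooth_rep_pdiff[OF _ S rep] smooth_rep_pdiff[OF _ T])
qed

lemma clin_super_pdiff:
  assumes "open S" "x \<in> S" "sf S F" "clin L"
  shows "L (super_pdiff i F x) = pdiff i (\<lambda>x. L (F x)) x"
proof -
  obtain fs where "smooth_rep S F fs" using assms(3) sf_def by blast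
  then show ?thesis
    by (simp only: super_pdiff_rep[OF assms(1,2)] smooth_rep_pdiff[OF assms(4,1,2)])
qed

lemma super_pdiff_eqI:
  assumes "open S" "x \<in> S" "sf S F" "\<And>L. clin L \<Longrightarrow> pdiff i (\<lambda>x. L (F x)) x = L v"
  shows "super_pdiff i F x = v"
  by (rule clin_separates) (simp only: clin_super_pdiff[OF assms(1-3)] assms(4))

lemma super_pdiff_cong:
  assumes "open S" "x \<in> S" "sf S F" "\<And>x. x \<in> S \<Longrightarrow> F x = G x"
  shows "super_pdiff i F x = super_pdiff i G x"
proof (rule super_pdiff_eqI[OF assms(1-3)])
  fix L :: "'a clifford grass \<Rightarrow> complex" assume L: "clin L"
  have "pdiff i (\<lambda>x. L (F x)) x = pdiff i (\<lambda>x. L (G x)) x"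
    by (rule pdiff_cong[OF assms(1,2)]) (simp add: assms(4))
  then show "pdiff i (\<lambda>x. L (F x)) x = L (super_pdiff i G x)"
    using clin_super_pdiff[OF assms(1,2) sf_cong[OF assms(3,4)] L] by simp
qed

lemma super_pdiff_add:
  assumes S: "open S" "x \<in> S" and F: "sf S F" "sf S G"
  shows "super_pdiff i (\<lambda>x. F x + G x) x = super_pdiff i F x + super_pdiff i G x"
  by (rule super_pdiff_eqI[OF S sf_add[OF F]])
     (simp add: clin_add clin_super_pdiff[OF S] F pdiff_add[OF S(1) clin_smooth[OF S(1)] clin_smooth[OF S(1)] S(2)])

lemma super_pdiff_clin_op:
  assumes S: "open S" "x \<in> S" and F: "sf S F" and H: "clin_op H"
  shows "super_pdiff i (\<lambda>x. H (F x)) x = H (super_pdiff i F x)"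
  by (rule super_pdiff_eqI[OF S sf_clin_op[OF H F]])
     (use clin_super_pdiff[OF S F clin_comp[OF _ H]] in simp)

lemma super_pdiff_const: "super_pdiff i (\<lambda>x. c) x = 0"
  by (rule super_pdiff_eqI[OF open_UNIV UNIV_I sf_const]) (simp add: pdiff_const clin_zero)

lemma super_pdiff_smult:
  assumes S: "open S" "x \<in> S" and f: "smooth_on S f" and F: "sf S F"
  shows "super_pdiff i (\<lambda>x. sscal (f x) * F x) x = sscal (pdiff i f x) * F x + sscal (f x) * super_pdiff i F x"
  by (rule super_pdiff_eqI[OF S sf_smult[OF S(1) f F]])
     (simp add: clin_add clin_scal clin_super_pdiff[OF S F] pdiff_mult[OF S(1) f clin_smooth[OF S(1) _ F] S(2)])

text \<open>A functional does not split a product, so the scalar Leibniz rule cannot be quoted under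
  \<open>L\<close>. Induction over a representation of \<open>F\<close> reduces the claim to
  multiples by scalar functions, and the order of the factors is kept.\<close>

lemma super_pdiff_mult:
  assumes S: "open S" "x \<in> S" and F: "sf S F" and G: "sf S G"
  shows "super_pdiff i (\<lambda>x. F x * G x) x = super_pdiff i F x * G x + F x * super_pdiff i G x"
  using F
proof (induction rule: sf_induct)
  case (cong F F')
  have "super_pdiff i (\<lambda>x. F x * G x) x = super_pdiff i (\<lambda>x. F' x * G x) x"
    by (rule super_pdiff_cong[OF S sf_mult[OF S(1) cong(1) G]]) (simp add: cong(2))
  moreover have "super_pdiff i F x = super_pdiff i F' x"
    by (rule super_pdiff_cong[OF S cong(1,2)])
  ultimately show ?case using cong(3) cong(2)[OF S(2)] by simp
next
  case zero
  then show ?case by (simp add: super_pdiff_const)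
next
  case (step f c F)
  have cG: "sf S (\<lambda>x. c * G x)" by (rule sf_clin_op[OF clin_op_left G])
  have "super_pdiff i (\<lambda>x. (sscal (f x) * c + F x) * G x) x =
      super_pdiff i (\<lambda>x. sscal (f x) * (c * G x) + F x * G x) x"
    by (simp add: distrib_right mult.assoc)
  also have "\<dots> = sscal (pdiff i f x) * (c * G x) + sscal (f x) * (c * super_pdiff i G x)
      + (super_pdiff i F x * G x + F x * super_pdiff i G x)"
    by (simp add: super_pdiff_add[OF S sf_smult[OF S(1) step(1) cG] sf_mult[OF S(1) step(2) G]]
        super_pdiff_smult[OF S step(1) cG] super_pdiff_clin_op[OF S G clin_op_left] step(3))
  also have "\<dots> = (sscal (pdiff i f x) * c + super_pdiff i F x) * G x
      + (sscal (f x) * c + F x) * super_pdiff i G x"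
    by (simp only: distrib_right distrib_left mult.assoc add_ac)
  also have "sscal (pdiff i f x) * c + super_pdiff i F x = super_pdiff i (\<lambda>x. sscal (f x) * c + F x) x"
    by (simp only: super_pdiff_add[OF S sf_scal[OF step(1)] step(2)] super_pdiff_smult[OF S step(1) sf_const]
        super_pdiff_const mult_zero_right add_0_right)
  finally show ?case .
qed

subsection \<open>Grassmann algebra\<close>

lemma gconst_gmono_commute: "gconst c * gmono A = gmono A * gconst c"
  by (rule grass_eqI') (simp add: gmono.rep_eq)

lemma gmono_empty [simp]: "gmono {} = 1"
  by (rule grass_eqI') (simp add: gmono.rep_eq one_grass.rep_eq)

text \<open>Extracting the smallest variable on the left passes no other variable, so no sign
  appears.\<close>

lemma gmono_insert:
  assumes "finite A" "\<forall>a\<in>A. v < a" shows "gmono (insert v A) = gvar v * gmono A"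
proof (rule grass_eqI)
  fix B :: "gvar set" assume B: "finite B"
  have vA: "v \<notin> A" using assms(2) by blast
  show "gcoeff (gmono (insert v A)) B = gcoeff (gvar v * gmono A) B"
  proof (cases "B = insert v A")
    case True
    have "{b \<in> B. b < v} = {}" "B - {v} = A" using True assms(2) vA by (auto dest: order.asym)
    then show ?thesis using True assms(1) B by (simp add: coeff_gvar_times gmono.rep_eq del: Collect_empty_eq)
  next
    case False
    then have "\<not> (v \<in> B \<and> B - {v} = A)" by auto
    then show ?thesis using False B by (auto simp: coeff_gvar_times gmono.rep_eq)
  qed
qed

lemma grass_expand: "F = (\<Sum>A | gcoeff F A \<noteq> 0. gmono A * gconst (gcoeff F A))"
proof (rule grass_eqI')
  fix B
  have fin: "finite {A. gcoeff F A \<noteq> 0}" using gcoeff[of F] by simp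
  have "(\<Sum>A | gcoeff F A \<noteq> 0. gcoeff (gmono A * gconst (gcoeff F A)) B) =
      (\<Sum>A | gcoeff F A \<noteq> 0. if A = B then gcoeff F B else 0)"
    by (rule sum.cong[OF refl]) (auto simp: gmono.rep_eq gcoeff_infinite)
  also have "\<dots> = gcoeff F B" using fin by (simp add: sum.delta)
  finally show "gcoeff F B = gcoeff (\<Sum>A | gcoeff F A \<noteq> 0. gmono A * gconst (gcoeff F A)) B"
    by (simp only: gcoeff_sum)
qed

text \<open>With this rule identities are checked on generators, instead of through sums over
  subsets with inversion signs. Monomials are built by prepending variables smaller than all present
  ones.\<close>

lemma grass_induct [case_names const add gvar]:
  assumes const: "\<And>c. P (gconst c)" and add: "\<And>F G. P F \<Longrightarrow> P G \<Longrightarrow> P (F + G)"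
    and gvar: "\<And>v F. P F \<Longrightarrow> P (gvar v * F)"
  shows "P F"
proof -
  have m: "P (gmono A * gconst c)" if "finite A" for A c
    using that
  proof (induction A rule: finite_linorder_min_induct)
    case empty
    then show ?case using const[of c] by simp
  next
    case (insert v A)
    show ?case unfolding gmono_insert[OF insert(1,2)] mult.assoc by (rule gvar[OF insert(3)])
  qed
  have "P (\<Sum>A\<in>I. gmono A * gconst (gcoeff F A))" if "finite I" "\<forall>A\<in>I. finite A" for I
    using that
  proof (induction I rule: finite_induct)
    case empty
    then show ?case using const[of 0] by simp
  next
    case (insert A I)
    then have "P (\<Sum>A\<in>I. gmono A * gconst (gcoeff F A))" "finite A" by auto
    then show ?case unfolding sum.insert[OF insert(1,2)] by (intro add m)
  qed
  moreover have "finite {A. gcoeff F A \<noteq> 0}" "\<forall>A\<in>{A. gcoeff F A \<noteq> 0}. finite A"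
    using gcoeff[of F] by auto
  ultimately show ?thesis using grass_expand[of F] by metis
qed

lemma gvar_anticommute: "gvar v * gvar w = - (gvar w * gvar v)"
proof -
  show ?thesis
  proof (rule grass_eqI)
    fix A :: "gvar set" assume A: "finite A"
    show "gcoeff (gvar v * gvar w) A = gcoeff (- (gvar w * gvar v)) A"
    proof (cases "v \<noteq> w \<and> A = {v, w}")
      case True
      have "{b \<in> {v, w}. b < v} = (if w < v then {w} else {})" "{b \<in> {v, w}. b < w} = (if v < w then {v} else {})"
        using True by auto
      then have c: "card {b \<in> {v, w}. b < v} = (if w < v then 1 else 0)" "card {b \<in> {v, w}. b < w} = (if v < w then 1 else 0)"
        by (simp_all only: card.empty card_1_singleton_iff split: if_split) auto
      have d: "{v, w} - {v} = {w}" "{v, w} - {w} = {v}" "v \<in> {v, w}" "w \<in> {v, w}" "A = {v, w}" using True by auto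
      have f: "finite {v, w}" "finite {v}" "finite {w}" by auto
      have "w < v \<longleftrightarrow> \<not> v < w" using True by auto
      then show ?thesis
        by (cases "v < w") (simp_all only: d coeff_gvar_times[OF f(1)] gcoeff_simps gmono.rep_eq c if_True if_False f simp_thms, simp_all)
    next
      case False
      then have "\<not> (v \<in> A \<and> A - {v} = {w})" "\<not> (w \<in> A \<and> A - {w} = {v})" by auto
      then show ?thesis using A by (auto simp: coeff_gvar_times gmono.rep_eq)
    qed
  qed
qed

text \<open>The grading automorphism, which is -1 on odd elements. It records the signs of the
  graded Leibniz rule, and \<open>ginv a = a\<close> is the form in which evenness is used.\<close>

lift_definition ginv :: "'c::ring_1 grass \<Rightarrow> 'c grass" is "\<lambda>F A. (- 1) ^ card A * F A"
  by (auto elim: rev_finite_subset)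

lemma gcoeff_ginv: "gcoeff (ginv F) A = (- 1) ^ card A * gcoeff F A"
  by (simp add: ginv.rep_eq)

lemma ginv_simps [simp]: "ginv (F + G) = ginv F + ginv G" "ginv (gconst c) = gconst c"
  "ginv (- F) = - ginv F" "ginv (F - G) = ginv F - ginv G" "ginv 0 = 0"
  by (rule grass_eqI', simp add: gcoeff_ginv algebra_simps gconst.rep_eq)+

lemma ginv_gvar_times [simp]: "ginv (gvar v * F) = - (gvar v * ginv F)"
proof (rule grass_eqI)
  fix A :: "gvar set" assume A: "finite A"
  show "gcoeff (ginv (gvar v * F)) A = gcoeff (- (gvar v * ginv F)) A"
  proof (cases "v \<in> A")
    case True
    then obtain k where k: "card A = Suc k" "card (A - {v}) = k"
      using card_Suc_Diff1[OF A] by metis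
    have "(- 1 :: 'a) ^ Suc k * ((- 1) ^ l * x) = - ((- 1) ^ l * ((- 1) ^ k * x))" for l x
      by (cases "even k"; cases "even l") auto
    then show ?thesis using True
      by (simp only: gcoeff_ginv coeff_gvar_times[OF A] gcoeff_simps k if_True)
  qed (simp add: gcoeff_ginv coeff_gvar_times[OF A])
qed

lemma ginv_one [simp]: "ginv 1 = 1"
  using ginv_simps(2)[of 1] by (simp only: gconst_simps)

lemma gderiv_left_one [simp]: "gderiv_left v 1 = 0"
  using gderiv_left_const[of v 1] by (simp only: gconst_simps)

lemma ginv_gvar [simp]: "ginv (gvar v) = - gvar v"
  using ginv_gvar_times[of v 1] by simp

lemma ginv_gconst_times [simp]: "ginv (gconst c * F) = gconst c * ginv F"
proof (rule grass_eqI')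
  fix A
  have "(- 1) ^ k * (c * x) = c * ((- 1) ^ k * x)" for k x
    by (cases "even k") auto
  then show "gcoeff (ginv (gconst c * F)) A = gcoeff (gconst c * ginv F) A"
    by (simp add: gcoeff_ginv)
qed

lemma ginv_mult: "ginv (F * G) = ginv F * ginv G"
  by (induction F rule: grass_induct) (simp_all add: distrib_right mult.assoc)

lemma ginv_ginv [simp]: "ginv (ginv F) = F"
  by (induction F rule: grass_induct) simp_all

lemma ginv_sum: "ginv (\<Sum>i\<in>I. f i) = (\<Sum>i\<in>I. ginv (f i))"
  by (induction I rule: infinite_finite_induct) auto

text \<open>Clifford coefficients commute with the variables, so only the degree in the variables
  produces signs.\<close>

lemma gvar_ginv_commute: "gvar v * F = ginv F * gvar v"
proof (induction F rule: grass_induct)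
  case (const c)
  then show ?case by (simp add: gconst_gmono_commute)
next
  case (add F G)
  then show ?case by (simp add: distrib_left distrib_right)
next
  case (gvar w F)
  have "gvar v * (gvar w * F) = - (gvar w * (gvar v * F))"
    unfolding mult.assoc[symmetric] gvar_anticommute[of v w] by simp
  then show ?case by (simp add: gvar mult.assoc)
qed

lemma gderiv_left_simps [simp]:
  "gderiv_left v (F + G) = gderiv_left v F + gderiv_left v G"
  "gderiv_left v 0 = 0"
  "gderiv_left v (- F) = - gderiv_left v F"
  "gderiv_left v (F - G) = gderiv_left v F - gderiv_left v G"
  by (rule grass_eqI', simp add: gderiv_left.rep_eq algebra_simps)+

lemma gderiv_left_gconst_times [simp]: "gderiv_left v (gconst c * F) = gconst c * gderiv_left v F"
proof (rule grass_eqI')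
  fix A
  have "(- 1) ^ k * (c * x) = c * ((- 1) ^ k * x)" for k x
    by (cases "even k") auto
  then show "gcoeff (gderiv_left v (gconst c * F)) A = gcoeff (gconst c * gderiv_left v F) A"
    by (simp add: gderiv_left.rep_eq)
qed

lemma gderiv_left_sum: "gderiv_left v (\<Sum>i\<in>I. f i) = (\<Sum>i\<in>I. gderiv_left v (f i))"
  by (induction I rule: infinite_finite_induct) auto

lemma gderiv_left_gvar_times:
  "gderiv_left v (gvar w * F) = (if v = w then F else 0) - gvar w * gderiv_left v F"
  using gderiv_left_rule[of v w F] by (simp add: eq_diff_eq)

lemma gderiv_left_gvar: "gderiv_left v (gvar w) = (if v = w then 1 else 0)"
  using gderiv_left_gvar_times[of v w 1] by simp

lemma gderiv_left_mult: "gderiv_left v (F * G) = gderiv_left v F * G + ginv F * gderiv_left v G"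
proof (induction F rule: grass_induct)
  case (const c)
  then show ?case by (simp add: gderiv_left_const)
next
  case (add F G)
  then show ?case by (simp add: distrib_right)
next
  case (gvar w F)
  then show ?case by (simp add: mult.assoc gderiv_left_gvar_times algebra_simps)
qed

lemma gderiv_left_anticommute: "gderiv_left v (gderiv_left w F) = - gderiv_left w (gderiv_left v F)"
proof (induction F rule: grass_induct)
  case (const c)
  then show ?case by (simp add: gderiv_left_const)
next
  case (gvar u F)
  then show ?case by (simp add: gderiv_left_gvar_times algebra_simps)
qed simp

lemma gderiv_left_square: "gderiv_left v (gderiv_left v F) = 0"
  by (rule grass_eqI') (simp add: gderiv_left.rep_eq)

lemma ginv_gderiv_left: "ginv (gderiv_left v F) = - gderiv_left v (ginv F)"
  by (induction F rule: grass_induct) (auto simp: gderiv_left_const gderiv_left_gvar_times)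

lemma clin_op_gderiv_left: "clin_op (gderiv_left v)"
  by (simp add: clin_op_def)

lemma clin_op_ginv: "clin_op ginv"
  by (simp add: clin_op_def)

subsection \<open>The embedding of the scalar Grassmann algebra\<close>

lemma gcoeff_gembed [simp]: "gcoeff (gembed F) A = cscal (gcoeff F A)"
  by (simp add: gembed.rep_eq)

lemma cscal_sign: "cscal ((- 1) ^ k) = (- 1) ^ k"
  by (induction k) (simp_all add: cscal_simps(2) cscal_simps(4) cscal_minus)

lemma gembed_simps [simp]:
  "gembed (F + G) = gembed F + gembed G" "gembed (- F) = - gembed F" "gembed (F - G) = gembed F - gembed G"
  "gembed 0 = 0" "gembed (gconst c) = sscal c" "gembed (gmono A) = gmono A" "gembed 1 = 1"
  by (rule grass_eqI', simp add: cscal_simps(1-3) cscal_minus cscal_diff gconst.rep_eq gmono.rep_eq one_grass.rep_eq)+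

lemma gembed_mult [simp]: "(gembed (F * G) :: 'm::finite clifford grass) = gembed F * gembed G"
proof (rule grass_eqI)
  fix A :: "gvar set" assume A: "finite A"
  have "cscal (inv_sign B C * x * y) = (inv_sign B C * cscal x * cscal y :: 'm clifford)" for B C x y
    by (simp add: inv_sign_def cscal_simps(4) cscal_sign)
  then have "(\<Sum>B\<in>Pow A. cscal (inv_sign B (A - B) * gcoeff F B * gcoeff G (A - B))) =
      (\<Sum>B\<in>Pow A. inv_sign B (A - B) * cscal (gcoeff F B) * cscal (gcoeff G (A - B)) :: 'm clifford)"
    by (intro sum.cong[OF refl])
  then show "gcoeff (gembed (F * G)) A = gcoeff (gembed F * gembed G :: 'm clifford grass) A"
    using A by (simp add: times_grass.rep_eq cscal_sum)
qed

lemma gembed_power [simp]: "gembed (F ^ k) = gembed F ^ k"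
  by (induction k) auto

lemma gembed_sum: "gembed (\<Sum>i\<in>I. f i) = (\<Sum>i\<in>I. gembed (f i))"
  by (induction I rule: infinite_finite_induct) auto

lemma ginv_gembed: "ginv (gembed F) = gembed (ginv F)"
  by (rule grass_eqI') (simp add: gcoeff_ginv cscal_simps(4) cscal_sign)

lemma gderiv_left_gembed: "gderiv_left v (gembed F) = gembed (gderiv_left v F)"
  by (rule grass_eqI') (simp add: gderiv_left.rep_eq cscal_simps(1,4) cscal_sign)

text \<open>Two reasons combine: scalar coefficients commute with the Clifford coefficients of
  \<open>F\<close>, and even degree makes the element commute with the variables.\<close>

lemma gembed_even_central:
  assumes "ginv a = a" shows "gembed a * F = F * gembed a"
proof (induction F rule: grass_induct)
  case (const c)
  show ?case by (rule grass_eqI') (simp add: cscal_simps(5))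
next
  case (add F G)
  then show ?case by (simp add: distrib_left distrib_right)
next
  case (gvar v F)
  have e: "gembed a * gvar v = gvar v * gembed a"
    unfolding gvar_ginv_commute[of v "gembed a"] ginv_gembed assms ..
  have "gembed a * (gvar v * F) = gvar v * (gembed a * F)"
    by (simp only: mult.assoc[symmetric] e)
  then show ?case by (simp only: gvar mult.assoc)
qed

lemma gembed_gconst_commute: "gembed a * gconst c = gconst c * gembed a"
  by (rule grass_eqI') (simp add: cscal_simps(5))

subsection \<open>Berezin integration\<close>

lemma clin_op_fold: "(\<And>j. clin_op (D j)) \<Longrightarrow> clin_op (fold D js)"
  by (induction js) (auto simp: clin_op_def)

lemma clin_op_berezin: "clin_op (berezin n)"
proof -
  have "clin_op (fold (\<lambda>j. gderiv_left (XV j)) js)" for js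
    by (rule clin_op_fold) (rule clin_op_gderiv_left)
  from clin_op_comp[OF clin_op_left this] show ?thesis unfolding berezin_def[abs_def] .
qed

lemma fold_gderiv_zero: "fold (\<lambda>j. gderiv_left (XV j)) js 0 = 0"
  by (induction js) auto

text \<open>A left derivative moves past the others at the cost of signs until it meets its own
  copy, and the square of a left derivative is zero. This is the odd counterpart of the vanishing
  integral of a divergence.\<close>

lemma fold_gderiv_exact: "j \<in> set js \<Longrightarrow> fold (\<lambda>j. gderiv_left (XV j)) js (gderiv_left (XV j) F) = 0"
proof (induction js arbitrary: F)
  case (Cons k ks)
  show ?case
  proof (cases "k = j")
    case True
    then show ?thesis by (simp add: gderiv_left_square fold_gderiv_zero)
  next
    case False
    have "gderiv_left (XV k) (gderiv_left (XV j) F) = gderiv_left (XV j) (gderiv_left (XV k) (- F))"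
      by (subst gderiv_left_anticommute) simp
    then have "fold (\<lambda>j. gderiv_left (XV j)) (k # ks) (gderiv_left (XV j) F) =
        fold (\<lambda>j. gderiv_left (XV j)) ks (gderiv_left (XV j) (gderiv_left (XV k) (- F)))"
      by (simp only: fold_Cons o_apply)
    then show ?thesis using Cons.IH[of "gderiv_left (XV k) (- F)"] Cons.prems False by simp
  qed
qed simp

lemma berezin_gderiv: "j \<in> {1..2 * n} \<Longrightarrow> berezin n (gderiv_left (XV j) F) = 0"
  unfolding berezin_def by (subst fold_gderiv_exact) auto

definition xfree :: "'c::ring_1 grass \<Rightarrow> bool" where
  "xfree c \<longleftrightarrow> (\<forall>j. gderiv_left (XV j) c = 0)"

lemma fold_gderiv_xfree:
  assumes "xfree c"
  shows "fold (\<lambda>j. gderiv_left (XV j)) js (c * F) = (ginv ^^ length js) c * fold (\<lambda>j. gderiv_left (XV j)) js F"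
  using assms
proof (induction js arbitrary: c F)
  case (Cons j js)
  have "xfree (ginv c)" using Cons.prems unfolding xfree_def
    by (metis add.inverse_inverse ginv_gderiv_left ginv_simps(5) neg_equal_0_iff_equal)
  with Cons show ?case by (simp add: gderiv_left_mult xfree_def funpow_swap1)
qed simp

text \<open>Each of the \<open>2 * n\<close> derivatives applies \<open>ginv\<close> once when it
  passes \<open>c\<close>; the number is even, so the grading signs disappear.\<close>

lemma berezin_xfree: assumes "xfree c" shows "berezin n (c * F) = c * berezin n F"
proof -
  have "(ginv ^^ (2 * k)) c = c" for k by (induction k) auto
  then have "(ginv ^^ length [1..<Suc (2 * n)]) c = c" by simp
  then show ?thesis unfolding berezin_def
    by (simp only: fold_gderiv_xfree[OF assms]) (metis sscal_left_commute)
qed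

lemma xfree_xcoeff: "xfree (xcoeff B F)"
  unfolding xfree_def by (intro allI grass_eqI') (auto simp: gderiv_left.rep_eq xcoeff.rep_eq)

lemma clin_op_xcoeff: "clin_op (xcoeff B)"
  unfolding clin_op_def by (intro conjI allI grass_eqI') (auto simp: xcoeff.rep_eq)

text \<open>The order of the variables puts every \<open>YV\<close> before every \<open>XV\<close>,
  so splitting a monomial into these two blocks creates no inversion and no sign.\<close>

lemma xcoeff_times_gmono:
  assumes B: "B \<subseteq> xvars n"
  shows "gcoeff (xcoeff B F * gmono B) A = (if B = A \<inter> range XV then gcoeff F A else 0)"
proof (cases "finite A")
  case True
  have fB: "finite B" using B finite_subset by blast
  have "gcoeff (xcoeff B F * gmono B) A =
      (\<Sum>C\<in>Pow A. if C = A - B \<and> B \<subseteq> A then inv_sign C (A - C) * gcoeff (xcoeff B F) C else 0)"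
    unfolding times_grass.rep_eq gmono.rep_eq
    by (simp only: True if_True) (rule sum.cong[OF refl], use fB in auto)
  also have "\<dots> = (if B \<subseteq> A then inv_sign (A - B) (A - (A - B)) * gcoeff (xcoeff B F) (A - B) else 0)"
    using True by (auto simp: sum.delta)
  also have "\<dots> = (if B = A \<inter> range XV then gcoeff F A else 0)"
  proof (cases "B = A \<inter> range XV")
    case eq: True
    have r: "w \<in> range YV" if "w \<notin> range XV" for w using that by (cases w) auto
    have s: "A - B \<subseteq> range YV" "A - (A - B) = B" "A - B \<union> B = A" using eq r by auto
    have "{(b, c). b \<in> A - B \<and> c \<in> B \<and> c < b} = {}"
    proof -
      have "\<not> c < b" if b: "b \<in> range YV" and c: "c \<in> range XV" for b c :: gvar
        using that by (auto simp: less_gvar_def)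
      then show ?thesis using s(1) eq by blast
    qed
    then have "inv_sign (A - B) B = (1 :: 'a)" unfolding inv_sign_def by (simp only: card.empty power_0)
    then show ?thesis using eq s by (simp add: xcoeff.rep_eq)
  next
    case False
    have "gcoeff (xcoeff B F) (A - B) = 0" if "B \<subseteq> A"
    proof -
      have "\<not> A - B \<subseteq> range YV"
      proof
        assume "A - B \<subseteq> range YV"
        then have "B = A \<inter> range XV" using B that by auto
        with False show False by simp
      qed
      then show ?thesis by (simp add: xcoeff.rep_eq)
    qed
    then show ?thesis using False by simp
  qed
  finally show ?thesis .
qed (simp add: gcoeff_infinite)

lemma xcoeff_expand:
  assumes "\<And>A. gcoeff F A \<noteq> 0 \<Longrightarrow> A \<subseteq> xvars n \<union> range YV"
  shows "F = (\<Sum>B\<in>Pow (xvars n). xcoeff B F * gmono B)"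
proof (rule grass_eqI')
  fix A
  have "(\<Sum>B\<in>Pow (xvars n). gcoeff (xcoeff B F * gmono B) A) =
      (\<Sum>B\<in>Pow (xvars n). if B = A \<inter> range XV then gcoeff F A else 0)"
    by (rule sum.cong[OF refl]) (rule xcoeff_times_gmono, simp)
  also have "\<dots> = (if A \<inter> range XV \<subseteq> xvars n then gcoeff F A else 0)"
    by (simp add: sum.delta)
  also have "\<dots> = gcoeff F A" using assms[of A] by auto
  finally show "gcoeff F A = gcoeff (\<Sum>B\<in>Pow (xvars n). xcoeff B F * gmono B) A"
    by (simp only: gcoeff_sum)
qed

text \<open>This rewrites the double sum in \<open>super_integral\<close> as one Berezin integral of
  a product. Evenness of \<open>s\<close> lets it pass the coefficients of \<open>F\<close>, which
  may contain odd powers of the \<open>YV\<close>.\<close>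

lemma berezin_expand:
  fixes F :: "'m::finite clifford grass"
  assumes s: "\<And>A. gcoeff s A \<noteq> 0 \<Longrightarrow> A \<subseteq> xvars n" and even: "ginv s = s"
    and F: "\<And>A. gcoeff F A \<noteq> 0 \<Longrightarrow> A \<subseteq> xvars n \<union> range YV"
  shows "berezin n (gembed s * F) =
    (\<Sum>A\<in>Pow (xvars n). \<Sum>B\<in>Pow (xvars n).
       sscal (gcoeff s A) * (xcoeff B F * berezin n (gmono A * gmono B)))"
proof -
  have s_eq: "(gembed s :: 'm clifford grass) = (\<Sum>A\<in>Pow (xvars n). sscal (gcoeff s A) * gmono A)"
  proof (rule grass_eqI')
    fix A
    have "(\<Sum>B\<in>Pow (xvars n). gcoeff (sscal (gcoeff s B) * gmono B) A) =
        (\<Sum>B\<in>Pow (xvars n). if B = A then cscal (gcoeff s A) else (0 :: 'm clifford))"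
      by (rule sum.cong[OF refl]) (auto simp: gmono.rep_eq gcoeff_infinite cscal_simps(1))
    also have "\<dots> = cscal (gcoeff s A)" using s[of A]
      by (cases "gcoeff s A = 0") (auto simp: sum.delta cscal_simps(1))
    finally show "gcoeff (gembed s) A =
        gcoeff (\<Sum>A\<in>Pow (xvars n). sscal (gcoeff s A) * gmono A :: 'm clifford grass) A"
      by (simp only: gcoeff_sum gcoeff_gembed)
  qed
  have "gembed s * F = gembed s * (\<Sum>B\<in>Pow (xvars n). xcoeff B F * gmono B)"
    using xcoeff_expand[of F n] F by simp
  also have "\<dots> = (\<Sum>B\<in>Pow (xvars n). xcoeff B F * (gembed s * gmono B))"
    unfolding sum_distrib_left mult.assoc[symmetric] by (simp only: gembed_even_central[OF even])
  finally have "berezin n (gembed s * F) = (\<Sum>B\<in>Pow (xvars n). xcoeff B F * berezin n (gembed s * gmono B))"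
    by (simp only: clin_op_sum[OF clin_op_berezin] berezin_xfree[OF xfree_xcoeff])
  also have "\<dots> = (\<Sum>B\<in>Pow (xvars n). \<Sum>A\<in>Pow (xvars n).
      sscal (gcoeff s A) * (xcoeff B F * berezin n (gmono A * gmono B)))"
  proof (rule sum.cong[OF refl])
    fix B
    have "gembed s * gmono B =
        (\<Sum>A\<in>Pow (xvars n). sscal (gcoeff s A) * (gmono A * gmono B) :: 'm clifford grass)"
      unfolding s_eq sum_distrib_right mult.assoc ..
    from arg_cong[OF this, of "\<lambda>v. xcoeff B F * berezin n v"]
    show "xcoeff B F * berezin n (gembed s * gmono B) = (\<Sum>A\<in>Pow (xvars n).
        sscal (gcoeff s A) * (xcoeff B F * berezin n (gmono A * gmono B)))"
      by (simp only: clin_op_sum[OF clin_op_berezin] clin_op_scal[OF clin_op_berezin] sum_distrib_left sscal_left_commute)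
  qed
  also have "\<dots> = (\<Sum>A\<in>Pow (xvars n). \<Sum>B\<in>Pow (xvars n).
      sscal (gcoeff s A) * (xcoeff B F * berezin n (gmono A * gmono B)))"
    by (rule sum.swap)
  finally show ?thesis .
qed

subsection \<open>Pairing with distributions\<close>

lemma integrable_test: "test_function \<phi> \<Longrightarrow> integrable lborel \<phi>"
  by (rule test_function_integrable[OF test_function_continuous, of _ "tsupp \<phi>"])
     (auto simp: test_function_def tsupp_zero)

text \<open>The counterpart for distributions of \<open>smooth_rep_pdiff\<close>: under a functional
  the list representation disappears and a pairing with a scalar test function remains.\<close>

lemma sum_list_pairing:
  assumes T: "\<And>f g. test_function f \<Longrightarrow> test_function g \<Longrightarrow> T (\<lambda>x. f x + g x) = T f + T g"
    "\<And>c f. test_function f \<Longrightarrow> T (\<lambda>x. c * f x) = c * T f"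
    and S: "open S" and eta: "test_function \<eta>" "tsupp \<eta> \<subseteq> S" and L: "clin L"
    and rep: "smooth_rep S F fs"
  shows "L (\<Sum>(f, c)\<leftarrow>fs. sscal (T (\<lambda>x. \<eta> x * f x)) * c) = T (\<lambda>x. \<eta> x * L (F x))"
  using rep
proof (induction fs arbitrary: F)
  case Nil
  have "\<eta> x * L (F x) = 0" for x
    using Nil eta(2) tsupp_zero[of x \<eta>] by (cases "x \<in> S") (auto simp: smooth_rep_Nil clin_zero[OF L])
  then have "(\<lambda>x. \<eta> x * L (F x)) = (\<lambda>x. 0)" by (rule ext)
  moreover have "T (\<lambda>x. 0) = 0" using T(2)[OF eta(1), of 0] by simp
  ultimately show ?case by (simp add: clin_zero[OF L])
next
  case (Cons p fs)
  obtain f c where p: "p = (f, c)" by fastforce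
  let ?G = "\<lambda>x. F x - sscal (f x) * c"
  have F: "smooth_on S f" "smooth_rep S ?G fs"
    using Cons.prems unfolding p smooth_rep_Cons by auto
  then have g: "smooth_on S (\<lambda>x. L (?G x))" by (intro clin_smooth S L) (auto simp: sf_def)
  have t: "test_function (\<lambda>x. \<eta> x * f x)" "test_function (\<lambda>x. \<eta> x * L (?G x))"
    by (rule test_function_mult(1)[OF S F(1) eta]) (rule test_function_mult(1)[OF S g eta])
  have "(\<lambda>x. \<eta> x * L (F x)) = (\<lambda>x. L c * (\<eta> x * f x) + \<eta> x * L (?G x))"
    by (simp add: clin_diff[OF L] clin_scal[OF L] algebra_simps)
  then have "T (\<lambda>x. \<eta> x * L (F x)) = L c * T (\<lambda>x. \<eta> x * f x) + T (\<lambda>x. \<eta> x * L (?G x))"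
    using T(1)[OF test_function_scale[OF t(1), of "L c"] t(2)] T(2)[OF t(1)] by simp
  then show ?case
    using Cons.IH[OF F(2)] by (simp add: p clin_add[OF L] clin_scal[OF L])
qed

text \<open>Two admissible cut-offs give the same value because either may be inserted next to the
  other: the change is a test function vanishing near a set that supports \<open>T\<close>. Hence
  the description in \<open>dist_pair\<close> has exactly one solution, and functionals compute
  it.\<close>

lemma clin_dist_pair:
  fixes F :: "'m::finite point \<Rightarrow> 'm clifford grass"
  assumes T: "\<And>f g. test_function f \<Longrightarrow> test_function g \<Longrightarrow> T (\<lambda>x. f x + g x) = T f + T g"
    "\<And>c f. test_function f \<Longrightarrow> T (\<lambda>x. c * f x) = c * T f"
    and K: "compact K" "supported_in T K" "open S" "K \<subseteq> S" and F: "sf S F"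
    and eta: "test_function \<eta>" "tsupp \<eta> \<subseteq> S" "open U" "K \<subseteq> U" "\<And>x. x \<in> U \<Longrightarrow> \<eta> x = 1"
    and L: "clin L"
  shows "L (dist_pair T F) = T (\<lambda>x. \<eta> x * L (F x))"
proof -
  let ?Q = "\<lambda>v. \<exists>K S U \<eta> fs.
     compact K \<and> supported_in T K \<and> open S \<and> K \<subseteq> S \<and> smooth_rep S F fs \<and>
     test_function \<eta> \<and> tsupp \<eta> \<subseteq> S \<and> open U \<and> K \<subseteq> U \<and> (\<forall>x\<in>U. \<eta> x = 1) \<and>
     v = (\<Sum>(f, c)\<leftarrow>fs. sscal (T (\<lambda>x. \<eta> x * f x)) * c)"
  have cut: "T (\<lambda>x. \<eta>1 x * L (F x)) = T (\<lambda>x. \<eta>2 x * (\<eta>1 x * L (F x)))"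
    if L: "clin L" and S: "open S1" "sf S1 F" and e1: "test_function \<eta>1" "tsupp \<eta>1 \<subseteq> S1"
      and e2: "test_function \<eta>2" "open U2" "K2 \<subseteq> U2" "\<And>x. x \<in> U2 \<Longrightarrow> \<eta>2 x = 1" and K2: "supported_in T K2"
    for \<eta>1 \<eta>2 U2 K2 S1 and L :: "'m clifford grass \<Rightarrow> complex"
  proof -
    let ?f = "\<lambda>x. \<eta>1 x * L (F x)"
    have f: "test_function ?f" by (rule test_function_mult(1)[OF S(1) clin_smooth[OF S(1) L S(2)] e1])
    then have f2: "test_function (\<lambda>x. \<eta>2 x * ?f x)"
      using test_function_mult(1)[OF open_UNIV _ e2(1)] by (simp add: test_function_def)
    let ?d = "\<lambda>x. ?f x + (- 1) * (\<eta>2 x * ?f x)"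
    have d: "test_function ?d" by (intro test_function_add f test_function_scale[OF f2])
    have "tsupp ?d \<subseteq> - U2" by (rule tsupp_subset) (use e2 in auto)
    then have disj: "tsupp ?d \<inter> K2 = {}" using e2(3) by auto
    have "T ?d = 0" by (rule K2[unfolded supported_in_def, rule_format, OF conjI[OF d disj]])
    moreover have "T ?d = T ?f + (- 1) * T (\<lambda>x. \<eta>2 x * ?f x)"
      unfolding T(2)[OF f2, symmetric] by (rule T(1)[OF f test_function_scale[OF f2]])
    ultimately show ?thesis by simp
  qed
  have uniq: "L v = T (\<lambda>x. \<eta> x * L (F x))" if "?Q v" and L: "clin L" for v L
  proof -
    from \<open>?Q v\<close> obtain K' S' U' \<eta>' fs where q: "compact K'" "supported_in T K'" "open S'" "K' \<subseteq> S'"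
      "smooth_rep S' F fs" "test_function \<eta>'" "tsupp \<eta>' \<subseteq> S'" "open U'" "K' \<subseteq> U'" "\<forall>x\<in>U'. \<eta>' x = 1"
      "v = (\<Sum>(f, c)\<leftarrow>fs. sscal (T (\<lambda>x. \<eta>' x * f x)) * c)"
      by (elim exE conjE) (rule that, assumption+)
    have q10: "\<And>x. x \<in> U' \<Longrightarrow> \<eta>' x = 1" using q(10) by blast
    have sf': "sf S' F" using q(5) sf_def by blast
    have "L v = T (\<lambda>x. \<eta>' x * L (F x))"
      unfolding q(11) by (rule sum_list_pairing[OF T q(3,6,7) L q(5)])
    also have "\<dots> = T (\<lambda>x. \<eta> x * (\<eta>' x * L (F x)))"
      by (rule cut[OF L q(3) sf' q(6,7) eta(1,3,4,5) K(2)])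
    also have "\<dots> = T (\<lambda>x. \<eta>' x * (\<eta> x * L (F x)))" by (simp only: mult.left_commute)
    also have "\<dots> = T (\<lambda>x. \<eta> x * L (F x))"
      by (rule cut[OF L K(3) F eta(1,2) q(6,8,9) q10 q(2), symmetric])
    finally show ?thesis .
  qed
  obtain fs where fs: "smooth_rep S F fs" using F sf_def by blast
  have ex: "?Q (\<Sum>(f, c)\<leftarrow>fs. sscal (T (\<lambda>x. \<eta> x * f x)) * c)"
    using K eta fs by (intro exI[of _ K] exI[of _ S] exI[of _ U] exI[of _ \<eta>] exI[of _ fs]) auto
  have "?Q (dist_pair T F)" unfolding dist_pair_def
  proof (rule theI[of ?Q, OF ex])
    fix v assume "?Q v"
    then show "v = (\<Sum>(f, c)\<leftarrow>fs. sscal (T (\<lambda>x. \<eta> x * f x)) * c)"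
      using uniq uniq[OF ex] by (intro clin_separates) (simp only:)
  qed
  then show ?thesis by (rule uniq[OF _ L])
qed

subsection \<open>Composition with superfunctions\<close>

text \<open>The Taylor polynomial in the nilpotent part of a function of the body. The derivatives
  are passed as a sequence \<open>th\<close>, so that real powers and test functions are treated
  alike.\<close>

definition gcomp :: "nat \<Rightarrow> (nat \<Rightarrow> real \<Rightarrow> complex) \<Rightarrow> complex grass \<Rightarrow> complex grass" where
  "gcomp n th a = (\<Sum>j\<le>n. gconst (th j (gbody a) / fact j) * gnil a ^ j)"

lemma gcoeff_mult_support:
  assumes "\<And>A. gcoeff a A \<noteq> 0 \<Longrightarrow> A \<subseteq> V" "\<And>A. gcoeff b A \<noteq> 0 \<Longrightarrow> A \<subseteq> V" "gcoeff (a * b) A \<noteq> 0"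
  shows "A \<subseteq> V"
proof -
  have "finite A" using assms(3) gcoeff_infinite by blast
  then have "(\<Sum>B\<in>Pow A. inv_sign B (A - B) * gcoeff a B * gcoeff b (A - B)) \<noteq> 0"
    using assms(3) by (simp add: times_grass.rep_eq)
  then obtain B where B: "B \<in> Pow A" "inv_sign B (A - B) * gcoeff a B * gcoeff b (A - B) \<noteq> 0"
    by (meson sum.neutral)
  then have "gcoeff a B \<noteq> 0" "gcoeff b (A - B) \<noteq> 0" by auto
  then have "B \<subseteq> V" "A - B \<subseteq> V" using assms by auto
  then show ?thesis by auto
qed

lemma gcoeff_power_support:
  assumes "\<And>A. gcoeff a A \<noteq> 0 \<Longrightarrow> A \<subseteq> V"
  shows "gcoeff (a ^ k) A \<noteq> 0 \<Longrightarrow> A \<subseteq> V"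
proof (induction k arbitrary: A)
  case 0
  then show ?case by (auto simp: one_grass.rep_eq split: if_splits)
next
  case (Suc k)
  show ?case by (rule gcoeff_mult_support[of a V "a ^ k"]) (use assms Suc in auto)
qed

lemma gcoeff_gnil: "gcoeff (gnil a) A = (if A = {} then 0 else gcoeff a A)"
  by (simp add: gnil_def gconst.rep_eq)

lemma ginv_power: "ginv (a ^ k) = ginv a ^ k"
  by (induction k) (auto simp: ginv_mult)

lemma gcomp_support:
  assumes "\<And>A. gcoeff a A \<noteq> 0 \<Longrightarrow> A \<subseteq> V" "gcoeff (gcomp n th a) A \<noteq> 0"
  shows "A \<subseteq> V"
proof -
  have "\<exists>j. gcoeff (gnil a ^ j) A \<noteq> 0"
    using assms(2) unfolding gcomp_def gcoeff_sum by (metis (no_types, lifting) gcoeff_gconst_mult mult_zero_right sum.neutral)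
  then obtain j where "gcoeff (gnil a ^ j) A \<noteq> 0" ..
  then show ?thesis
    by (rule gcoeff_power_support[rotated]) (use assms(1) in \<open>auto simp: gcoeff_gnil split: if_splits\<close>)
qed

lemma ginv_gnil: "ginv a = a \<Longrightarrow> ginv (gnil a) = gnil a"
  by (simp add: gnil_def)

lemma ginv_gcomp: "ginv a = a \<Longrightarrow> ginv (gcomp n th a) = gcomp n th a"
  unfolding gcomp_def by (simp add: ginv_sum ginv_power ginv_gnil)

lemma smooth_gcoeff_mult:
  assumes S: "open S" and "\<And>A. smooth_on S (\<lambda>x. gcoeff (F x) A)" "\<And>A. smooth_on S (\<lambda>x. gcoeff (G x) A)"
  shows "smooth_on S (\<lambda>x. gcoeff (F x * G x :: complex grass) A)"
  using assms by (cases "finite A") (auto simp: times_grass.rep_eq intro!: smooth_on_sum smooth_on_mult)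

lemma smooth_gcoeff_power:
  assumes S: "open S" and "\<And>A. smooth_on S (\<lambda>x. gcoeff (F x) A)"
  shows "smooth_on S (\<lambda>x. gcoeff (F x ^ k :: complex grass) A)"
proof (induction k arbitrary: A)
  case 0
  then show ?case by simp
next
  case (Suc k)
  show ?case unfolding power_Suc by (rule smooth_gcoeff_mult[OF S assms(2) Suc])
qed

lemma smooth_gcoeff_gnil:
  assumes "\<And>A. smooth_on S (\<lambda>x. gcoeff (F x) A)"
  shows "smooth_on S (\<lambda>x. gcoeff (gnil (F x)) A)"
  using assms by (cases "A = {}") (simp_all add: gcoeff_gnil)

lemma phase_function_ginv: "phase_function n g \<Longrightarrow> ginv (g x) = g x"
proof (rule grass_eqI')
  fix A assume g: "phase_function n g"
  show "gcoeff (ginv (g x)) A = gcoeff (g x) A"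
  proof (cases "gcoeff (g x) A = 0")
    case False
    then have "even (card A)" using g by (auto simp: phase_function_def)
    then show ?thesis by (simp add: gcoeff_ginv)
  qed (simp add: gcoeff_ginv)
qed

lemma phase_function_body:
  assumes "phase_function n g"
  shows "smooth_on UNIV (\<lambda>x. gbody (g x))" "complex_of_real (gbody (g x)) = gcoeff (g x) {}"
  using assms by (auto simp: phase_function_def gbody_def intro: smooth_on_Re)

subsection \<open>The delta distribution of a phase function\<close>

lemma super_delta_term_test:
  assumes g: "phase_function n g" and phi: "test_function \<phi>"
  shows "test_function (\<lambda>x. gcoeff (gnil (g x) ^ j) A / fact j * \<phi> x)"
proof -
  have "smooth_on UNIV (\<lambda>x. gcoeff (gnil (g x) ^ j) A * (1 / fact j))"
    using g by (intro smooth_on_mult smooth_gcoeff_power smooth_gcoeff_gnil smooth_on_const)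
      (auto simp: phase_function_def)
  from test_function_mult(1)[OF open_UNIV this phi] show ?thesis
    by (simp add: mult.commute)
qed

text \<open>These are the conditions under which \<open>clin_dist_pair\<close> evaluates the pairing
  with a component of the delta distribution.\<close>

lemma super_delta_props:
  assumes g: "phase_function n g" and u: "regular_zero_set (\<lambda>x. gbody (g x))"
  shows "test_function \<phi> \<Longrightarrow> test_function \<zeta> \<Longrightarrow>
      super_delta n g A (\<lambda>x. \<phi> x + \<zeta> x) = super_delta n g A \<phi> + super_delta n g A \<zeta>"
    and "test_function \<phi> \<Longrightarrow> super_delta n g A (\<lambda>x. c * \<phi> x) = c * super_delta n g A \<phi>"
    and "supported_in (super_delta n g A) {x. gbody (g x) = 0}"
proof -
  assume "test_function \<phi>" "test_function \<zeta>"
  then show "super_delta n g A (\<lambda>x. \<phi> x + \<zeta> x) = super_delta n g A \<phi> + super_delta n g A \<zeta>"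
    unfolding super_delta_def distrib_left
    by (simp only: delta_pullback_add[OF u super_delta_term_test[OF g] super_delta_term_test[OF g]] sum.distrib)
next
  assume p: "test_function \<phi>"
  show "super_delta n g A (\<lambda>x. c * \<phi> x) = c * super_delta n g A \<phi>"
    unfolding super_delta_def mult.left_commute[of _ c] delta_pullback_scale[OF u super_delta_term_test[OF g p]]
      sum_distrib_left ..
next
  show "supported_in (super_delta n g A) {x. gbody (g x) = 0}"
    unfolding supported_in_def
  proof (intro allI impI)
    fix \<phi> :: "'a point \<Rightarrow> complex"
    assume p: "test_function \<phi> \<and> tsupp \<phi> \<inter> {x. gbody (g x) = 0} = {}"
    show "super_delta n g A \<phi> = 0"
      unfolding super_delta_def
    proof (intro sum.neutral ballI delta_pullback_supported[OF u super_delta_term_test[OF g]])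
      fix j
      have "tsupp (\<lambda>x. gcoeff (gnil (g x) ^ j) A / fact j * \<phi> x) \<subseteq> tsupp \<phi>"
        by (rule tsupp_subset) (auto simp: tsupp_zero)
      then show "tsupp (\<lambda>x. gcoeff (gnil (g x) ^ j) A / fact j * \<phi> x) \<inter> {x. gbody (g x) = 0} = {}"
        using p by blast
    qed (use p in auto)
  qed
qed

lemma germ_value_cong:
  assumes "germ_value v \<Phi>" "\<And>\<psi>. test_function \<psi> \<Longrightarrow> \<Phi> \<psi> = \<Psi> \<psi>"
  shows "germ_value v \<Psi>"
  using assms unfolding germ_value_def by metis

text \<open>When a test function \<open>\<psi>\<close> takes the place of \<delta>, the component at
  \<open>A\<close> becomes that of \<open>gcomp\<close> formed with the derivatives of
  \<open>\<psi>\<close>; the finite Taylor sum of pullbacks is treated term by term.\<close>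

lemma germ_value_super_delta:
  assumes g: "phase_function n g" and u: "regular_zero_set (\<lambda>x. gbody (g x))" and phi: "test_function \<phi>"
  shows "germ_value (super_delta n g A \<phi>)
    (\<lambda>\<psi>. LINT x|lborel. gcoeff (gcomp n (\<lambda>j. vderivs j \<psi>) (g x)) A * \<phi> x)"
proof -
  interpret fibre "\<lambda>x. gbody (g x)" by (rule regular_zero_set_fibre(1)[OF u])
  have "germ_value (super_delta n g A \<phi>) (\<lambda>\<psi>. \<Sum>j\<le>n. LINT x|lborel.
      gcoeff (gnil (g x) ^ j) A / fact j * \<phi> x * vderivs j \<psi> (gbody (g x)))"
    unfolding super_delta_def
    by (intro germ_value_sum germ_value_delta_pullback u super_delta_term_test[OF g] phi)
  then show ?thesis
  proof (rule germ_value_cong)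
    fix \<psi> :: "real \<Rightarrow> complex" assume p: "test_function \<psi>"
    have "(\<Sum>j\<le>n. LINT x|lborel. gcoeff (gnil (g x) ^ j) A / fact j * \<phi> x * vderivs j \<psi> (gbody (g x))) =
       (LINT x|lborel. (\<Sum>j\<le>n. gcoeff (gnil (g x) ^ j) A / fact j * \<phi> x * vderivs j \<psi> (gbody (g x))))"
      by (rule Bochner_Integration.integral_sum[symmetric])
        (rule integrable_test_comp[OF super_delta_term_test[OF g phi] vderivs_test(3)[OF p]])
    also have "\<dots> = (LINT x|lborel. gcoeff (gcomp n (\<lambda>j. vderivs j \<psi>) (g x)) A * \<phi> x)"
      unfolding gcomp_def gcoeff_sum sum_distrib_right
      by (intro arg_cong[where f = "integral\<^sup>L lborel"] ext sum.cong refl) simp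
    finally show "(\<Sum>j\<le>n. LINT x|lborel. gcoeff (gnil (g x) ^ j) A / fact j * \<phi> x * vderivs j \<psi> (gbody (g x))) =
        (LINT x|lborel. gcoeff (gcomp n (\<lambda>j. vderivs j \<psi>) (g x)) A * \<phi> x)" .
  qed
qed

lemma gcomp_smooth:
  assumes S: "open S" and g: "\<And>A. smooth_on S (\<lambda>x. gcoeff (g x) A)"
    and th: "\<And>j. smooth_on S (\<lambda>x. th j (gbody (g x)))"
  shows "smooth_on S (\<lambda>x. gcoeff (gcomp n th (g x)) A)"
proof -
  have "smooth_on S (\<lambda>x. th j (gbody (g x)) * (1 / fact j) * gcoeff (gnil (g x) ^ j) A)" for j
    by (intro smooth_on_mult S smooth_gcoeff_power smooth_gcoeff_gnil g th smooth_on_const)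
  then show ?thesis unfolding gcomp_def gcoeff_sum gcoeff_gconst_mult
    by (intro smooth_on_sum S) (simp add: divide_inverse)
qed

text \<open>The bridge from the distributional integral to ordinary ones: its image under
  \<open>L\<close> is the value at 0 of the density of the integrals in which \<psi>(g) replaces
  \<delta>(g). The cut-off confines \<open>F\<close> to \<open>S\<close>, where it is
  smooth.\<close>

lemma germ_value_super_integral:
  fixes F :: "'m::finite point \<Rightarrow> 'm clifford grass"
  assumes g: "phase_function n g" and u: "regular_zero_set (\<lambda>x. gbody (g x))"
    and K: "compact {x. gbody (g x) = 0}" "open S" "{x. gbody (g x) = 0} \<subseteq> S" and F: "sf S F"
    and supp: "\<And>x A. x \<in> S \<Longrightarrow> gcoeff (F x) A \<noteq> 0 \<Longrightarrow> A \<subseteq> xvars n \<union> range YV"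
    and eta: "test_function \<eta>" "tsupp \<eta> \<subseteq> S" "open U" "{x. gbody (g x) = 0} \<subseteq> U" "\<And>x. x \<in> U \<Longrightarrow> \<eta> x = 1"
    and L: "clin L"
  shows "germ_value (L (super_integral n (super_delta n g) F))
    (\<lambda>\<psi>. LINT x|lborel. \<eta> x * L (berezin n (gembed (gcomp n (\<lambda>j. vderivs j \<psi>) (g x)) * F x)))"
proof -
  let ?f = "\<lambda>A B x. \<eta> x * L (xcoeff B (F x) * berezin n (gmono A * gmono B))"
  have cl: "clin_op (\<lambda>v. xcoeff B v * berezin n (gmono A * gmono B))" for A B
    by (rule clin_op_comp[OF clin_op_right clin_op_xcoeff])
  have t: "test_function (?f A B)" for A B
    by (rule test_function_mult(1)[OF K(2) clin_smooth[OF K(2) L sf_clin_op[OF cl F]] eta(1,2)])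
  have "L (super_integral n (super_delta n g) F) =
      (\<Sum>A\<in>Pow (xvars n). \<Sum>B\<in>Pow (xvars n). super_delta n g A (?f A B))"
    unfolding super_integral_def clin_sum[OF L]
  proof (intro sum.cong refl)
    fix A B
    show "L (dist_pair (super_delta n g A) (\<lambda>x. xcoeff B (F x)) * berezin n (gmono A * gmono B)) =
        super_delta n g A (?f A B)"
      by (rule clin_dist_pair[OF super_delta_props(1,2)[OF g u] K(1) super_delta_props(3)[OF g u] K(2,3)
            sf_clin_op[OF clin_op_xcoeff F] eta clin_comp[OF L clin_op_right]])
  qed
  moreover have "germ_value (\<Sum>A\<in>Pow (xvars n). \<Sum>B\<in>Pow (xvars n). super_delta n g A (?f A B))
      (\<lambda>\<psi>. \<Sum>A\<in>Pow (xvars n). \<Sum>B\<in>Pow (xvars n). LINT x|lborel. gcoeff (gcomp n (\<lambda>j. vderivs j \<psi>) (g x)) A * ?f A B x)"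
    by (intro germ_value_sum germ_value_super_delta[OF g u t])
  ultimately have "germ_value (L (super_integral n (super_delta n g) F))
      (\<lambda>\<psi>. \<Sum>A\<in>Pow (xvars n). \<Sum>B\<in>Pow (xvars n). LINT x|lborel. gcoeff (gcomp n (\<lambda>j. vderivs j \<psi>) (g x)) A * ?f A B x)"
    by (simp only:)
  then show ?thesis
  proof (rule germ_value_cong)
    fix \<psi> :: "real \<Rightarrow> complex" assume p: "test_function \<psi>"
    let ?s = "\<lambda>x. gcomp n (\<lambda>j. vderivs j \<psi>) (g x)"
    have sm: "smooth_on UNIV (\<lambda>x. gcoeff (?s x) A)" for A
    proof (rule gcomp_smooth[OF open_UNIV])
      show "smooth_on UNIV (\<lambda>x. vderivs j \<psi> (gbody (g x)))" for j
      proof -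
        have "smooth_on UNIV (vderivs j \<psi>)" using vderivs_test(1)[OF p, of j] by (simp add: test_function_def)
        from smooth_on_compose_real[OF open_UNIV open_UNIV subset_UNIV this phase_function_body(1)[OF g]]
        show ?thesis .
      qed
    qed (use g in \<open>auto simp: phase_function_def\<close>)
    have i: "integrable lborel (\<lambda>x. gcoeff (?s x) A * ?f A B x)" for A B
    proof -
      have "test_function (\<lambda>x. ?f A B x * gcoeff (?s x) A)"
        by (rule test_function_mult(1)[OF open_UNIV sm t]) simp
      then have "integrable lborel (\<lambda>x. ?f A B x * gcoeff (?s x) A)" by (rule integrable_test)
      then show ?thesis by (simp only: mult.commute)
    qed
    have "(\<Sum>A\<in>Pow (xvars n). \<Sum>B\<in>Pow (xvars n). LINT x|lborel. gcoeff (?s x) A * ?f A B x) =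
        (LINT x|lborel. (\<Sum>A\<in>Pow (xvars n). \<Sum>B\<in>Pow (xvars n). gcoeff (?s x) A * ?f A B x))"
      using i by (simp add: Bochner_Integration.integral_sum)
    also have "\<dots> = (LINT x|lborel. \<eta> x * L (berezin n (gembed (?s x) * F x)))"
    proof (rule arg_cong[where f = "integral\<^sup>L lborel"], rule ext)
      fix x
      show "(\<Sum>A\<in>Pow (xvars n). \<Sum>B\<in>Pow (xvars n). gcoeff (?s x) A * ?f A B x) =
          \<eta> x * L (berezin n (gembed (?s x) * F x))"
      proof (cases "x \<in> S")
        case True
        have "berezin n (gembed (?s x) * F x) = (\<Sum>A\<in>Pow (xvars n). \<Sum>B\<in>Pow (xvars n).
            sscal (gcoeff (?s x) A) * (xcoeff B (F x) * berezin n (gmono A * gmono B)))"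
        proof (rule berezin_expand)
          show "A \<subseteq> xvars n" if "gcoeff (?s x) A \<noteq> 0" for A
            by (rule gcomp_support[OF _ that]) (use g in \<open>auto simp: phase_function_def\<close>)
          show "ginv (?s x) = ?s x" by (rule ginv_gcomp[OF phase_function_ginv[OF g]])
        qed (use supp[OF True] in auto)
        then show ?thesis
          by (simp add: clin_sum[OF L] clin_scal[OF L] sum_distrib_left mult.left_commute)
      next
        case False
        then have "\<eta> x = 0" using eta(2) tsupp_zero by blast
        then show ?thesis by simp
      qed
    qed
    finally show "(\<Sum>A\<in>Pow (xvars n). \<Sum>B\<in>Pow (xvars n). LINT x|lborel. gcoeff (?s x) A * ?f A B x) =
        (LINT x|lborel. \<eta> x * L (berezin n (gembed (?s x) * F x)))" .
  qed
qed

subsection \<open>Clifford relations\<close>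

definition acom :: "'r::ring_1 \<Rightarrow> 'r \<Rightarrow> 'r" where "acom s t = s * t + t * s"
definition comm :: "'r::ring_1 \<Rightarrow> 'r \<Rightarrow> 'r" where "comm s t = s * t - t * s"

lemma cscal_left_commute: "s * (cscal c * t) = cscal c * (s * t)"
  by (metis cscal_simps(5) mult.assoc)

lemma cscal_merge: "cscal a * (cscal b * x) = cscal (a * b) * x"
  by (simp add: cscal_simps(4) mult.assoc)

lemma acom_linear:
  "acom (cscal a * s) t = cscal a * acom s t" "acom s (cscal a * t) = cscal a * acom s t"
  "acom (s + s') t = acom s t + acom s' t" "acom s (t + t') = acom s t + acom s t'"
  by (simp_all add: acom_def distrib_left distrib_right mult.assoc cscal_left_commute[of t] cscal_left_commute[of s])

lemma comm_linear:
  "comm (cscal a * s) t = cscal a * comm s t" "comm s (cscal a * t) = cscal a * comm s t"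
  "comm (s + s') t = comm s t + comm s' t" "comm s (t + t') = comm s t + comm s t'"
  by (simp_all add: comm_def distrib_left distrib_right right_diff_distrib mult.assoc
      cscal_left_commute[of t] cscal_left_commute[of s])

text \<open>All Witt vectors have the shape \<open>cscal a * (s + cscal b * t)\<close>, so one
  bilinear expansion yields every relation among them.\<close>

lemma acom_bilinear:
  "acom (cscal a * (s + cscal b * t)) (cscal c * (u + cscal d * v)) =
   cscal (a * c) * (acom s u + cscal d * acom s v + cscal b * acom t u + cscal (b * d) * acom t v)"
  by (simp only: acom_linear cscal_merge distrib_left add_ac mult_ac)

lemma comm_bilinear:
  "comm (cscal a * (s + cscal b * t)) (cscal c * (u + cscal d * v)) =
   cscal (a * c) * (comm s u + cscal d * comm s v + cscal b * comm t u + cscal (b * d) * comm t v)"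
  by (simp only: comm_linear cscal_merge distrib_left add_ac mult_ac)

lemma witt_forms:
  "witt j = cscal (1 / 2) * (clE (Inl j) + cscal (- \<i>) * clE (Inr j))"
  "witt_dag j = cscal (- (1 / 2)) * (clE (Inl j) + cscal \<i> * clE (Inr j))"
  "gwitt k = cscal (1 / 2) * (clG (2 * k - 1) + cscal (- \<i>) * clG (2 * k))"
  "gwitt_dag k = cscal (- (1 / 2)) * (clG (2 * k - 1) + cscal \<i> * clG (2 * k))"
  by (simp_all add: witt_def witt_dag_def gwitt_def gwitt_dag_def cscal_minus)

lemma acom_clE: "acom (clE j) (clE k) = cscal (if j = k then - 2 else 0)"
  unfolding acom_def by (rule clE_clE)

lemma acom_clE_clG: "acom (clE j) (clG l) = 0" "acom (clG l) (clE j) = 0"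
  using clE_clG[of j l] unfolding acom_def by (simp_all only: add.commute)

lemma comm_clG: "comm (clG l) (clG l') = cscal (sympl l l')"
  unfolding comm_def by (rule clG_clG)

lemma cscal_collect: "cscal a * cscal b = cscal (a * b)" "cscal a + cscal b = cscal (a + b)"
  by (simp_all only: cscal_simps(3,4))

lemma acom_witt:
  "acom (witt j) (witt k) = 0" "acom (witt_dag j) (witt_dag k) = 0"
  "acom (witt j) (witt_dag k) = cscal (if j = k then 1 else 0)"
  "acom (witt j) (gwitt l) = 0" "acom (witt_dag j) (gwitt l) = 0"
  "acom (witt j) (gwitt_dag l) = 0" "acom (witt_dag j) (gwitt_dag l) = 0"
  "acom (gwitt l) (witt_dag j) = 0"
  unfolding witt_forms acom_bilinear acom_clE acom_clE_clG
  by (auto simp: cscal_collect cscal_simps(1))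

text \<open>The last constant is -(1/4)(i + i), from the two nonzero symplectic pairings. The bounds
  exclude index 0, where \<open>2 * j - 1\<close> would be truncated to
  \<open>2 * j\<close>.\<close>

lemma comm_gwitt:
  assumes "j \<ge> 1" "k \<ge> 1"
  shows "comm (gwitt j) (gwitt k) = 0" "comm (gwitt_dag j) (gwitt_dag k) = 0"
    "comm (gwitt j) (gwitt_dag k) = cscal (if j = k then - \<i> / 2 else 0)"
proof -
  obtain a b where ab: "j = Suc a" "k = Suc b" using assms by (metis Suc_le_D One_nat_def)
  have s: "sympl (2 * j - 1) (2 * k - 1) = 0" "sympl (2 * j) (2 * k) = 0"
    "sympl (2 * j - 1) (2 * k) = (if j = k then 1 else 0)"
    "sympl (2 * j) (2 * k - 1) = (if j = k then - 1 else 0)"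
    unfolding ab by (auto simp: sympl_def) presburger+
  show "comm (gwitt j) (gwitt k) = 0" "comm (gwitt_dag j) (gwitt_dag k) = 0"
    "comm (gwitt j) (gwitt_dag k) = cscal (if j = k then - \<i> / 2 else 0)"
    unfolding witt_forms comm_bilinear comm_clG s
    by (auto simp: cscal_collect cscal_simps(1))
qed

subsection \<open>First order operators\<close>

text \<open>Both Dirac operators have this form, with constant Clifford coefficients to the left of
  real derivatives, so the analysis is done once for both.\<close>

definition dop :: "nat \<Rightarrow> ('m + 'm \<Rightarrow> 'm clifford) \<Rightarrow> (nat \<Rightarrow> 'm clifford) \<Rightarrow>
    ('m::finite point \<Rightarrow> 'm clifford grass) \<Rightarrow> 'm point \<Rightarrow> 'm clifford grass" where
  "dop n a b F x = (\<Sum>i\<in>UNIV. gconst (a i) * super_pdiff i F x)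
     + (\<Sum>k\<in>{1..2 * n}. gconst (b k) * gderiv_left (XV k) (F x))"

text \<open>The operator acting from the right: the transpose of \<open>dop\<close> up to sign.\<close>

definition rop :: "nat \<Rightarrow> ('m + 'm \<Rightarrow> 'm clifford) \<Rightarrow> (nat \<Rightarrow> 'm clifford) \<Rightarrow>
    ('m::finite point \<Rightarrow> 'm clifford grass) \<Rightarrow> 'm point \<Rightarrow> 'm clifford grass" where
  "rop n a b F x = (\<Sum>i\<in>UNIV. super_pdiff i F x * gconst (a i))
     + (\<Sum>k\<in>{1..2 * n}. gderiv_left (XV k) (ginv (F x)) * gconst (b k))"

definition aZ :: "'m + 'm \<Rightarrow> 'm::finite clifford" where
  "aZ = case_sum (\<lambda>j. cscal (1 / 2) * witt_dag j) (\<lambda>j. cscal (- \<i> / 2) * witt_dag j)"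
definition aZd :: "'m + 'm \<Rightarrow> 'm::finite clifford" where
  "aZd = case_sum (\<lambda>j. cscal (1 / 2) * witt j) (\<lambda>j. cscal (\<i> / 2) * witt j)"
text \<open>The prefactor 2i of the odd part and the factors 1/2 and -i/2 of the complex derivative
  combine to i and 1. The conjugate operator has -2i with 1/2 and i/2, hence -i and 1 in
  \<open>bZd\<close>.\<close>

definition bZ :: "nat \<Rightarrow> 'm::finite clifford" where
  "bZ k = (if odd k then cscal \<i> * gwitt_dag (Suc k div 2) else gwitt_dag (k div 2))"
definition bZd :: "nat \<Rightarrow> 'm::finite clifford" where
  "bZd k = (if odd k then cscal (- \<i>) * gwitt (Suc k div 2) else gwitt (k div 2))"

lemma sum_Plus_UNIV: "(\<Sum>i\<in>(UNIV :: ('m::finite + 'm) set). h i) = (\<Sum>j\<in>UNIV. h (Inl j) + h (Inr j))"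
  by (subst UNIV_Plus_UNIV[symmetric], subst sum.Plus) (simp_all add: sum.distrib)

lemma sum_pairs: "(\<Sum>k\<in>{1..2 * n}. h k) = (\<Sum>j\<in>{1..n::nat}. h (2 * j - 1) + h (2 * j))"
  by (induction n) (simp_all add: add.assoc)

lemma dirac_eq_dop: "dirac_Z n = (dop n aZ bZ :: ('m::finite point \<Rightarrow> 'm clifford grass) \<Rightarrow> _)"
  "dirac_Zdag n = (dop n aZd bZd :: ('m point \<Rightarrow> 'm clifford grass) \<Rightarrow> _)"
proof -
  have b: "(if odd (2 * j - 1) then p else q) = p" "Suc (2 * j - 1) div 2 = j" "(if odd (2 * j) then p else q) = q"
    "2 * j div 2 = j" if "j \<in> {1..n}" for j :: nat and p q :: "'m clifford"
    using that by (auto simp: Suc_double_not_eq_double)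
  have c: "sscal c * (gconst w * (sscal d * v)) = gconst (cscal (c * d) * w) * v" for c d w and v :: "'m clifford grass"
    unfolding sscal_left_commute[of "gconst w" d v] by (simp only: gconst_mult cscal_simps(4) mult.assoc)
  show "dirac_Z n = dop n aZ (bZ :: nat \<Rightarrow> 'm clifford)"
  proof (intro ext)
    fix F :: "'m point \<Rightarrow> 'm clifford grass" and x
    have 1: "(\<Sum>j\<in>UNIV. gconst (witt_dag j) * d_z j F x) = (\<Sum>i\<in>UNIV. gconst (aZ i) * super_pdiff i F x)"
      unfolding sum_Plus_UNIV
    proof (rule sum.cong[OF refl])
      fix j :: 'm
      have "gconst (witt_dag j) * d_z j F x = sscal 1 * (gconst (witt_dag j) * (sscal (1 / 2) * super_pdiff (Inl j) F x))
          + sscal (- \<i>) * (gconst (witt_dag j) * (sscal (1 / 2) * super_pdiff (Inr j) F x))"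
        unfolding d_z_def right_diff_distrib sscal_left_commute[of "gconst (witt_dag j)"]
        by (simp only: mult.assoc[symmetric] sscal_simps(4)[symmetric]) (simp add: sscal_simps)
      then show "gconst (witt_dag j) * d_z j F x =
          gconst (aZ (Inl j)) * super_pdiff (Inl j) F x + gconst (aZ (Inr j)) * super_pdiff (Inr j) F x"
        unfolding c by (simp add: aZ_def)
    qed
    have 2: "sscal (2 * \<i>) * (\<Sum>j=1..n. gconst (gwitt_dag j) * d_gz j (F x)) =
        (\<Sum>k\<in>{1..2 * n}. gconst (bZ k) * gderiv_left (XV k) (F x))"
      unfolding sum_pairs sum_distrib_left
    proof (rule sum.cong[OF refl])
      fix j assume j: "j \<in> {1..n}"
      have "sscal (2 * \<i>) * (gconst (gwitt_dag j) * d_gz j (F x)) =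
          sscal (2 * \<i>) * (gconst (gwitt_dag j) * (sscal (1 / 2) * gderiv_left (XV (2 * j - 1)) (F x)))
        + sscal (2 * \<i>) * (gconst (gwitt_dag j) * (sscal (- \<i> / 2) * gderiv_left (XV (2 * j)) (F x)))"
        unfolding d_gz_def right_diff_distrib sscal_left_commute[of "gconst (gwitt_dag j)"]
        by (simp only: mult.assoc[symmetric] sscal_simps(4)[symmetric]) (simp add: sscal_simps)
      then show "sscal (2 * \<i>) * (gconst (gwitt_dag j) * d_gz j (F x)) =
          gconst (bZ (2 * j - 1)) * gderiv_left (XV (2 * j - 1)) (F x) + gconst (bZ (2 * j)) * gderiv_left (XV (2 * j)) (F x)"
        unfolding c bZ_def b[OF j] by (simp add: cscal_simps(2))
    qed
    show "dirac_Z n F x = dop n aZ bZ F x" unfolding dirac_Z_def dop_def 1 2 ..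
  qed
  show "dirac_Zdag n = dop n aZd (bZd :: nat \<Rightarrow> 'm clifford)"
  proof (intro ext)
    fix F :: "'m point \<Rightarrow> 'm clifford grass" and x
    have 1: "(\<Sum>j\<in>UNIV. gconst (witt j) * d_zc j F x) = (\<Sum>i\<in>UNIV. gconst (aZd i) * super_pdiff i F x)"
      unfolding sum_Plus_UNIV
    proof (rule sum.cong[OF refl])
      fix j :: 'm
      have "gconst (witt j) * d_zc j F x = sscal 1 * (gconst (witt j) * (sscal (1 / 2) * super_pdiff (Inl j) F x))
          + sscal \<i> * (gconst (witt j) * (sscal (1 / 2) * super_pdiff (Inr j) F x))"
        unfolding d_zc_def distrib_left sscal_left_commute[of "gconst (witt j)"]
        by (simp only: mult.assoc[symmetric] sscal_simps(4)[symmetric]) (simp add: sscal_simps)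
      then show "gconst (witt j) * d_zc j F x =
          gconst (aZd (Inl j)) * super_pdiff (Inl j) F x + gconst (aZd (Inr j)) * super_pdiff (Inr j) F x"
        unfolding c by (simp add: aZd_def)
    qed
    have 2: "sscal (2 * \<i>) * (\<Sum>j=1..n. gconst (gwitt j) * d_gzc j (F x)) =
        - (\<Sum>k\<in>{1..2 * n}. gconst (bZd k) * gderiv_left (XV k) (F x))"
      unfolding sum_pairs sum_distrib_left sum_negf[symmetric]
    proof (rule sum.cong[OF refl])
      fix j assume j: "j \<in> {1..n}"
      have "sscal (2 * \<i>) * (gconst (gwitt j) * d_gzc j (F x)) =
          sscal (2 * \<i>) * (gconst (gwitt j) * (sscal (1 / 2) * gderiv_left (XV (2 * j - 1)) (F x)))
        + sscal (2 * \<i>) * (gconst (gwitt j) * (sscal (\<i> / 2) * gderiv_left (XV (2 * j)) (F x)))"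
        unfolding d_gzc_def distrib_left sscal_left_commute[of "gconst (gwitt j)"]
        by (simp only: mult.assoc[symmetric] sscal_simps(4)[symmetric]) (simp add: sscal_simps)
      then show "sscal (2 * \<i>) * (gconst (gwitt j) * d_gzc j (F x)) =
          - (gconst (bZd (2 * j - 1)) * gderiv_left (XV (2 * j - 1)) (F x) + gconst (bZd (2 * j)) * gderiv_left (XV (2 * j)) (F x))"
        unfolding c bZd_def b[OF j] by (simp add: cscal_simps(2) cscal_minus gconst_minus)
    qed
    show "dirac_Zdag n F x = dop n aZd bZd F x" unfolding dirac_Zdag_def dop_def 1 2 by simp
  qed
qed

lemma dop_cong:
  assumes "open S" "x \<in> S" "sf S F" "\<And>x. x \<in> S \<Longrightarrow> F x = G x"
  shows "dop n a b F x = dop n a b G x"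
  unfolding dop_def using super_pdiff_cong[OF assms] assms(2,4) by simp

lemma sf_super_pdiff: assumes S: "open S" and F: "sf S F" shows "sf S (super_pdiff i F)"
proof -
  obtain fs where fs: "smooth_rep S F fs" using F sf_def by blast
  have "sf S (\<lambda>x. \<Sum>(f, c)\<leftarrow>fs. sscal (pdiff i f x) * c)"
    using fs
  proof (induction fs arbitrary: F)
    case (Cons p fs)
    obtain f c where p: "p = (f, c)" by fastforce
    show ?case using Cons.prems Cons.IH unfolding p smooth_rep_Cons
      by (auto intro!: sf_step pdiff_smooth_on)
  qed (simp add: sf_zero)
  then show ?thesis by (rule sf_cong) (simp add: super_pdiff_rep[OF S _ fs])
qed

lemma sf_dop: "open S \<Longrightarrow> sf S F \<Longrightarrow> sf S (dop n a b F)"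
  unfolding dop_def[abs_def]
  by (intro sf_add sf_sum sf_mult sf_const sf_super_pdiff sf_clin_op[OF clin_op_gderiv_left])

lemma sf_rop: "open S \<Longrightarrow> sf S F \<Longrightarrow> sf S (rop n a b F)"
  unfolding rop_def[abs_def]
  by (intro sf_add sf_sum sf_mult sf_const sf_super_pdiff sf_clin_op[OF clin_op_gderiv_left] sf_clin_op[OF clin_op_ginv])

text \<open>Evenness removes the grading sign in the odd directions; centrality lets
  \<open>T x\<close> pass the Clifford coefficients of the operator.\<close>

lemma dop_leibniz:
  assumes S: "open S" "x \<in> S" and T: "sf S T" and G: "sf S G"
    and central: "\<And>v. T x * v = v * T x" and even: "ginv (T x) = T x"
  shows "dop n a b (\<lambda>x. T x * G x) x = dop n a b T x * G x + T x * dop n a b G x"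
proof -
  have "gconst w * (T x * Q) = T x * (gconst w * Q)" for w Q
    by (simp only: mult.assoc[symmetric] central[of "gconst w", symmetric])
  then show ?thesis
    unfolding dop_def super_pdiff_mult[OF S T G] gderiv_left_mult even
    by (simp only: sum.distrib sum_distrib_left sum_distrib_right distrib_left distrib_right mult.assoc add_ac)
qed

lemma integrable_compact_smooth:
  assumes "smooth_on UNIV f" "compact C" "\<And>x. x \<notin> C \<Longrightarrow> f x = 0"
  shows "integrable lborel (f :: 'a::euclidean_space \<Rightarrow> complex)"
  by (rule test_function_integrable[OF smooth_on_continuous[OF assms(1)] assms(2,3)])

lemma integral_pdiff_zero:
  fixes f :: "'m::finite point \<Rightarrow> complex"
  assumes "smooth_on UNIV f" "compact C" "\<And>x. x \<notin> C \<Longrightarrow> f x = 0"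
  shows "(LINT x|lborel. pdiff i f x) = 0"
  unfolding pdiff_def
  by (rule integral_directional_derivative_zero[OF _ _ assms(2,3)])
     (use smooth_on_has_derivative[OF assms(1)] smooth_on_continuous[OF pdiff_smooth_on[OF assms(1)]] in
       \<open>auto simp: pdiff_def[abs_def]\<close>)

text \<open>The sum of the two integrands is a total derivative. Its even part integrates to zero by
  compact support, and its odd part is annihilated by the Berezin integral.\<close>

lemma dop_by_parts:
  fixes P F :: "'m::finite point \<Rightarrow> 'm clifford grass"
  assumes P: "sf UNIV P" and F: "sf UNIV F" and C: "compact C" "\<And>x. x \<notin> C \<Longrightarrow> F x = 0" and L: "clin L"
  shows "(LINT x|lborel. L (berezin n (P x * dop n a b F x))) = - (LINT x|lborel. L (berezin n (rop n a b P x * F x)))"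
proof -
  let ?G = "\<lambda>i x. P x * (gconst (a i) * F x)"
  \<comment> \<open>With \<open>ginv (P x)\<close> the graded Leibniz rule returns
    \<open>P x\<close> itself in front of the derivative of \<open>F x\<close>; this is the origin
    of \<open>ginv\<close> in \<open>rop\<close>.\<close>
  let ?H = "\<lambda>k x. ginv (P x) * (gconst (b k) * F x)"
  let ?B = "\<lambda>v. L (berezin n v)"
  have B: "clin ?B" by (rule clin_comp[OF L clin_op_berezin])
  have aF: "sf UNIV (\<lambda>x. gconst (a i) * F x)" for i by (rule sf_clin_op[OF clin_op_left F])
  have G: "sf UNIV (?G i)" for i by (rule sf_mult[OF open_UNIV P aF])
  have pG: "super_pdiff i (?G i) x = super_pdiff i P x * gconst (a i) * F x + P x * (gconst (a i) * super_pdiff i F x)" for i x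
    using super_pdiff_mult[OF open_UNIV UNIV_I P aF] super_pdiff_clin_op[OF open_UNIV UNIV_I F clin_op_left]
    by (simp add: mult.assoc)
  have pH: "gderiv_left (XV k) (?H k x) = gderiv_left (XV k) (ginv (P x)) * gconst (b k) * F x
      + P x * (gconst (b k) * gderiv_left (XV k) (F x))" for k x
    by (simp add: gderiv_left_mult gderiv_left_const mult.assoc)
  have "P x * dop n a b F x + rop n a b P x * F x =
      (\<Sum>i\<in>UNIV. super_pdiff i (?G i) x) + (\<Sum>k\<in>{1..2 * n}. gderiv_left (XV k) (?H k x))" for x
    unfolding pG pH dop_def rop_def
    by (simp only: sum.distrib sum_distrib_left sum_distrib_right distrib_left distrib_right add_ac mult.assoc)
  then have "?B (P x * dop n a b F x) + ?B (rop n a b P x * F x) = (\<Sum>i\<in>UNIV. ?B (super_pdiff i (?G i) x))" for x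
    by (simp add: clin_add[OF B, symmetric]) (simp add: clin_add[OF B] clin_sum[OF B] berezin_gderiv clin_zero[OF L])
  also have "(\<Sum>i\<in>UNIV. ?B (super_pdiff i (?G i) x)) = (\<Sum>i\<in>UNIV. pdiff i (\<lambda>x. ?B (?G i x)) x)" for x
    by (intro sum.cong refl clin_super_pdiff[OF open_UNIV UNIV_I G B])
  finally have pt: "?B (P x * dop n a b F x) + ?B (rop n a b P x * F x) = (\<Sum>i\<in>UNIV. pdiff i (\<lambda>x. ?B (?G i x)) x)" for x .
  have Gs: "smooth_on UNIV (\<lambda>x. ?B (?G i x))" for i by (rule clin_smooth[OF open_UNIV B G])
  have Gz: "?B (?G i x) = 0" if "x \<notin> C" for i x using C(2)[OF that] clin_zero[OF B] by simp
  have pz: "pdiff i (\<lambda>x. ?B (?G i x)) x = 0" if "x \<notin> C" for i x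
    using pdiff_cong[of "- C" x "\<lambda>x. ?B (?G i x)" "\<lambda>x. 0" i] that Gz C(1)
    by (simp add: pdiff_const compact_imp_closed open_Compl)
  have ip: "integrable lborel (\<lambda>x. pdiff i (\<lambda>x. ?B (?G i x)) x)" for i
    by (rule integrable_compact_smooth[OF pdiff_smooth_on[OF Gs] C(1) pz])
  have dz: "dop n a b F x = 0" if "x \<notin> C" for x
    using dop_cong[of "- C" x F "\<lambda>x. 0" n a b] that C sf_subset[OF open_UNIV _ _ F, of "- C"]
    by (simp add: compact_imp_closed open_Compl) (simp add: dop_def super_pdiff_const)
  have i1: "integrable lborel (\<lambda>x. ?B (P x * dop n a b F x))"
    by (rule integrable_compact_smooth[OF clin_smooth[OF open_UNIV B sf_mult[OF open_UNIV P sf_dop[OF open_UNIV F]]] C(1)])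
       (simp add: dz clin_zero[OF B])
  have i2: "integrable lborel (\<lambda>x. ?B (rop n a b P x * F x))"
    by (rule integrable_compact_smooth[OF clin_smooth[OF open_UNIV B sf_mult[OF open_UNIV sf_rop[OF open_UNIV P] F]] C(1)])
       (simp add: C(2) clin_zero[OF B])
  have "(LINT x|lborel. ?B (P x * dop n a b F x)) + (LINT x|lborel. ?B (rop n a b P x * F x)) =
      (LINT x|lborel. (\<Sum>i\<in>UNIV. pdiff i (\<lambda>x. ?B (?G i x)) x))"
    using i1 i2 pt by (subst Bochner_Integration.integral_add[symmetric]) auto
  also have "\<dots> = 0"
    using ip integral_pdiff_zero[OF Gs C(1) Gz] by (subst Bochner_Integration.integral_sum) auto
  finally show ?thesis by (simp add: add_eq_0_iff2)
qed

subsection \<open>The chain rule\<close>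

lemma grass_even_central:
  fixes a F :: "complex grass" assumes "ginv a = a" shows "a * F = F * a"
proof (induction F rule: grass_induct)
  case (const c)
  show ?case by (rule grass_eqI') (simp add: mult.commute)
next
  case (add F G)
  then show ?case by (simp add: distrib_left distrib_right)
next
  case (gvar v F)
  have e: "a * gvar v = gvar v * a" unfolding gvar_ginv_commute[of v a] assms ..
  have "a * (gvar v * F) = gvar v * (a * F)" by (simp only: mult.assoc[symmetric] e)
  then show ?case by (simp only: gvar mult.assoc)
qed

lemma grass_odd_commute:
  fixes a F :: "complex grass" assumes "ginv a = - a" shows "a * F = ginv F * a"
proof (induction F rule: grass_induct)
  case (const c)
  show ?case unfolding ginv_simps by (rule grass_eqI') (simp add: mult.commute)
next
  case (add F G)
  then show ?case by (simp add: distrib_left distrib_right)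
next
  case (gvar v F)
  have e: "a * gvar v = - (gvar v * a)" using gvar_ginv_commute[of v a] assms by simp
  have "a * (gvar v * F) = - (gvar v * (a * F))" by (simp add: mult.assoc[symmetric] e)
  then show ?case by (simp add: gvar mult.assoc)
qed

lemma grass_odd_anticommute:
  fixes a b :: "complex grass" assumes "ginv a = - a" "ginv b = - b" shows "a * b = - (b * a)"
  using grass_odd_commute[OF assms(1), of b] assms(2) by simp

lemma gembed_expand:
  assumes "\<And>A. gcoeff s A \<noteq> 0 \<Longrightarrow> A \<subseteq> V" "finite V"
  shows "(gembed s :: 'm::finite clifford grass) = (\<Sum>A\<in>Pow V. sscal (gcoeff s A) * gmono A)"
proof (rule grass_eqI')
  fix A
  have "(\<Sum>B\<in>Pow V. gcoeff (sscal (gcoeff s B) * gmono B) A) =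
      (\<Sum>B\<in>Pow V. if B = A then cscal (gcoeff s A) else (0 :: 'm clifford))"
    by (rule sum.cong[OF refl]) (auto simp: gmono.rep_eq gcoeff_infinite cscal_simps(1))
  also have "\<dots> = cscal (gcoeff s A)" using assms(1)[of A] assms(2)
    by (cases "gcoeff s A = 0") (auto simp: sum.delta cscal_simps(1))
  finally show "gcoeff (gembed s) A = gcoeff (\<Sum>A\<in>Pow V. sscal (gcoeff s A) * gmono A :: 'm clifford grass) A"
    by (simp only: gcoeff_sum gcoeff_gembed)
qed

lemma sf_gembed:
  assumes "finite V" "\<And>A. smooth_on S (\<lambda>x. gcoeff (g x) A)" "\<And>x A. gcoeff (g x) A \<noteq> 0 \<Longrightarrow> A \<subseteq> V"
  shows "sf S (\<lambda>x. gembed (g x))"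
proof (rule sf_cong)
  show "sf S (\<lambda>x. \<Sum>A\<in>Pow V. sscal (gcoeff (g x) A) * gmono A)"
    by (intro sf_sum sf_scal assms(2))
  show "(\<Sum>A\<in>Pow V. sscal (gcoeff (g x) A) * gmono A) = gembed (g x)" for x
    by (rule gembed_expand[OF assms(3,1), symmetric])
qed

text \<open>The common computation behind the chain rule for both kinds of derivatives.\<close>

lemma chain_rule_sum:
  fixes N D :: "'m::finite clifford grass"
  assumes "N ^ n * D = 0"
  shows "(\<Sum>j\<le>n. sscal (t (Suc j) * d / fact j) * N ^ j + sscal (t j / fact j) * (of_nat j * N ^ (j - 1) * D))
    = (\<Sum>j\<le>n. sscal (t (Suc j) / fact j) * N ^ j) * (sscal d + D)"
proof -
  have 1: "(\<Sum>j\<le>n. sscal (t (Suc j) * d / fact j) * N ^ j) = (\<Sum>j\<le>n. sscal (t (Suc j) / fact j) * N ^ j) * sscal d"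
    unfolding sum_distrib_right
  proof (rule sum.cong[OF refl])
    fix j
    have "t (Suc j) * d / fact j = t (Suc j) / fact j * d" by simp
    then show "sscal (t (Suc j) * d / fact j) * N ^ j = sscal (t (Suc j) / fact j) * N ^ j * sscal d"
      by (simp only: sscal_simps(4) mult.assoc sscal_commute[of d "N ^ j"])
  qed
  have "(\<Sum>j\<le>n. sscal (t j / fact j) * (of_nat j * N ^ (j - 1) * D)) =
      (\<Sum>j<n. sscal (t (Suc j) / fact (Suc j)) * (of_nat (Suc j) * N ^ j * D))"
    by (subst sum.atMost_shift) simp
  also have "\<dots> = (\<Sum>j<n. sscal (t (Suc j) / fact j) * N ^ j * D)"
  proof (rule sum.cong[OF refl])
    fix j
    have "sscal (of_nat k) = (of_nat k :: 'm clifford grass)" for k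
      by (induction k) (simp_all add: sscal_simps)
    then have "sscal (t (Suc j) / fact (Suc j)) * (of_nat (Suc j) * N ^ j * D) =
        sscal (t (Suc j) / fact (Suc j)) * sscal (of_nat (Suc j)) * (N ^ j * D)"
      by (simp only: mult.assoc)
    also have "sscal (t (Suc j) / fact (Suc j)) * sscal (of_nat (Suc j)) = (sscal (t (Suc j) / fact j) :: 'm clifford grass)"
      unfolding sscal_simps(4)[symmetric]
      by (rule arg_cong[where f = sscal]) (simp add: field_simps del: of_nat_Suc)
    finally show "sscal (t (Suc j) / fact (Suc j)) * (of_nat (Suc j) * N ^ j * D) = sscal (t (Suc j) / fact j) * N ^ j * D"
      by (simp only: mult.assoc)
  qed
  also have "\<dots> = (\<Sum>j\<le>n. sscal (t (Suc j) / fact j) * N ^ j * D)"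
    using assms by (simp add: lessThan_Suc_atMost[symmetric] mult.assoc)
  finally show ?thesis
    unfolding sum.distrib 1 distrib_left by (simp only: sum_distrib_right)
qed

lemma of_nat_sscal: "(of_nat k :: 'm::finite clifford grass) = sscal (of_nat k)"
  by (induction k) (simp_all add: sscal_simps)

lemma sscal_cancel: "sscal c * v = 0 \<Longrightarrow> c \<noteq> 0 \<Longrightarrow> v = (0 :: 'm::finite clifford grass)"
proof -
  assume *: "sscal c * v = 0" "c \<noteq> 0"
  then have "sscal (1 / c) * (sscal c * v) = 0" by simp
  then show "v = 0" using *(2) by (simp add: mult.assoc[symmetric] sscal_simps(4)[symmetric] sscal_simps(2) del: mult.assoc)
qed

lemma gderiv_power_central:
  assumes "\<And>v. N * v = v * N" "ginv N = N"
  shows "gderiv_left v (N ^ Suc j) = of_nat (Suc j) * N ^ j * gderiv_left v N"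
proof (induction j)
  case (Suc j)
  have "gderiv_left v (N ^ Suc (Suc j)) = gderiv_left v N * N ^ Suc j + N * gderiv_left v (N ^ Suc j)"
    by (simp add: gderiv_left_mult assms(2))
  also have "gderiv_left v N * N ^ Suc j = N ^ Suc j * gderiv_left v N"
    using power_commuting_commutes[of N "gderiv_left v N" "Suc j"] assms(1) by simp
  also have "N * gderiv_left v (N ^ Suc j) = of_nat (Suc j) * N ^ Suc j * gderiv_left v N"
  proof -
    have "N * of_nat (Suc j) = of_nat (Suc j) * N" by (rule mult_of_nat_commute[symmetric])
    then show ?thesis unfolding Suc by (simp only: power_Suc mult.assoc[symmetric])
  qed
  finally show ?case by (simp add: algebra_simps)
qed simp

lemma super_pdiff_power_central:
  assumes S: "open S" "x \<in> S" and N: "sf S N" and c: "\<And>x v. N x * v = v * N x"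
  shows "super_pdiff i (\<lambda>x. N x ^ Suc j) x = of_nat (Suc j) * N x ^ j * super_pdiff i N x"
proof (induction j)
  case (Suc j)
  have "super_pdiff i (\<lambda>x. N x ^ Suc (Suc j)) x = super_pdiff i N x * N x ^ Suc j + N x * super_pdiff i (\<lambda>x. N x ^ Suc j) x"
    using super_pdiff_mult[OF S N sf_power[OF S(1) N, of "Suc j"]] by simp
  also have "super_pdiff i N x * N x ^ Suc j = N x ^ Suc j * super_pdiff i N x"
    using power_commuting_commutes[of "N x" "super_pdiff i N x" "Suc j"] c by simp
  also have "N x * super_pdiff i (\<lambda>x. N x ^ Suc j) x = of_nat (Suc j) * N x ^ Suc j * super_pdiff i N x"
  proof -
    have "N x * of_nat (Suc j) = of_nat (Suc j) * N x" by (rule mult_of_nat_commute[symmetric])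
    then show ?thesis unfolding Suc by (simp only: power_Suc mult.assoc[symmetric])
  qed
  finally show ?case by (simp add: algebra_simps)
qed simp

lemma gcoeff_split: "complex_of_real (gbody a) = gcoeff a {} \<Longrightarrow> a = gconst (complex_of_real (gbody a)) + gnil a"
  by (simp add: gnil_def)

lemma gembed_gcomp:
  "gembed (gcomp n th a) = (\<Sum>j\<le>n. sscal (th j (gbody a) / fact j) * gembed (gnil a) ^ j)"
  unfolding gcomp_def gembed_sum by simp

text \<open>Nilpotency is a separate assumption because \<open>V\<close> does not determine its
  order: for the squared norm of the difference, \<open>V\<close> consists of \<open>4 * n\<close>
  variables, the \<open>YV\<close> included, although the power \<open>n + 1\<close> of the
  nilpotent part already vanishes.\<close>

locale even_superfunction =
  fixes S :: "'m::finite point set" and g :: "'m point \<Rightarrow> complex grass" and V :: "gvar set" and n :: nat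
  assumes S: "open S" and V: "finite V" and g_smooth: "\<And>A. smooth_on S (\<lambda>x. gcoeff (g x) A)"
    and g_supp: "\<And>x A. gcoeff (g x) A \<noteq> 0 \<Longrightarrow> A \<subseteq> V"
    and g_even: "\<And>x. ginv (g x) = g x" and g_real: "\<And>x. complex_of_real (gbody (g x)) = gcoeff (g x) {}"
    and g_nil: "\<And>x. gnil (g x) ^ Suc n = 0"
begin

lemma body_smooth: "smooth_on S (\<lambda>x. gbody (g x))"
  unfolding gbody_def by (rule smooth_on_Re[OF S g_smooth])

lemma sf_g: "sf S (\<lambda>x. gembed (g x))"
  by (rule sf_gembed[OF V g_smooth g_supp])

lemma sf_nil: "sf S (\<lambda>x. gembed (gnil (g x)))"
  by (rule sf_gembed[OF V smooth_gcoeff_gnil[OF g_smooth]]) (use g_supp in \<open>auto simp: gcoeff_gnil split: if_splits\<close>)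

lemma nil_central: "gembed (gnil (g x)) * v = v * gembed (gnil (g x))"
  by (rule gembed_even_central[OF ginv_gnil[OF g_even]])

lemma gcomp_central: "gembed (gcomp n th (g x)) * v = v * gembed (gcomp n th (g x))"
  by (rule gembed_even_central[OF ginv_gcomp[OF g_even]])

lemma sf_gcomp:
  assumes "\<And>j. smooth_on S (\<lambda>x. th j (gbody (g x)))"
  shows "sf S (\<lambda>x. gembed (gcomp n th (g x)) :: 'm clifford grass)"
  by (rule sf_gembed[OF V gcomp_smooth[OF S g_smooth assms]]) (rule gcomp_support[OF g_supp])

text \<open>A truncated Taylor sum loses its top term under differentiation. The missing term is a
  multiple of \<open>?N ^ n * ?D\<close>, which is zero: differentiate the vanishing power
  \<open>Suc n\<close> of \<open>?N\<close> and divide by \<open>n + 1\<close>.\<close>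

lemma gderiv_gcomp:
  "gderiv_left v (gembed (gcomp n th (g x))) =
   (gembed (gcomp n (\<lambda>j. th (Suc j)) (g x)) * gderiv_left v (gembed (g x)) :: 'm clifford grass)"
proof -
  let ?N = "gembed (gnil (g x)) :: 'm clifford grass"
  let ?D = "gderiv_left v ?N"
  have even: "ginv ?N = ?N" by (simp add: ginv_gembed ginv_gnil[OF g_even])
  note P = gderiv_power_central[OF nil_central even, of v]
  have "of_nat (Suc n) * ?N ^ n * ?D = gderiv_left v (gembed (gnil (g x) ^ Suc n))"
    unfolding P[symmetric] gembed_power ..
  also have "\<dots> = 0" unfolding g_nil by simp
  finally have "sscal (of_nat (Suc n)) * (?N ^ n * ?D) = 0" by (simp only: of_nat_sscal mult.assoc)
  then have z: "?N ^ n * ?D = 0" by (rule sscal_cancel) (rule of_nat_neq_0)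
  have D: "gderiv_left v (gembed (g x)) = sscal 0 + ?D"
    by (subst gcoeff_split[OF g_real]) (simp add: gderiv_left_const sscal_simps)
  have Pj: "gderiv_left v (?N ^ j) = of_nat j * ?N ^ (j - 1) * ?D" for j
    using P by (cases j) auto
  have "gderiv_left v (gembed (gcomp n th (g x))) =
     (\<Sum>j\<le>n. sscal (th (Suc j) (gbody (g x)) * 0 / fact j) * ?N ^ j
        + sscal (th j (gbody (g x)) / fact j) * (of_nat j * ?N ^ (j - 1) * ?D))"
    unfolding gembed_gcomp gderiv_left_sum gderiv_left_gconst_times Pj by (simp add: sscal_simps)
  also have "\<dots> = gembed (gcomp n (\<lambda>j. th (Suc j)) (g x)) * gderiv_left v (gembed (g x))"
    unfolding gembed_gcomp D by (rule chain_rule_sum[OF z, where t = "\<lambda>j. th j (gbody (g x))"])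
  finally show ?thesis .
qed

text \<open>As for the odd derivatives, the truncation is harmless. Here the body depends on x as
  well, so the scalar term of the chain rule is present too.\<close>

lemma super_pdiff_gcomp:
  assumes x: "x \<in> S" and th: "\<And>j. smooth_on S (\<lambda>x. th j (gbody (g x)))"
    and d: "\<And>j. (th j has_vector_derivative th (Suc j) (gbody (g x))) (at (gbody (g x)))"
  shows "super_pdiff i (\<lambda>x. gembed (gcomp n th (g x))) x =
   (gembed (gcomp n (\<lambda>j. th (Suc j)) (g x)) * super_pdiff i (\<lambda>x. gembed (g x)) x :: 'm clifford grass)"
proof -
  let ?N = "\<lambda>x. gembed (gnil (g x)) :: 'm clifford grass" and ?u = "\<lambda>x. gbody (g x)"
  let ?D = "super_pdiff i ?N x"
  let ?d = "pdiff i (\<lambda>x. complex_of_real (?u x)) x"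
  note P = super_pdiff_power_central[OF S x sf_nil nil_central]
  have "of_nat (Suc n) * ?N x ^ n * ?D = super_pdiff i (\<lambda>x. gembed (gnil (g x) ^ Suc n)) x"
    unfolding P[symmetric] gembed_power ..
  also have "\<dots> = 0" unfolding g_nil by (simp add: super_pdiff_const)
  finally have "sscal (of_nat (Suc n)) * (?N x ^ n * ?D) = 0" by (simp only: of_nat_sscal mult.assoc)
  then have z: "?N x ^ n * ?D = 0" by (rule sscal_cancel) (rule of_nat_neq_0)
  have us: "smooth_on S (\<lambda>x. complex_of_real (?u x))" by (intro smooth_on_of_real S body_smooth)
  have "(\<lambda>x. gembed (g x)) = (\<lambda>x. sscal (complex_of_real (?u x)) * 1 + ?N x)"
    by (rule ext, subst gcoeff_split[OF g_real]) simp
  then have D: "super_pdiff i (\<lambda>x. gembed (g x)) x = sscal ?d + ?D"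
    using super_pdiff_add[OF S x sf_scal[OF us, of 1] sf_nil] super_pdiff_smult[OF S x us sf_const[of S 1]]
    by (simp add: super_pdiff_const)
  have Pj: "super_pdiff i (\<lambda>x. ?N x ^ j) x = of_nat j * ?N x ^ (j - 1) * ?D" for j
    using P by (cases j) (auto simp: super_pdiff_const)
  have Nj: "sf S (\<lambda>x. ?N x ^ j)" for j by (rule sf_power[OF S sf_nil])
  have ts: "smooth_on S (\<lambda>x. th j (?u x) / fact j)" for j
    using smooth_on_mult[OF S th[of j] smooth_on_const[of S "1 / fact j"]] by simp
  have pd: "pdiff i (\<lambda>x. th j (?u x) / fact j) x = th (Suc j) (?u x) * ?d / fact j" for j
  proof -
    have du: "(?u has_derivative frechet_derivative ?u (at x)) (at x)"
      by (rule smooth_on_has_derivative[OF body_smooth S x])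
    have "((\<lambda>x. th j (?u x)) has_derivative (\<lambda>b. frechet_derivative ?u (at x) b *\<^sub>R th (Suc j) (?u x))) (at x)"
      by (rule has_derivative_compose[OF du d[unfolded has_vector_derivative_def]])
    from pdiffI[OF has_derivative_mult_left[OF this, of "1 / fact j"]]
    have "pdiff i (\<lambda>x. th j (?u x) / fact j) x = frechet_derivative ?u (at x) (axis i 1) *\<^sub>R th (Suc j) (?u x) / fact j"
      by simp
    moreover have "?d = complex_of_real (frechet_derivative ?u (at x) (axis i 1))"
      by (rule pdiffI[OF has_derivative_of_real[OF du]])
    ultimately show ?thesis by (simp add: scaleR_conv_of_real mult.commute)
  qed
  have sum: "super_pdiff i (\<lambda>x. \<Sum>j\<in>J. F j x) x = (\<Sum>j\<in>J. super_pdiff i (F j) x)"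
    if "finite J" "\<And>j. sf S (F j)" for J :: "nat set" and F
    using that(1)
  proof (induction J rule: finite_induct)
    case (insert j J)
    show ?case unfolding sum.insert[OF insert(1,2)] insert(3)[symmetric]
      by (rule super_pdiff_add[OF S x that(2) sf_sum[OF that(2)]])
  qed (simp add: super_pdiff_const)
  have "super_pdiff i (\<lambda>x. gembed (gcomp n th (g x))) x =
     (\<Sum>j\<le>n. sscal (th (Suc j) (?u x) * ?d / fact j) * ?N x ^ j
        + sscal (th j (?u x) / fact j) * (of_nat j * ?N x ^ (j - 1) * ?D))"
    unfolding gembed_gcomp sum[OF finite_atMost sf_smult[OF S ts Nj]] super_pdiff_smult[OF S x ts Nj] pd Pj ..
  also have "\<dots> = gembed (gcomp n (\<lambda>j. th (Suc j)) (g x)) * super_pdiff i (\<lambda>x. gembed (g x)) x"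
    unfolding gembed_gcomp D by (rule chain_rule_sum[OF z, where t = "\<lambda>j. th j (gbody (g x))"])
  finally show ?thesis .
qed

lemma dop_gcomp:
  assumes x: "x \<in> S" and th: "\<And>j. smooth_on S (\<lambda>x. th j (gbody (g x)))"
    and d: "\<And>j. (th j has_vector_derivative th (Suc j) (gbody (g x))) (at (gbody (g x)))"
  shows "dop k a b (\<lambda>x. gembed (gcomp n th (g x))) x =
   (gembed (gcomp n (\<lambda>j. th (Suc j)) (g x)) * dop k a b (\<lambda>x. gembed (g x)) x :: 'm clifford grass)"
proof -
  let ?E = "gembed (gcomp n (\<lambda>j. th (Suc j)) (g x)) :: 'm clifford grass"
  have "gconst w * (?E * v) = ?E * (gconst w * v)" for w v
    by (simp only: mult.assoc[symmetric] gcomp_central[of _ _ "gconst w"])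
  then show ?thesis
    unfolding dop_def super_pdiff_gcomp[where th = th, OF x th d] gderiv_gcomp
    by (simp only: distrib_left sum_distrib_left)
qed

end

subsection \<open>Powers of the squared norm\<close>

text \<open>The derivative of order \<open>j\<close> of the real power with exponent
  \<open>p\<close>, so that \<open>super_powr\<close> becomes an instance of \<open>gcomp\<close>
  and obeys its chain rule.\<close>

definition pw :: "real \<Rightarrow> nat \<Rightarrow> real \<Rightarrow> complex" where
  "pw p j s = complex_of_real ((\<Prod>i<j. p - real i) * s powr (p - real j))"

lemma super_powr_gcomp: "super_powr n a p = gcomp n (pw p) a"
  unfolding super_powr_def gcomp_def pw_def by (simp add: divide_inverse mult_ac)

lemma pw_Suc: "pw p (Suc j) s = complex_of_real p * pw (p - 1) j s"
proof -
  have "(\<Prod>i<Suc j. p - real i) = p * (\<Prod>i<j. (p - 1) - real i)"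
    by (subst prod.lessThan_Suc_shift) (simp add: algebra_simps)
  then show ?thesis by (simp add: pw_def algebra_simps)
qed

lemma pw_has_derivative: "s > 0 \<Longrightarrow> (pw p j has_vector_derivative pw p (Suc j) s) (at s)"
proof -
  assume s: "s > 0"
  have "((\<lambda>s. (\<Prod>i<j. p - real i) * s powr (p - real j)) has_real_derivative
      (\<Prod>i<j. p - real i) * ((p - real j) * s powr (p - real j - 1))) (at s)"
    by (rule DERIV_cmult[OF has_real_derivative_powr[OF s]])
  then have "((\<lambda>s. complex_of_real ((\<Prod>i<j. p - real i) * s powr (p - real j))) has_vector_derivative
      complex_of_real ((\<Prod>i<j. p - real i) * ((p - real j) * s powr (p - real j - 1)))) (at s)"
    by (rule has_vector_derivative_of_real)
  moreover have "complex_of_real ((\<Prod>i<j. p - real i) * ((p - real j) * s powr (p - real j - 1))) = pw p (Suc j) s"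
    by (simp add: pw_def mult.assoc diff_diff_eq add.commute)
  moreover have "pw p j = (\<lambda>s. complex_of_real ((\<Prod>i<j. p - real i) * s powr (p - real j)))"
    by (rule ext) (rule pw_def)
  ultimately show ?thesis by (simp only:)
qed

lemma pw_smooth: "smooth_on {0<..} (pw p j)"
  unfolding pw_def[abs_def]
  by (intro smooth_on_of_real smooth_on_mult smooth_on_const smooth_on_powr) auto

lemma gcomp_cmult: "gcomp n (\<lambda>j s. c * th j s) a = gconst c * gcomp n th a"
  unfolding gcomp_def sum_distrib_left
  by (rule sum.cong[OF refl]) (simp add: mult.assoc[symmetric] gconst_mult[symmetric])

lemma pw_gbinomial: "pw p j s / fact j = complex_of_real ((p gchoose j) * s powr (p - real j))"
proof -
  have "(p gchoose j) = (\<Prod>i<j. p - real i) / fact j"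
    by (simp add: gbinomial_prod_rev atLeast0LessThan)
  then show ?thesis by (simp add: pw_def)
qed

text \<open>Multiplication by body plus nilpotent part shifts the binomial expansion; Pascal's rule
  \<open>gbinomial_Suc_Suc\<close> collects the coefficients, and the surplus term of degree
  \<open>n + 1\<close> is zero.\<close>

lemma gcomp_pw_mult:
  assumes a: "gbody a > 0" "complex_of_real (gbody a) = gcoeff a {}" "gnil a ^ Suc n = 0"
  shows "gcomp n (pw p) a = a * gcomp n (pw (p - 1)) a"
proof -
  let ?s = "gbody a" and ?N = "gnil a" and ?d = "\<lambda>j. (p - 1) gchoose j"
  let ?e = "\<lambda>j. complex_of_real (?d j * ?s powr (p - 1 - real j))"
  have "a * gcomp n (pw (p - 1)) a = (gconst (complex_of_real ?s) + ?N) * (\<Sum>j\<le>n. gconst (?e j) * ?N ^ j)"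
    unfolding gcomp_def pw_gbinomial using gcoeff_split[OF a(2)] by simp
  also have "\<dots> = (\<Sum>j\<le>n. gconst (complex_of_real ?s * ?e j) * ?N ^ j) + (\<Sum>j\<le>n. gconst (?e j) * ?N ^ Suc j)"
  proof -
    have "?N * (gconst c * X) = gconst c * (?N * X)" for c X
    proof -
      have "?N * gconst c = gconst c * ?N" by (rule grass_eqI') (simp add: mult.commute)
      then show ?thesis by (metis mult.assoc)
    qed
    then show ?thesis
      unfolding distrib_right sum_distrib_left power_Suc by (simp only: mult.assoc[symmetric] gconst_mult sum.distrib)
  qed
  also have "(\<Sum>j\<le>n. gconst (?e j) * ?N ^ Suc j) = (\<Sum>j\<le>n. gconst (if j = 0 then 0 else ?e (j - 1)) * ?N ^ j)"
  proof -
    have "(\<Sum>j\<le>n. gconst (?e j) * ?N ^ Suc j) = (\<Sum>j\<le>Suc n. gconst (if j = 0 then 0 else ?e (j - 1)) * ?N ^ j)"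
      by (subst sum.atMost_Suc_shift) simp
    then show ?thesis using a(3) by simp
  qed
  also have "(\<Sum>j\<le>n. gconst (complex_of_real ?s * ?e j) * ?N ^ j) + \<dots> =
      (\<Sum>j\<le>n. gconst (complex_of_real ?s * ?e j + (if j = 0 then 0 else ?e (j - 1))) * ?N ^ j)"
    unfolding sum.distrib[symmetric] by (simp only: gconst_add distrib_right)
  also have "\<dots> = (\<Sum>j\<le>n. gconst (complex_of_real ((p gchoose j) * ?s powr (p - real j))) * ?N ^ j)"
  proof (rule sum.cong[OF refl], rule arg_cong[where f = "\<lambda>c. gconst c * _"])
    fix j
    have sp: "?s * ?s powr (p - 1 - real j) = ?s powr (p - real j)"
    proof -
      have "?s powr (p - real j) = ?s powr (1 + (p - 1 - real j))" by simp
      also have "\<dots> = ?s * ?s powr (p - 1 - real j)" using a(1) by (simp only: powr_add powr_one)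
      finally show ?thesis ..
    qed
    show "complex_of_real ?s * ?e j + (if j = 0 then 0 else ?e (j - 1)) =
        complex_of_real ((p gchoose j) * ?s powr (p - real j))"
    proof (cases j)
      case 0
      then show ?thesis using sp by (simp del: of_real_mult add: of_real_mult[symmetric])
    next
      case (Suc k)
      have e1: "complex_of_real ?s * ?e j = complex_of_real (?d j * ?s powr (p - real j))"
        by (simp only: sp[symmetric] of_real_mult mult_ac)
      have "p - 1 - real (j - 1) = p - real j" "?d (j - 1) = ?d k" using Suc by simp_all
      then have e2: "?e (j - 1) = complex_of_real (?d k * ?s powr (p - real j))" by (simp only:)
      have e3: "(p gchoose j) = ?d k + ?d j" using gbinomial_Suc_Suc[of "p - 1" k] Suc by simp
      have "(if j = 0 then 0 else ?e (j - 1)) = ?e (j - 1)" using Suc by simp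
      then show ?thesis by (simp only: e1 e2 e3 of_real_add[symmetric] distrib_right add.commute)
    qed
  qed
  also have "\<dots> = gcomp n (pw p) a" unfolding gcomp_def pw_gbinomial ..
  finally show ?thesis ..
qed

subsection \<open>The kernel\<close>

abbreviation thd :: "nat \<Rightarrow> complex grass" where "thd \<equiv> \<lambda>j. gvar (XV j) - gvar (YV j)"

text \<open>By \<open>Z_norm2_eq\<close> this is minus the nilpotent part of the squared norm of the
  difference.\<close>

definition tsum :: "nat \<Rightarrow> complex grass" where "tsum k = (\<Sum>j=1..k. thd (2 * j - 1) * thd (2 * j))"

lemma ginv_thd: "ginv (thd j) = - thd j" by simp

lemma thd_anticommute: "thd i * thd j = - (thd j * thd i)"
  by (rule grass_odd_anticommute) simp_all

lemma thd_square: "thd j * thd j = 0"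
proof -
  have "thd j * thd j = - (thd j * thd j)" by (rule thd_anticommute)
  then have "gcoeff (thd j * thd j) A = - gcoeff (thd j * thd j) A" for A by (metis gcoeff_simps(3))
  then show ?thesis by (intro grass_eqI') (simp add: eq_neg_iff_add_eq_0 del: add_uminus_conv_diff)
qed

lemma gcoeff_mult_empty: "gcoeff (a * b) {} = gcoeff a {} * gcoeff b {}"
  by (simp add: times_grass.rep_eq)

lemma tsum_props: "ginv (tsum k) = tsum k" "gcoeff (tsum k) {} = 0"
    "gcoeff (tsum k) A \<noteq> 0 \<Longrightarrow> A \<subseteq> xvars k \<union> YV ` {1..2 * k}"
proof -
  show "ginv (tsum k) = tsum k" unfolding tsum_def ginv_sum ginv_mult ginv_thd minus_mult_minus ..
  show "gcoeff (tsum k) {} = 0"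
    unfolding tsum_def gcoeff_sum gcoeff_mult_empty by (simp add: gmono.rep_eq)
  assume "gcoeff (tsum k) A \<noteq> 0"
  then obtain j where j: "j \<in> {1..k}" "gcoeff (thd (2 * j - 1) * thd (2 * j)) A \<noteq> 0"
    unfolding tsum_def gcoeff_sum by (meson sum.neutral)
  have t: "B \<subseteq> xvars k \<union> YV ` {1..2 * k}" if "gcoeff (thd i) B \<noteq> 0" "i \<in> {1..2 * k}" for i B
    using that by (auto simp: gmono.rep_eq split: if_splits)
  show "A \<subseteq> xvars k \<union> YV ` {1..2 * k}"
  proof -
    have "2 * j - 1 \<in> {1..2 * k}" "2 * j \<in> {1..2 * k}" using j(1) by auto
    then have "B \<subseteq> xvars k \<union> YV ` {1..2 * k}"
      if "gcoeff (thd (2 * j - 1)) B \<noteq> 0 \<or> gcoeff (thd (2 * j)) B \<noteq> 0" for B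
      using that t by blast
    then show ?thesis by (intro gcoeff_mult_support[OF _ _ j(2)]) blast+
  qed
qed

text \<open>Since \<open>t\<close> squares to zero, the binomial expansion stops after the linear
  term.\<close>

lemma power_add_square_zero:
  fixes a t :: "'r::ring_1" assumes "a * t = t * a" "t * t = 0"
  shows "(a + t) ^ Suc k = a ^ Suc k + of_nat (Suc k) * (a ^ k * t)"
proof (induction k)
  case (Suc k)
  have c: "a ^ Suc k * t = t * a ^ Suc k" by (rule power_commuting_commutes[OF assms(1)])
  have "t * (of_nat (Suc k) * (a ^ k * t)) = of_nat (Suc k) * (t * a ^ k * t)"
    by (metis mult.assoc mult_of_nat_commute)
  also have "t * a ^ k * t = 0"
    using power_commuting_commutes[OF assms(1), of k] assms(2) by (metis mult.assoc mult_zero_right)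
  finally have z: "t * (of_nat (Suc k) * (a ^ k * t)) = 0" by simp
  have "(a + t) ^ Suc (Suc k) = (a + t) * (a ^ Suc k + of_nat (Suc k) * (a ^ k * t))"
    using Suc by simp
  also have "\<dots> = a ^ Suc (Suc k) + a * (of_nat (Suc k) * (a ^ k * t)) + t * a ^ Suc k"
    unfolding distrib_left distrib_right z by (simp add: add_ac)
  also have "a * (of_nat (Suc k) * (a ^ k * t)) = of_nat (Suc k) * (a ^ Suc k * t)"
  proof -
    have "a * of_nat (Suc k) = of_nat (Suc k) * a" by (rule mult_of_nat_commute[symmetric])
    then show ?thesis by (simp only: mult.assoc[symmetric] power_Suc)
  qed
  finally show ?case unfolding c[symmetric] by (simp add: algebra_simps)
qed simp

definition tprod :: "nat \<Rightarrow> complex grass" where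
  "tprod k = prod_list (map thd [1..<Suc (2 * k)])"

lemma tprod_Suc: "tprod (Suc k) = tprod k * (thd (2 * Suc k - 1) * thd (2 * Suc k))"
  unfolding tprod_def by (simp add: mult.assoc)

text \<open>The pairs in \<open>tsum\<close> commute and square to zero, so only products of
  distinct pairs remain in a power of their sum. The product of all \<open>k\<close> pairs arises in
  \<open>fact k\<close> orders, and nothing is left in degree \<open>k + 1\<close>.\<close>

lemma tsum_power: "tsum k ^ k = of_nat (fact k) * tprod k" "tsum k ^ Suc k = 0"
proof (induction k)
  case 0
  show "tsum 0 ^ 0 = of_nat (fact 0) * tprod 0" by (simp add: tprod_def)
  show "tsum 0 ^ Suc 0 = 0" by (simp add: tsum_def)
next
  case (Suc k)
  let ?t = "thd (2 * Suc k - 1) * thd (2 * Suc k)"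
  have ts: "tsum (Suc k) = tsum k + ?t" unfolding tsum_def by simp
  have c: "tsum k * ?t = ?t * tsum k" by (rule grass_even_central[OF tsum_props(1)])
  have "?t * ?t = - (thd (2 * Suc k - 1) * (thd (2 * Suc k - 1) * thd (2 * Suc k)) * thd (2 * Suc k))"
    using thd_anticommute[of "2 * Suc k" "2 * Suc k - 1"] by (metis (no_types, lifting) mult.assoc mult_minus_left mult_minus_right)
  also have "\<dots> = 0" by (simp only: mult.assoc[symmetric] thd_square) simp
  finally have sq: "?t * ?t = 0" .
  show "tsum (Suc k) ^ Suc k = of_nat (fact (Suc k)) * tprod (Suc k)"
    unfolding ts power_add_square_zero[OF c sq] Suc tprod_Suc fact_Suc
    by (simp only: of_nat_mult of_nat_id mult.assoc add_0)
  show "tsum (Suc k) ^ Suc (Suc k) = 0"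
    unfolding ts power_add_square_zero[OF c sq] using Suc(2) by (simp add: mult.assoc)
qed

lemma norm_point: "(norm x)\<^sup>2 = (\<Sum>j\<in>UNIV. (x $ Inl j)\<^sup>2 + (x $ Inr j)\<^sup>2)" for x :: "'m::finite point"
  unfolding power2_norm_eq_inner inner_vec_def sum_Plus_UNIV by (simp add: power2_eq_square)

lemma gz_gzc: "gz_var j thd * gzc_var j thd = - (gconst (2 * \<i>) * (thd (2 * j - 1) * thd (2 * j)))"
proof -
  obtain a b where ab: "a = thd (2 * j - 1)" "b = thd (2 * j)" by blast
  have c: "w * (gconst \<i> * v) = gconst \<i> * (w * v)" for w v :: "complex grass"
  proof -
    have "w * gconst \<i> = gconst \<i> * w" by (rule grass_eqI') (simp add: mult.commute)
    then show ?thesis by (metis mult.assoc)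
  qed
  have sq: "a * a = 0" "b * b = 0" "b * a = - (a * b)"
    unfolding ab by (rule thd_square thd_anticommute)+
  have "gz_var j thd * gzc_var j thd = (a + gconst \<i> * b) * (a - gconst \<i> * b)"
    unfolding gz_var_def gzc_var_def ab ..
  also have "\<dots> = a * a - gconst \<i> * (a * b) + (gconst \<i> * (b * a) - gconst \<i> * (gconst \<i> * (b * b)))"
    by (simp only: distrib_right right_diff_distrib mult.assoc c[of a b] c[of b b])
       (simp only: add_diff_eq diff_add_eq diff_diff_add add.commute add.left_commute)
  also have "\<dots> = - (gconst \<i> * (a * b) + gconst \<i> * (a * b))" unfolding sq by simp
  also have "\<dots> = - (gconst (2 * \<i>) * (a * b))"
    unfolding distrib_right[symmetric] gconst_add[symmetric] by simp
  finally show ?thesis unfolding ab .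
qed

lemma Z_norm2_eq: "Z_norm2 n x thd = gconst (complex_of_real ((norm x)\<^sup>2)) - tsum n"
proof -
  have 1: "(\<Sum>j\<in>UNIV. z_var j x * zc_var j x) = complex_of_real ((norm x)\<^sup>2)"
    unfolding norm_point of_real_sum
    by (rule sum.cong[OF refl]) (simp add: z_var_def zc_var_def algebra_simps power2_eq_square)
  have "gconst (\<i> / 2) * (gz_var j thd * gzc_var j thd) = thd (2 * j - 1) * thd (2 * j)" for j
  proof -
    have "gconst (\<i> / 2) * (gz_var j thd * gzc_var j thd) = gconst (\<i> / 2 * - (2 * \<i>)) * (thd (2 * j - 1) * thd (2 * j))"
      unfolding gz_gzc gconst_mult gconst_minus by (simp add: mult.assoc)
    also have "\<i> / 2 * - (2 * \<i>) = (1 :: complex)" by simp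
    finally show ?thesis by simp
  qed
  then show ?thesis unfolding Z_norm2_def 1 tsum_def sum_distrib_left by simp
qed

lemma super_pdiff_sum:
  assumes S: "open S" "x \<in> S" and F: "\<And>j. j \<in> J \<Longrightarrow> sf S (F j)"
  shows "super_pdiff i (\<lambda>x. \<Sum>j\<in>J. F j x) x = (\<Sum>j\<in>J. super_pdiff i (F j) x)"
  using F
proof (induction J rule: infinite_finite_induct)
  case (insert j J)
  have "super_pdiff i (\<lambda>x. F j x + (\<Sum>j\<in>J. F j x)) x = super_pdiff i (F j) x + super_pdiff i (\<lambda>x. \<Sum>j\<in>J. F j x) x"
    by (rule super_pdiff_add[OF S]) (use insert.prems in \<open>auto intro: sf_sum\<close>)
  then show ?case unfolding sum.insert[OF insert(1,2)] using insert by simp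
qed (simp_all add: super_pdiff_const)

lemma super_pdiff_scal:
  assumes S: "open S" "x \<in> S" and f: "smooth_on S f"
  shows "super_pdiff i (\<lambda>x. sscal (f x) * c) x = sscal (pdiff i f x) * c"
  using super_pdiff_smult[OF S f sf_const[of S c]] by (simp add: super_pdiff_const)

lemma smooth_on_shift_component: "smooth_on UNIV (\<lambda>x :: 'm::finite point. (x - y) $ i)"
  by (rule smooth_on_bounded_linear[OF bounded_linear_vec_nth])
     (auto intro!: smooth_on_diff smooth_on_id)

lemma z_var_smooth:
  "smooth_on UNIV (\<lambda>x :: 'm::finite point. z_var j (x - y))" "smooth_on UNIV (\<lambda>x :: 'm point. zc_var j (x - y))"
  unfolding z_var_def zc_var_def
  by (intro smooth_on_add smooth_on_diff smooth_on_mult smooth_on_of_real smooth_on_shift_component smooth_on_const open_UNIV)+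

lemma z_var_pdiff:
  "pdiff (Inl k) (\<lambda>x :: 'm::finite point. z_var j (x - y)) x = (if j = k then 1 else 0)"
  "pdiff (Inr k) (\<lambda>x :: 'm::finite point. z_var j (x - y)) x = (if j = k then \<i> else 0)"
  "pdiff (Inl k) (\<lambda>x :: 'm::finite point. zc_var j (x - y)) x = (if j = k then 1 else 0)"
  "pdiff (Inr k) (\<lambda>x :: 'm::finite point. zc_var j (x - y)) x = (if j = k then - \<i> else 0)"
proof -
  have d: "((\<lambda>x. complex_of_real ((x - y) $ i)) has_derivative (\<lambda>h. complex_of_real (h $ i))) (at x)" for i
    by (auto intro!: derivative_eq_intros bounded_linear.has_derivative[OF bounded_linear_vec_nth] has_derivative_of_real)
  have z: "((\<lambda>x. z_var j (x - y)) has_derivative (\<lambda>h. complex_of_real (h $ Inl j) + \<i> * complex_of_real (h $ Inr j))) (at x)"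
    unfolding z_var_def by (intro has_derivative_add has_derivative_mult_right d)
  have zc: "((\<lambda>x. zc_var j (x - y)) has_derivative (\<lambda>h. complex_of_real (h $ Inl j) - \<i> * complex_of_real (h $ Inr j))) (at x)"
    unfolding zc_var_def by (intro has_derivative_diff has_derivative_mult_right d)
  show "pdiff (Inl k) (\<lambda>x. z_var j (x - y)) x = (if j = k then 1 else 0)"
    "pdiff (Inr k) (\<lambda>x. z_var j (x - y)) x = (if j = k then \<i> else 0)"
    "pdiff (Inl k) (\<lambda>x. zc_var j (x - y)) x = (if j = k then 1 else 0)"
    "pdiff (Inr k) (\<lambda>x. zc_var j (x - y)) x = (if j = k then - \<i> else 0)"
    unfolding pdiffI[OF z] pdiffI[OF zc] by (auto simp: axis_def)
qed

locale kernel =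
  fixes n :: nat and y :: "'m::finite point"
begin

definition zv :: "'m point \<Rightarrow> 'm clifford grass" where "zv x = Z_var n (x - y) thd"
definition zd :: "'m point \<Rightarrow> 'm clifford grass" where "zd x = Zdag_var n (x - y) thd"
text \<open>The squared norm of the difference with \<open>e\<close> added to its body; by
  \<open>Z_norm2_eq\<close> the case \<open>e = 0\<close> is \<open>Z_norm2\<close> itself.\<close>

definition nf :: "real \<Rightarrow> 'm point \<Rightarrow> complex grass" where
  "nf e x = gconst (complex_of_real ((norm (x - y))\<^sup>2 + e)) - tsum n"

lemma sf_zv: "sf UNIV zv" and sf_zd: "sf UNIV zd"
  unfolding zv_def[abs_def] zd_def[abs_def] Z_var_def Zdag_var_def
  by (intro sf_add sf_sum sf_scal sf_const z_var_smooth)+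

lemma pd_zv: "super_pdiff (Inl k) zv x = gconst (witt k)" "super_pdiff (Inr k) zv x = sscal \<i> * gconst (witt k)"
  "super_pdiff (Inl k) zd x = gconst (witt_dag k)" "super_pdiff (Inr k) zd x = sscal (- \<i>) * gconst (witt_dag k)"
proof -
  have s: "sf UNIV (\<lambda>x. sscal (z_var j (x - y)) * gconst w)" "sf UNIV (\<lambda>x. sscal (zc_var j (x - y)) * gconst w)" for j w
    by (intro sf_scal z_var_smooth)+
  have a: "super_pdiff i zv x = (\<Sum>j\<in>UNIV. sscal (pdiff i (\<lambda>x. z_var j (x - y)) x) * gconst (witt j))"
    "super_pdiff i zd x = (\<Sum>j\<in>UNIV. sscal (pdiff i (\<lambda>x. zc_var j (x - y)) x) * gconst (witt_dag j))" for i
    unfolding zv_def[abs_def] zd_def[abs_def] Z_var_def Zdag_var_def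
      super_pdiff_add[OF open_UNIV UNIV_I sf_sum[OF s(1)] sf_const] super_pdiff_add[OF open_UNIV UNIV_I sf_sum[OF s(2)] sf_const]
      super_pdiff_sum[OF open_UNIV UNIV_I s(1)] super_pdiff_sum[OF open_UNIV UNIV_I s(2)]
      super_pdiff_scal[OF open_UNIV UNIV_I z_var_smooth(1)] super_pdiff_scal[OF open_UNIV UNIV_I z_var_smooth(2)]
      super_pdiff_const by simp_all
  have d: "(\<Sum>j\<in>UNIV. sscal (if j = k then c else 0) * gconst (w j)) = sscal c * gconst (w k)" for c and w :: "'m \<Rightarrow> 'm clifford"
  proof -
    have "(\<Sum>j\<in>UNIV. sscal (if j = k then c else 0) * gconst (w j)) = (\<Sum>j\<in>UNIV. if j = k then sscal c * gconst (w k) else 0)"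
      by (rule sum.cong[OF refl]) (simp add: sscal_simps(1))
    then show ?thesis by simp
  qed
  show "super_pdiff (Inl k) zv x = gconst (witt k)" "super_pdiff (Inr k) zv x = sscal \<i> * gconst (witt k)"
    "super_pdiff (Inl k) zd x = gconst (witt_dag k)" "super_pdiff (Inr k) zd x = sscal (- \<i>) * gconst (witt_dag k)"
    unfolding a z_var_pdiff d by (simp_all add: sscal_simps(2))
qed

lemma gderiv_thd: "gderiv_left (XV k) (thd j) = (if k = j then 1 else 0)"
  by (simp add: gderiv_left_gvar)

lemma gderiv_gz:
  assumes "j \<ge> 1" "l \<ge> 1"
  shows "gderiv_left (XV (2 * l - 1)) (gz_var j thd) = (if j = l then 1 else 0)"
    "gderiv_left (XV (2 * l)) (gz_var j thd) = (if j = l then gconst \<i> else 0)"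
    "gderiv_left (XV (2 * l - 1)) (gzc_var j thd) = (if j = l then 1 else 0)"
    "gderiv_left (XV (2 * l)) (gzc_var j thd) = (if j = l then - gconst \<i> else 0)"
proof -
  have "2 * l - 1 = 2 * j - 1 \<longleftrightarrow> j = l" "2 * l - 1 \<noteq> 2 * j" "2 * l \<noteq> 2 * j - 1" "2 * l = 2 * j \<longleftrightarrow> j = l"
    using assms by (auto; presburger)+
  then show "gderiv_left (XV (2 * l - 1)) (gz_var j thd) = (if j = l then 1 else 0)"
    "gderiv_left (XV (2 * l)) (gz_var j thd) = (if j = l then gconst \<i> else 0)"
    "gderiv_left (XV (2 * l - 1)) (gzc_var j thd) = (if j = l then 1 else 0)"
    "gderiv_left (XV (2 * l)) (gzc_var j thd) = (if j = l then - gconst \<i> else 0)"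
    unfolding gz_var_def gzc_var_def gderiv_left_simps(1,4) gderiv_left_gconst_times gderiv_left_gvar by auto
qed

lemma ginv_gz: "ginv (gz_var j thd) = - gz_var j thd" "ginv (gzc_var j thd) = - gzc_var j thd"
  unfolding gz_var_def gzc_var_def ginv_simps(1,4) ginv_gconst_times ginv_thd by (simp_all add: algebra_simps)

lemma gderiv_ginv_zv:
  assumes l: "l \<in> {1..n}"
  shows "gderiv_left (XV (2 * l - 1)) (ginv (zv x)) = - gconst (gwitt l)"
    "gderiv_left (XV (2 * l)) (ginv (zv x)) = - (sscal \<i> * gconst (gwitt l))"
    "gderiv_left (XV (2 * l - 1)) (ginv (zd x)) = - gconst (gwitt_dag l)"
    "gderiv_left (XV (2 * l)) (ginv (zd x)) = sscal \<i> * gconst (gwitt_dag l)"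
proof -
  have h: "gderiv_left v (gembed a * gconst w) = gembed (gderiv_left v a) * gconst w" for v a and w :: "'m clifford"
    by (simp add: gderiv_left_mult gderiv_left_gembed gderiv_left_const)
  have gi: "ginv (gembed a * gconst w) = gembed (ginv a) * gconst w" for a and w :: "'m clifford"
    by (simp add: ginv_mult ginv_gembed)
  have a: "gderiv_left v (ginv (zv x)) = - (\<Sum>j=1..n. gembed (gderiv_left v (gz_var j thd)) * gconst (gwitt j))"
    "gderiv_left v (ginv (zd x)) = - (\<Sum>j=1..n. gembed (gderiv_left v (gzc_var j thd)) * gconst (gwitt_dag j))" for v
    unfolding zv_def zd_def Z_var_def Zdag_var_def ginv_simps(1) ginv_sum gi ginv_gz
    by (simp_all add: gderiv_left_sum gderiv_left_const h sum_negf)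
  have s: "(\<Sum>j=1..n. gembed (if j = l then c else 0) * gconst (w j)) = gembed c * gconst (w l)" for c and w :: "nat \<Rightarrow> 'm clifford"
  proof -
    have "(\<Sum>j=1..n. gembed (if j = l then c else 0) * gconst (w j)) = (\<Sum>j=1..n. if j = l then gembed c * gconst (w l) else 0)"
      by (rule sum.cong[OF refl]) simp
    then show ?thesis using l by simp
  qed
  have t: "(\<Sum>j=1..n. gembed (gderiv_left (XV (2 * l - 1)) (gz_var j thd)) * gconst (w j)) = gembed 1 * gconst (w l)"
    "(\<Sum>j=1..n. gembed (gderiv_left (XV (2 * l)) (gz_var j thd)) * gconst (w j)) = gembed (gconst \<i>) * gconst (w l)"
    "(\<Sum>j=1..n. gembed (gderiv_left (XV (2 * l - 1)) (gzc_var j thd)) * gconst (w j)) = gembed 1 * gconst (w l)"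
    "(\<Sum>j=1..n. gembed (gderiv_left (XV (2 * l)) (gzc_var j thd)) * gconst (w j)) = gembed (- gconst \<i>) * gconst (w l)"
    for w :: "nat \<Rightarrow> 'm clifford"
    unfolding s[symmetric] by (rule sum.cong[OF refl], use l in \<open>simp only: gderiv_gz atLeastAtMost_iff\<close>)+
  show "gderiv_left (XV (2 * l - 1)) (ginv (zv x)) = - gconst (gwitt l)"
    "gderiv_left (XV (2 * l)) (ginv (zv x)) = - (sscal \<i> * gconst (gwitt l))"
    "gderiv_left (XV (2 * l - 1)) (ginv (zd x)) = - gconst (gwitt_dag l)"
    "gderiv_left (XV (2 * l)) (ginv (zd x)) = sscal \<i> * gconst (gwitt_dag l)"
    unfolding a t by (simp_all only: gembed_simps mult_1 mult_minus_left minus_minus)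
qed

lemma bZ_pair: "l \<ge> 1 \<Longrightarrow> bZ (2 * l - 1) = cscal \<i> * gwitt_dag l" "bZ (2 * l) = gwitt_dag l"
  "l \<ge> 1 \<Longrightarrow> bZd (2 * l - 1) = cscal (- \<i>) * gwitt l" "bZd (2 * l) = gwitt l"
  by (auto simp: bZ_def bZd_def)

text \<open>\<open>zv\<close> fits this pattern with \<open>c = \<i>\<close> and \<open>zd\<close>
  with \<open>c = - \<i>\<close>. The scalars in the conclusion are then either all 0, or 1 in the
  even part and plus or minus 2i in the odd part; the pairs with 0 are the ones that must
  vanish.\<close>

lemma rop_linear_vector:
  fixes F :: "'m point \<Rightarrow> 'm clifford grass" and p :: "'m \<Rightarrow> 'm clifford" and q :: "nat \<Rightarrow> 'm clifford"
  assumes "\<And>k. super_pdiff (Inl k) F x = gconst (p k)" "\<And>k. super_pdiff (Inr k) F x = sscal c * gconst (p k)"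
    "\<And>l. l \<in> {1..n} \<Longrightarrow> gderiv_left (XV (2 * l - 1)) (ginv (F x)) = - gconst (q l)"
    "\<And>l. l \<in> {1..n} \<Longrightarrow> gderiv_left (XV (2 * l)) (ginv (F x)) = - (sscal c * gconst (q l))"
  shows "rop n aZ bZ F x = gconst ((\<Sum>k\<in>UNIV. cscal (1 / 2 - c * \<i> / 2) * (p k * witt_dag k))
      - (\<Sum>l=1..n. cscal (\<i> + c) * (q l * gwitt_dag l)))"
    and "rop n aZd bZd F x = gconst ((\<Sum>k\<in>UNIV. cscal (1 / 2 + c * \<i> / 2) * (p k * witt k))
      - (\<Sum>l=1..n. cscal (c - \<i>) * (q l * gwitt l)))"
proof -
  have e: "gconst s * gconst (cscal a * t) = gconst (cscal a * (s * t))"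
    "sscal b * gconst s * gconst (cscal a * t) = gconst (cscal (b * a) * (s * t))"
    "sscal b * gconst s * gconst t = gconst (cscal b * (s * t))" for a b and s t :: "'m clifford"
    by (simp_all only: gconst_mult[symmetric] mult.assoc cscal_left_commute[of s] cscal_merge)
  have e4: "gconst (cscal b * (s * (cscal a * t))) = gconst (cscal (b * a) * (s * t))" for a b and s t :: "'m clifford"
    by (simp only: cscal_left_commute[of s] cscal_merge)
  have f: "gconst (cscal a * s) + gconst (cscal b * s) = gconst (cscal (a + b) * s)" for a b and s :: "'m clifford"
    by (simp only: gconst_add[symmetric] cscal_simps(3) distrib_right)
  have 1: "(\<Sum>i\<in>UNIV. super_pdiff i F x * gconst (aZ i)) = gconst (\<Sum>k\<in>UNIV. cscal (1 / 2 - c * \<i> / 2) * (p k * witt_dag k))"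
    unfolding sum_Plus_UNIV gconst_sum assms(1,2)
    by (rule sum.cong[OF refl], simp only: aZ_def sum.case e e4 f, simp)
  have 2: "(\<Sum>i\<in>UNIV. super_pdiff i F x * gconst (aZd i)) = gconst (\<Sum>k\<in>UNIV. cscal (1 / 2 + c * \<i> / 2) * (p k * witt k))"
    unfolding sum_Plus_UNIV gconst_sum assms(1,2)
    by (rule sum.cong[OF refl], simp only: aZd_def sum.case e e4 f, simp)
  have 3: "(\<Sum>k\<in>{1..2 * n}. gderiv_left (XV k) (ginv (F x)) * gconst (bZ k)) = - gconst (\<Sum>l=1..n. cscal (\<i> + c) * (q l * gwitt_dag l))"
    unfolding sum_pairs gconst_sum sum_negf[symmetric]
  proof (rule sum.cong[OF refl])
    fix l assume l: "l \<in> {1..n}"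
    then have "l \<ge> 1" by simp
    then show "gderiv_left (XV (2 * l - 1)) (ginv (F x)) * gconst (bZ (2 * l - 1)) +
        gderiv_left (XV (2 * l)) (ginv (F x)) * gconst (bZ (2 * l)) = - gconst (cscal (\<i> + c) * (q l * gwitt_dag l))"
      unfolding assms(3,4)[OF l] bZ_pair(2) bZ_pair(1)[OF \<open>l \<ge> 1\<close>] mult_minus_left
      by (simp only: e e4 f[symmetric]) simp
  qed
  have 4: "(\<Sum>k\<in>{1..2 * n}. gderiv_left (XV k) (ginv (F x)) * gconst (bZd k)) = - gconst (\<Sum>l=1..n. cscal (c - \<i>) * (q l * gwitt l))"
    unfolding sum_pairs gconst_sum sum_negf[symmetric]
  proof (rule sum.cong[OF refl])
    fix l assume l: "l \<in> {1..n}"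
    then have "l \<ge> 1" by simp
    have ci: "c - \<i> = - \<i> + c" by simp
    show "gderiv_left (XV (2 * l - 1)) (ginv (F x)) * gconst (bZd (2 * l - 1)) +
        gderiv_left (XV (2 * l)) (ginv (F x)) * gconst (bZd (2 * l)) = - gconst (cscal (c - \<i>) * (q l * gwitt l))"
      unfolding assms(3,4)[OF l] bZ_pair(4) bZ_pair(3)[OF \<open>l \<ge> 1\<close>] mult_minus_left ci
      by (simp only: e e4 f[symmetric]) simp
  qed
  show "rop n aZ bZ F x = gconst ((\<Sum>k\<in>UNIV. cscal (1 / 2 - c * \<i> / 2) * (p k * witt_dag k))
      - (\<Sum>l=1..n. cscal (\<i> + c) * (q l * gwitt_dag l)))"
    unfolding rop_def 1 3 gconst_diff by simp
  show "rop n aZd bZd F x = gconst ((\<Sum>k\<in>UNIV. cscal (1 / 2 + c * \<i> / 2) * (p k * witt k))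
      - (\<Sum>l=1..n. cscal (c - \<i>) * (q l * gwitt l)))"
    unfolding rop_def 2 4 gconst_diff by simp
qed

text \<open>Each of the m Witt pairs has anticommutator 1; each of the n symplectic pairs has
  commutator -i/2 and enters with weight -2i, hence contributes -1. The total is half the
  superdimension.\<close>

lemma rop_zv:
  "rop n aZ bZ zv x + rop n aZd bZd zd x = sscal (of_nat CARD('m) - of_nat n)"
  "rop n aZd bZd zv x = 0" "rop n aZ bZ zd x = 0"
proof -
  note v = rop_linear_vector[of zv x witt \<i> gwitt, OF pd_zv(1,2) gderiv_ginv_zv(1,2)]
  have d: "gderiv_left (XV (2 * l)) (ginv (zd x)) = - (sscal (- \<i>) * gconst (gwitt_dag l))" if "l \<in> {1..n}" for l
    using gderiv_ginv_zv(4)[OF that, of x] by (simp add: sscal_simps)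
  note w = rop_linear_vector[of zd x witt_dag "- \<i>" gwitt_dag, OF pd_zv(3,4) gderiv_ginv_zv(3) d]
  show "rop n aZd bZd zv x = 0" "rop n aZ bZ zd x = 0"
    using v(2) w(1) by (simp_all add: cscal_simps(1))
  have 1: "(\<Sum>k\<in>UNIV. witt k * witt_dag k) + (\<Sum>k\<in>UNIV. witt_dag k * witt k) = (of_nat CARD('m) :: 'm clifford)"
  proof -
    have "witt k * witt_dag k + witt_dag k * witt k = (1 :: 'm clifford)" for k
      using acom_witt(3)[of k k] by (simp add: acom_def cscal_simps(2))
    then show ?thesis unfolding sum.distrib[symmetric] by simp
  qed
  have "(\<Sum>l=1..n. gwitt l * gwitt_dag l) - (\<Sum>l=1..n. gwitt_dag l * gwitt l) = (\<Sum>l=1..n. cscal (- \<i> / 2) :: 'm clifford)"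
    unfolding sum_subtractf[symmetric]
  proof (rule sum.cong[OF refl])
    fix l assume "l \<in> {1..n}"
    then show "gwitt l * gwitt_dag l - gwitt_dag l * gwitt l = (cscal (- \<i> / 2) :: 'm clifford)"
      using comm_gwitt(3)[of l l] by (simp add: comm_def)
  qed
  also have "\<dots> = cscal (of_nat n * (- \<i> / 2))"
    unfolding cscal_sum[symmetric] by simp
  finally have 2: "(\<Sum>l=1..n. gwitt l * gwitt_dag l) - (\<Sum>l=1..n. gwitt_dag l * gwitt l) = (cscal (of_nat n * (- \<i> / 2)) :: 'm clifford)" .
  have on: "(of_nat k :: 'm clifford) = cscal (of_nat k)" for k
    by (induction k) (simp_all add: cscal_simps(1,2,3))
  have "rop n aZ bZ zv x + rop n aZd bZd zd x = gconst (
      ((\<Sum>k\<in>UNIV. witt k * witt_dag k) + (\<Sum>k\<in>UNIV. witt_dag k * witt k))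
      - cscal (2 * \<i>) * ((\<Sum>l=1..n. gwitt l * gwitt_dag l) - (\<Sum>l=1..n. gwitt_dag l * gwitt l)))"
  proof -
    have "- \<i> - \<i> = - (2 * \<i>)" "\<i> + \<i> = 2 * \<i>" "1 / 2 - \<i> * \<i> / 2 = (1::complex)" "1 / 2 + - \<i> * \<i> / 2 = (1::complex)" by simp_all
    then show ?thesis
      by (simp only: v(1) w(2) sum_distrib_left[symmetric])
         (simp only: cscal_simps(2) mult_1 cscal_minus mult_minus_left right_diff_distrib gconst_add[symmetric],
          simp add: algebra_simps)
  qed
  also have "\<dots> = sscal (of_nat CARD('m) - of_nat n)"
    unfolding 1 2 on cscal_simps(4)[symmetric] cscal_diff[symmetric]
    by (rule arg_cong[where f = sscal]) (simp add: algebra_simps)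
  finally show "rop n aZ bZ zv x + rop n aZd bZd zd x = sscal (of_nat CARD('m) - of_nat n)" .
qed

end

section \<open>Products of the vector variables and of the regularised kernel\<close>

lemma acom_commute: "acom s t = acom t s" by (simp add: acom_def add.commute)

lemma acom_sum: "acom (\<Sum>i\<in>I. f i) (\<Sum>j\<in>J. g j) = (\<Sum>i\<in>I. \<Sum>j\<in>J. acom (f i) (g j))"
proof -
  have "(\<Sum>j\<in>J. \<Sum>i\<in>I. g j * f i) = (\<Sum>i\<in>I. \<Sum>j\<in>J. g j * f i)" by (rule sum.swap)
  then show ?thesis by (simp only: acom_def sum_product sum.distrib)
qed

lemma gembed_gconst_product: "(gembed p * gconst s) * (gembed q * gconst t) = gembed (p * q) * gconst (s * t)"
proof -
  have "(gembed p * gconst s) * (gembed q * gconst t) = gembed p * (gconst s * gembed q) * gconst t"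
    by (simp only: mult.assoc)
  also have "gconst s * gembed q = gembed q * gconst s" by (rule gembed_gconst_commute[symmetric])
  finally show ?thesis by (simp only: mult.assoc gembed_mult gconst_mult)
qed

text \<open>Exchanging odd coefficients costs a sign, so the anticommutator of the products sees the
  commutator of their Clifford factors. This is where the symplectic relations fit in with the
  orthogonal ones.\<close>

lemma acom_products:
  "acom (sscal a * gconst s) (sscal b * gconst t) = sscal (a * b) * gconst (acom s t)"
  "acom (sscal a * gconst s) (gembed q * gconst t) = sscal a * gembed q * gconst (acom s t)"
  "p * q = - (q * p) \<Longrightarrow> acom (gembed p * gconst s) (gembed q * gconst t) = gembed (p * q) * gconst (comm s t)"
proof -
  have c: "gconst (cscal a) = (gembed (gconst a) :: 'a clifford grass)" for a by simp
  have k: "gconst a * q = q * gconst a" for a and q :: "complex grass"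
    by (rule grass_eqI') (simp add: mult.commute)
  show "acom (sscal a * gconst s) (sscal b * gconst t) = sscal (a * b) * gconst (acom s t)"
    unfolding c acom_def gembed_gconst_product gconst_mult[of a b] k[of b] gconst_add distrib_left ..
  show "acom (sscal a * gconst s) (gembed q * gconst t) = sscal a * gembed q * gconst (acom s t)"
    unfolding c acom_def gembed_gconst_product gembed_mult[symmetric] k[of a q] gconst_add distrib_left ..
  assume pq: "p * q = - (q * p)"
  then have "q * p = - (p * q)" by simp
  then show "acom (gembed p * gconst s) (gembed q * gconst t) = gembed (p * q) * gconst (comm s t)"
    unfolding acom_def comm_def gembed_gconst_product by (simp add: gconst_diff right_diff_distrib)
qed

text \<open>The derivative of an even scalar factor commutes with Clifford constants, even in the
  odd directions where that derivative is odd. So the derivatives of the factor can be collected in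
  \<open>dop\<close> to the right of \<open>P x\<close>.\<close>

lemma rop_mult:
  fixes P :: "'m::finite point \<Rightarrow> 'm clifford grass"
  assumes S: "open S" "x \<in> S" and P: "sf S P" and E: "sf S (\<lambda>x. gembed (e x))" and ev: "\<And>x. ginv (e x) = e x"
  shows "rop n a b (\<lambda>x. P x * gembed (e x)) x = gembed (e x) * rop n a b P x + P x * dop n a b (\<lambda>x. gembed (e x)) x"
proof -
  let ?E = "\<lambda>x. gembed (e x) :: 'm clifford grass"
  have c: "?E x * v = v * ?E x" for x v by (rule gembed_even_central[OF ev])
  \<comment> \<open>Differentiating the commutation of \<open>?E x\<close> with a constant gives
    that of its derivative.\<close>
  have pc: "super_pdiff i ?E x * gconst w = gconst w * super_pdiff i ?E x" for i w
  proof -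
    have "super_pdiff i ?E x * gconst w = super_pdiff i (\<lambda>x. ?E x * gconst w) x"
      by (rule super_pdiff_clin_op[OF S E clin_op_right, symmetric])
    also have "\<dots> = super_pdiff i (\<lambda>x. gconst w * ?E x) x" by (simp only: c)
    also have "\<dots> = gconst w * super_pdiff i ?E x" by (rule super_pdiff_clin_op[OF S E clin_op_left])
    finally show ?thesis .
  qed
  have gc: "gderiv_left v (?E x) * gconst w = gconst w * gderiv_left v (?E x)" for v w
    unfolding gderiv_left_gembed by (rule gembed_gconst_commute)
  have 1: "super_pdiff i (\<lambda>x. P x * ?E x) x * gconst w =
      ?E x * (super_pdiff i P x * gconst w) + P x * (gconst w * super_pdiff i ?E x)" for i w
    unfolding super_pdiff_mult[OF S P E] distrib_right mult.assoc pc
      c[of x "super_pdiff i P x * gconst w"] c[of x "gconst w"] by (simp only: mult.assoc)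
  have 2: "gderiv_left v (ginv (P x * ?E x)) * gconst w =
      ?E x * (gderiv_left v (ginv (P x)) * gconst w) + P x * (gconst w * gderiv_left v (?E x))" for v w
    unfolding ginv_mult ginv_gembed ev gderiv_left_mult ginv_ginv distrib_right mult.assoc gc
      c[of x "gderiv_left v (ginv (P x)) * gconst w"] c[of x "gconst w"] by (simp only: mult.assoc)
  show ?thesis
    unfolding rop_def dop_def 1 2 sum.distrib sum_distrib_left distrib_left by (simp only: add_ac)
qed

context kernel
begin

abbreviation kvars :: "gvar set" where "kvars \<equiv> xvars n \<union> YV ` {1..2 * n}"

lemma gbody_nf: "gbody (nf e x) = (norm (x - y))\<^sup>2 + e"
  and gnil_nf: "gnil (nf e x) = - tsum n"
  and nf_body: "complex_of_real (gbody (nf e x)) = gcoeff (nf e x) {}"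
  by (simp_all add: gbody_def gnil_def nf_def gconst.rep_eq tsum_props(2))

lemma ginv_nf: "ginv (nf e x) = nf e x"
  by (simp add: nf_def tsum_props(1))

lemma norm_shift_smooth: "smooth_on UNIV (\<lambda>x :: 'm point. (norm (x - y))\<^sup>2 + e)"
  unfolding power2_norm_eq_inner
  by (intro smooth_on_add smooth_on_bilinear[OF bounded_bilinear_inner] smooth_on_diff smooth_on_id
      smooth_on_const open_UNIV)

lemma even_superfunction_nf: assumes "open S" shows "even_superfunction S (nf e) kvars n"
proof
  show "smooth_on S (\<lambda>x. gcoeff (nf e x) A)" for A
  proof -
    have "smooth_on UNIV (\<lambda>x. (if A = {} then complex_of_real ((norm (x - y))\<^sup>2 + e) else 0) - gcoeff (tsum n) A)"
    proof (cases "A = {}")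
      case True
      have "smooth_on UNIV (\<lambda>x. complex_of_real ((norm (x - y))\<^sup>2 + e) - gcoeff (tsum n) A)"
        by (intro smooth_on_diff smooth_on_of_real norm_shift_smooth smooth_on_const open_UNIV)
      then show ?thesis using True by simp
    qed simp
    from smooth_on_subset[OF this open_UNIV assms subset_UNIV] show ?thesis
      unfolding nf_def by (simp only: gcoeff_diff gconst.rep_eq)
  qed
  show "gcoeff (nf e x) A \<noteq> 0 \<Longrightarrow> A \<subseteq> kvars" for x A
    using tsum_props(3)[of n A] by (cases "A = {}") (auto simp: nf_def gconst.rep_eq)
  show "gnil (nf e x) ^ Suc n = 0" for x
  proof -
    have "(- tsum n) ^ Suc n = (- 1) ^ Suc n * tsum n ^ Suc n" by (rule power_minus)
    then show ?thesis unfolding gnil_nf tsum_power(2) by simp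
  qed
qed (auto simp: assms ginv_nf nf_body)

text \<open>The power with exponent \<open>q\<close> of the regularised squared norm
  \<open>nf e\<close>.\<close>

definition ee :: "real \<Rightarrow> real \<Rightarrow> 'm point \<Rightarrow> 'm clifford grass" where
  "ee q e x = gembed (gcomp n (pw q) (nf e x))"

lemma pdiff_norm: "pdiff i (\<lambda>x :: 'm point. complex_of_real ((norm (x - y))\<^sup>2 + e)) x = 2 * complex_of_real ((x - y) $ i)"
proof -
  have "((\<lambda>x. (x - y) \<bullet> (x - y) + e) has_derivative (\<lambda>h. (x - y) \<bullet> h + h \<bullet> (x - y))) (at x)"
    by (auto intro!: derivative_eq_intros)
  from has_derivative_of_real[OF this, where 'a = complex] show ?thesis
    unfolding power2_norm_eq_inner by (simp add: pdiffI inner_axis inner_axis')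
qed

lemma gderiv_tsum:
  assumes l: "l \<in> {1..n}"
  shows "gderiv_left (XV (2 * l - 1)) (tsum n) = thd (2 * l)" "gderiv_left (XV (2 * l)) (tsum n) = - thd (2 * l - 1)"
proof -
  have d: "gderiv_left v (thd i * thd j) = gderiv_left v (thd i) * thd j - thd i * gderiv_left v (thd j)" for v i j
    unfolding gderiv_left_mult ginv_thd mult_minus_left by (rule diff_conv_add_uminus[symmetric])
  have a: "gderiv_left (XV k) (thd i * thd j) = (if k = i then 1 else 0) * thd j - thd i * (if k = j then 1 else 0)" for k i j
    unfolding d gderiv_thd ..
  have p: "2 * l - 1 = 2 * j - 1 \<longleftrightarrow> j = l" "2 * l - 1 \<noteq> 2 * j" "2 * l \<noteq> 2 * j - 1" "2 * l = 2 * j \<longleftrightarrow> j = l"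
    if "j \<in> {1..n}" for j using l that by (auto; presburger)+
  have "gderiv_left (XV (2 * l - 1)) (tsum n) = (\<Sum>j=1..n. if j = l then thd (2 * l) else 0)"
    unfolding tsum_def gderiv_left_sum a by (rule sum.cong[OF refl]) (simp only: p, simp)
  then show "gderiv_left (XV (2 * l - 1)) (tsum n) = thd (2 * l)" using l by simp
  have "gderiv_left (XV (2 * l)) (tsum n) = (\<Sum>j=1..n. if j = l then - thd (2 * l - 1) else 0)"
    unfolding tsum_def gderiv_left_sum a by (rule sum.cong[OF refl]) (simp only: p, simp)
  then show "gderiv_left (XV (2 * l)) (tsum n) = - thd (2 * l - 1)" using l by simp
qed

lemma dop_nf:
  "dop n aZ bZ (\<lambda>x. gembed (nf e x)) x = zd x" "dop n aZd bZd (\<lambda>x. gembed (nf e x)) x = zv x"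
proof -
  have s: "smooth_on UNIV (\<lambda>x. complex_of_real ((norm (x - y))\<^sup>2 + e))"
    by (intro smooth_on_of_real norm_shift_smooth open_UNIV)
  have pd: "super_pdiff i (\<lambda>x. gembed (nf e x)) x = sscal (2 * complex_of_real ((x - y) $ i))" for i
  proof -
    have eq: "(\<lambda>x. gembed (nf e x) :: 'm clifford grass) =
        (\<lambda>x. sscal (complex_of_real ((norm (x - y))\<^sup>2 + e)) * 1 + gembed (- tsum n))"
      by (rule ext) (simp add: nf_def)
    show ?thesis
      unfolding eq super_pdiff_add[OF open_UNIV UNIV_I sf_scal[OF s] sf_const]
          super_pdiff_scal[OF open_UNIV UNIV_I s] super_pdiff_const pdiff_norm by (simp only: mult_1_right add_0_right)
  qed
  have gd: "gderiv_left (XV (2 * l - 1)) (gembed (nf e x)) = (- gembed (thd (2 * l)) :: 'm clifford grass)"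
    "gderiv_left (XV (2 * l)) (gembed (nf e x)) = (gembed (thd (2 * l - 1)) :: 'm clifford grass)" if "l \<in> {1..n}" for l
    unfolding gderiv_left_gembed nf_def gderiv_left_simps(4) gderiv_left_const gderiv_tsum[OF that]
      diff_0 minus_minus by (simp_all only: gembed_simps)
  have e: "gconst (cscal a * w) * sscal b + gconst (cscal c * w) * sscal d = sscal (a * b + c * d) * gconst w" for a b c d and w :: "'m clifford"
  proof -
    have "gconst (cscal a * w) * sscal b = sscal (a * b) * gconst w" for a b
      by (simp only: gconst_mult[symmetric]) (simp only: cscal_simps(4) mult.assoc cscal_simps(5)[of b w])
    then show ?thesis by (simp only: sscal_simps(3) distrib_right)
  qed
  have f: "gconst (cscal a * w) * - gembed p + gconst w * gembed q = gembed (q - gconst a * p) * gconst w" for a p q and w :: "'m clifford"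
  proof -
    have "gconst (cscal a * w) * gembed p = gembed (gconst a * p) * gconst w"
      unfolding gconst_mult by (simp only: gembed_mult gembed_simps mult.assoc gembed_gconst_commute)
    then show ?thesis by (simp add: left_diff_distrib gembed_gconst_commute del: gembed_mult)
  qed
  have 1: "(\<Sum>i\<in>UNIV. gconst (aZ i) * super_pdiff i (\<lambda>x. gembed (nf e x)) x) = (\<Sum>j\<in>UNIV. sscal (zc_var j (x - y)) * gconst (witt_dag j))"
    unfolding sum_Plus_UNIV pd
    by (rule sum.cong[OF refl], simp only: aZ_def sum.case e zc_var_def) (rule arg_cong[where f = "\<lambda>c. sscal c * _"], simp add: algebra_simps diff_divide_distrib)
  have 2: "(\<Sum>i\<in>UNIV. gconst (aZd i) * super_pdiff i (\<lambda>x. gembed (nf e x)) x) = (\<Sum>j\<in>UNIV. sscal (z_var j (x - y)) * gconst (witt j))"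
    unfolding sum_Plus_UNIV pd
    by (rule sum.cong[OF refl], simp only: aZd_def sum.case e z_var_def) (rule arg_cong[where f = "\<lambda>c. sscal c * _"], simp add: algebra_simps diff_divide_distrib)
  have 3: "(\<Sum>k\<in>{1..2 * n}. gconst (bZ k) * gderiv_left (XV k) (gembed (nf e x))) = (\<Sum>j=1..n. gembed (gzc_var j thd) * gconst (gwitt_dag j :: 'm clifford))"
    unfolding sum_pairs
  proof (rule sum.cong[OF refl])
    fix l assume l: "l \<in> {1..n}"
    then have "l \<ge> 1" by simp
    show "gconst (bZ (2 * l - 1)) * gderiv_left (XV (2 * l - 1)) (gembed (nf e x)) + gconst (bZ (2 * l)) * gderiv_left (XV (2 * l)) (gembed (nf e x))
      = gembed (gzc_var l thd) * gconst (gwitt_dag l :: 'm clifford)"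
      unfolding gd[OF l] bZ_pair(2) bZ_pair(1)[OF \<open>l \<ge> 1\<close>] f gzc_var_def ..
  qed
  have 4: "(\<Sum>k\<in>{1..2 * n}. gconst (bZd k) * gderiv_left (XV k) (gembed (nf e x))) = (\<Sum>j=1..n. gembed (gz_var j thd) * gconst (gwitt j :: 'm clifford))"
    unfolding sum_pairs
  proof (rule sum.cong[OF refl])
    fix l assume l: "l \<in> {1..n}"
    then have "l \<ge> 1" by simp
    show "gconst (bZd (2 * l - 1)) * gderiv_left (XV (2 * l - 1)) (gembed (nf e x)) + gconst (bZd (2 * l)) * gderiv_left (XV (2 * l)) (gembed (nf e x))
      = gembed (gz_var l thd) * gconst (gwitt l :: 'm clifford)"
      unfolding gd[OF l] bZ_pair(4) bZ_pair(3)[OF \<open>l \<ge> 1\<close>] f gz_var_def gconst_minus mult_minus_left diff_minus_eq_add ..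
  qed
  show "dop n aZ bZ (\<lambda>x. gembed (nf e x)) x = zd x" "dop n aZd bZd (\<lambda>x. gembed (nf e x)) x = zv x"
    unfolding dop_def 1 2 3 4 zv_def zd_def Z_var_def Zdag_var_def by (rule refl)+
qed

text \<open>The anticommutators are expanded over the Witt vectors. Blocks mixing both kinds vanish,
  and in the symplectic block the odd coefficients convert commutators into anticommutators, so both
  blocks add up to one squared norm.\<close>

lemma z_relations: "zv x * zd x + zd x * zv x = gembed (nf 0 x)" "zv x * zv x = 0" "zd x * zd x = 0"
proof -
  define P where "P j = sscal (z_var j (x - y)) * gconst (witt j)" for j :: 'm
  define Q where "Q j = gembed (gz_var j thd) * gconst (gwitt j :: 'm clifford)" for j
  define P' where "P' j = sscal (zc_var j (x - y)) * gconst (witt_dag j)" for j :: 'm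
  define Q' where "Q' j = gembed (gzc_var j thd) * gconst (gwitt_dag j :: 'm clifford)" for j
  have z: "zv x = sum P UNIV + sum Q {1..n}" "zd x = sum P' UNIV + sum Q' {1..n}"
    by (simp_all add: zv_def zd_def Z_var_def Zdag_var_def P_def Q_def P'_def Q'_def)
  have odd: "gz_var i thd * gz_var j thd = - (gz_var j thd * gz_var i thd)"
    "gzc_var i thd * gzc_var j thd = - (gzc_var j thd * gzc_var i thd)"
    "gz_var i thd * gzc_var j thd = - (gzc_var j thd * gz_var i thd)" for i j
    by (rule grass_odd_anticommute; rule ginv_gz)+
  have 1: "acom (P i) (P j) = 0" "acom (P' i) (P' j) = 0"
    "acom (P i) (P' j) = (if i = j then sscal (z_var i (x - y) * zc_var j (x - y)) else 0)" for i j
    unfolding P_def P'_def acom_products acom_witt by (simp_all add: sscal_simps(1,2))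
  have 2: "acom (P i) (Q j) = 0" "acom (P' i) (Q' j) = 0" "acom (P i) (Q' j) = 0" "acom (P' i) (Q j) = 0" for i j
    unfolding P_def P'_def Q_def Q'_def acom_products acom_witt by simp_all
  have 3: "acom (Q i) (Q j) = 0" "acom (Q' i) (Q' j) = 0"
    "acom (Q i) (Q' j) = (if i = j then - (gembed (gconst (\<i> / 2) * (gz_var i thd * gzc_var j thd))) else 0)"
    if "i \<in> {1..n}" "j \<in> {1..n}" for i j
  proof -
    have ij: "i \<ge> 1" "j \<ge> 1" using that by auto
    show "acom (Q i) (Q j) = 0" "acom (Q' i) (Q' j) = 0"
      unfolding Q_def Q'_def acom_products(3)[OF odd(1)] acom_products(3)[OF odd(2)] comm_gwitt[OF ij] by simp_all
    have g: "gembed p * sscal (- \<i> / 2) = (- gembed (gconst (\<i> / 2) * p) :: 'm clifford grass)" for p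
      unfolding gembed_mult gembed_simps(5) sscal_commute[of "\<i> / 2", symmetric]
      by (simp add: sscal_simps(5) sscal_commute[of "\<i> / 2"])
    show "acom (Q i) (Q' j) = (if i = j then - (gembed (gconst (\<i> / 2) * (gz_var i thd * gzc_var j thd))) else 0)"
    proof (cases "i = j")
      case True
      then show ?thesis unfolding Q_def Q'_def acom_products(3)[OF odd(3)] comm_gwitt[OF ij] by (simp only: if_True simp_thms g)
    next
      case False
      then show ?thesis unfolding Q_def Q'_def acom_products(3)[OF odd(3)] comm_gwitt[OF ij] by (simp add: sscal_simps(1))
    qed
  qed
  have add: "acom (a + b) (c + d) = acom a c + acom a d + acom b c + acom b d" for a b c d :: "'m clifford grass"
    by (simp add: acom_def algebra_simps)
  have r2: "acom (Q j) (P i) = 0" "acom (Q' j) (P' i) = 0" "acom (Q j) (P' i) = 0" for i j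
    using 2[of i j] by (simp_all only: acom_commute[of "Q j"] acom_commute[of "Q' j"])
  have "acom (zv x) (zv x) = 0" "acom (zd x) (zd x) = 0"
    unfolding z add acom_sum using 1 2 r2 3 by simp_all
  \<comment> \<open>\<open>acom\<close> of an element with itself is twice its square, and 2 can be
    cancelled over the complex numbers.\<close>
  moreover have "(sscal 2 :: 'm clifford grass) = 2"
    by (metis one_add_one sscal_simps(2,3))
  then have "sscal 2 * v = v + v" for v :: "'m clifford grass"
    by (simp only: mult_2)
  ultimately have d: "sscal 2 * (zv x * zv x) = 0" "sscal 2 * (zd x * zd x) = 0"
    by (simp_all only: acom_def)
  show "zv x * zv x = 0" "zd x * zd x = 0"
    by (rule sscal_cancel[OF d(1)] sscal_cancel[OF d(2)], simp)+
  have "acom (zv x) (zd x) = (\<Sum>i\<in>UNIV. sscal (z_var i (x - y) * zc_var i (x - y)))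
      + (\<Sum>i=1..n. - (gembed (gconst (\<i> / 2) * (gz_var i thd * gzc_var i thd))))"
  proof -
    have "(\<Sum>i=1..n. \<Sum>j=1..n. acom (Q i) (Q' j)) = (\<Sum>i=1..n. \<Sum>j=1..n. if i = j then - (gembed (gconst (\<i> / 2) * (gz_var i thd * gzc_var j thd))) else 0)"
      by (intro sum.cong refl 3)
    then show ?thesis unfolding z add acom_sum 1 2 r2 by (simp add: sum.delta')
  qed
  also have "\<dots> = gembed (Z_norm2 n (x - y) thd)"
    unfolding Z_norm2_def by (simp add: gembed_sum cscal_sum gconst_sum sum_distrib_left sum_negf del: gembed_mult)
  also have "Z_norm2 n (x - y) thd = nf 0 x"
    unfolding Z_norm2_eq nf_def by simp
  finally show "zv x * zd x + zd x * zv x = gembed (nf 0 x)" by (simp add: acom_def)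
qed

end

subsection \<open>An approximate identity\<close>

text \<open>Layer-cake formula: \<open>f x\<close> is the integral of \<open>?w\<close> from the
  squared norm of \<open>x\<close> to infinity. After Fubini the inner integral is the volume of a
  ball of radius \<open>sqrt s\<close> in dimension 2m, and the remaining radial integral is
  elementary.\<close>

lemma approximate_identity_mass:
  defines "f \<equiv> \<lambda>x :: 'm::finite point. 1 / (1 + (norm x)\<^sup>2) ^ (CARD('m) + 1)"
  shows "integrable lborel f" "(LINT x|lborel. f x) = pi ^ CARD('m) / fact CARD('m)"
proof -
  let ?m = "CARD('m)"
  let ?V = "pi ^ ?m / fact ?m :: real"
  let ?w = "\<lambda>s :: real. real (?m + 1) / (1 + s) ^ (?m + 2)"
  have f: "ennreal (f x) = (\<integral>\<^sup>+s. ennreal (?w s) * indicator {(norm x)\<^sup>2..} s \<partial>lborel)" for x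
  proof -
    have "(\<integral>\<^sup>+s. ennreal (?w s) * indicator {(norm x)\<^sup>2..} s \<partial>lborel) = ennreal (0 - (- (1 / (1 + (norm x)\<^sup>2) ^ (?m + 1))))"
    proof (rule nn_integral_FTC_atLeast)
      fix s :: real assume "(norm x)\<^sup>2 \<le> s"
      then have s: "1 + s > 0" using zero_le_power2[of "norm x"] by linarith
      have p: "((\<lambda>s. (1 + s) ^ (?m + 1)) has_real_derivative real (?m + 1) * (1 * (1 + s) ^ (?m + 1 - Suc 0))) (at s)"
        by (rule DERIV_power) (auto intro!: derivative_eq_intros)
      have "((\<lambda>s. - (inverse ((1 + s) ^ (?m + 1)))) has_real_derivative
          (inverse ((1 + s) ^ (?m + 1)) * (real (?m + 1) * (1 + s) ^ ?m) * inverse ((1 + s) ^ (?m + 1)))) (at s)"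
        using DERIV_minus[OF DERIV_inverse'[OF p]] s by simp
      moreover have "inverse ((1 + s) ^ (?m + 1)) * (real (?m + 1) * (1 + s) ^ ?m) * inverse ((1 + s) ^ (?m + 1)) = ?w s"
      proof -
        have "inverse (u ^ (k + 1)) * (r * u ^ k) * inverse (u ^ (k + 1)) = r / u ^ (k + 2)" if "u > 0" for u r :: real and k
          using that by (simp add: field_simps)
        then show ?thesis using s .
      qed
      ultimately show "((\<lambda>s. - (1 / (1 + s) ^ (?m + 1))) has_real_derivative ?w s) (at s)"
        by (simp only: inverse_eq_divide)
      show "0 \<le> ?w s" using s by simp
    next
      have "filterlim (\<lambda>s :: real. 1 + s) at_top at_top"
        by (rule filterlim_tendsto_add_at_top[OF tendsto_const filterlim_ident])
      then have "filterlim (\<lambda>s :: real. (1 + s) ^ (?m + 1)) at_top at_top"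
        by (rule filterlim_pow_at_top[rotated]) simp
      then have "((\<lambda>s :: real. - (1 / (1 + s) ^ (?m + 1))) \<longlongrightarrow> - 0) at_top"
        by (intro tendsto_minus tendsto_divide_0[OF tendsto_const] filterlim_at_top_imp_at_infinity)
      then show "((\<lambda>s :: real. - (1 / (1 + s) ^ (?m + 1))) \<longlongrightarrow> 0) at_top" by simp
    qed simp
    then show ?thesis by (simp add: f_def)
  qed
  have meas: "(\<lambda>(x :: 'm point, s). ennreal (?w s) * indicator {(norm x)\<^sup>2..} s) \<in> borel_measurable (lborel \<Otimes>\<^sub>M lborel)"
  proof -
    have "closed {p :: 'm point \<times> real. (norm (fst p))\<^sup>2 \<le> snd p}"
      by (intro closed_Collect_le continuous_intros)
    then have c [measurable]: "{p :: 'm point \<times> real. (norm (fst p))\<^sup>2 \<le> snd p} \<in> sets borel" by (rule borel_closed)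
    have "(\<lambda>p :: 'm point \<times> real. ennreal (?w (snd p)) * indicator {p. (norm (fst p))\<^sup>2 \<le> snd p} p) \<in> borel_measurable borel"
      by (intro borel_measurable_times_ennreal borel_measurable_indicator c measurable_compose[OF _ measurable_ennreal]
          borel_measurable_divide borel_measurable_const)
        (intro borel_measurable_continuous_onI continuous_intros)
    then have "(\<lambda>p :: 'm point \<times> real. ennreal (?w (snd p)) * indicator {p. (norm (fst p))\<^sup>2 \<le> snd p} p) \<in> borel_measurable (lborel \<Otimes>\<^sub>M lborel)"
      unfolding lborel_prod by (simp only: measurable_lborel1 measurable_lborel2)
    then show ?thesis by (simp add: indicator_def case_prod_unfold)
  qed
  have vol: "emeasure lborel {x :: 'm point. (norm x)\<^sup>2 \<le> s} = ennreal (?V * s ^ ?m)" if "s \<ge> 0" for s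
  proof -
    have "{x :: 'm point. (norm x)\<^sup>2 \<le> s} = cball 0 (sqrt s)"
      by (auto simp: real_le_rsqrt sqrt_le_D) (metis norm_ge_zero real_sqrt_le_iff real_sqrt_unique)
    moreover have "sqrt s ^ DIM('m point) = s ^ ?m"
      using that by (simp add: power_mult[symmetric] mult_2 power_add real_sqrt_mult_self power_mult_distrib[symmetric])
    moreover have "unit_ball_vol (real (DIM('m point))) = ?V"
    proof -
      have "DIM('m point) = 2 * ?m" by simp
      then show ?thesis by (simp only: unit_ball_vol_even)
    qed
    ultimately show ?thesis using that by (simp only: emeasure_cball[OF real_sqrt_ge_zero[OF that]])
  qed
  have "(\<integral>\<^sup>+x. ennreal (f x) \<partial>lborel) = (\<integral>\<^sup>+s. \<integral>\<^sup>+x. ennreal (?w s) * indicator {(norm (x :: 'm point))\<^sup>2..} s \<partial>lborel \<partial>lborel)"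
    unfolding f by (rule lborel_pair.Fubini'[OF meas, symmetric])
  also have "\<dots> = (\<integral>\<^sup>+s. ennreal (?w s * (?V * s ^ ?m)) * indicator {0..} s \<partial>lborel)"
  proof (rule nn_integral_cong)
    fix s :: real
    have "(\<integral>\<^sup>+x. ennreal (?w s) * indicator {(norm (x :: 'm point))\<^sup>2..} s \<partial>lborel) =
        (\<integral>\<^sup>+x. ennreal (?w s) * indicator {x :: 'm point. (norm x)\<^sup>2 \<le> s} x \<partial>lborel)"
      by (rule nn_integral_cong) (simp add: indicator_def)
    also have "\<dots> = ennreal (?w s) * emeasure lborel {x :: 'm point. (norm x)\<^sup>2 \<le> s}"
      by (rule nn_integral_cmult_indicator) measurable
    also have "\<dots> = ennreal (?w s * (?V * s ^ ?m)) * indicator {0..} s"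
    proof (cases "s \<ge> 0")
      case True
      then show ?thesis unfolding vol[OF True] by (simp add: ennreal_mult[symmetric])
    next
      case False
      have "\<not> (norm x)\<^sup>2 \<le> s" for x :: "'m point" using False zero_le_power2[of "norm x"] by linarith
      then have "{x :: 'm point. (norm x)\<^sup>2 \<le> s} = {}" by blast
      then show ?thesis using False by simp
    qed
    finally show "(\<integral>\<^sup>+x. ennreal (?w s) * indicator {(norm (x :: 'm point))\<^sup>2..} s \<partial>lborel) =
        ennreal (?w s * (?V * s ^ ?m)) * indicator {0..} s" .
  qed
  \<comment> \<open>The antiderivative is \<open>?V\<close> times the power \<open>?m + 1\<close> of
    \<open>s / (1 + s)\<close>, which grows from 0 to \<open>?V\<close>.\<close>
  also have "\<dots> = ennreal (?V - ?V * (0 / (1 + 0)) ^ (?m + 1))"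
  proof (rule nn_integral_FTC_atLeast)
    fix s :: real assume s: "0 \<le> s"
    have "((\<lambda>s. ?V * (s / (1 + s)) ^ (?m + 1)) has_real_derivative
        ?V * (real (?m + 1) * (s / (1 + s)) ^ ?m * ((1 * (1 + s) - s * 1) / ((1 + s) * (1 + s))))) (at s)"
    proof -
      have q: "((\<lambda>s. s / (1 + s)) has_real_derivative (1 * (1 + s) - s * 1) / ((1 + s) * (1 + s))) (at s)"
        by (rule DERIV_divide) (use s in \<open>auto intro!: derivative_eq_intros\<close>)
      have "?V * (real (?m + 1) * (D * r ^ (?m + 1 - Suc 0))) = ?V * (real (?m + 1) * r ^ ?m * D)" for D r :: real by simp
      then show ?thesis using DERIV_cmult[OF DERIV_power[OF q, of "?m + 1"], of ?V] by (simp only:)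
    qed
    moreover have "?V * (real (?m + 1) * (s / (1 + s)) ^ ?m * ((1 * (1 + s) - s * 1) / ((1 + s) * (1 + s)))) = ?w s * (?V * s ^ ?m)"
      using s by (simp add: power_divide field_simps)
    ultimately show "((\<lambda>s. ?V * (s / (1 + s)) ^ (?m + 1)) has_real_derivative ?w s * (?V * s ^ ?m)) (at s)" by simp
    show "0 \<le> ?w s * (?V * s ^ ?m)" using s by simp
  next
    have "filterlim (\<lambda>s :: real. 1 + s) at_top at_top"
      by (rule filterlim_tendsto_add_at_top[OF tendsto_const filterlim_ident])
    then have "((\<lambda>s :: real. 1 / (1 + s)) \<longlongrightarrow> 0) at_top"
      by (intro tendsto_divide_0[OF tendsto_const] filterlim_at_top_imp_at_infinity)
    from tendsto_diff[OF tendsto_const this] have "((\<lambda>s :: real. 1 - 1 / (1 + s)) \<longlongrightarrow> 1 - 0) at_top" .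
    then have "((\<lambda>s :: real. s / (1 + s)) \<longlongrightarrow> 1) at_top"
    proof -
      assume l: "((\<lambda>s :: real. 1 - 1 / (1 + s)) \<longlongrightarrow> 1 - 0) at_top"
      have "\<forall>\<^sub>F s :: real in at_top. 1 - 1 / (1 + s) = s / (1 + s)"
        by (rule eventually_mono[OF eventually_ge_at_top[of 0]]) (simp add: field_simps)
      from Lim_transform_eventually[OF l this] show ?thesis by simp
    qed
    from tendsto_mult[OF tendsto_const tendsto_power[OF this]]
    have "((\<lambda>s. ?V * (s / (1 + s)) ^ (?m + 1)) \<longlongrightarrow> ?V * 1 ^ (?m + 1)) at_top" .
    then show "((\<lambda>s. ?V * (s / (1 + s)) ^ (?m + 1)) \<longlongrightarrow> ?V) at_top" by simp
  qed simp
  finally have nn: "(\<integral>\<^sup>+x. ennreal (f x) \<partial>lborel) = ennreal ?V" by simp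
  have fm: "f \<in> borel_measurable lborel" unfolding f_def by measurable
  have f0: "0 \<le> f x" for x unfolding f_def by simp
  show "integrable lborel f"
    by (rule integrableI_nonneg[OF fm]) (simp_all add: f0 nn)
  have "(LINT x|lborel. f x) = enn2real (\<integral>\<^sup>+x. ennreal (f x) \<partial>lborel)"
    by (rule integral_eq_nn_integral[OF fm]) (simp add: f0)
  then show "(LINT x|lborel. f x) = ?V" unfolding nn by simp
qed

lemma integral_scale_shift:
  fixes F :: "'a::euclidean_space \<Rightarrow> complex"
  assumes F: "F \<in> borel_measurable borel" and c: "c > 0"
  shows "(LINT x|lborel. F x) = c ^ DIM('a) *\<^sub>R (LINT z|lborel. F (y + c *\<^sub>R z))"
proof -
  have "(LINT x|lborel. F x) = (LINT x|density (distr lborel borel (\<lambda>z. y + c *\<^sub>R z)) (\<lambda>_. \<bar>c\<bar> ^ DIM('a)). F x)"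
    using lborel_affine[of c y] c by simp
  also have "\<dots> = (LINT x|distr lborel borel (\<lambda>z. y + c *\<^sub>R z). \<bar>c\<bar> ^ DIM('a) *\<^sub>R F x)"
    by (rule integral_density) (use F in auto)
  also have "\<dots> = (LINT z|lborel. \<bar>c\<bar> ^ DIM('a) *\<^sub>R F (y + c *\<^sub>R z))"
    by (rule integral_distr) (use F in auto)
  finally show ?thesis using c by simp
qed

text \<open>The substitution x = y + sqrt(t) z has Jacobian t^m, which together with the factor t
  cancels the scaling of the denominator. What remains is a fixed integrable kernel times a function
  tending to \<open>f y\<close>, or to 0 if \<open>d > 0\<close>.\<close>

lemma approximate_identity:
  fixes f :: "'m::finite point \<Rightarrow> complex"
  assumes f: "continuous_on UNIV f" and C: "compact C" "\<And>x. x \<notin> C \<Longrightarrow> f x = 0"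
    and e: "\<And>j. e j > 0" "\<And>j. e j \<le> 1" "e \<longlonglongrightarrow> 0"
  shows "(\<lambda>j. LINT x|lborel. complex_of_real (e j / ((norm (x - y))\<^sup>2 + e j) ^ (CARD('m) + 1) * ((norm (x - y))\<^sup>2 + e j) ^ d) * f x)
    \<longlonglongrightarrow> complex_of_real (pi ^ CARD('m) / fact CARD('m)) * (if d = 0 then f y else 0)"
proof -
  let ?m = "CARD('m)"
  let ?k = "\<lambda>z :: 'm point. 1 / (1 + (norm z)\<^sup>2) ^ (?m + 1)"
  let ?g = "\<lambda>t x. complex_of_real (((norm (x - y))\<^sup>2 + t) ^ d) * f x"
  \<comment> \<open>The value 1 bounds all \<open>e j\<close>, so this yields one bound for every
    parameter.\<close>
  have "continuous_on C (\<lambda>x. complex_of_real (((norm (x - y))\<^sup>2 + 1) ^ d) * f x)"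
    by (intro continuous_intros continuous_on_subset[OF f]) auto
  then have "bounded ((\<lambda>x. complex_of_real (((norm (x - y))\<^sup>2 + 1) ^ d) * f x) ` C)"
    by (intro compact_imp_bounded compact_continuous_image C)
  then obtain M where M: "\<And>x. x \<in> C \<Longrightarrow> norm (complex_of_real (((norm (x - y))\<^sup>2 + 1) ^ d) * f x) \<le> M"
    by (auto simp: bounded_iff)
  have bound: "norm (?g t x) \<le> max M 0" if t: "0 < t" "t \<le> 1" for t x
  proof (cases "x \<in> C")
    case True
    have "((norm (x - y))\<^sup>2 + t) ^ d \<le> ((norm (x - y))\<^sup>2 + 1) ^ d" using t by (intro power_mono) auto
    then have "norm (?g t x) \<le> norm (complex_of_real (((norm (x - y))\<^sup>2 + 1) ^ d) * f x)"
      unfolding norm_mult norm_of_real using t by (intro mult_right_mono) auto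
    then show ?thesis using M[OF True] by linarith
  qed (simp add: C(2))
  have eq: "(LINT x|lborel. complex_of_real (t / ((norm (x - y))\<^sup>2 + t) ^ (?m + 1) * ((norm (x - y))\<^sup>2 + t) ^ d) * f x)
      = (LINT z|lborel. complex_of_real (?k z) * ?g t (y + sqrt t *\<^sub>R z))" if t: "t > 0" for t
  proof -
    let ?F = "\<lambda>x. complex_of_real (t / ((norm (x - y))\<^sup>2 + t) ^ (?m + 1) * ((norm (x - y))\<^sup>2 + t) ^ d) * f x"
    have nz: "(norm (x - y))\<^sup>2 + t > 0" for x using t by (simp add: add_nonneg_pos)
    have "continuous_on UNIV ?F"
      using nz by (intro continuous_intros f) (metis less_numeral_extra(3) power_not_zero)
    then have "(LINT x|lborel. ?F x) = sqrt t ^ DIM('m point) *\<^sub>R (LINT z|lborel. ?F (y + sqrt t *\<^sub>R z))"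
      using t by (intro integral_scale_shift borel_measurable_continuous_onI) auto
    also have "\<dots> = (LINT z|lborel. sqrt t ^ DIM('m point) *\<^sub>R ?F (y + sqrt t *\<^sub>R z))" by simp
    also have "\<dots> = (LINT z|lborel. complex_of_real (?k z) * ?g t (y + sqrt t *\<^sub>R z))"
    proof (rule arg_cong[where f = "integral\<^sup>L lborel"], rule ext)
      fix z :: "'m point"
      have s: "sqrt t ^ DIM('m point) = t ^ ?m"
        using t by (simp add: mult_2 power_add power_mult_distrib[symmetric])
      have n: "(norm (y + sqrt t *\<^sub>R z - y))\<^sup>2 = t * (norm z)\<^sup>2" using t by (simp add: power_mult_distrib)
      have "t * (norm z)\<^sup>2 + t = t * (1 + (norm z)\<^sup>2)" by (simp add: algebra_simps)
      then have "t ^ ?m * (t / (t * (norm z)\<^sup>2 + t) ^ (?m + 1)) = ?k z"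
        using t by (simp add: power_mult_distrib)
      then have "t ^ ?m * (t / (t * (norm z)\<^sup>2 + t) ^ (?m + 1) * (t * (norm z)\<^sup>2 + t) ^ d) = ?k z * (t * (norm z)\<^sup>2 + t) ^ d"
        by (simp only: mult.assoc[symmetric])
      then have "complex_of_real (t ^ ?m) * complex_of_real (t / (t * (norm z)\<^sup>2 + t) ^ (?m + 1) * (t * (norm z)\<^sup>2 + t) ^ d)
          = complex_of_real (?k z) * complex_of_real ((t * (norm z)\<^sup>2 + t) ^ d)"
        by (simp only: of_real_mult[symmetric])
      then show "sqrt t ^ DIM('m point) *\<^sub>R ?F (y + sqrt t *\<^sub>R z) = complex_of_real (?k z) * ?g t (y + sqrt t *\<^sub>R z)"
        unfolding s n scaleR_conv_of_real[of "t ^ ?m"] mult.assoc[symmetric] by (simp only:)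
    qed
    finally show ?thesis .
  qed
  have "(\<lambda>j. LINT z|lborel. complex_of_real (?k z) * ?g (e j) (y + sqrt (e j) *\<^sub>R z))
    \<longlonglongrightarrow> (LINT z|lborel. complex_of_real (?k z) * (if d = 0 then f y else 0))"
  proof (rule integral_dominated_convergence[where w = "\<lambda>z. ?k z * max M 0"])
    show "integrable lborel (\<lambda>z :: 'm point. ?k z * max M 0)"
      by (intro integrable_mult_left approximate_identity_mass)
    have kc: "continuous_on UNIV (\<lambda>z :: 'm point. complex_of_real (?k z))"
      by (intro continuous_intros) (metis add_nonneg_eq_0_iff power_not_zero zero_le_one zero_le_power2 zero_neq_one)
    have fc: "continuous_on UNIV (\<lambda>z. f (y + sqrt (e j) *\<^sub>R z))" for j
      by (rule continuous_on_compose2[OF f]) (auto intro!: continuous_intros)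
    show "(\<lambda>z. complex_of_real (?k z) * (if d = 0 then f y else 0)) \<in> borel_measurable lborel"
      using borel_measurable_continuous_onI[OF continuous_on_mult[OF kc continuous_on_const[of UNIV "if d = 0 then f y else 0"]]]
      by (simp only: measurable_lborel1 measurable_lborel2)
    show "(\<lambda>z. complex_of_real (?k z) * ?g (e j) (y + sqrt (e j) *\<^sub>R z)) \<in> borel_measurable lborel" for j
      by (simp only: measurable_lborel1 measurable_lborel2, intro borel_measurable_continuous_onI continuous_on_mult kc fc)
         (intro continuous_intros)
    show "AE z in lborel. (\<lambda>j. complex_of_real (?k z) * ?g (e j) (y + sqrt (e j) *\<^sub>R z))
        \<longlonglongrightarrow> complex_of_real (?k z) * (if d = 0 then f y else 0)"
    proof (rule AE_I2)
      fix z :: "'m point"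
      have "(\<lambda>j. y + sqrt (e j) *\<^sub>R z) \<longlonglongrightarrow> y + sqrt 0 *\<^sub>R z" by (intro tendsto_intros e(3))
      then have l: "(\<lambda>j. y + sqrt (e j) *\<^sub>R z) \<longlonglongrightarrow> y" by simp
      have fl: "(\<lambda>j. f (y + sqrt (e j) *\<^sub>R z)) \<longlonglongrightarrow> f y"
        by (rule isCont_tendsto_compose[where g = f, OF _ l]) (use f in \<open>simp add: continuous_on_eq_continuous_at\<close>)
      have "(\<lambda>j. ((norm (y + sqrt (e j) *\<^sub>R z - y))\<^sup>2 + e j) ^ d) \<longlonglongrightarrow> ((norm (y - y))\<^sup>2 + 0) ^ d"
        by (intro tendsto_intros l e(3))
      then have "(\<lambda>j. ?g (e j) (y + sqrt (e j) *\<^sub>R z)) \<longlonglongrightarrow> complex_of_real (((norm (y - y))\<^sup>2 + 0) ^ d) * f y"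
        by (intro tendsto_mult tendsto_of_real fl)
      then show "(\<lambda>j. complex_of_real (?k z) * ?g (e j) (y + sqrt (e j) *\<^sub>R z))
        \<longlonglongrightarrow> complex_of_real (?k z) * (if d = 0 then f y else 0)"
        by (intro tendsto_mult tendsto_const) (auto simp: power_0_left)
    qed
    show "AE z in lborel. norm (complex_of_real (?k z) * ?g (e j) (y + sqrt (e j) *\<^sub>R z)) \<le> ?k z * max M 0" for j
    proof (rule AE_I2)
      fix z :: "'m point"
      have "norm (complex_of_real (?k z)) = ?k z" unfolding norm_of_real by (rule abs_of_nonneg) simp
      then show "norm (complex_of_real (?k z) * ?g (e j) (y + sqrt (e j) *\<^sub>R z)) \<le> ?k z * max M 0"
        unfolding norm_mult[of "complex_of_real (?k z)"] by (simp only:) (intro mult_left_mono bound e, simp)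
    qed
  qed
  moreover have "(LINT z|lborel. complex_of_real (?k z) * (if d = 0 then f y else 0)) =
      complex_of_real (pi ^ ?m / fact ?m) * (if d = 0 then f y else 0)"
    by (simp only: integral_mult_left_zero integral_complex_of_real approximate_identity_mass(2))
  ultimately show ?thesis unfolding eq[OF e(1)] by (simp only:)
qed

text \<open>\<open>f\<close> vanishes near \<open>y\<close>, so only arguments of \<open>pw\<close>
  in a compact subset of the positive half-line count; a bound there dominates all integrands,
  whatever the exponent.\<close>

lemma regular_part_limit:
  fixes f :: "'m::finite point \<Rightarrow> complex"
  assumes f: "continuous_on UNIV f" and C: "compact C" "\<And>x. x \<notin> C \<Longrightarrow> f x = 0"
    and W: "open W" "y \<in> W" "\<And>x. x \<in> W \<Longrightarrow> f x = 0"
    and e: "\<And>j. e j > 0" "\<And>j. e j \<le> 1" "e \<longlonglongrightarrow> 0"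
  shows "(\<lambda>j. LINT x|lborel. pw q k ((norm (x - y))\<^sup>2 + e j) * f x) \<longlonglongrightarrow> (LINT x|lborel. pw q k ((norm (x - y))\<^sup>2) * f x)"
proof -
  obtain r where r: "r > 0" "cball y r \<subseteq> W" using W open_contains_cball by blast
  have "compact (C - ball y r)" by (intro compact_diff C) auto
  let ?K = "(\<lambda>(x, t). (norm (x - y))\<^sup>2 + t) ` ((C - ball y r) \<times> {0..1::real})"
  have K: "compact ?K"
    by (intro compact_continuous_image compact_Times compact_diff C) (auto intro!: continuous_intros simp: case_prod_unfold)
  have Kpos: "s > 0" if "s \<in> ?K" for s
  proof -
    obtain x t where x: "x \<in> C - ball y r" "t \<ge> 0" "s = (norm (x - y))\<^sup>2 + t" using \<open>s \<in> ?K\<close> by auto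
    then have "norm (x - y) > 0" using r(1) by auto
    then show ?thesis using x by (simp add: add_pos_nonneg)
  qed
  have pc: "continuous_on {0<..} (pw q k)" by (rule smooth_on_continuous[OF pw_smooth])
  have "bounded (pw q k ` ?K)"
    by (intro compact_imp_bounded compact_continuous_image K continuous_on_subset[OF pc]) (use Kpos in auto)
  then obtain M where "\<forall>v \<in> pw q k ` ?K. norm v \<le> M" unfolding bounded_iff ..
  then have M: "\<And>s. s \<in> ?K \<Longrightarrow> norm (pw q k s) \<le> M" by (rule bspec[OF _ imageI])
  have fz: "f x = 0" if "x \<notin> C - ball y r" for x
  proof (cases "x \<in> C")
    case True
    then have "x \<in> W" using that r(2) ball_subset_cball by blast
    then show ?thesis by (rule W(3))
  qed (rule C(2))
  have pm: "pw q k \<in> borel_measurable borel"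
    unfolding pw_def[abs_def] by measurable
  have fm: "f \<in> borel_measurable borel" by (rule borel_measurable_continuous_onI[OF f])
  show ?thesis
  proof (rule integral_dominated_convergence[where w = "\<lambda>x. M * norm (f x)"])
    show "(\<lambda>x. pw q k ((norm (x - y))\<^sup>2) * f x) \<in> borel_measurable lborel"
      "(\<lambda>x. pw q k ((norm (x - y))\<^sup>2 + e j) * f x) \<in> borel_measurable lborel" for j
      using pm fm by measurable
    have "integrable lborel f" by (rule test_function_integrable[OF f C])
    then show "integrable lborel (\<lambda>x. M * norm (f x))" by simp
    show "AE x in lborel. (\<lambda>j. pw q k ((norm (x - y))\<^sup>2 + e j) * f x) \<longlonglongrightarrow> pw q k ((norm (x - y))\<^sup>2) * f x"
    proof (rule AE_I2)
      fix x
      show "(\<lambda>j. pw q k ((norm (x - y))\<^sup>2 + e j) * f x) \<longlonglongrightarrow> pw q k ((norm (x - y))\<^sup>2) * f x"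
      proof (cases "x \<in> C - ball y r")
        case True
        have "(norm (x - y))\<^sup>2 + 0 \<in> ?K" using True by (intro image_eqI[of _ _ "(x, 0)"]) auto
        then have "(norm (x - y))\<^sup>2 > 0" using Kpos by force
        then have "isCont (pw q k) ((norm (x - y))\<^sup>2)" using pc by (simp add: continuous_on_eq_continuous_at)
        moreover have "(\<lambda>j. (norm (x - y))\<^sup>2 + e j) \<longlonglongrightarrow> (norm (x - y))\<^sup>2 + 0" by (intro tendsto_intros e(3))
        ultimately show ?thesis by (intro tendsto_mult tendsto_const) (rule isCont_tendsto_compose[where g = "pw q k"], simp_all)
      qed (simp add: fz)
    qed
    show "AE x in lborel. norm (pw q k ((norm (x - y))\<^sup>2 + e j) * f x) \<le> M * norm (f x)" for j
    proof (rule AE_I2)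
      fix x
      show "norm (pw q k ((norm (x - y))\<^sup>2 + e j) * f x) \<le> M * norm (f x)"
      proof (cases "x \<in> C - ball y r")
        case True
        have "(norm (x - y))\<^sup>2 + e j \<in> ?K"
          using True e(1)[of j] e(2)[of j] by (intro image_eqI[of _ _ "(x, e j)"]) auto
        then show ?thesis unfolding norm_mult by (intro mult_right_mono M) auto
      qed (simp add: fz)
    qed
  qed
qed

context kernel
begin

lemma nf_pos: "e > 0 \<Longrightarrow> gbody (nf e x) > 0"
  by (simp add: gbody_nf add_nonneg_pos)

lemma nf_zero_pos: "x \<noteq> y \<Longrightarrow> gbody (nf 0 x) > 0"
  by (simp add: gbody_nf)

lemma gnil_nf_power: "gnil (nf e x) ^ Suc n = 0"
  using even_superfunction.g_nil[OF even_superfunction_nf[OF open_UNIV]] .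

lemma pw_nf_smooth: assumes "open S" "\<And>x. x \<in> S \<Longrightarrow> gbody (nf e x) > 0"
  shows "smooth_on S (\<lambda>x. pw q j (gbody (nf e x)))"
  unfolding gbody_nf
  by (rule smooth_on_compose_real[of S "{0<..}", OF assms(1) open_greaterThan _ pw_smooth])
     (use assms(2) smooth_on_subset[OF norm_shift_smooth open_UNIV assms(1)] in \<open>auto simp: gbody_nf\<close>)

lemma sf_ee: assumes "open S" "\<And>x. x \<in> S \<Longrightarrow> gbody (nf e x) > 0" shows "sf S (ee q e)"
  unfolding ee_def[abs_def]
  by (rule even_superfunction.sf_gcomp[OF even_superfunction_nf[OF assms(1)] pw_nf_smooth[OF assms]])

lemma ee_central: "ee q e x * v = v * ee q e x"
  unfolding ee_def by (rule gembed_even_central[OF ginv_gcomp[OF ginv_nf]])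

lemma ee_step: assumes "gbody (nf e x) > 0"
  shows "ee q e x = gembed (nf e x) * ee (q - 1) e x"
  unfolding ee_def gcomp_pw_mult[OF assms nf_body gnil_nf_power, of q] by simp

lemma dop_ee:
  assumes e: "e > 0"
  shows "dop n a b (ee q e) x = sscal (of_real q) * ee (q - 1) e x * dop n a b (\<lambda>x. gembed (nf e x)) x"
proof -
  have p: "gbody (nf e x) > 0" for x by (rule nf_pos[OF e])
  have "gcomp n (\<lambda>j. pw q (Suc j)) (nf e x) = gconst (of_real q) * gcomp n (pw (q - 1)) (nf e x)"
    unfolding pw_Suc[abs_def] by (rule gcomp_cmult)
  then have "(gembed (gcomp n (\<lambda>j. pw q (Suc j)) (nf e x)) :: 'm clifford grass) = sscal (of_real q) * ee (q - 1) e x"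
    unfolding ee_def by (simp add: gembed_simps)
  moreover have "dop n a b (\<lambda>x. gembed (gcomp n (pw q) (nf e x))) x =
      (gembed (gcomp n (\<lambda>j. pw q (Suc j)) (nf e x)) * dop n a b (\<lambda>x. gembed (nf e x)) x :: 'm clifford grass)"
    by (rule even_superfunction.dop_gcomp[OF even_superfunction_nf[OF open_UNIV] UNIV_I, where th = "pw q"])
      (rule pw_nf_smooth[OF open_UNIV p], rule pw_has_derivative[OF p])
  ultimately show ?thesis unfolding ee_def[abs_def] by (simp only:)
qed

lemma rop_ee:
  assumes e: "e > 0" and P: "sf UNIV P"
  shows "rop n a b (\<lambda>x. P x * ee q e x) x = ee q e x * rop n a b P x
    + sscal (of_real q) * ee (q - 1) e x * (P x * dop n a b (\<lambda>x. gembed (nf e x)) x)"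
proof -
  have E: "sf UNIV (ee q e)" by (rule sf_ee[OF open_UNIV nf_pos[OF e]])
  have "rop n a b (\<lambda>x. P x * ee q e x) x = ee q e x * rop n a b P x + P x * dop n a b (ee q e) x"
    using rop_mult[OF open_UNIV UNIV_I P E[unfolded ee_def[abs_def]] ginv_gcomp[OF ginv_nf], of n a b x]
    unfolding ee_def[abs_def] .
  also have "P x * dop n a b (ee q e) x = sscal (of_real q) * ee (q - 1) e x * (P x * dop n a b (\<lambda>x. gembed (nf e x)) x)"
    unfolding dop_ee[OF e] mult.assoc sscal_left_commute[of "P x"]
    by (simp only: mult.assoc[symmetric] ee_central[of _ _ _ "P x"])
  finally show ?thesis .
qed

text \<open>For this \<open>q\<close> the linear factors contribute \<open>- q\<close> times the
  power, that is, by \<open>ee_step\<close>, \<open>- q\<close> times \<open>nf e\<close> times the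
  next lower power. The derivative of the power contributes \<open>q\<close> times
  \<open>nf 0\<close> times the same, and the two norms differ by \<open>e\<close>. In the second
  sum only squares of the vector variables occur.\<close>

lemma rop_kernel:
  assumes e: "e > 0" and q: "q = - (real CARD('m) - real n)"
  shows "rop n aZ bZ (\<lambda>x. zv x * ee q e x) x + rop n aZd bZd (\<lambda>x. zd x * ee q e x) x
      = sscal (of_real (- q * e)) * ee (q - 1) e x"
    and "rop n aZd bZd (\<lambda>x. zv x * ee q e x) x + rop n aZ bZ (\<lambda>x. zd x * ee q e x) x = 0"
proof -
  note r = rop_ee[OF e sf_zv] rop_ee[OF e sf_zd]
  let ?E = "ee q e x" and ?E' = "ee (q - 1) e x"
  have nf: "gembed (nf e x) = gembed (nf 0 x) + (sscal (of_real e) :: 'm clifford grass)"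
    by (simp add: nf_def gconst_add sscal_simps(3))
  have M: "(of_nat CARD('m) - of_nat n :: complex) = of_real (- q)" unfolding q by simp
  have "rop n aZ bZ (\<lambda>x. zv x * ee q e x) x + rop n aZd bZd (\<lambda>x. zd x * ee q e x) x
      = ?E * (rop n aZ bZ zv x + rop n aZd bZd zd x) + sscal (of_real q) * ?E' * (zv x * zd x + zd x * zv x)"
    unfolding r dop_nf by (simp only: distrib_left add_ac)
  also have "\<dots> = sscal (of_real (- q)) * (gembed (nf e x) * ?E') + sscal (of_real q) * (gembed (nf 0 x) * ?E')"
    unfolding rop_zv z_relations M sscal_commute[of _ ?E, symmetric] ee_step[OF nf_pos[OF e], of q]
    by (simp only: mult.assoc ee_central sscal_left_commute[of "gembed (nf e x)"])
  also have "\<dots> = sscal (of_real (- q * e)) * ?E'"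
    unfolding nf distrib_right distrib_left
    by (simp add: sscal_simps mult.assoc)
  finally show "rop n aZ bZ (\<lambda>x. zv x * ee q e x) x + rop n aZd bZd (\<lambda>x. zd x * ee q e x) x
      = sscal (of_real (- q * e)) * ?E'" .
  show "rop n aZd bZd (\<lambda>x. zv x * ee q e x) x + rop n aZ bZ (\<lambda>x. zd x * ee q e x) x = 0"
    unfolding r dop_nf rop_zv z_relations by simp
qed

end

subsection \<open>The Berezin integral as evaluation\<close>

lemma gderiv_prod_thd_notin: "j \<notin> set js \<Longrightarrow> gderiv_left (XV j) (prod_list (map thd js)) = 0"
proof (induction js)
  case Nil
  show ?case using gderiv_left_const[of "XV j" 1] by simp
next
  case (Cons i js)
  then show ?case by (simp add: left_diff_distrib gderiv_left_gvar_times)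
qed

lemma fold_gderiv_prod_thd:
  "distinct js \<Longrightarrow> fold (\<lambda>j. gderiv_left (XV j)) js (prod_list (map thd js)) = (1 :: complex grass)"
proof (induction js)
  case (Cons j js)
  then show ?case by (simp add: left_diff_distrib gderiv_left_gvar_times gderiv_prod_thd_notin)
qed simp

lemma fold_gderiv_gembed:
  "fold (\<lambda>j. gderiv_left (XV j)) js (gembed F) = gembed (fold (\<lambda>j. gderiv_left (XV j)) js F)"
  by (induction js arbitrary: F) (simp_all only: fold_simps gderiv_left_gembed)

lemma berezin_tprod: "berezin n (gembed (tprod n)) = (sscal (1 / complex_of_real (pi ^ n)) :: 'm::finite clifford grass)"
  unfolding berezin_def tprod_def fold_gderiv_gembed fold_gderiv_prod_thd[OF distinct_upt] by (simp only: gembed_simps mult_1_right)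

lemma ginv_tprod: "ginv (tprod k) = tprod k"
proof (induction k)
  case 0
  show ?case by (simp add: tprod_def)
next
  case (Suc k)
  have "ginv (thd i * thd j) = thd i * thd j" for i j by (simp only: ginv_mult ginv_thd minus_mult_minus)
  then show ?case unfolding tprod_Suc ginv_mult[of "tprod k"] Suc by simp
qed

text \<open>The factor \<open>thd j\<close> is repeated; moved next to its copy it squares to zero.
  So multiplication by the product identifies \<open>XV j\<close> with \<open>YV j\<close>, as a
  delta function would.\<close>

lemma prod_thd_annihilates: "j \<in> set js \<Longrightarrow> prod_list (map thd js) * thd j = (0 :: complex grass)"
proof (induction js)
  case (Cons i js)
  show ?case
  proof (cases "j \<in> set js")
    case True
    then show ?thesis using Cons.IH by (simp only: list.map prod_list.Cons mult.assoc mult_zero_right)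
  next
    case False
    then have "i = j" using Cons.prems by simp
    moreover have "prod_list (map thd js) * thd j = thd j * ginv (prod_list (map thd js) :: complex grass)"
      using grass_odd_commute[OF ginv_thd, of j "ginv (prod_list (map thd js))"] by (simp only: ginv_ginv)
    moreover have "thd j * (thd j * F) = 0" for F :: "complex grass"
      unfolding mult.assoc[symmetric] thd_square mult_zero_left ..
    ultimately show ?thesis by (simp only: list.map prod_list.Cons mult.assoc)
  qed
qed simp

definition yvars :: "gvar set \<Rightarrow> gvar set" where "yvars A = {YV j |j. XV j \<in> A}"

lemma subst_y_simps:
  "subst_y (F + G) = subst_y F + subst_y G" "subst_y 0 = 0" "subst_y (gconst c * F) = gconst c * subst_y F"
  by (rule grass_eqI', simp add: subst_y.rep_eq)+

lemma subst_y_sum: "subst_y (\<Sum>i\<in>I. F i) = (\<Sum>i\<in>I. subst_y (F i))"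
  by (induction I rule: infinite_finite_induct) (auto simp: subst_y_simps)

lemma finite_yvars: "finite A \<Longrightarrow> finite (yvars A)"
  by (rule finite_subset[of _ "(\<lambda>v. case v of XV j \<Rightarrow> YV j | YV j \<Rightarrow> YV j) ` A"])
     (auto simp: yvars_def image_iff split: gvar.splits)

lemma subst_y_gmono:
  assumes "finite A" "A \<subseteq> range XV" shows "subst_y (gmono A) = gmono (yvars A)"
proof (rule grass_eqI')
  fix B
  have "B \<subseteq> range YV \<and> to_xvar ` B = A \<longleftrightarrow> B = yvars A"
  proof
    assume B: "B \<subseteq> range YV \<and> to_xvar ` B = A"
    show "B = yvars A"
    proof (intro equalityI subsetI)
      fix v assume v: "v \<in> B"
      with B obtain j where j: "v = YV j" by blast
      have "to_xvar v \<in> A" using v B by blast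
      then show "v \<in> yvars A" by (simp add: yvars_def j)
    next
      fix v assume "v \<in> yvars A"
      then obtain j where j: "v = YV j" "XV j \<in> A" by (auto simp: yvars_def)
      then obtain b where b: "b \<in> B" "XV j = to_xvar b" using B by blast
      moreover obtain k where "b = YV k" using b(1) B by blast
      ultimately show "v \<in> B" by (simp add: j)
    qed
  next
    assume B: "B = yvars A"
    have "to_xvar ` yvars A = A"
    proof (intro equalityI subsetI)
      fix v assume "v \<in> A"
      then obtain j where j: "v = XV j" "YV j \<in> yvars A" using assms(2) by (auto simp: yvars_def)
      show "v \<in> to_xvar ` yvars A" by (rule image_eqI[OF _ j(2)]) (simp add: j)
    qed (auto simp: yvars_def)
    then show "B \<subseteq> range YV \<and> to_xvar ` B = A" using B by (auto simp: yvars_def)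
  qed
  then show "gcoeff (subst_y (gmono A)) B = gcoeff (gmono (yvars A)) B"
    using assms(1) finite_yvars[OF assms(1)] by (auto simp: subst_y.rep_eq gmono.rep_eq)
qed

lemma grass_expand_vars:
  assumes "\<And>A. gcoeff F A \<noteq> 0 \<Longrightarrow> A \<subseteq> V" "finite V"
  shows "F = (\<Sum>A\<in>Pow V. gconst (gcoeff F A) * gmono A)"
proof (rule grass_eqI')
  fix A
  have "(\<Sum>B\<in>Pow V. gcoeff F B * gcoeff (gmono B) A) = (\<Sum>B\<in>Pow V. if B = A then gcoeff F A else 0)"
    by (rule sum.cong[OF refl]) (use assms(2) in \<open>auto simp: gmono.rep_eq finite_subset\<close>)
  also have "\<dots> = gcoeff F A" using assms by (auto simp: sum.delta)
  finally show "gcoeff F A = gcoeff (\<Sum>A\<in>Pow V. gconst (gcoeff F A) * gmono A) A"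
    by (simp add: gcoeff_sum)
qed

text \<open>Variables are replaced one at a time. Passing from \<open>XV j\<close> to
  \<open>YV j\<close> preserves the order, so the replaced variables form an ordered monomial again
  and no sign arises.\<close>

lemma tprod_gmono:
  fixes n :: nat
  defines "T \<equiv> gembed (tprod n) :: 'm::finite clifford grass"
  assumes "finite A" "A \<subseteq> xvars n"
  shows "T * gmono A = T * gmono (yvars A)"
  using assms(2,3)
proof (induction A rule: finite_linorder_min_induct)
  case empty
  show ?case by (simp add: yvars_def)
next
  case (insert v A)
  have c: "T * F = F * T" for F unfolding T_def by (rule gembed_even_central[OF ginv_tprod])
  obtain j where j: "v = XV j" "j \<in> {1..2 * n}" using insert.prems by auto
  have "tprod n * thd j = 0" unfolding tprod_def by (rule prod_thd_annihilates) (use j in auto)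
  then have "(gembed (tprod n * thd j) :: 'm clifford grass) = 0" by simp
  then have t: "T * gvar (XV j) = T * gvar (YV j)"
    unfolding gembed_mult T_def by (simp add: right_diff_distrib)
  have y: "yvars (insert v A) = insert (YV j) (yvars A)" by (auto simp: yvars_def j)
  have lt: "\<forall>w\<in>yvars A. YV j < w" using insert(2) by (auto simp: yvars_def j less_gvar_def)
  have "T * gmono (insert v A) = T * gvar (XV j) * gmono A"
    unfolding gmono_insert[OF insert(1,2)] unfolding j(1) mult.assoc ..
  also have "\<dots> = gvar (YV j) * (T * gmono A)" unfolding t c[of "gvar (YV j)"] mult.assoc ..
  also have "T * gmono A = T * gmono (yvars A)" using insert by simp
  also have "gvar (YV j) * (T * gmono (yvars A)) = T * (gvar (YV j) * gmono (yvars A))"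
    unfolding mult.assoc[symmetric] c[of "gvar (YV j)"] ..
  finally show ?case unfolding y gmono_insert[OF finite_yvars[OF insert(1)] lt] .
qed

lemma xfree_subst_y: "xfree (subst_y F)"
  unfolding xfree_def by (intro allI grass_eqI') (auto simp: gderiv_left.rep_eq subst_y.rep_eq)

text \<open>Next to \<open>tprod n\<close> the element \<open>F\<close> may be replaced by
  \<open>subst_y F\<close>, which is constant for the Berezin integral; the integral of
  \<open>tprod n\<close> itself is the normalising factor.\<close>

lemma berezin_tprod_mult:
  assumes F: "\<And>A. gcoeff F A \<noteq> 0 \<Longrightarrow> A \<subseteq> xvars n"
  shows "berezin n (gembed (tprod n) * F) = sscal (1 / complex_of_real (pi ^ n)) * subst_y (F :: 'm::finite clifford grass)"
proof -
  let ?T = "gembed (tprod n) :: 'm clifford grass"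
  have c: "?T * F = F * ?T" for F by (rule gembed_even_central[OF ginv_tprod])
  have s: "subst_y F = (\<Sum>A\<in>Pow (xvars n). gconst (gcoeff F A) * gmono (yvars A))"
  proof -
    have "subst_y F = subst_y (\<Sum>A\<in>Pow (xvars n). gconst (gcoeff F A) * gmono A)"
      using grass_expand_vars[of F "xvars n"] F by simp
    also have "\<dots> = (\<Sum>A\<in>Pow (xvars n). gconst (gcoeff F A) * gmono (yvars A))"
      unfolding subst_y_sum subst_y_simps
      by (rule sum.cong[OF refl], subst subst_y_gmono) (auto intro: finite_subset)
    finally show ?thesis .
  qed
  have l: "?T * (gconst w * v) = gconst w * (?T * v)" for w v
    unfolding mult.assoc[symmetric] c[of "gconst w"] ..
  have "?T * F = ?T * (\<Sum>A\<in>Pow (xvars n). gconst (gcoeff F A) * gmono A)"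
    using grass_expand_vars[of F "xvars n"] F by simp
  also have "\<dots> = (\<Sum>A\<in>Pow (xvars n). gconst (gcoeff F A) * (?T * gmono A))"
    unfolding sum_distrib_left l ..
  also have "\<dots> = (\<Sum>A\<in>Pow (xvars n). gconst (gcoeff F A) * (?T * gmono (yvars A)))"
  proof (rule sum.cong[OF refl])
    fix A assume "A \<in> Pow (xvars n)"
    then have "A \<subseteq> xvars n" "finite A" by (auto intro: finite_subset)
    then show "gconst (gcoeff F A) * (?T * gmono A) = gconst (gcoeff F A) * (?T * gmono (yvars A))"
      by (simp only: tprod_gmono[OF \<open>finite A\<close> \<open>A \<subseteq> xvars n\<close>])
  qed
  also have "\<dots> = ?T * subst_y F" unfolding s sum_distrib_left l ..
  finally have "?T * F = subst_y F * ?T" unfolding c[of "subst_y F"] .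
  then show ?thesis
    by (simp only: berezin_xfree[OF xfree_subst_y] berezin_tprod sscal_commute[symmetric])
qed

context kernel
begin

lemma clin_berezin: "clin L \<Longrightarrow> clin (\<lambda>v. L (berezin n v))"
  by (rule clin_comp[OF _ clin_op_berezin])

text \<open>The expansion separates scalar radial powers from coefficients that do not involve
  \<open>e\<close>, so both limits below become statements about complex functions.\<close>

lemma ee_expand:
  assumes L: "clin L"
  shows "L (berezin n (ee q e x * v)) =
    (\<Sum>k\<le>n. pw q k ((norm (x - y))\<^sup>2 + e) * L (berezin n (sscal (1 / fact k) * (gembed (- tsum n) ^ k * v))))"
proof -
  have "ee q e x * v = (\<Sum>k\<le>n. sscal (pw q k ((norm (x - y))\<^sup>2 + e)) * (sscal (1 / fact k) * (gembed (- tsum n) ^ k * v)))"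
    unfolding ee_def gembed_gcomp gnil_nf gbody_nf sum_distrib_right
    by (rule sum.cong[OF refl]) (simp only: mult.assoc[symmetric] sscal_simps(4)[symmetric] times_divide_eq_right mult_1_right)
  then show ?thesis
    by (simp only: clin_sum[OF clin_berezin[OF L]] clin_scal[OF clin_berezin[OF L]])
qed

lemma coefficient_smooth:
  assumes L: "clin L" and V: "sf UNIV V"
  shows "smooth_on UNIV (\<lambda>x. L (berezin n (sscal (1 / fact k) * (gembed (- tsum n) ^ k * V x))))"
  by (rule clin_smooth[OF open_UNIV clin_berezin[OF L]]) (intro sf_mult sf_const V open_UNIV)

text \<open>For parameter 0 the radial powers may be singular at \<open>y\<close>, but
  \<open>V\<close> vanishes on a neighbourhood, so every term stays integrable and
  converges.\<close>

lemma ee_limit: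
  assumes L: "clin L" and V: "sf UNIV V" and C: "compact C" "\<And>x. x \<notin> C \<Longrightarrow> V x = 0"
    and W: "open W" "y \<in> W" "\<And>x. x \<in> W \<Longrightarrow> V x = 0"
    and e: "\<And>j. e j > 0" "\<And>j. e j \<le> 1" "e \<longlonglongrightarrow> 0"
  shows "(\<lambda>j. LINT x|lborel. L (berezin n (ee q (e j) x * V x))) \<longlonglongrightarrow> (LINT x|lborel. L (berezin n (ee q 0 x * V x)))"
proof -
  define f where "f k x = L (berezin n (sscal (1 / fact k) * (gembed (- tsum n) ^ k * V x)))" for k x
  have f: "smooth_on UNIV (f k)" for k unfolding f_def[abs_def] by (rule coefficient_smooth[OF L V])
  have fz: "V x = 0 \<Longrightarrow> f k x = 0" for k x
    by (simp add: f_def clin_zero[OF clin_berezin[OF L]])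
  have int: "integrable lborel (\<lambda>x. pw q k ((norm (x - y))\<^sup>2 + t) * f k x)" if t: "t \<ge> 0" for t k
  proof (rule integrable_compact_smooth[OF _ C(1)])
    have 1: "smooth_on (UNIV - {y}) (\<lambda>x. pw q k ((norm (x - y))\<^sup>2 + t) * f k x)"
    proof (rule smooth_on_mult)
      have o: "open (UNIV - {y})" by (simp add: open_delete)
      show "smooth_on (UNIV - {y}) (\<lambda>x. pw q k ((norm (x - y))\<^sup>2 + t))"
        using pw_nf_smooth[OF o, of t q k] t by (simp add: gbody_nf add_pos_nonneg)
      show "smooth_on (UNIV - {y}) (f k)" by (rule smooth_on_subset[OF f open_UNIV o]) simp
    qed (simp add: open_delete)
    have 2: "smooth_on W (\<lambda>x. pw q k ((norm (x - y))\<^sup>2 + t) * f k x)"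
      using smooth_on_cong[OF W(1), of "\<lambda>x. pw q k ((norm (x - y))\<^sup>2 + t) * f k x" "\<lambda>x. 0"] fz[OF W(3)]
      by (simp add: smooth_on_const)
    have "(UNIV - {y}) \<union> W = UNIV" using W(2) by blast
    with smooth_on_Un[OF _ W(1) 1 2] show "smooth_on UNIV (\<lambda>x. pw q k ((norm (x - y))\<^sup>2 + t) * f k x)"
      by (simp add: open_delete)
  qed (simp add: fz C(2))
  have ex: "(LINT x|lborel. L (berezin n (ee q t x * V x))) = (\<Sum>k\<le>n. LINT x|lborel. pw q k ((norm (x - y))\<^sup>2 + t) * f k x)"
    if "t \<ge> 0" for t
    unfolding ee_expand[OF L] f_def[symmetric] by (rule Bochner_Integration.integral_sum) (rule int[OF that])
  have "(\<lambda>j. \<Sum>k\<le>n. LINT x|lborel. pw q k ((norm (x - y))\<^sup>2 + e j) * f k x)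
      \<longlonglongrightarrow> (\<Sum>k\<le>n. LINT x|lborel. pw q k ((norm (x - y))\<^sup>2) * f k x)"
    by (rule tendsto_sum, rule regular_part_limit[OF smooth_on_continuous[OF f] C(1) _ W(1,2) _ e])
       (simp_all add: fz C(2) W(3))
  then show ?thesis
    unfolding ex[OF less_imp_le[OF e(1)]] ex[OF order_refl] by (simp only: add_0_right)
qed

text \<open>With r the distance to \<open>y\<close>, the term with nilpotent power \<open>k\<close>
  carries e (r^2 + e)^(n - k) / (r^2 + e)^(m + 1), which concentrates at \<open>y\<close> for
  \<open>k = n\<close> and tends to 0 for \<open>k < n\<close>. In the surviving term
  \<open>tsum n ^ n\<close> is \<open>fact n\<close> times \<open>tprod n\<close>, so the Berezin
  integral evaluates at the odd parameters.\<close>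

lemma ee_delta:
  assumes mn: "n < CARD('m)" and q: "q = - (real CARD('m) - real n)"
    and L: "clin L" and V: "sf UNIV V" and C: "compact C" "\<And>x. x \<notin> C \<Longrightarrow> V x = 0"
    and supp: "\<And>A. gcoeff (V y) A \<noteq> 0 \<Longrightarrow> A \<subseteq> xvars n"
    and e: "\<And>j. e j > 0" "\<And>j. e j \<le> 1" "e \<longlonglongrightarrow> 0"
  shows "(\<lambda>j. complex_of_real (e j) * (LINT x|lborel. L (berezin n (ee (q - 1) (e j) x * V x))))
    \<longlonglongrightarrow> complex_of_real (pi ^ (CARD('m) - n) / fact (CARD('m) - n)) * L (subst_y (V y))"
proof -
  let ?m = "CARD('m)"
  define f where "f k x = L (berezin n (sscal (1 / fact k) * (gembed (- tsum n) ^ k * V x)))" for k x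
  define c where "c k = (\<Prod>i<k. q - 1 - real i)" for k :: nat
  have f: "smooth_on UNIV (f k)" for k unfolding f_def[abs_def] by (rule coefficient_smooth[OF L V])
  have fz: "x \<notin> C \<Longrightarrow> f k x = 0" for k x
    by (simp add: f_def C(2) clin_zero[OF clin_berezin[OF L]])
  have int: "integrable lborel (\<lambda>x. pw (q - 1) k ((norm (x - y))\<^sup>2 + t) * f k x)" if t: "t > 0" for t k
  proof (rule integrable_compact_smooth[OF _ C(1)])
    have "smooth_on UNIV (\<lambda>x. pw (q - 1) k ((norm (x - y))\<^sup>2 + t))"
      using pw_nf_smooth[OF open_UNIV nf_pos[OF t]] by (simp only: gbody_nf)
    then show "smooth_on UNIV (\<lambda>x. pw (q - 1) k ((norm (x - y))\<^sup>2 + t) * f k x)"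
      by (rule smooth_on_mult[OF open_UNIV _ f])
  qed (simp add: fz)
  let ?a = "\<lambda>t k x. complex_of_real (t / ((norm (x - y))\<^sup>2 + t) ^ (?m + 1) * ((norm (x - y))\<^sup>2 + t) ^ (n - k)) * f k x"
  \<comment> \<open>The exponent \<open>q - 1 - k\<close> is split as \<open>n - k\<close> minus
    \<open>m + 1\<close>, the form in which \<open>approximate_identity\<close> is stated.\<close>
  have pk: "complex_of_real t * pw (q - 1) k s = complex_of_real (c k) * complex_of_real (t / s ^ (?m + 1) * s ^ (n - k))"
    if "s > 0" "k \<le> n" for s t k
  proof -
    have "q - 1 - real k = real (n - k) - real (?m + 1)" using \<open>k \<le> n\<close> by (simp add: q of_nat_diff)
    then have "s powr (q - 1 - real k) = s ^ (n - k) / s ^ (?m + 1)"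
      using \<open>s > 0\<close> by (simp only: powr_diff powr_realpow)
    then show ?thesis unfolding pw_def c_def by simp
  qed
  have ex: "complex_of_real t * (LINT x|lborel. L (berezin n (ee (q - 1) t x * V x)))
      = (\<Sum>k\<le>n. complex_of_real (c k) * (LINT x|lborel. ?a t k x))" if t: "t > 0" for t
  proof -
    have "(LINT x|lborel. L (berezin n (ee (q - 1) t x * V x)))
        = (\<Sum>k\<le>n. LINT x|lborel. pw (q - 1) k ((norm (x - y))\<^sup>2 + t) * f k x)"
      unfolding ee_expand[OF L] f_def[symmetric] by (rule Bochner_Integration.integral_sum) (rule int[OF t])
    then have "complex_of_real t * (LINT x|lborel. L (berezin n (ee (q - 1) t x * V x)))
        = (\<Sum>k\<le>n. LINT x|lborel. complex_of_real t * (pw (q - 1) k ((norm (x - y))\<^sup>2 + t) * f k x))"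
      by (simp only: sum_distrib_left integral_mult_right_zero)
    also have "\<dots> = (\<Sum>k\<le>n. complex_of_real (c k) * (LINT x|lborel. ?a t k x))"
    proof (rule sum.cong[OF refl])
      fix k assume "k \<in> {..n}"
      then have "k \<le> n" by simp
      have p: "(norm (x - y))\<^sup>2 + t > 0" for x using t by (simp add: add_nonneg_pos)
      show "(LINT x|lborel. complex_of_real t * (pw (q - 1) k ((norm (x - y))\<^sup>2 + t) * f k x)) = complex_of_real (c k) * (LINT x|lborel. ?a t k x)"
        unfolding integral_mult_right_zero[symmetric]
        by (rule arg_cong[where f = "integral\<^sup>L lborel"], rule ext) (simp only: mult.assoc[symmetric] pk[OF p \<open>k \<le> n\<close>])
    qed
    finally show ?thesis .
  qed
  have lim: "(\<lambda>j. \<Sum>k\<le>n. complex_of_real (c k) * (LINT x|lborel. ?a (e j) k x))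
      \<longlonglongrightarrow> (\<Sum>k\<le>n. complex_of_real (c k) * (complex_of_real (pi ^ ?m / fact ?m) * (if n - k = 0 then f k y else 0)))"
    by (intro tendsto_sum tendsto_mult tendsto_const approximate_identity[OF smooth_on_continuous[OF f] C(1) _ e]) (rule fz)
  have "(\<Sum>k\<le>n. complex_of_real (c k) * (complex_of_real (pi ^ ?m / fact ?m) * (if n - k = 0 then f k y else 0)))
      = (\<Sum>k\<le>n. if k = n then complex_of_real (c n) * (complex_of_real (pi ^ ?m / fact ?m) * f n y) else 0)"
    by (rule sum.cong[OF refl]) auto
  also have "\<dots> = complex_of_real (c n) * (complex_of_real (pi ^ ?m / fact ?m) * f n y)" by simp
  also have "f n y = (- 1) ^ n / complex_of_real (pi ^ n) * L (subst_y (V y))"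
  proof -
    have "gembed (- tsum n) ^ n = ((- 1) ^ n * gembed (tsum n ^ n) :: 'm clifford grass)"
      by (simp only: gembed_simps gembed_power power_minus[of "gembed (tsum n)"])
    also have "gembed (tsum n ^ n) = (sscal (fact n) * gembed (tprod n) :: 'm clifford grass)"
    proof -
      have "(of_nat (fact n) :: complex grass) = gconst (fact n)"
      proof -
        have "(of_nat k :: complex grass) = gconst (of_nat k)" for k by (induction k) (simp_all add: gconst_add)
        then show ?thesis by (metis of_nat_fact)
      qed
      then show ?thesis unfolding tsum_power(1) by simp
    qed
    also have "(- 1) ^ n * (sscal (fact n) * gembed (tprod n)) = (sscal ((- 1) ^ n * fact n) * gembed (tprod n) :: 'm clifford grass)"
    proof -
      have "((- 1) ^ k :: 'm clifford grass) = sscal ((- 1) ^ k)" for k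
        by (induction k) (simp_all add: sscal_simps)
      then show ?thesis by (simp only: sscal_simps(4) mult.assoc)
    qed
    finally have t: "gembed (- tsum n) ^ n = (sscal ((- 1) ^ n * fact n) * gembed (tprod n) :: 'm clifford grass)" .
    have "sscal (1 / fact n) * (gembed (- tsum n) ^ n * V y) = sscal ((- 1) ^ n) * (gembed (tprod n) * V y)"
      unfolding t mult.assoc[symmetric] sscal_simps(4)[symmetric] by simp
    moreover have "berezin n (gembed (tprod n) * V y) = sscal (1 / complex_of_real (pi ^ n)) * subst_y (V y)"
      by (rule berezin_tprod_mult) (rule supp)
    ultimately show ?thesis
      unfolding f_def by (simp only: clin_scal[OF clin_berezin[OF L]] clin_scal[OF L]) simp
  qed
  also have "complex_of_real (c n) * (complex_of_real (pi ^ ?m / fact ?m) * ((- 1) ^ n / complex_of_real (pi ^ n) * L (subst_y (V y))))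
      = complex_of_real (pi ^ (?m - n) / fact (?m - n)) * L (subst_y (V y))"
  proof -
    \<comment> \<open>The factors of \<open>c k\<close> are the negatives of m - n + 1 up to m - n +
      k. For \<open>k = n\<close> the resulting m! cancels the one in the mass of the approximate
      identity, and the sign cancels that of the power of \<open>- tsum n\<close>.\<close>
    have ck: "c k = (- 1) ^ k * (fact (?m - n + k) / fact (?m - n))" for k
    proof (induction k)
      case (Suc k)
      have "c (Suc k) = c k * (q - 1 - real k)" by (simp add: c_def)
      also have "q - 1 - real k = - real (Suc (?m - n + k))" using mn by (simp add: q of_nat_diff)
      finally show ?case using Suc by (simp add: field_simps)
    qed (simp add: c_def)
    have cn: "c n = (- 1) ^ n * (fact ?m / fact (?m - n))" using ck[of n] mn by simp
    have pm: "(pi :: real) ^ ?m = pi ^ (?m - n) * pi ^ n" using mn by (simp flip: power_add)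
    have alg: "s * (a / b) * (p' * r / a * (s / r)) = (s * s) * (p' / b)" if "a \<noteq> 0" "r \<noteq> 0" for s a b p' r :: real
      using that by simp
    have "c n * (pi ^ ?m / fact ?m * ((- 1) ^ n / pi ^ n)) = ((- 1) ^ n * (- 1) ^ n) * (pi ^ (?m - n) / fact (?m - n))"
      unfolding cn pm by (rule alg) simp_all
    also have "(- 1 :: real) ^ n * (- 1) ^ n = 1" by (simp flip: power_mult_distrib)
    finally have "c n * (pi ^ ?m / fact ?m * ((- 1) ^ n / pi ^ n)) = pi ^ (?m - n) / fact (?m - n)" by simp
    moreover have "complex_of_real (c n * (pi ^ ?m / fact ?m * ((- 1) ^ n / pi ^ n))) =
        complex_of_real (c n) * (complex_of_real (pi ^ ?m / fact ?m) * ((- 1) ^ n / complex_of_real (pi ^ n)))"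
      by (simp only: of_real_mult of_real_divide of_real_power of_real_minus of_real_1)
    ultimately have "complex_of_real (c n) * (complex_of_real (pi ^ ?m / fact ?m) * ((- 1) ^ n / complex_of_real (pi ^ n)))
        = complex_of_real (pi ^ (?m - n) / fact (?m - n))" by (simp only:)
    then show ?thesis by (simp only: mult.assoc[symmetric])
  qed
  finally show ?thesis using lim unfolding ex[OF e(1)] by (simp only:)
qed

end

section \<open>The Cauchy-Pompeiu formula\<close>

lemma dop_zero_outside:
  assumes "sf UNIV F" "open S" "x \<in> S" "\<And>x. x \<in> S \<Longrightarrow> F x = c" "xfree c"
  shows "dop n a b F x = 0"
proof -
  have "dop n a b F x = dop n a b (\<lambda>x. c) x"
    by (rule dop_cong[OF assms(2,3) sf_subset[OF open_UNIV assms(2) subset_UNIV assms(1)] assms(4)])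
  also have "\<dots> = 0" using assms(5) by (simp add: dop_def super_pdiff_const xfree_def)
  finally show ?thesis .
qed

lemma xfree_gconst: "xfree (gconst c)" by (simp add: xfree_def gderiv_left_const)

context kernel
begin

text \<open>Partial integration is available for every positive parameter. \<open>ee_limit\<close>
  handles the differentiated side, where the derivatives of \<open>F\<close> vanish near
  \<open>y\<close>; on the other side \<open>rop_kernel\<close> leaves the concentrating term, or
  nothing for the mixed pairs.\<close>

lemma pompeiu:
  assumes mn: "n < CARD('m)" and q: "q = - (real CARD('m) - real n)"
    and L: "clin L" and F: "sf UNIV F" and C: "compact C" "\<And>x. x \<notin> C \<Longrightarrow> F x = 0"
    and supp: "\<And>A. gcoeff (F y) A \<noteq> 0 \<Longrightarrow> A \<subseteq> xvars n"
    and W: "open W" "y \<in> W" "\<And>x. x \<in> W \<Longrightarrow> dop n aZ bZ F x = 0" "\<And>x. x \<in> W \<Longrightarrow> dop n aZd bZd F x = 0"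
  shows "(LINT x|lborel. L (berezin n (ee q 0 x * (zv x * dop n aZ bZ F x))))
      + (LINT x|lborel. L (berezin n (ee q 0 x * (zd x * dop n aZd bZd F x))))
      = complex_of_real (q * (pi ^ (CARD('m) - n) / fact (CARD('m) - n))) * L (subst_y (F y))"
    and "(LINT x|lborel. L (berezin n (ee q 0 x * (zv x * dop n aZd bZd F x))))
      + (LINT x|lborel. L (berezin n (ee q 0 x * (zd x * dop n aZ bZ F x)))) = 0"
proof -
  define e where "e j = inverse (real (Suc j))" for j
  have e: "\<And>j. e j > 0" "\<And>j. e j \<le> 1" "e \<longlonglongrightarrow> 0"
    unfolding e_def[abs_def] using LIMSEQ_inverse_real_of_nat by (simp_all add: inverse_le_1_iff)
  have z: "dop n a b F x = 0" if "x \<notin> C" for a b x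
    by (rule dop_zero_outside[OF F, of "- C" x 0])
       (use that C compact_imp_closed[OF C(1)] xfree_gconst[of 0] in \<open>auto simp: open_Compl\<close>)
  have bp: "(LINT x|lborel. L (berezin n (ee q (e j) x * (p x * dop n a b F x))))
      = - (LINT x|lborel. L (berezin n (rop n a b (\<lambda>x. p x * ee q (e j) x) x * F x)))"
    if "sf UNIV p" for p a b j
  proof -
    have s: "sf UNIV (\<lambda>x. p x * ee q (e j) x)"
      by (rule sf_mult[OF open_UNIV that sf_ee[OF open_UNIV nf_pos[OF e(1)]]])
    have "ee q (e j) x * (p x * dop n a b F x) = p x * ee q (e j) x * dop n a b F x" for x
      by (simp only: mult.assoc[symmetric] ee_central)
    moreover have "(LINT x|lborel. L (berezin n (p x * ee q (e j) x * dop n a b F x)))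
        = - (LINT x|lborel. L (berezin n (rop n a b (\<lambda>x. p x * ee q (e j) x) x * F x)))"
      by (rule dop_by_parts[OF s F C L])
    ultimately show ?thesis by (simp only:)
  qed
  have add: "(LINT x|lborel. L (berezin n (R x * F x))) + (LINT x|lborel. L (berezin n (R' x * F x)))
      = (LINT x|lborel. L (berezin n ((R x + R' x) * F x)))" if "sf UNIV R" "sf UNIV R'" for R R'
  proof -
    have i: "integrable lborel (\<lambda>x. L (berezin n (R x * F x)))" if "sf UNIV R" for R
      by (rule integrable_compact_smooth[OF clin_smooth[OF open_UNIV clin_berezin[OF L] sf_mult[OF open_UNIV that F]] C(1)])
         (simp add: C(2) clin_zero[OF clin_berezin[OF L]])
    show ?thesis
      unfolding distrib_right clin_add[OF clin_berezin[OF L]]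
      by (rule Bochner_Integration.integral_add[OF i[OF that(1)] i[OF that(2)], symmetric])
  qed
  have r: "sf UNIV (rop n a b (\<lambda>x. p x * ee q (e j) x))" if "sf UNIV p" for a b p j
    by (rule sf_rop[OF open_UNIV sf_mult[OF open_UNIV that sf_ee[OF open_UNIV nf_pos[OF e(1)]]]])
  have lim: "(\<lambda>j. LINT x|lborel. L (berezin n (ee q (e j) x * (p x * dop n a b F x))))
      \<longlonglongrightarrow> (LINT x|lborel. L (berezin n (ee q 0 x * (p x * dop n a b F x))))"
    if "sf UNIV p" "\<And>x. x \<in> W \<Longrightarrow> dop n a b F x = 0" for p a b
    by (rule ee_limit[OF L sf_mult[OF open_UNIV that(1) sf_dop[OF open_UNIV F]] C(1) _ W(1,2) _ e])
       (simp_all add: z that(2))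
  have main: "(LINT x|lborel. L (berezin n (ee q (e j) x * (zv x * dop n aZ bZ F x))))
      + (LINT x|lborel. L (berezin n (ee q (e j) x * (zd x * dop n aZd bZd F x))))
      = complex_of_real q * (complex_of_real (e j) * (LINT x|lborel. L (berezin n (ee (q - 1) (e j) x * F x))))" for j
  proof -
    have "(LINT x|lborel. L (berezin n (ee q (e j) x * (zv x * dop n aZ bZ F x))))
        + (LINT x|lborel. L (berezin n (ee q (e j) x * (zd x * dop n aZd bZd F x))))
        = - (LINT x|lborel. L (berezin n ((rop n aZ bZ (\<lambda>x. zv x * ee q (e j) x) x + rop n aZd bZd (\<lambda>x. zd x * ee q (e j) x) x) * F x)))"
      unfolding bp[OF sf_zv] bp[OF sf_zd] add[OF r[OF sf_zv] r[OF sf_zd], symmetric] by simp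
    also have "\<dots> = complex_of_real q * (complex_of_real (e j) * (LINT x|lborel. L (berezin n (ee (q - 1) (e j) x * F x))))"
      unfolding rop_kernel(1)[OF e(1) q] mult.assoc[of "sscal _"] clin_scal[OF clin_berezin[OF L]] integral_mult_right_zero
      by simp
    finally show ?thesis .
  qed
  have cross: "(LINT x|lborel. L (berezin n (ee q (e j) x * (zv x * dop n aZd bZd F x))))
      + (LINT x|lborel. L (berezin n (ee q (e j) x * (zd x * dop n aZ bZ F x)))) = 0" for j
  proof -
    have "(LINT x|lborel. L (berezin n (ee q (e j) x * (zv x * dop n aZd bZd F x))))
        + (LINT x|lborel. L (berezin n (ee q (e j) x * (zd x * dop n aZ bZ F x))))
        = - (LINT x|lborel. L (berezin n ((rop n aZd bZd (\<lambda>x. zv x * ee q (e j) x) x + rop n aZ bZ (\<lambda>x. zd x * ee q (e j) x) x) * F x)))"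
      unfolding bp[OF sf_zv] bp[OF sf_zd] add[OF r[OF sf_zv] r[OF sf_zd], symmetric] by simp
    also have "\<dots> = 0"
      unfolding rop_kernel(2)[OF e(1) q] by (simp add: clin_zero[OF clin_berezin[OF L]])
    finally show ?thesis .
  qed
  have "(\<lambda>j. complex_of_real q * (complex_of_real (e j) * (LINT x|lborel. L (berezin n (ee (q - 1) (e j) x * F x)))))
    \<longlonglongrightarrow> complex_of_real q * (complex_of_real (pi ^ (CARD('m) - n) / fact (CARD('m) - n)) * L (subst_y (F y)))"
    by (rule tendsto_mult[OF tendsto_const ee_delta[OF mn q L F C supp e]])
  note main_limit = this
  have l: "(\<lambda>j. LINT x|lborel. L (berezin n (ee q (e j) x * (zv x * dop n aZ bZ F x))))
      \<longlonglongrightarrow> (LINT x|lborel. L (berezin n (ee q 0 x * (zv x * dop n aZ bZ F x))))"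
    "(\<lambda>j. LINT x|lborel. L (berezin n (ee q (e j) x * (zd x * dop n aZd bZd F x))))
      \<longlonglongrightarrow> (LINT x|lborel. L (berezin n (ee q 0 x * (zd x * dop n aZd bZd F x))))"
    "(\<lambda>j. LINT x|lborel. L (berezin n (ee q (e j) x * (zv x * dop n aZd bZd F x))))
      \<longlonglongrightarrow> (LINT x|lborel. L (berezin n (ee q 0 x * (zv x * dop n aZd bZd F x))))"
    "(\<lambda>j. LINT x|lborel. L (berezin n (ee q (e j) x * (zd x * dop n aZ bZ F x))))
      \<longlonglongrightarrow> (LINT x|lborel. L (berezin n (ee q 0 x * (zd x * dop n aZ bZ F x))))"
    by (rule lim[OF sf_zv W(3)] lim[OF sf_zd W(4)] lim[OF sf_zv W(4)] lim[OF sf_zd W(3)], assumption)+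
  from LIMSEQ_unique[OF tendsto_add[OF l(1,2), unfolded main] main_limit]
  show "(LINT x|lborel. L (berezin n (ee q 0 x * (zv x * dop n aZ bZ F x))))
      + (LINT x|lborel. L (berezin n (ee q 0 x * (zd x * dop n aZd bZd F x))))
      = complex_of_real (q * (pi ^ (CARD('m) - n) / fact (CARD('m) - n))) * L (subst_y (F y))"
    by (simp only: of_real_mult mult.assoc)
  from LIMSEQ_unique[OF tendsto_add[OF l(3,4), unfolded cross] tendsto_const]
  show "(LINT x|lborel. L (berezin n (ee q 0 x * (zv x * dop n aZd bZd F x))))
      + (LINT x|lborel. L (berezin n (ee q 0 x * (zd x * dop n aZ bZ F x)))) = 0" .
qed

definition kconst :: complex where "kconst = complex_of_real (2 / super_sphere_area CARD('m) n)"

text \<open>\<open>Z_norm_powr\<close> halves its exponent because it raises the squared norm, and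
  minus half the superdimension is \<open>q\<close>.\<close>

lemma Psi_eq:
  assumes q: "q = - (real CARD('m) - real n)"
  shows "Psi n (x - y) thd = sscal kconst * (zv x * ee q 0 x)"
    "Psi_dag n (x - y) thd = sscal kconst * (zd x * ee q 0 x)"
proof -
  have h: "- super_dim CARD('m) n / 2 = q" by (simp add: super_dim_def q)
  have nf: "Z_norm2 n (x - y) thd = nf 0 x" unfolding Z_norm2_eq nf_def by simp
  have "Z_norm_powr n (x - y) thd (- super_dim CARD('m) n) = ee q 0 x"
    unfolding Z_norm_powr_def super_powr_gcomp nf h ee_def ..
  then show "Psi n (x - y) thd = sscal kconst * (zv x * ee q 0 x)"
    "Psi_dag n (x - y) thd = sscal kconst * (zd x * ee q 0 x)"
    unfolding Psi_def Psi_dag_def kconst_def zv_def zd_def by (simp_all only: mult.assoc)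
qed

text \<open>Half the superdimension is the positive integer m - n, so the sphere area is 2 pi^(m -
  n) / (m - n - 1)! and all factorials and powers of pi cancel. The remaining sign is compensated
  later by the derivative of \<theta> being -\<rho>.\<close>

lemma kconst_normalizes:
  assumes mn: "n < CARD('m)" and q: "q = - (real CARD('m) - real n)"
  shows "kconst * complex_of_real (q * (pi ^ (CARD('m) - n) / fact (CARD('m) - n))) = - 1"
proof -
  obtain k where k: "CARD('m) - n = Suc k" using mn by (metis Suc_diff_Suc)
  then have qk: "q = - real (Suc k)" and h: "super_dim CARD('m) n / 2 = real (Suc k)"
    using mn by (simp_all add: q super_dim_def of_nat_diff flip: k)
  have G: "Gamma (real (Suc k)) = fact k" using Gamma_fact[of k, where 'a = real] by (simp add: add.commute)
  have "2 / super_sphere_area CARD('m) n = fact k / pi ^ Suc k"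
    unfolding super_sphere_area_def h G powr_realpow[OF pi_gt_zero] by simp
  then have "2 / super_sphere_area CARD('m) n * (q * (pi ^ (CARD('m) - n) / fact (CARD('m) - n))) = - 1"
    unfolding k qk by (simp add: fact_Suc field_simps del: of_nat_Suc)
  then show ?thesis unfolding kconst_def by (metis of_real_1 of_real_minus of_real_mult)
qed

lemma pompeiu_Psi:
  assumes mn: "n < CARD('m)"
    and L: "clin L" and F: "sf UNIV F" and C: "compact C" "\<And>x. x \<notin> C \<Longrightarrow> F x = 0"
    and supp: "\<And>A. gcoeff (F y) A \<noteq> 0 \<Longrightarrow> A \<subseteq> xvars n"
    and W: "open W" "y \<in> W" "\<And>x. x \<in> W \<Longrightarrow> dop n aZ bZ F x = 0" "\<And>x. x \<in> W \<Longrightarrow> dop n aZd bZd F x = 0"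
  shows "(LINT x|lborel. L (berezin n (Psi n (x - y) thd * dop n aZ bZ F x)))
      + (LINT x|lborel. L (berezin n (Psi_dag n (x - y) thd * dop n aZd bZd F x))) = - L (subst_y (F y))"
    and "(LINT x|lborel. L (berezin n (Psi n (x - y) thd * dop n aZd bZd F x)))
      + (LINT x|lborel. L (berezin n (Psi_dag n (x - y) thd * dop n aZ bZ F x))) = 0"
proof -
  define q where "q = - (real CARD('m) - real n)"
  have c: "sscal kconst * (v * ee q 0 x) * D = sscal kconst * (ee q 0 x * (v * D))" for v D x
    by (simp only: mult.assoc[symmetric] ee_central[of _ _ _ v])
  have P: "(LINT x|lborel. L (berezin n (ee q 0 x * (zv x * dop n aZ bZ F x))))
      + (LINT x|lborel. L (berezin n (ee q 0 x * (zd x * dop n aZd bZd F x))))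
      = complex_of_real (q * (pi ^ (CARD('m) - n) / fact (CARD('m) - n))) * L (subst_y (F y))"
    "(LINT x|lborel. L (berezin n (ee q 0 x * (zv x * dop n aZd bZd F x))))
      + (LINT x|lborel. L (berezin n (ee q 0 x * (zd x * dop n aZ bZ F x)))) = 0"
    by (rule pompeiu[OF mn q_def L F C supp W]; assumption)+
  show "(LINT x|lborel. L (berezin n (Psi n (x - y) thd * dop n aZ bZ F x)))
      + (LINT x|lborel. L (berezin n (Psi_dag n (x - y) thd * dop n aZd bZd F x))) = - L (subst_y (F y))"
    unfolding Psi_eq[OF q_def] c clin_scal[OF clin_berezin[OF L]] integral_mult_right_zero distrib_left[symmetric] P(1)
    by (simp only: mult.assoc[symmetric] kconst_normalizes[OF mn q_def] mult_minus1)
  show "(LINT x|lborel. L (berezin n (Psi n (x - y) thd * dop n aZd bZd F x)))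
      + (LINT x|lborel. L (berezin n (Psi_dag n (x - y) thd * dop n aZ bZ F x))) = 0"
    unfolding Psi_eq[OF q_def] c clin_scal[OF clin_berezin[OF L]] integral_mult_right_zero distrib_left[symmetric] P(2) by simp
qed

lemma sf_Psi: "sf (UNIV - {y}) (\<lambda>x. Psi n (x - y) thd)" "sf (UNIV - {y}) (\<lambda>x. Psi_dag n (x - y) thd)"
proof -
  have o: "open (UNIV - {y})" by (simp add: open_delete)
  have e: "sf (UNIV - {y}) (ee q 0)" for q by (rule sf_ee[OF o]) (simp add: nf_zero_pos)
  show "sf (UNIV - {y}) (\<lambda>x. Psi n (x - y) thd)" "sf (UNIV - {y}) (\<lambda>x. Psi_dag n (x - y) thd)"
    unfolding Psi_eq[OF refl]
    by (intro sf_mult o sf_const e sf_subset[OF open_UNIV o subset_UNIV sf_zv] sf_subset[OF open_UNIV o subset_UNIV sf_zd])+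
qed

end

subsection \<open>Supports in the Grassmann algebra\<close>

definition gsupp :: "gvar set \<Rightarrow> 'c::ring_1 grass \<Rightarrow> bool" where
  "gsupp V F \<longleftrightarrow> (\<forall>A. gcoeff F A \<noteq> 0 \<longrightarrow> A \<subseteq> V)"

lemma gsupp_add: "gsupp V F \<Longrightarrow> gsupp V G \<Longrightarrow> gsupp V (F + G)"
  unfolding gsupp_def by (metis add_0_right gcoeff_simps(2))

lemma gsupp_zero: "gsupp V 0" by (simp add: gsupp_def)

lemma gsupp_minus: "gsupp V F \<Longrightarrow> gsupp V (- F)" by (simp add: gsupp_def)

lemma gsupp_diff: "gsupp V F \<Longrightarrow> gsupp V G \<Longrightarrow> gsupp V (F - G)"
  using gsupp_add[OF _ gsupp_minus] by fastforce

lemma gsupp_sum: "(\<And>i. i \<in> I \<Longrightarrow> gsupp V (F i)) \<Longrightarrow> gsupp V (\<Sum>i\<in>I. F i)"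
  by (induction I rule: infinite_finite_induct) (auto simp: gsupp_zero gsupp_add)

lemma gsupp_mult: "gsupp V F \<Longrightarrow> gsupp V G \<Longrightarrow> gsupp V (F * G)"
  unfolding gsupp_def using gcoeff_mult_support[of F V G] by blast

lemma gsupp_gconst: "gsupp V (gconst c)"
  by (simp add: gsupp_def gconst.rep_eq)

lemma gsupp_gmono: "A \<subseteq> V \<Longrightarrow> gsupp V (gmono A)"
  by (simp add: gsupp_def gmono.rep_eq)

lemma gsupp_gembed: "gsupp V F \<Longrightarrow> gsupp V (gembed F)"
  unfolding gsupp_def gembed.rep_eq using cscal_simps(1) by metis

lemma gsupp_gderiv: "gsupp V F \<Longrightarrow> gsupp V (gderiv_left v F)"
proof -
  assume F: "gsupp V F"
  have "A \<subseteq> V" if "gcoeff (gderiv_left v F) A \<noteq> 0" for A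
  proof -
    have "gcoeff F (insert v A) \<noteq> 0" using that by (auto simp: gderiv_left.rep_eq split: if_splits)
    then have "insert v A \<subseteq> V" using F unfolding gsupp_def by blast
    then show ?thesis by blast
  qed
  then show ?thesis unfolding gsupp_def by blast
qed

lemma gsupp_mono: "gsupp V F \<Longrightarrow> V \<subseteq> W \<Longrightarrow> gsupp W F"
  by (auto simp: gsupp_def)

context even_superfunction
begin

lemma gsupp_dop:
  assumes x: "x \<in> S" shows "gsupp V (dop k a b (\<lambda>x. gembed (g x)) x)"
proof -
  have e: "(\<lambda>x. gembed (g x) :: 'm clifford grass) = (\<lambda>x. \<Sum>A\<in>Pow V. sscal (gcoeff (g x) A) * gmono A)"
    by (rule ext) (rule gembed_expand[OF g_supp V])
  have p: "super_pdiff i (\<lambda>x. gembed (g x) :: 'm clifford grass) x = (\<Sum>A\<in>Pow V. sscal (pdiff i (\<lambda>x. gcoeff (g x) A) x) * gmono A)" for i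
    unfolding e super_pdiff_sum[OF S x sf_scal[OF g_smooth]] super_pdiff_scal[OF S x g_smooth] ..
  have "gsupp V (gembed (g x) :: 'm clifford grass)"
    by (rule gsupp_gembed) (use g_supp in \<open>auto simp: gsupp_def\<close>)
  then show ?thesis
    unfolding dop_def p by (intro gsupp_add gsupp_sum gsupp_mult gsupp_gconst gsupp_gmono gsupp_gderiv) auto
qed

end

lemma gcoeff_mult_nonzero:
  assumes "gcoeff (a * b) A \<noteq> 0"
  obtains B where "finite A" "B \<subseteq> A" "gcoeff a B \<noteq> 0" "gcoeff b (A - B) \<noteq> 0"
proof -
  have "finite A" using assms gcoeff_infinite by blast
  then have "(\<Sum>B\<in>Pow A. inv_sign B (A - B) * gcoeff a B * gcoeff b (A - B)) \<noteq> 0"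
    using assms by (simp add: times_grass.rep_eq)
  then obtain B where B: "B \<in> Pow A" "inv_sign B (A - B) * gcoeff a B * gcoeff b (A - B) \<noteq> 0"
    by (meson sum.neutral)
  then have "gcoeff a B \<noteq> 0" "gcoeff b (A - B) \<noteq> 0" by auto
  then show thesis using that \<open>finite A\<close> B(1) by blast
qed

text \<open>Every monomial of the nilpotent part has positive even degree, hence at least 2. A
  monomial in the power \<open>n + 1\<close> would have degree at least \<open>2 * n + 2\<close> in
  only \<open>2 * n\<close> variables.\<close>

lemma phase_function_nilpotent:
  assumes g: "phase_function n g" shows "gnil (g x) ^ Suc n = 0"
proof (rule grass_eqI')
  fix A
  have d: "2 * k \<le> card A" if "gcoeff (gnil (g x) ^ k) A \<noteq> 0" for k A
    using that
  proof (induction k arbitrary: A)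
    case (Suc k)
    from Suc.prems obtain B where B: "finite A" "B \<subseteq> A" "gcoeff (gnil (g x)) B \<noteq> 0" "gcoeff (gnil (g x) ^ k) (A - B) \<noteq> 0"
      unfolding power_Suc by (rule gcoeff_mult_nonzero)
    then have "B \<noteq> {}" "gcoeff (g x) B \<noteq> 0" by (auto simp: gcoeff_gnil split: if_splits)
    then have "even (card B)" "card B \<noteq> 0" using g B(1,2) by (auto simp: phase_function_def finite_subset)
    then have "2 \<le> card B" by presburger
    moreover have "card A = card B + card (A - B)"
      using B(1,2) by (metis card_Diff_subset card_mono finite_subset le_add_diff_inverse)
    ultimately show ?case using Suc.IH[OF B(4)] by simp
  qed simp
  show "gcoeff (gnil (g x) ^ Suc n) A = gcoeff 0 A"
  proof (rule ccontr)
    assume "gcoeff (gnil (g x) ^ Suc n) A \<noteq> gcoeff 0 A"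
    then have nz: "gcoeff (gnil (g x) ^ Suc n) A \<noteq> 0" by simp
    have "A \<subseteq> xvars n"
      by (rule gcoeff_power_support[of "gnil (g x)", OF _ nz]) (use g in \<open>auto simp: gcoeff_gnil phase_function_def split: if_splits\<close>)
    then have "card A \<le> card (xvars n)" by (intro card_mono) auto
    also have "\<dots> \<le> 2 * n" using card_image_le[of "{1..2 * n}" XV] by simp
    finally show False using d[OF nz] by simp
  qed
qed

lemma phase_even_superfunction:
  assumes g: "phase_function n g" and S: "open S" shows "even_superfunction S g (xvars n) n"
proof
  show "smooth_on S (\<lambda>x. gcoeff (g x) A)" for A
    using g smooth_on_subset[OF _ open_UNIV S subset_UNIV] by (auto simp: phase_function_def)
  show "gcoeff (g x) A \<noteq> 0 \<Longrightarrow> A \<subseteq> xvars n" for x A using g by (auto simp: phase_function_def)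
qed (use S phase_function_ginv[OF g] phase_function_body(2)[OF g] phase_function_nilpotent[OF g] in auto)

lemma sf_cutoff:
  assumes "open S" "test_function \<zeta>" "tsupp \<zeta> \<subseteq> S" "sf S F"
  shows "sf UNIV (\<lambda>x. sscal (\<zeta> x) * F x)"
  using assms(4)
proof (induction rule: sf_induct)
  case (cong F G)
  have "sscal (\<zeta> x) * F x = sscal (\<zeta> x) * G x" for x
  proof (cases "x \<in> S")
    case False
    then have "\<zeta> x = 0" using assms(3) tsupp_zero by blast
    then show ?thesis by (simp add: sscal_simps(1))
  qed (simp add: cong)
  then show ?case using cong by simp
next
  case zero
  show ?case by (simp add: sf_zero)
next
  case (step f c F)
  have "smooth_on UNIV (\<lambda>x. \<zeta> x * f x)"
    using test_function_mult(1)[OF assms(1) step(1) assms(2,3)] by (simp add: test_function_def)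
  from sf_step[OF this step(3)] show ?case
    by (simp only: distrib_left sscal_simps(4) mult.assoc)
qed

subsection \<open>Characteristic superfunctions\<close>

text \<open>\<open>th 0\<close> is the antiderivative of \<open>- \<rho>\<close> that vanishes to
  the right of the support; to the left it equals the full integral. The other members are its
  derivatives, as \<open>gcomp\<close> expects them.\<close>

lemma ramp:
  fixes \<rho> :: "real \<Rightarrow> complex"
  assumes rho: "test_function \<rho>" "tsupp \<rho> \<subseteq> {- r<..<r}" and r: "r > 0"
  obtains th :: "nat \<Rightarrow> real \<Rightarrow> complex" where "\<And>k. smooth_on UNIV (th k)"
    "\<And>k t. (th k has_vector_derivative th (Suc k) t) (at t)"
    "\<And>k. th (Suc k) = (\<lambda>t. - vderivs k \<rho> t)"
    "\<And>t. t \<ge> r \<Longrightarrow> th 0 t = 0" "\<And>t. t \<le> - r \<Longrightarrow> th 0 t = (LINT t|lborel. \<rho> t)"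
proof -
  have c: "continuous_on UNIV \<rho>" by (rule test_function_continuous[OF rho(1)])
  have z: "\<rho> t = 0" if "t \<ge> r \<or> t \<le> - r" for t
    by (rule tsupp_zero) (use that rho(2) in auto)
  have "\<exists>F. \<forall>t. - \<infinity> < ereal t \<longrightarrow> ereal t < \<infinity> \<longrightarrow> (F has_vector_derivative \<rho> t) (at t)"
    by (rule einterval_antiderivative) (use c in \<open>auto simp: continuous_on_eq_continuous_at\<close>)
  then obtain F where F: "\<And>t. (F has_vector_derivative \<rho> t) (at t)" by auto
  define th where "th k = (case k of 0 \<Rightarrow> (\<lambda>t. F r - F t) | Suc k \<Rightarrow> (\<lambda>t. - vderivs k \<rho> t))" for k
  have s: "smooth_on UNIV (vderivs k \<rho>)" for k
    using rho(1) by (intro smooth_on_vderivs open_UNIV) (simp add: test_function_def)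
  have d0: "((\<lambda>t. F r - F t) has_vector_derivative - \<rho> t) (at t)" for t
    using has_vector_derivative_diff[OF has_vector_derivative_const F] by simp
  have cst: "F s = F t" if "(s \<ge> r \<and> t \<ge> r) \<or> (s \<le> - r \<and> t \<le> - r)" for s t
  proof -
    have *: "F s = F t" if "convex I" "\<And>t. t \<in> I \<Longrightarrow> t \<ge> r \<or> t \<le> - r" "s \<in> I" "t \<in> I" for I
    proof -
      have "(F has_vector_derivative 0) (at x within I)" if "x \<in> I" for x
        using has_vector_derivative_at_within[OF F[of x]] z \<open>x \<in> I\<close> that \<open>\<And>t. t \<in> I \<Longrightarrow> t \<ge> r \<or> t \<le> - r\<close> by metis
      with has_vector_derivative_zero_constant[OF \<open>convex I\<close>, of F] that(3,4) show ?thesis by metis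
    qed
    show ?thesis using that *[of "{r..}"] *[of "{..- r}"] by auto
  qed
  have "F r - F (- r) = (LINT t|lborel. indicator {- r..r} t *\<^sub>R \<rho> t)"
    by (rule integral_FTC_Icc[symmetric])
       (use r in \<open>auto intro: has_vector_derivative_at_within F continuous_on_subset[OF c]\<close>)
  also have "(\<lambda>t. indicator {- r..r} t *\<^sub>R \<rho> t) = \<rho>"
    by (rule ext) (use z in \<open>auto simp: indicator_def\<close>)
  finally have I: "F r - F (- r) = (LINT t|lborel. \<rho> t)" .
  show thesis
  proof
    show "smooth_on UNIV (th k)" for k
    proof (cases k)
      case 0
      have "smooth_on UNIV (\<lambda>t. F r - F t)"
      proof (rule smooth_on_derivI[OF open_UNIV])
        show "((\<lambda>t. F r - F t) has_derivative (\<lambda>h. h *\<^sub>R - \<rho> t)) (at t)" for t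
          using d0[of t] by (simp add: has_vector_derivative_def)
        have "smooth_on UNIV (\<lambda>t. - \<rho> t)"
          using smooth_on_diff[OF open_UNIV smooth_on_const[of _ 0] s[of 0]] by simp
        then show "smooth_on UNIV (\<lambda>t. b *\<^sub>R - \<rho> t)" if "b \<in> Basis" for b :: real
          using that by simp
      qed
      then show ?thesis using 0 by (simp add: th_def)
    next
      case (Suc k)
      have "smooth_on UNIV (\<lambda>t. 0 - vderivs k \<rho> t)" by (intro smooth_on_diff smooth_on_const s open_UNIV)
      then show ?thesis using Suc by (simp add: th_def)
    qed
    show "(th k has_vector_derivative th (Suc k) t) (at t)" for k t
    proof (cases k)
      case (Suc k)
      have "(vderivs k \<rho> has_vector_derivative vderivs (Suc k) \<rho> t) (at t)"
        by (rule vderivs_has_vector_derivative[OF open_UNIV s[of 0, unfolded vderivs_simps] UNIV_I])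
      from has_vector_derivative_minus[OF this] show ?thesis using Suc by (simp add: th_def)
    qed (use d0 in \<open>simp add: th_def\<close>)
    show "th (Suc k) = (\<lambda>t. - vderivs k \<rho> t)" for k by (simp add: th_def)
    show "th 0 t = 0" if "t \<ge> r" for t using cst[of r t] that by (simp add: th_def)
    show "th 0 t = (LINT t|lborel. \<rho> t)" if "t \<le> - r" for t using cst[of "- r" t] that I by (simp add: th_def)
  qed
qed

lemma gcomp_constant:
  assumes "\<And>j. th (Suc j) (gbody a) = 0" shows "gcomp n th a = gconst (th 0 (gbody a))"
  unfolding gcomp_def sum.atMost_shift by (simp add: assms)

text \<open>Outside \<open>T\<close> the body of \<open>g\<close> may come arbitrarily close to 0
  without vanishing, so composing the ramp with \<open>g\<close> everywhere would not give locally
  constant values there. The ramp is used only on \<open>U\<close>; elsewhere the sign of the body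
  selects one of two constants.\<close>

lemma characteristic_superfunction:
  fixes g :: "'m::finite point \<Rightarrow> complex grass" and \<rho> :: "real \<Rightarrow> complex"
  assumes g: "phase_function n g" and T: "closed T" and U: "open U" "U \<subseteq> T" "{x. gbody (g x) = 0} \<subseteq> U"
    and r: "r > 0" "\<And>x. x \<in> T \<Longrightarrow> \<bar>gbody (g x)\<bar> \<le> r \<Longrightarrow> x \<in> U"
    and rho: "test_function \<rho>" "tsupp \<rho> \<subseteq> {- r<..<r}"
  obtains Th :: "'m point \<Rightarrow> 'm clifford grass" and Om Op where "sf UNIV Th" "\<And>x v. Th x * v = v * Th x" "\<And>x. ginv (Th x) = Th x"
    "\<And>k a b x. x \<in> U \<Longrightarrow> dop k a b Th x =
      - (gembed (gcomp n (\<lambda>j. vderivs j \<rho>) (g x)) * dop k a b (\<lambda>x. gembed (g x)) x)"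
    "open Om" "open Op" "U \<union> Om \<union> Op = UNIV" "- T \<subseteq> Om \<union> Op"
    "Om \<subseteq> {x. gbody (g x) < 0}" "Op \<subseteq> {x. gbody (g x) > 0}"
    "\<And>x. x \<in> Om \<Longrightarrow> Th x = sscal (LINT t|lborel. \<rho> t)" "\<And>x. x \<in> Op \<Longrightarrow> Th x = 0"
proof -
  let ?u = "\<lambda>x. gbody (g x)" and ?I = "LINT t|lborel. \<rho> t"
  obtain th :: "nat \<Rightarrow> real \<Rightarrow> complex" where th: "\<And>k. smooth_on UNIV (th k)"
    "\<And>k t. (th k has_vector_derivative th (Suc k) t) (at t)" "\<And>k. th (Suc k) = (\<lambda>t. - vderivs k \<rho> t)"
    "\<And>t. t \<ge> r \<Longrightarrow> th 0 t = 0" "\<And>t. t \<le> - r \<Longrightarrow> th 0 t = ?I"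
    using ramp[OF rho r(1)] by blast
  have thz: "th (Suc k) t = 0" if "r \<le> \<bar>t\<bar>" for k t
  proof -
    have "t \<notin> tsupp (vderivs k \<rho>)" using vderivs_test(2)[OF rho(1), of k] rho(2) that by (auto simp: abs_if split: if_splits)
    then show ?thesis using tsupp_zero by (simp add: th(3))
  qed
  have cu: "continuous_on UNIV ?u" by (rule smooth_on_continuous[OF phase_function_body(1)[OF g]])
  \<comment> \<open>By the choice of \<open>r\<close> this closed set lies in \<open>U\<close>. On
    the rest of \<open>U\<close> the body exceeds \<open>r\<close> in absolute value, so the ramp is
    constant there and agrees with the sign rule.\<close>
  define U' where "U' = {x \<in> T. \<bar>?u x\<bar> \<le> r}"
  have "closed {x. \<bar>?u x\<bar> \<le> r}" by (intro closed_Collect_le continuous_intros cu)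
  moreover have "U' = T \<inter> {x. \<bar>?u x\<bar> \<le> r}" by (auto simp: U'_def)
  ultimately have U': "closed U'" using T by (simp add: closed_Int)
  define Om where "Om = {x. ?u x < 0} - U'"
  define Op where "Op = {x. ?u x > 0} - U'"
  have o: "open Om" "open Op" unfolding Om_def Op_def
    by (intro open_Diff U' open_Collect_less continuous_intros cu)+
  have cov: "U \<union> Om \<union> Op = UNIV"
  proof -
    have "x \<in> U \<union> Om \<union> Op" for x
      using U(3) r(2)[of x] by (cases "?u x" "0 :: real" rule: linorder_cases) (auto simp: Om_def Op_def U'_def)
    then show ?thesis by blast
  qed
  define Tc where "Tc x = (if x \<in> U then gcomp n th (g x) else gconst (if ?u x < 0 then ?I else 0))" for x
  have far: "x \<in> U \<Longrightarrow> x \<notin> U' \<Longrightarrow> Tc x = gconst (th 0 (?u x)) \<and> r < \<bar>?u x\<bar>" for x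
    using U(2) by (auto simp: Tc_def U'_def intro!: gcomp_constant thz)
  have TOm: "Tc x = gconst ?I" if "x \<in> Om" for x
  proof (cases "x \<in> U")
    case True
    then show ?thesis using far[OF True] that th(5)[of "?u x"] by (auto simp: Om_def abs_if split: if_splits)
  qed (use that in \<open>simp add: Tc_def Om_def\<close>)
  have TOp: "Tc x = 0" if "x \<in> Op" for x
  proof (cases "x \<in> U")
    case True
    then show ?thesis using far[OF True] that th(4)[of "?u x"] by (auto simp: Op_def abs_if split: if_splits)
  qed (use that in \<open>simp add: Tc_def Op_def\<close>)
  have thu: "smooth_on S (\<lambda>x. th j (?u x))" if "open S" for S j
    by (rule smooth_on_compose_real[of S UNIV]) (use that th(1) smooth_on_subset[OF phase_function_body(1)[OF g] open_UNIV that] in auto)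
  have gs: "smooth_on S (\<lambda>x. gcoeff (g x) A)" if "open S" for S A
    by (rule even_superfunction.g_smooth[OF phase_even_superfunction[OF g that]])
  have sm: "smooth_on UNIV (\<lambda>x. gcoeff (Tc x) A)" for A
  proof -
    have 0: "smooth_on U (\<lambda>x. gcoeff (gcomp n th (g x)) A)"
      by (rule gcomp_smooth[OF U(1) gs[OF U(1)] thu[OF U(1)]])
    have 1: "smooth_on U (\<lambda>x. gcoeff (Tc x) A)"
      using smooth_on_cong[OF U(1), of "\<lambda>x. gcoeff (Tc x) A" "\<lambda>x. gcoeff (gcomp n th (g x)) A"]
        0 by (simp add: Tc_def)
    have 2: "smooth_on Om (\<lambda>x. gcoeff (Tc x) A)"
      using smooth_on_cong[OF o(1), of "\<lambda>x. gcoeff (Tc x) A" "\<lambda>x. gcoeff (gconst ?I) A"] TOm by simp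
    have 3: "smooth_on Op (\<lambda>x. gcoeff (Tc x) A)"
      using smooth_on_cong[OF o(2), of "\<lambda>x. gcoeff (Tc x) A" "\<lambda>x. 0"] TOp by simp
    show ?thesis
      using smooth_on_Un[OF _ o(2) smooth_on_Un[OF U(1) o(1) 1 2] 3] U(1) o(1) cov by (simp add: open_Un)
  qed
  have supp: "gcoeff (Tc x) A \<noteq> 0 \<Longrightarrow> A \<subseteq> xvars n" for x A
    using gcomp_support[of "g x" "xvars n" n th A] g
    by (cases "x \<in> U"; cases "A = {}") (auto simp: Tc_def gconst.rep_eq phase_function_def)
  have ev: "ginv (Tc x) = Tc x" for x
    by (simp add: Tc_def ginv_gcomp phase_function_ginv[OF g])
  have sfT: "sf UNIV (\<lambda>x. gembed (Tc x) :: 'm clifford grass)"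
    by (rule sf_gembed[OF _ sm supp]) simp_all
  show thesis
  proof (rule that[of "\<lambda>x. gembed (Tc x)" Om Op])
    show "sf UNIV (\<lambda>x. gembed (Tc x) :: 'm clifford grass)" by (rule sfT)
    show "gembed (Tc x) * v = v * gembed (Tc x)" for x and v :: "'m clifford grass"
      by (rule gembed_even_central[OF ev])
    show "ginv (gembed (Tc x) :: 'm clifford grass) = gembed (Tc x)" for x
      by (simp add: ginv_gembed ev)
    show "dop k a b (\<lambda>x. gembed (Tc x) :: 'm clifford grass) x =
      - (gembed (gcomp n (\<lambda>j. vderivs j \<rho>) (g x)) * dop k a b (\<lambda>x. gembed (g x)) x)" if x: "x \<in> U" for k a b x
    proof -
      have "dop k a b (\<lambda>x. gembed (Tc x) :: 'm clifford grass) x = dop k a b (\<lambda>x. gembed (gcomp n th (g x))) x"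
        by (rule dop_cong[OF U(1) x sf_subset[OF open_UNIV U(1) subset_UNIV sfT]]) (simp add: Tc_def)
      also have "\<dots> = gembed (gcomp n (\<lambda>j. th (Suc j)) (g x)) * dop k a b (\<lambda>x. gembed (g x)) x"
        by (rule even_superfunction.dop_gcomp[OF phase_even_superfunction[OF g U(1)] x, where th = th])
           (rule thu[OF U(1)], rule th(2))
      also have "gcomp n (\<lambda>j. th (Suc j)) (g x) = - gcomp n (\<lambda>j. vderivs j \<rho>) (g x)"
        using gcomp_cmult[of n "- 1" "\<lambda>j. vderivs j \<rho>" "g x"] by (simp add: th(3) gconst_minus)
      finally show ?thesis by simp
    qed
    \<comment> \<open>Zeros of the body lie in \<open>U\<close>, hence in \<open>T\<close>, and
      \<open>U'\<close> is a part of \<open>T\<close>.\<close>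
    show "- T \<subseteq> Om \<union> Op" using U(2,3) by (force simp: Om_def Op_def U'_def)
  qed (use o cov TOm TOp in \<open>auto simp: Om_def Op_def\<close>)
qed

lemma xfree_zero: "xfree 0"
  by (simp add: xfree_def)

section \<open>The Cauchy integral formula\<close>

lemma superfunctions_props:
  assumes "G \<in> superfunctions n S"
  shows "sf S G" "x \<in> S \<Longrightarrow> gsupp (xvars n) (G x)"
proof -
  obtain fs where fs: "smooth_rep S G fs" "\<forall>(f, c)\<in>set fs. c \<in> super_alg n"
    using assms unfolding superfunctions_def by blast
  then show "sf S G" unfolding sf_def by blast
  have "gsupp (xvars n) (\<Sum>(f, c)\<leftarrow>fs. sscal (f x) * c)"
    using fs(2)
  proof (induction fs)
    case (Cons p fs)
    obtain f c where p: "p = (f, c)" by fastforce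
    have "gsupp (xvars n) c" using Cons.prems by (auto simp: p super_alg_def gsupp_def)
    then show ?case using Cons by (simp add: p gsupp_add gsupp_mult gsupp_gconst)
  qed (simp add: gsupp_zero)
  then show "x \<in> S \<Longrightarrow> gsupp (xvars n) (G x)" using fs(1) by (simp add: smooth_rep_def)
qed

lemma gsupp_thd: "{XV j, YV j} \<subseteq> V \<Longrightarrow> gsupp V (thd j)"
  by (intro gsupp_diff gsupp_gmono) auto

lemma (in kernel) gsupp_Psi:
  "gsupp (xvars n \<union> range YV) (Psi n (x - y) thd)" "gsupp (xvars n \<union> range YV) (Psi_dag n (x - y) thd)"
proof -
  let ?V = "xvars n \<union> range YV"
  have t: "gsupp ?V (thd (2 * j - 1))" "gsupp ?V (thd (2 * j))" if "j \<in> {1..n}" for j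
  proof -
    have "2 * j - 1 \<in> {1..2 * n}" "2 * j \<in> {1..2 * n}" using that by auto
    then show "gsupp ?V (thd (2 * j - 1))" "gsupp ?V (thd (2 * j))" by (intro gsupp_thd, blast)+
  qed
  have z: "gsupp ?V (gz_var j thd)" "gsupp ?V (gzc_var j thd)" if "j \<in> {1..n}" for j
    unfolding gz_var_def gzc_var_def by (intro gsupp_add gsupp_diff gsupp_mult gsupp_gconst t that)+
  have v: "gsupp ?V (zv x)" "gsupp ?V (zd x)"
    unfolding zv_def zd_def Z_var_def Zdag_var_def
    by (intro gsupp_add gsupp_sum gsupp_mult gsupp_gconst gsupp_gembed z; assumption)+
  have e: "gsupp ?V (ee q 0 x)" for q
    unfolding ee_def
  proof (rule gsupp_gembed, unfold gsupp_def, intro allI impI)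
    fix A assume A: "gcoeff (gcomp n (pw q) (nf 0 x)) A \<noteq> 0"
    have "A \<subseteq> kvars"
      by (rule gcomp_support[OF even_superfunction.g_supp[OF even_superfunction_nf[OF open_UNIV]] A])
    then show "A \<subseteq> ?V" by auto
  qed
  show "gsupp ?V (Psi n (x - y) thd)" "gsupp ?V (Psi_dag n (x - y) thd)"
    unfolding Psi_eq[OF refl] by (intro gsupp_mult gsupp_gconst v e)+
qed

text \<open>The four matrix entries are two instances of this statement: the diagonal ones with
  \<open>s = 1\<close>, the others with \<open>s = 0\<close> and the two operators interchanged.
  \<open>pomp\<close> is the Cauchy-Pompeiu formula for the chosen pair.\<close>

lemma super_integral_value:
  fixes G P1 P2 :: "'m::finite point \<Rightarrow> 'm clifford grass" and g :: "'m point \<Rightarrow> complex grass"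
    and a1 a2 :: "'m + 'm \<Rightarrow> 'm clifford" and b1 b2 :: "nat \<Rightarrow> 'm clifford"
  assumes Om: "open \<Omega>" and G: "G \<in> superfunctions n \<Omega>"
    and mono: "\<And>x. x \<in> \<Omega> \<Longrightarrow> dop n a1 b1 G x = 0" "\<And>x. x \<in> \<Omega> \<Longrightarrow> dop n a2 b2 G x = 0"
    and g: "phase_function n g" and K: "compact {x. gbody (g x) \<le> 0}" "{x. gbody (g x) \<le> 0} \<subseteq> \<Omega>"
    and reg: "\<forall>x. gbody (g x) = 0 \<longrightarrow> \<not> GDERIV (\<lambda>x. gbody (g x)) x :> 0"
    and y: "gbody (g y) \<noteq> 0"
    and P: "sf (UNIV - {y}) P1" "sf (UNIV - {y}) P2"
    and Psupp: "\<And>x. gsupp (xvars n \<union> range YV) (P1 x)" "\<And>x. gsupp (xvars n \<union> range YV) (P2 x)"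
    and pomp: "\<And>L F C W. clin L \<Longrightarrow> sf UNIV F \<Longrightarrow> compact C \<Longrightarrow> (\<And>x. x \<notin> C \<Longrightarrow> F x = 0) \<Longrightarrow> gsupp (xvars n) (F y) \<Longrightarrow>
      open W \<Longrightarrow> y \<in> W \<Longrightarrow> (\<And>x. x \<in> W \<Longrightarrow> dop n a1 b1 F x = 0) \<Longrightarrow> (\<And>x. x \<in> W \<Longrightarrow> dop n a2 b2 F x = 0) \<Longrightarrow>
      (LINT x|lborel. L (berezin n (P1 x * dop n a1 b1 F x))) + (LINT x|lborel. L (berezin n (P2 x * dop n a2 b2 F x)))
      = - (s * L (subst_y (F y)))"
  shows "super_integral n (super_delta n g) (\<lambda>x. (P1 x * dop n a1 b1 (\<lambda>x. gembed (g x)) x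
      + P2 x * dop n a2 b2 (\<lambda>x. gembed (g x)) x) * G x)
    = (if gbody (g y) < 0 then sscal s * subst_y (G y) else 0)"
proof (rule clin_separates)
  fix L :: "'m clifford grass \<Rightarrow> complex" assume L: "clin L"
  note B = clin_comp[OF L clin_op_berezin[of n]]
  let ?u = "\<lambda>x. gbody (g x)"
  define D1 where "D1 = dop n a1 b1 (\<lambda>x. gembed (g x) :: 'm clifford grass)"
  define D2 where "D2 = dop n a2 b2 (\<lambda>x. gembed (g x) :: 'm clifford grass)"
  define F where "F x = (P1 x * D1 x + P2 x * D2 x) * G x" for x
  \<comment> \<open>The kernels are singular at \<open>y\<close>, which does not lie on the zero
    set.\<close>
  define S where "S = \<Omega> - {y}"
  interpret E: even_superfunction UNIV g "xvars n" n by (rule phase_even_superfunction[OF g open_UNIV])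
  have S: "open S" "S \<subseteq> \<Omega>" "S \<subseteq> UNIV - {y}" using Om by (auto simp: S_def open_delete)
  have oy: "open (UNIV - {y})" by (simp add: open_delete)
  note sfG = superfunctions_props(1)[OF G]
  have sfD: "sf UNIV D1" "sf UNIV D2" unfolding D1_def D2_def by (rule sf_dop[OF open_UNIV E.sf_g])+
  have sfF: "sf S F"
    unfolding F_def[abs_def]
    by (intro sf_mult sf_add S(1) sf_subset[OF oy S(1) S(3) P(1)] sf_subset[OF oy S(1) S(3) P(2)]
        sf_subset[OF open_UNIV S(1) subset_UNIV sfD(1)] sf_subset[OF open_UNIV S(1) subset_UNIV sfD(2)] sf_subset[OF Om S(1,2) sfG])
  have Dsupp: "gsupp (xvars n \<union> range YV) (D1 x)" "gsupp (xvars n \<union> range YV) (D2 x)" for x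
    unfolding D1_def D2_def by (rule gsupp_mono[OF E.gsupp_dop[OF UNIV_I]], simp)+
  have Fsupp: "A \<subseteq> xvars n \<union> range YV" if "x \<in> S" "gcoeff (F x) A \<noteq> 0" for x A
  proof -
    have "x \<in> \<Omega>" using S(2) that(1) by blast
    have "gsupp (xvars n \<union> range YV) (F x)"
      unfolding F_def by (intro gsupp_mult gsupp_add Psupp Dsupp gsupp_mono[OF superfunctions_props(2)[OF G \<open>x \<in> \<Omega>\<close>]]) simp
    then show ?thesis using that(2) unfolding gsupp_def by blast
  qed
  have cu: "continuous_on UNIV ?u" by (rule smooth_on_continuous[OF phase_function_body(1)[OF g]])
  have K0: "compact {x. ?u x = 0}"
  proof -
    have "closed {x. ?u x = 0}" by (intro closed_Collect_eq continuous_intros cu)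
    moreover have "{x. ?u x = 0} = {x. ?u x \<le> 0} \<inter> {x. ?u x = 0}" by auto
    ultimately show ?thesis using compact_Int_closed[OF K(1)] by metis
  qed
  have K0S: "{x. ?u x = 0} \<subseteq> S" using K(2) y by (auto simp: S_def)
  obtain \<eta> :: "'m point \<Rightarrow> complex" and U where eta: "test_function \<eta>" "tsupp \<eta> \<subseteq> S" "open U" "{x. ?u x = 0} \<subseteq> U" "\<And>x. x \<in> U \<Longrightarrow> \<eta> x = 1"
    using smooth_cutoff[OF K0 S(1) K0S] by blast
  let ?T = "tsupp \<eta>"
  have cT: "compact ?T" using eta(1) by (simp add: test_function_def)
  have UT: "U \<subseteq> ?T" using eta(5) tsupp_zero[of _ \<eta>] by force
  \<comment> \<open>On the compact part of \<open>?T\<close> outside \<open>U\<close> the body has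
    no zero; half the minimum of its absolute value serves as \<open>r\<close>.\<close>
  obtain r where r: "r > 0" "\<And>x. x \<in> ?T \<Longrightarrow> \<bar>?u x\<bar> \<le> r \<Longrightarrow> x \<in> U"
  proof (cases "?T - U = {}")
    case True
    then show thesis using that[of 1] by auto
  next
    case False
    have "compact (?T - U)" by (rule compact_diff[OF cT eta(3)])
    moreover have "continuous_on (?T - U) (\<lambda>x. \<bar>?u x\<bar>)"
      by (intro continuous_intros continuous_on_subset[OF cu]) simp
    ultimately obtain x0 where x0: "x0 \<in> ?T - U" "\<And>x. x \<in> ?T - U \<Longrightarrow> \<bar>?u x0\<bar> \<le> \<bar>?u x\<bar>"
      using continuous_attains_inf[OF _ False] by blast
    have p: "\<bar>?u x0\<bar> > 0" using x0(1) eta(4) by auto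
    show thesis
    proof (rule that[of "\<bar>?u x0\<bar> / 2"])
      show "\<bar>?u x0\<bar> / 2 > 0" using p by simp
      fix x assume "x \<in> ?T" "\<bar>?u x\<bar> \<le> \<bar>?u x0\<bar> / 2"
      then show "x \<in> U" using x0(2)[of x] p by (cases "x \<in> U") auto
    qed
  qed
  \<comment> \<open>Outside this compact set \<theta>(g) vanishes: there the body is positive and
    the ramp is not in use.\<close>
  let ?C = "{x. ?u x \<le> 0} \<union> ?T"
  have cC: "compact ?C" by (rule compact_Un[OF K(1) cT])
  have "?C \<subseteq> \<Omega>" using K(2) eta(2) S(2) by blast
  then obtain \<zeta> :: "'m point \<Rightarrow> complex" and U2 where zeta: "test_function \<zeta>" "tsupp \<zeta> \<subseteq> \<Omega>" "open U2" "?C \<subseteq> U2" "\<And>x. x \<in> U2 \<Longrightarrow> \<zeta> x = 1"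
    using smooth_cutoff[OF cC Om] by blast
  have U2: "U2 \<subseteq> \<Omega>" using zeta(2,5) tsupp_zero[of _ \<zeta>] by force
  define c where "c = (if ?u y < 0 then s * L (subst_y (G y)) else 0)"
  have u: "regular_zero_set ?u" using phase_function_body(1)[OF g] reg by (simp add: regular_zero_set_def)
  have germ: "germ_value (L (super_integral n (super_delta n g) F))
      (\<lambda>\<psi>. LINT x|lborel. \<eta> x * L (berezin n (gembed (gcomp n (\<lambda>j. vderivs j \<psi>) (g x)) * F x)))"
    by (rule germ_value_super_integral[OF g u K0 S(1) K0S sfF Fsupp eta L])
  have "L (super_integral n (super_delta n g) F) = c"
  \<comment> \<open>The functional on the right has the constant density \<open>c\<close>, so it
    remains to evaluate one ordinary integral for each \<open>\<rho>\<close> supported in the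
    interval of radius \<open>r\<close>.\<close>
  proof (rule germ_value_unique[OF germ germ_value_const r(1)])
    fix \<rho> :: "real \<Rightarrow> complex" assume rho: "test_function \<rho>" "tsupp \<rho> \<subseteq> {- r<..<r}"
    obtain Th :: "'m point \<Rightarrow> 'm clifford grass" and Om' Op where Th: "sf UNIV Th" "\<And>x v. Th x * v = v * Th x" "\<And>x. ginv (Th x) = Th x"
      and dTh: "\<And>k a b x. x \<in> U \<Longrightarrow> dop k a b Th x =
        - (gembed (gcomp n (\<lambda>j. vderivs j \<rho>) (g x)) * dop k a b (\<lambda>x. gembed (g x)) x)"
      and O: "open Om'" "open Op" "U \<union> Om' \<union> Op = UNIV" "- ?T \<subseteq> Om' \<union> Op"
        "Om' \<subseteq> {x. ?u x < 0}" "Op \<subseteq> {x. ?u x > 0}"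
      and ThO: "\<And>x. x \<in> Om' \<Longrightarrow> Th x = sscal (LINT t|lborel. \<rho> t)" "\<And>x. x \<in> Op \<Longrightarrow> Th x = 0"
      using characteristic_superfunction[OF g closed_tsupp eta(3) UT eta(4) r rho] by blast
    have dTh0: "dop k a b Th x = 0" if "x \<in> Om' \<union> Op" for k a b x
    proof (cases "x \<in> Om'")
      case True
      show ?thesis by (rule dop_zero_outside[OF Th(1) O(1) True ThO(1) xfree_gconst])
    next
      case False
      then have "x \<in> Op" using that by blast
      show ?thesis
        by (rule dop_zero_outside[OF Th(1) O(2) \<open>x \<in> Op\<close> ThO(2) xfree_zero])
    qed
    \<comment> \<open>\<open>G\<close> is controlled only on \<open>\<Omega>\<close>; after the
      cut-off it is a global superfunction that agrees with \<open>G\<close> near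
      \<open>?C\<close>.\<close>
    define G' where "G' x = sscal (\<zeta> x) * G x" for x
    define H where "H x = Th x * G' x" for x
    have sfG': "sf UNIV G'" unfolding G'_def[abs_def] by (rule sf_cutoff[OF Om zeta(1,2) sfG])
    have sfH: "sf UNIV H" unfolding H_def[abs_def] by (rule sf_mult[OF open_UNIV Th(1) sfG'])
    have out: "x \<in> Op" if "x \<notin> ?C" for x using that O(4,5) by fastforce
    have H0: "H x = 0" if "x \<notin> ?C" for x using ThO(2)[OF out[OF that]] by (simp add: H_def)
    \<comment> \<open>On \<open>U2\<close> the Leibniz rule leaves only the derivative of
      \<open>Th\<close>, because \<open>G\<close> is monogenic; off \<open>U2\<close> both sides are
      zero because \<open>Th\<close> vanishes locally.\<close>
    have dH: "dop n a b H x = dop n a b Th x * G x" if G0: "\<And>x. x \<in> \<Omega> \<Longrightarrow> dop n a b G x = 0" for a b x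
    proof (cases "x \<in> U2")
      case True
      have eq: "G' z = G z" if "z \<in> U2" for z using zeta(5)[OF that] by (simp add: G'_def sscal_simps(2))
      have "dop n a b G' x = dop n a b G x"
        by (rule dop_cong[OF zeta(3) True sf_subset[OF open_UNIV zeta(3) subset_UNIV sfG'] eq])
      also have "\<dots> = 0" using G0 True U2 by blast
      finally have d: "dop n a b G' x = 0" .
      have "dop n a b H x = dop n a b Th x * G' x + Th x * dop n a b G' x"
        unfolding H_def[abs_def] by (rule dop_leibniz[OF open_UNIV UNIV_I Th(1) sfG' Th(2,3)])
      then show ?thesis by (simp add: d eq[OF True])
    next
      case False
      then have x: "x \<in> - ?C" using zeta(4) by blast
      have o: "open (- ?C)" by (rule open_Compl[OF compact_imp_closed[OF cC]])
      have "dop n a b H x = 0"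
        by (rule dop_zero_outside[OF sfH o x, of 0]) (use H0 xfree_zero in auto)
      moreover have "dop n a b Th x = 0" by (rule dTh0) (use out x in auto)
      ultimately show ?thesis by simp
    qed
    have dH1: "dop n a1 b1 H x = dop n a1 b1 Th x * G x" for x by (rule dH[OF mono(1)])
    have dH2: "dop n a2 b2 H x = dop n a2 b2 Th x * G x" for x by (rule dH[OF mono(2)])
    define f1 where "f1 x = L (berezin n (P1 x * dop n a1 b1 H x))" for x
    define f2 where "f2 x = L (berezin n (P2 x * dop n a2 b2 H x))" for x
    \<comment> \<open>On \<open>U\<close> the derivative of \<open>Th\<close> is minus \<rho>(g)
      times that of \<open>g\<close>, whence the sign. Outside \<open>U\<close> the derivatives of
      \<open>Th\<close> vanish, and either the cut-off is 0 or the body lies beyond the support of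
      \<open>\<rho>\<close>.\<close>
    have point: "\<eta> x * L (berezin n (gembed (gcomp n (\<lambda>j. vderivs j \<rho>) (g x)) * F x)) = - (f1 x + f2 x)" for x
    proof (cases "x \<in> U")
      case True
      let ?E = "gembed (gcomp n (\<lambda>j. vderivs j \<rho>) (g x)) :: 'm clifford grass"
      have c: "?E * (v * w) = v * (?E * w)" for v w
        unfolding mult.assoc[symmetric] E.gcomp_central[of _ x v] ..
      have "?E * F x = - (P1 x * dop n a1 b1 H x + P2 x * dop n a2 b2 H x)"
        unfolding F_def dH1 dH2 dTh[OF True] D1_def[symmetric] D2_def[symmetric]
        by (simp only: distrib_right distrib_left mult.assoc c mult_minus_left mult_minus_right minus_add_distrib minus_minus)
      then show ?thesis
        by (simp only: eta(5)[OF True] clin_minus[OF B] clin_add[OF B] f1_def f2_def mult_1)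
    next
      case False
      then have "x \<in> Om' \<union> Op" using O(3) by blast
      then have "f1 x = 0" "f2 x = 0"
        unfolding f1_def f2_def dH1 dH2 using dTh0 by (simp_all add: clin_zero[OF B])
      moreover have "\<eta> x = 0 \<or> gcomp n (\<lambda>j. vderivs j \<rho>) (g x) = 0"
      proof (cases "x \<in> ?T")
        case True
        then have "r < \<bar>?u x\<bar>" using r(2)[OF True] False by linarith
        then have "vderivs j \<rho> (?u x) = 0" for j
          using vderivs_test(2)[OF rho(1), of j] rho(2) by (intro tsupp_zero) (auto simp: abs_if split: if_splits)
        then show ?thesis by (simp add: gcomp_def)
      qed (simp add: tsupp_zero)
      ultimately show ?thesis by (auto simp: clin_zero[OF B])
    qed
    have "y \<notin> ?T" using eta(2) by (auto simp: S_def)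
    then have yO: "y \<in> Om' \<union> Op" using O(4) by blast
    have W: "open (Om' \<union> Op)" using O by (simp add: open_Un)
    have Wd: "dop n a1 b1 H x = 0" "dop n a2 b2 H x = 0" if "x \<in> Om' \<union> Op" for x
      unfolding dH1 dH2 dTh0[OF that] by simp_all
    have Cd: "dop n a1 b1 H x = 0" "dop n a2 b2 H x = 0" if "x \<notin> ?C" for x
      by (rule Wd, use out[OF that] in blast)+
    \<comment> \<open>\<open>Q\<close> stands for a kernel singular at \<open>y\<close>. Smoothness
      there comes from \<open>D\<close>, which vanishes on the neighbourhood
      \<open>Om' \<union> Op\<close> of \<open>y\<close>.\<close>
    have int: "integrable lborel (\<lambda>x. L (berezin n (Q x * D x)))"
      if Q: "sf (UNIV - {y}) Q" and D: "sf UNIV D" "\<And>x. x \<in> Om' \<union> Op \<Longrightarrow> D x = 0" "\<And>x. x \<notin> ?C \<Longrightarrow> D x = 0" for Q D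
    proof (rule integrable_compact_smooth[OF _ cC])
      have 1: "smooth_on (UNIV - {y}) (\<lambda>x. L (berezin n (Q x * D x)))"
        by (rule clin_smooth[OF oy B sf_mult[OF oy Q sf_subset[OF open_UNIV oy subset_UNIV D(1)]]])
      have 2: "smooth_on (Om' \<union> Op) (\<lambda>x. L (berezin n (Q x * D x)))"
        using smooth_on_cong[OF W, of "\<lambda>x. L (berezin n (Q x * D x))" "\<lambda>x. 0"] D(2) by (simp add: clin_zero[OF B])
      have "(UNIV - {y}) \<union> (Om' \<union> Op) = UNIV" using yO by blast
      with smooth_on_Un[OF oy W 1 2] show "smooth_on UNIV (\<lambda>x. L (berezin n (Q x * D x)))" by (simp only:)
    qed (simp add: D(3) clin_zero[OF B])
    have i1: "integrable lborel f1" unfolding f1_def[abs_def]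
      by (rule int[OF P(1) sf_dop[OF open_UNIV sfH]]) (rule Wd(1) Cd(1), assumption)+
    have i2: "integrable lborel f2" unfolding f2_def[abs_def]
      by (rule int[OF P(2) sf_dop[OF open_UNIV sfH]]) (rule Wd(2) Cd(2), assumption)+
    have Hy: "H y = (if ?u y < 0 then sscal (LINT t|lborel. \<rho> t) * G y else 0)"
    proof (cases "?u y < 0")
      case True
      then have "y \<in> Om'" "y \<in> U2" using yO O(6) zeta(4) by auto
      then show ?thesis using True ThO(1) zeta(5) by (simp add: H_def G'_def sscal_simps(2))
    next
      case False
      then have "y \<in> Op" using yO O(5) by auto
      then show ?thesis using False ThO(2) by (simp add: H_def)
    qed
    have Hs: "gsupp (xvars n) (H y)"
    proof (cases "?u y < 0")
      case True
      then have "y \<in> \<Omega>" using K(2) by auto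
      then show ?thesis unfolding Hy using superfunctions_props(2)[OF G] by (simp add: gsupp_mult gsupp_gconst gsupp_zero)
    qed (simp add: Hy gsupp_zero)
    have "(LINT x|lborel. \<eta> x * L (berezin n (gembed (gcomp n (\<lambda>j. vderivs j \<rho>) (g x)) * F x)))
        = - ((LINT x|lborel. f1 x) + (LINT x|lborel. f2 x))"
      unfolding point by (simp add: i1 i2)
    also have "(LINT x|lborel. f1 x) + (LINT x|lborel. f2 x) = - (s * L (subst_y (H y)))"
      unfolding f1_def f2_def by (rule pomp[OF L sfH cC H0 Hs W yO]) (rule Wd Cd, assumption | assumption)+
    also have "- (- (s * L (subst_y (H y)))) = c * (LINT t|lborel. \<rho> t)"
      unfolding Hy c_def by (simp add: subst_y_simps clin_scal[OF L] clin_zero[OF L])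
    finally show "(LINT x|lborel. \<eta> x * L (berezin n (gembed (gcomp n (\<lambda>j. vderivs j \<rho>) (g x)) * F x)))
        = c * (LINT t|lborel. \<rho> t)" .
  qed
  then show "L (super_integral n (super_delta n g) (\<lambda>x. (P1 x * dop n a1 b1 (\<lambda>x. gembed (g x)) x
      + P2 x * dop n a2 b2 (\<lambda>x. gembed (g x)) x) * G x))
    = L (if gbody (g y) < 0 then sscal s * subst_y (G y) else 0)"
    unfolding F_def[abs_def] D1_def D2_def c_def by (simp add: clin_scal[OF L] clin_zero[OF L])
qed

lemma circ2_product:
  fixes a b c d k :: "'r::ring_1"
  shows "(circ2 a b ** circ2 c d ** mat k) $ 1 $ 1 = (a * c + b * d) * k"
    "(circ2 a b ** circ2 c d ** mat k) $ 1 $ 2 = (a * d + b * c) * k"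
    "(circ2 a b ** circ2 c d ** mat k) $ 2 $ 1 = (a * d + b * c) * k"
    "(circ2 a b ** circ2 c d ** mat k) $ 2 $ 2 = (a * c + b * d) * k"
  by (simp_all add: matrix_matrix_mult_def mat_def circ2_def sum_2 add.commute)

theorem corollary7:
  fixes n :: nat
    and \<Omega> :: "'m::finite point set"
    and G :: "'m point \<Rightarrow> 'm clifford grass"
    and g :: "'m point \<Rightarrow> complex grass"
    and y :: "'m point"
  assumes "n < CARD('m)"
    and "open \<Omega>"
    and "G \<in> superfunctions n \<Omega>"
    and "sh_monogenic_on n \<Omega> G"
    and "phase_function n g"
    and "compact {x. gbody (g x) \<le> 0}"
    and "{x. gbody (g x) \<le> 0} \<subseteq> \<Omega>"
    and "\<forall>x. gbody (g x) = 0 \<longrightarrow> \<not> GDERIV (\<lambda>x. gbody (g x)) x :> 0"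
    and "gbody (g y) \<noteq> 0"
  shows "super_integral_matrix n (super_delta n g)
      (\<lambda>x. Psi_matrix n (x - y) (\<lambda>j. gvar (XV j) - gvar (YV j))
         ** dirac_matrix n (\<lambda>x. gembed (g x)) x ** mat (G x))
    = (if gbody (g y) < 0 then mat (subst_y (G y)) else 0)"
proof -
  interpret kernel n y .
  have m: "dop n aZ bZ G x = 0" "dop n aZd bZd G x = 0" if "x \<in> \<Omega>" for x
    using assms(4) that by (simp_all add: sh_monogenic_on_def dirac_eq_dop)
  note V = super_integral_value[OF assms(2,3) _ _ assms(5,6,7,8,9) sf_Psi gsupp_Psi]
  have diag: "super_integral n (super_delta n g) (\<lambda>x. (Psi n (x - y) thd * dop n aZ bZ (\<lambda>x. gembed (g x)) x
      + Psi_dag n (x - y) thd * dop n aZd bZd (\<lambda>x. gembed (g x)) x) * G x)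
    = (if gbody (g y) < 0 then sscal 1 * subst_y (G y) else 0)"
  proof (rule V)
    fix L :: "'m clifford grass \<Rightarrow> complex" and F C W
    assume "clin L" "sf UNIV F" "compact C" "\<And>x. x \<notin> C \<Longrightarrow> F x = 0" "gsupp (xvars n) (F y)"
      "open W" "y \<in> W" "\<And>x. x \<in> W \<Longrightarrow> dop n aZ bZ F x = 0" "\<And>x. x \<in> W \<Longrightarrow> dop n aZd bZd F x = 0"
    then show "(LINT x|lborel. L (berezin n (Psi n (x - y) thd * dop n aZ bZ F x)))
      + (LINT x|lborel. L (berezin n (Psi_dag n (x - y) thd * dop n aZd bZd F x))) = - (1 * L (subst_y (F y)))"
      unfolding mult_1 by (intro pompeiu_Psi(1)[OF assms(1)]) (auto simp: gsupp_def)
  qed (use m in auto)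
  have off: "super_integral n (super_delta n g) (\<lambda>x. (Psi n (x - y) thd * dop n aZd bZd (\<lambda>x. gembed (g x)) x
      + Psi_dag n (x - y) thd * dop n aZ bZ (\<lambda>x. gembed (g x)) x) * G x)
    = (if gbody (g y) < 0 then sscal 0 * subst_y (G y) else 0)"
  proof (rule V)
    fix L :: "'m clifford grass \<Rightarrow> complex" and F C W
    assume "clin L" "sf UNIV F" "compact C" "\<And>x. x \<notin> C \<Longrightarrow> F x = 0" "gsupp (xvars n) (F y)"
      "open W" "y \<in> W" "\<And>x. x \<in> W \<Longrightarrow> dop n aZd bZd F x = 0" "\<And>x. x \<in> W \<Longrightarrow> dop n aZ bZ F x = 0"
    then show "(LINT x|lborel. L (berezin n (Psi n (x - y) thd * dop n aZd bZd F x)))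
      + (LINT x|lborel. L (berezin n (Psi_dag n (x - y) thd * dop n aZ bZ F x))) = - (0 * L (subst_y (F y)))"
      unfolding mult_zero_left minus_zero by (intro pompeiu_Psi(2)[OF assms(1)]) (auto simp: gsupp_def)
  qed (use m in auto)
  show ?thesis
    unfolding super_integral_matrix_def Psi_matrix_def dirac_matrix_def dirac_eq_dop vec_eq_iff forall_2
    by (simp only: vec_lambda_beta circ2_product diag off) (simp add: mat_def sscal_simps)
qed

end
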